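(* Let $K=\mathbb Q(\sqrt{-19})$. Up to conjugation in $\operatorname{GL}_3(K)$ there are exactly $40$ finite subgroups of $\operatorname{GL}_3(K)$, and their isomorphism types, each listed as many times as there are conjugacy classes of subgroups of that type, are: $C_1$ (once); $C_2$ (three times); $C_3$ (once); $C_4$ (twice); $C_2^2$ (three times); $S_3$ (twice); $C_6$ (three times); $C_2\times C_4$ (once); $Q_8$ (twice); $C_2^3$ (once); $D_4$ (three times); $D_6$ (four times); $C_3\rtimes C_4$ (twice); $A_4$ (once); $C_2\times C_6$ (once); $C_2\times Q_8$ (once); $C_2\times D_4$ (once); $C_2\times (C_3\rtimes C_4)$ (once); $\operatorname{SL}(2,3)$ (once); $C_2^2\times S_3$ (once); $S_4$ (twice); $C_2\times A_4$ (once); $C_2\times\operatorname{SL}(2,3)$ (once); $C_2\times S_4$ (once).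
   Context: $C_m$ is the cyclic group of order $m$; $D_m$ is the dihedral group of order $2m$; $Q_8$ is the quaternion group of order $8$; $C_3\rtimes C_4$ is the nonabelian semidirect product of order $12$ in which a generator of $C_4$ acts on $C_3$ by inversion; $\operatorname{SL}(2,3)=\operatorname{SL}_2(\mathbb F_3)$; $S_m$ and $A_m$ are the symmetric and alternating groups on $m$ letters. *)

theory Defs
  imports "HOL-Analysis.Analysis" "HOL-Algebra.Algebra"
begin

definition quadratic_field :: "int \<Rightarrow> complex set" where
  "quadratic_field d = {of_rat a + of_rat b * csqrt (of_int d) | a b. True}"

definition matrix_group :: "('a::semiring_1 ^ 'n ^ 'n) set \<Rightarrow> ('a ^ 'n ^ 'n) monoid" where
  "matrix_group S = \<lparr>carrier = S, monoid.mult = (**), one = mat 1\<rparr>"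

definition matrices_over :: "'a set \<Rightarrow> ('a ^ 'n ^ 'n) set" where
  "matrices_over F = {A. \<forall>i j. A $ i $ j \<in> F}"

text \<open>The general linear group over a subfield \<open>F\<close>: the matrices over \<open>F\<close> having an inverse
  over \<open>F\<close>.\<close>

definition GL :: "'a::field set \<Rightarrow> ('a ^ 'n ^ 'n) monoid" where
  "GL F = matrix_group {A \<in> matrices_over F. \<exists>B \<in> matrices_over F. A ** B = mat 1 \<and> B ** A = mat 1}"

definition finite_subgroups :: "('a, 'b) monoid_scheme \<Rightarrow> 'a set set" where
  "finite_subgroups G = {H. subgroup H G \<and> finite H}"

definition finite_subgroups_of_type ::
    "('a, 'b) monoid_scheme \<Rightarrow> ('c, 'd) monoid_scheme \<Rightarrow> 'a set set" where
  "finite_subgroups_of_type G T = {H \<in> finite_subgroups G. G\<lparr>carrier := H\<rparr> \<cong> T}"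

definition conjugacy :: "('a, 'b) monoid_scheme \<Rightarrow> ('a set \<times> 'a set) set" where
  "conjugacy G = {(H, H'). subgroup H G \<and> subgroup H' G \<and>
     (\<exists>g \<in> carrier G. H' = (g <#\<^bsub>G\<^esub> H) #>\<^bsub>G\<^esub> (inv\<^bsub>G\<^esub> g))}"

abbreviation Cyc :: "nat \<Rightarrow> int monoid" where
  "Cyc m \<equiv> integer_mod_group m"

definition semidirect_product ::
    "('a, 'c) monoid_scheme \<Rightarrow> ('b, 'd) monoid_scheme \<Rightarrow> ('b \<Rightarrow> 'a \<Rightarrow> 'a) \<Rightarrow> ('a \<times> 'b) monoid" where
  "semidirect_product N H \<phi> =
     \<lparr>carrier = carrier N \<times> carrier H,
      monoid.mult = (\<lambda>(x, h) (y, k). (x \<otimes>\<^bsub>N\<^esub> \<phi> h y, h \<otimes>\<^bsub>H\<^esub> k)),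
      one = (\<one>\<^bsub>N\<^esub>, \<one>\<^bsub>H\<^esub>)\<rparr>"

text \<open>The semidirect product of cyclic groups of orders \<open>m\<close> and \<open>k\<close> in which a generator of the
  second acts on the first by inversion; this is an action only for even \<open>k\<close>.\<close>

definition Cyc_inversion_Cyc :: "nat \<Rightarrow> nat \<Rightarrow> (int \<times> int) monoid" where
  "Cyc_inversion_Cyc m k =
     semidirect_product (Cyc m) (Cyc k) (\<lambda>h x. if even h then x else inv\<^bsub>Cyc m\<^esub> x)"

definition Dih :: "nat \<Rightarrow> (int \<times> int) monoid" where
  "Dih m = Cyc_inversion_Cyc m 2"

text \<open>The quaternion group as \<open>{\<plusminus>1, \<plusminus>I, \<plusminus>J, \<plusminus>IJ}\<close> in the usual complex matrix model of the
  quaternions.\<close>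

definition quat_I :: "complex ^ 2 ^ 2" where
  "quat_I = vector [vector [\<i>, 0], vector [0, - \<i>]]"

definition quat_J :: "complex ^ 2 ^ 2" where
  "quat_J = vector [vector [0, 1], vector [- 1, 0]]"

definition Q8 :: "(complex ^ 2 ^ 2) monoid" where
  "Q8 = matrix_group {mat 1, - mat 1, quat_I, - quat_I, quat_J, - quat_J,
                      quat_I ** quat_J, - (quat_I ** quat_J)}"

text \<open>The numeral type \<open>3\<close> is the ring of integers modulo 3.\<close>

definition SL23 :: "(3 ^ 2 ^ 2) monoid" where
  "SL23 = matrix_group {A. det A = 1}"

end

theory Submission
  imports Defs "HOL-Computational_Algebra.Computational_Algebra"
begin

text \<open>A matrix of finite order over \<open>K\<close> has a trace that is an integer of \<open>K\<close> of absolute value at most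
  three, which leaves only the orders 1, 2, 3, 4 and 6 in \<open>SL\<^sub>3(K)\<close>. A finite subgroup \<open>H\<close> of
  \<open>GL\<^sub>3(K)\<close> has determinants \<open>\<plusminus>1\<close> and is recovered from the projection \<open>N\<close> of \<open>H\<close> to \<open>SL\<^sub>3(K)\<close>
  along \<open>\<plusminus>1\<close>, the subgroup \<open>N\<^sub>0 = H \<inter> SL\<^sub>3(K)\<close> of index at most two in \<open>N\<close>, and the truth value of
  \<open>-1 \<in> H\<close>. If \<open>N\<close> is reducible, then by Maschke it is a finite subgroup of \<open>GL\<^sub>2(K)\<close>, namely
  cyclic, dihedral or built from the quaternion algebra \<open>(-1, -1)\<close>, which \<open>K\<close> splits; if it is
  irreducible, counting rotation axes leaves the rotation groups of the tetrahedron and the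
  octahedron. This gives 26 pairs \<open>(N, N\<^sub>0)\<close> up to conjugacy, 14 of them with \<open>N = N\<^sub>0\<close>, hence
  26 + 14 = 40 classes. The orders of \<open>N\<close> and \<open>N\<^sub>0\<close> and their numbers of solutions of \<open>x\<^sup>2 = 1\<close>
  separate the pairs, and the same two numbers of \<open>H\<close> separate all isomorphism types except
  \<open>A\<^sub>4\<close> and \<open>C\<^sub>2 \<times> C\<^sub>6\<close>.\<close>

section \<open>The field \<open>\<rat>(\<surd>-19)\<close>\<close>

text \<open>Two facts about the field carry the argument. Neither \<open>-3\<close> nor
  \<open>-4\<close> is a square, so a two by two matrix of determinant one and order 3, 4 or 6 has
  no eigenvalue in the field, and its trace fixes its conjugacy class. And \<open>-1\<close> is a
  sum of two squares, which supplies the quaternionic generator \<open>js0\<close>. The obstacle in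
  bounding orders is that integers of the field may have half-integral coordinates: the bound on the
  trace alone leaves eight irrational candidates, which only the traces of the second and fourth
  powers of the matrix remove.

  Non-conjugacy is never proved case by case. Once every pair is conjugate to an entry of a list
  with pairwise different numerical labels, equality of labels is conjugacy. The same completeness
  yields isomorphism types: one explicit model with given numbers settles all groups with these
  numbers. Multiplication tables are checked on integer data (exponents, doubled quaternion
  coordinates, integer matrices) and carried to the field by injective maps. The two types with
  equal numbers are told apart by commutativity.\<close>

datatype qf = Qf (qre: rat) (qim: rat)

instantiation qf :: field
begin
definition "0 = Qf 0 0"
definition "1 = Qf 1 0"
definition "x + y = Qf (qre x + qre y) (qim x + qim y)"
definition "x - y = Qf (qre x - qre y) (qim x - qim y)"
definition "- x = Qf (- qre x) (- qim x)"
definition "x * y = Qf (qre x * qre y - 19 * (qim x * qim y)) (qre x * qim y + qim x * qre y)"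
definition "inverse x = (let n = qre x * qre x + 19 * (qim x * qim x) in Qf (qre x / n) (- qim x / n))"
definition "x div (y::qf) = x * inverse y"
instance
proof
  fix a :: qf assume "a \<noteq> 0"
  \<comment> \<open>The norm form is positive definite over the rationals, so it vanishes only at
    zero.\<close>
  then have nz: "qre a * qre a + 19 * (qim a * qim a) \<noteq> 0"
    by (cases a) (auto simp: zero_qf_def add_nonneg_eq_0_iff)
  show "inverse a * a = 1"
    unfolding inverse_qf_def times_qf_def one_qf_def Let_def qf.sel qf.inject
  proof
    let ?n = "qre a * qre a + 19 * (qim a * qim a)"
    have "qre a / ?n * qre a - 19 * (- qim a / ?n * qim a) = qre a * qre a / ?n + 19 * (qim a * qim a) / ?n"
      by simp
    also have "\<dots> = ?n / ?n" by (rule add_divide_distrib[symmetric])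
    finally show "qre a / ?n * qre a - 19 * (- qim a / ?n * qim a) = 1" using nz by simp
    show "qre a / ?n * qim a + - qim a / ?n * qre a = 0" by simp
  qed
qed (auto simp: zero_qf_def one_qf_def plus_qf_def minus_qf_def uminus_qf_def times_qf_def
    divide_qf_def inverse_qf_def algebra_simps qf.expand)
end

lemma qf_sel [simp]:
  "qre 0 = 0" "qim 0 = 0" "qre 1 = 1" "qim 1 = 0"
  "qre (x + y) = qre x + qre y" "qim (x + y) = qim x + qim y"
  "qre (x - y) = qre x - qre y" "qim (x - y) = qim x - qim y"
  "qre (- x) = - qre x" "qim (- x) = - qim x"
  "qre (x * y) = qre x * qre y - 19 * (qim x * qim y)"
  "qim (x * y) = qre x * qim y + qim x * qre y"
  by (simp_all add: zero_qf_def one_qf_def plus_qf_def minus_qf_def uminus_qf_def times_qf_def)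

lemma qf_eq_iff: "x = y \<longleftrightarrow> qre x = qre y \<and> qim x = qim y" for x y :: qf
  by (cases x; cases y) auto

lemma of_nat_qf: "of_nat n = Qf (of_nat n) 0"
  by (induction n) (auto simp: qf_eq_iff)

lemma of_int_qf: "of_int z = Qf (of_int z) 0"
  by (cases z rule: int_diff_cases) (simp add: of_nat_qf qf_eq_iff)

lemma numeral_qf: "numeral k = Qf (numeral k) 0"
  using of_nat_qf[of "numeral k"] by simp

lemma qf_sel_numeral [simp]:
  "qre (numeral k) = numeral k" "qim (numeral k) = 0"
  "qre (of_int z) = of_int z" "qim (of_int z) = 0"
  by (simp_all add: numeral_qf of_int_qf)

instance qf :: field_char_0
  by standard (auto simp: inj_def of_nat_qf)

definition qnorm :: "qf \<Rightarrow> rat" where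
  "qnorm x = qre x * qre x + 19 * (qim x * qim x)"

definition qconj :: "qf \<Rightarrow> qf" where
  "qconj x = Qf (qre x) (- qim x)"

text \<open>The bridge to the complex field of the statement. The work is done in \<open>qf\<close>,
  where the field is a whole type of class \<open>field\<close>; \<open>cpx\<close> enters for
  absolute values and for the final transfer of subgroups.\<close>

definition cpx :: "qf \<Rightarrow> complex" where
  "cpx x = of_rat (qre x) + of_rat (qim x) * csqrt (of_int (- 19))"

lemma qnorm_mult: "qnorm (x * y) = qnorm x * qnorm y"
  by (simp add: qnorm_def algebra_simps)

lemma csqrt_19: "csqrt (of_int (- 19)) = \<i> * of_real (sqrt 19)"
  by (simp add: csqrt_of_real_nonpos)

lemma csqrt_19_sq: "csqrt (of_int (- 19)) * csqrt (of_int (- 19)) = - 19"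
  by (metis of_int_minus of_int_numeral power2_csqrt power2_eq_square)

lemma cpx_add: "cpx (x + y) = cpx x + cpx y"
  by (simp add: cpx_def of_rat_add algebra_simps del: of_int_minus)

lemma cpx_diff: "cpx (x - y) = cpx x - cpx y"
  by (simp add: cpx_def of_rat_diff algebra_simps del: of_int_minus)

lemma cpx_mult: "cpx (x * y) = cpx x * cpx y"
proof -
  let ?s = "csqrt (of_int (- 19))"
  have "cpx x * cpx y = of_rat (qre x) * of_rat (qre y) + of_rat (qim x) * of_rat (qim y) * (?s * ?s)
     + (of_rat (qre x) * of_rat (qim y) + of_rat (qim x) * of_rat (qre y)) * ?s"
    by (simp add: cpx_def algebra_simps del: of_int_minus)
  also have "\<dots> = cpx (x * y)"
    unfolding csqrt_19_sq by (simp add: cpx_def of_rat_diff of_rat_add of_rat_mult del: of_int_minus)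
  finally show ?thesis by simp
qed

lemma cpx_0 [simp]: "cpx 0 = 0" and cpx_1 [simp]: "cpx 1 = 1"
  by (simp_all add: cpx_def)

lemma of_rat_of_real: "(of_rat q :: complex) = of_real (of_rat q)"
  by (cases q) (simp add: of_rat_rat)

lemma Re_cpx: "Re (cpx x) = of_rat (qre x)" and Im_cpx: "Im (cpx x) = of_rat (qim x) * sqrt 19"
  unfolding cpx_def csqrt_19 by (simp_all add: of_rat_of_real)

lemma cpx_qconj: "cpx (qconj x) = cnj (cpx x)"
  by (simp add: complex_eq_iff Re_cpx Im_cpx qconj_def of_rat_minus)

lemma norm_cpx: "(norm (cpx x))\<^sup>2 = of_rat (qnorm x)"
  unfolding cmod_power2 Re_cpx Im_cpx
  by (simp add: qnorm_def of_rat_add of_rat_mult power_mult_distrib) (simp add: power2_eq_square)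

lemma inj_cpx: "cpx x = cpx y \<longleftrightarrow> x = y"
  by (auto simp: complex_eq_iff Re_cpx Im_cpx qf_eq_iff)

lemma range_cpx: "range cpx = quadratic_field (- 19)"
proof (intro equalityI subsetI)
  fix z assume "z \<in> quadratic_field (- 19)"
  then obtain a b where "z = cpx (Qf a b)" by (auto simp: quadratic_field_def cpx_def)
  then show "z \<in> range cpx" by blast
next
  fix z assume "z \<in> range cpx"
  then show "z \<in> quadratic_field (- 19)"
    unfolding quadratic_field_def cpx_def by blast
qed

section \<open>Matrix rings\<close>

text \<open>A record of named entries, instead of a function on a finite index type, turns matrix
  identities into entrywise polynomial identities within reach of \<open>algebra_simps\<close>, and
  lets concrete matrices be evaluated.\<close>

datatype 'a m2 = M2 (a11: 'a) (a12: 'a) (a21: 'a) (a22: 'a)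

lemma m2_eq_iff: "x = y \<longleftrightarrow> a11 x = a11 y \<and> a12 x = a12 y \<and> a21 x = a21 y \<and> a22 x = a22 y"
  by (cases x; cases y) auto

instantiation m2 :: (comm_ring_1) ring_1
begin
definition "0 = M2 0 0 0 0"
definition "1 = M2 1 0 0 1"
definition "x + y = M2 (a11 x + a11 y) (a12 x + a12 y) (a21 x + a21 y) (a22 x + a22 y)"
definition "x - y = M2 (a11 x - a11 y) (a12 x - a12 y) (a21 x - a21 y) (a22 x - a22 y)"
definition "- x = M2 (- a11 x) (- a12 x) (- a21 x) (- a22 x)"
definition "x * y = M2 (a11 x * a11 y + a12 x * a21 y) (a11 x * a12 y + a12 x * a22 y)
  (a21 x * a11 y + a22 x * a21 y) (a21 x * a12 y + a22 x * a22 y)"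
instance
  by standard (auto simp: m2_eq_iff zero_m2_def one_m2_def plus_m2_def minus_m2_def uminus_m2_def
    times_m2_def algebra_simps)
end

lemma m2_sel [simp]:
  "a11 0 = 0" "a12 0 = 0" "a21 0 = 0" "a22 0 = 0"
  "a11 1 = 1" "a12 1 = 0" "a21 1 = 0" "a22 1 = 1"
  "a11 (x + y) = a11 x + a11 y" "a12 (x + y) = a12 x + a12 y"
  "a21 (x + y) = a21 x + a21 y" "a22 (x + y) = a22 x + a22 y"
  "a11 (x - y) = a11 x - a11 y" "a12 (x - y) = a12 x - a12 y"
  "a21 (x - y) = a21 x - a21 y" "a22 (x - y) = a22 x - a22 y"
  "a11 (- x) = - a11 x" "a12 (- x) = - a12 x" "a21 (- x) = - a21 x" "a22 (- x) = - a22 x"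
  "a11 (x * y) = a11 x * a11 y + a12 x * a21 y" "a12 (x * y) = a11 x * a12 y + a12 x * a22 y"
  "a21 (x * y) = a21 x * a11 y + a22 x * a21 y" "a22 (x * y) = a21 x * a12 y + a22 x * a22 y"
  by (simp_all add: zero_m2_def one_m2_def plus_m2_def minus_m2_def uminus_m2_def times_m2_def)

definition tr2 :: "'a::comm_ring_1 m2 \<Rightarrow> 'a" where "tr2 x = a11 x + a22 x"
definition det2 :: "'a::comm_ring_1 m2 \<Rightarrow> 'a" where "det2 x = a11 x * a22 x - a12 x * a21 x"
definition adj2 :: "'a::comm_ring_1 m2 \<Rightarrow> 'a m2" where "adj2 x = M2 (a22 x) (- a12 x) (- a21 x) (a11 x)"
definition sc2 :: "'a::comm_ring_1 \<Rightarrow> 'a m2" where "sc2 c = M2 c 0 0 c"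

lemma adj2_sel [simp]: "a11 (adj2 x) = a22 x" "a12 (adj2 x) = - a12 x" "a21 (adj2 x) = - a21 x"
  "a22 (adj2 x) = a11 x"
  by (simp_all add: adj2_def)

lemma sc2_sel [simp]: "a11 (sc2 c) = c" "a12 (sc2 c) = 0" "a21 (sc2 c) = 0" "a22 (sc2 c) = c"
  by (simp_all add: sc2_def)

lemma det2_mult: "det2 (x * y) = det2 x * det2 y"
  by (simp add: det2_def algebra_simps)

lemma det2_1 [simp]: "det2 1 = 1" by (simp add: det2_def)

lemma adj2_right: "x * adj2 x = sc2 (det2 x)" and adj2_left: "adj2 x * x = sc2 (det2 x)"
  by (simp_all add: m2_eq_iff det2_def algebra_simps)

lemma sc2_1 [simp]: "sc2 1 = 1" by (simp add: m2_eq_iff)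

section \<open>Three by three matrices and their characteristic polynomial\<close>

datatype 'a m3 = M3 (b11: 'a) (b12: 'a) (b13: 'a) (b21: 'a) (b22: 'a) (b23: 'a)
  (b31: 'a) (b32: 'a) (b33: 'a)

lemma m3_eq_iff: "x = y \<longleftrightarrow> b11 x = b11 y \<and> b12 x = b12 y \<and> b13 x = b13 y \<and> b21 x = b21 y
  \<and> b22 x = b22 y \<and> b23 x = b23 y \<and> b31 x = b31 y \<and> b32 x = b32 y \<and> b33 x = b33 y"
  by (cases x; cases y) auto

instantiation m3 :: (comm_ring_1) ring_1
begin
definition "0 = M3 0 0 0 0 0 0 0 0 0"
definition "1 = M3 1 0 0 0 1 0 0 0 1"
definition "x + y = M3 (b11 x + b11 y) (b12 x + b12 y) (b13 x + b13 y)
  (b21 x + b21 y) (b22 x + b22 y) (b23 x + b23 y) (b31 x + b31 y) (b32 x + b32 y) (b33 x + b33 y)"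
definition "x - y = M3 (b11 x - b11 y) (b12 x - b12 y) (b13 x - b13 y)
  (b21 x - b21 y) (b22 x - b22 y) (b23 x - b23 y) (b31 x - b31 y) (b32 x - b32 y) (b33 x - b33 y)"
definition "- x = M3 (- b11 x) (- b12 x) (- b13 x) (- b21 x) (- b22 x) (- b23 x)
  (- b31 x) (- b32 x) (- b33 x)"
definition "x * y = M3
  (b11 x * b11 y + b12 x * b21 y + b13 x * b31 y)
  (b11 x * b12 y + b12 x * b22 y + b13 x * b32 y)
  (b11 x * b13 y + b12 x * b23 y + b13 x * b33 y)
  (b21 x * b11 y + b22 x * b21 y + b23 x * b31 y)
  (b21 x * b12 y + b22 x * b22 y + b23 x * b32 y)
  (b21 x * b13 y + b22 x * b23 y + b23 x * b33 y)
  (b31 x * b11 y + b32 x * b21 y + b33 x * b31 y)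
  (b31 x * b12 y + b32 x * b22 y + b33 x * b32 y)
  (b31 x * b13 y + b32 x * b23 y + b33 x * b33 y)"
instance
  by standard (auto simp: m3_eq_iff zero_m3_def one_m3_def plus_m3_def minus_m3_def uminus_m3_def
    times_m3_def algebra_simps)
end

lemma m3_sel [simp]:
  "b11 0 = 0" "b12 0 = 0" "b13 0 = 0" "b21 0 = 0" "b22 0 = 0" "b23 0 = 0" "b31 0 = 0" "b32 0 = 0" "b33 0 = 0"
  "b11 1 = 1" "b12 1 = 0" "b13 1 = 0" "b21 1 = 0" "b22 1 = 1" "b23 1 = 0" "b31 1 = 0" "b32 1 = 0" "b33 1 = 1"
  "b11 (x + y) = b11 x + b11 y" "b12 (x + y) = b12 x + b12 y" "b13 (x + y) = b13 x + b13 y"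
  "b21 (x + y) = b21 x + b21 y" "b22 (x + y) = b22 x + b22 y" "b23 (x + y) = b23 x + b23 y"
  "b31 (x + y) = b31 x + b31 y" "b32 (x + y) = b32 x + b32 y" "b33 (x + y) = b33 x + b33 y"
  "b11 (x - y) = b11 x - b11 y" "b12 (x - y) = b12 x - b12 y" "b13 (x - y) = b13 x - b13 y"
  "b21 (x - y) = b21 x - b21 y" "b22 (x - y) = b22 x - b22 y" "b23 (x - y) = b23 x - b23 y"
  "b31 (x - y) = b31 x - b31 y" "b32 (x - y) = b32 x - b32 y" "b33 (x - y) = b33 x - b33 y"
  "b11 (- x) = - b11 x" "b12 (- x) = - b12 x" "b13 (- x) = - b13 x"
  "b21 (- x) = - b21 x" "b22 (- x) = - b22 x" "b23 (- x) = - b23 x"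
  "b31 (- x) = - b31 x" "b32 (- x) = - b32 x" "b33 (- x) = - b33 x"
  "b11 (x * y) = b11 x * b11 y + b12 x * b21 y + b13 x * b31 y"
  "b12 (x * y) = b11 x * b12 y + b12 x * b22 y + b13 x * b32 y"
  "b13 (x * y) = b11 x * b13 y + b12 x * b23 y + b13 x * b33 y"
  "b21 (x * y) = b21 x * b11 y + b22 x * b21 y + b23 x * b31 y"
  "b22 (x * y) = b21 x * b12 y + b22 x * b22 y + b23 x * b32 y"
  "b23 (x * y) = b21 x * b13 y + b22 x * b23 y + b23 x * b33 y"
  "b31 (x * y) = b31 x * b11 y + b32 x * b21 y + b33 x * b31 y"
  "b32 (x * y) = b31 x * b12 y + b32 x * b22 y + b33 x * b32 y"
  "b33 (x * y) = b31 x * b13 y + b32 x * b23 y + b33 x * b33 y"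
  by (simp_all add: zero_m3_def one_m3_def plus_m3_def minus_m3_def uminus_m3_def times_m3_def)

definition tr3 :: "'a::comm_ring_1 m3 \<Rightarrow> 'a" where "tr3 x = b11 x + b22 x + b33 x"

definition det3 :: "'a::comm_ring_1 m3 \<Rightarrow> 'a" where
  "det3 x = b11 x * (b22 x * b33 x - b23 x * b32 x) - b12 x * (b21 x * b33 x - b23 x * b31 x)
    + b13 x * (b21 x * b32 x - b22 x * b31 x)"

definition adj3 :: "'a::comm_ring_1 m3 \<Rightarrow> 'a m3" where
  "adj3 x = M3
    (b22 x * b33 x - b23 x * b32 x) (b13 x * b32 x - b12 x * b33 x) (b12 x * b23 x - b13 x * b22 x)
    (b23 x * b31 x - b21 x * b33 x) (b11 x * b33 x - b13 x * b31 x) (b13 x * b21 x - b11 x * b23 x)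
    (b21 x * b32 x - b22 x * b31 x) (b12 x * b31 x - b11 x * b32 x) (b11 x * b22 x - b12 x * b21 x)"

definition sc3 :: "'a::comm_ring_1 \<Rightarrow> 'a m3" where "sc3 c = M3 c 0 0 0 c 0 0 0 c"

definition tp3 :: "'a::comm_ring_1 m3 \<Rightarrow> 'a m3" where
  "tp3 x = M3 (b11 x) (b21 x) (b31 x) (b12 x) (b22 x) (b32 x) (b13 x) (b23 x) (b33 x)"

lemma sc3_sel [simp]:
  "b11 (sc3 c) = c" "b12 (sc3 c) = 0" "b13 (sc3 c) = 0" "b21 (sc3 c) = 0" "b22 (sc3 c) = c"
  "b23 (sc3 c) = 0" "b31 (sc3 c) = 0" "b32 (sc3 c) = 0" "b33 (sc3 c) = c"
  by (simp_all add: sc3_def)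

lemma tp3_sel [simp]:
  "b11 (tp3 x) = b11 x" "b12 (tp3 x) = b21 x" "b13 (tp3 x) = b31 x" "b21 (tp3 x) = b12 x"
  "b22 (tp3 x) = b22 x" "b23 (tp3 x) = b32 x" "b31 (tp3 x) = b13 x" "b32 (tp3 x) = b23 x"
  "b33 (tp3 x) = b33 x"
  by (simp_all add: tp3_def)

lemma det3_mult: "det3 (x * y) = det3 x * det3 y"
  by (simp add: det3_def algebra_simps)

lemma det3_1 [simp]: "det3 1 = 1" by (simp add: det3_def)

lemma det3_minus: "det3 (- x) = - det3 x" by (simp add: det3_def algebra_simps)

lemma adj3_right: "x * adj3 x = sc3 (det3 x)" and adj3_left: "adj3 x * x = sc3 (det3 x)"
  by (simp_all add: m3_eq_iff det3_def adj3_def algebra_simps)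

lemma sc3_1 [simp]: "sc3 1 = 1" and sc3_0 [simp]: "sc3 0 = 0" by (simp_all add: m3_eq_iff)

lemma sc3_mult: "sc3 (c * d) = sc3 c * sc3 d" by (simp add: m3_eq_iff)

lemma sc3_commute: "sc3 c * x = x * sc3 c"
  by (simp add: m3_eq_iff algebra_simps)

lemma tp3_mult: "tp3 (x * y) = tp3 y * tp3 x"
  by (simp add: m3_eq_iff algebra_simps)

lemma tp3_tp3 [simp]: "tp3 (tp3 x) = x" by (simp add: m3_eq_iff)

text \<open>\<open>tr3 (adj3 x)\<close> is the sum of the principal two by two minors, hence the
  second elementary symmetric function of the eigenvalues.\<close>

lemma cayley_hamilton3:
  "x * x * x = sc3 (tr3 x) * (x * x) - sc3 (tr3 (adj3 x)) * x + sc3 (det3 x)"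
  by (simp add: m3_eq_iff tr3_def adj3_def det3_def algebra_simps)

text \<open>Newton's identity for the second power sum of the eigenvalues.\<close>

lemma tr3_square: "tr3 (x * x) = tr3 x * tr3 x - 2 * tr3 (adj3 x)"
  by (simp add: tr3_def adj3_def algebra_simps)

section \<open>Vectors of length three and kernels of singular matrices\<close>

datatype 'a v3 = V3 (c1: 'a) (c2: 'a) (c3: 'a)

lemma v3_eq_iff: "x = y \<longleftrightarrow> c1 x = c1 y \<and> c2 x = c2 y \<and> c3 x = c3 y"
  by (cases x; cases y) auto

instantiation v3 :: (comm_ring_1) ab_group_add
begin
definition "0 = V3 0 0 0"
definition "x + y = V3 (c1 x + c1 y) (c2 x + c2 y) (c3 x + c3 y)"
definition "x - y = V3 (c1 x - c1 y) (c2 x - c2 y) (c3 x - c3 y)"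
definition "- x = V3 (- c1 x) (- c2 x) (- c3 x)"
instance
  by standard (auto simp: v3_eq_iff zero_v3_def plus_v3_def minus_v3_def uminus_v3_def algebra_simps)
end

lemma v3_sel [simp]:
  "c1 0 = 0" "c2 0 = 0" "c3 0 = 0"
  "c1 (x + y) = c1 x + c1 y" "c2 (x + y) = c2 x + c2 y" "c3 (x + y) = c3 x + c3 y"
  "c1 (x - y) = c1 x - c1 y" "c2 (x - y) = c2 x - c2 y" "c3 (x - y) = c3 x - c3 y"
  "c1 (- x) = - c1 x" "c2 (- x) = - c2 x" "c3 (- x) = - c3 x"
  by (simp_all add: zero_v3_def plus_v3_def minus_v3_def uminus_v3_def)

definition app :: "'a::comm_ring_1 m3 \<Rightarrow> 'a v3 \<Rightarrow> 'a v3" where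
  "app x v = V3 (b11 x * c1 v + b12 x * c2 v + b13 x * c3 v)
    (b21 x * c1 v + b22 x * c2 v + b23 x * c3 v) (b31 x * c1 v + b32 x * c2 v + b33 x * c3 v)"

definition scale :: "'a::comm_ring_1 \<Rightarrow> 'a v3 \<Rightarrow> 'a v3" where
  "scale c v = V3 (c * c1 v) (c * c2 v) (c * c3 v)"

definition dot :: "'a::comm_ring_1 v3 \<Rightarrow> 'a v3 \<Rightarrow> 'a" where
  "dot v w = c1 v * c1 w + c2 v * c2 w + c3 v * c3 w"

definition cross :: "'a::comm_ring_1 v3 \<Rightarrow> 'a v3 \<Rightarrow> 'a v3" where
  "cross v w = V3 (c2 v * c3 w - c3 v * c2 w) (c3 v * c1 w - c1 v * c3 w) (c1 v * c2 w - c2 v * c1 w)"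

definition cols :: "'a v3 \<Rightarrow> 'a v3 \<Rightarrow> 'a v3 \<Rightarrow> 'a m3" where
  "cols u v w = M3 (c1 u) (c1 v) (c1 w) (c2 u) (c2 v) (c2 w) (c3 u) (c3 v) (c3 w)"

lemma app_sel [simp]:
  "c1 (app x v) = b11 x * c1 v + b12 x * c2 v + b13 x * c3 v"
  "c2 (app x v) = b21 x * c1 v + b22 x * c2 v + b23 x * c3 v"
  "c3 (app x v) = b31 x * c1 v + b32 x * c2 v + b33 x * c3 v"
  "c1 (scale c v) = c * c1 v" "c2 (scale c v) = c * c2 v" "c3 (scale c v) = c * c3 v"
  by (simp_all add: app_def scale_def)

lemma app_mult: "app (x * y) v = app x (app y v)"
  and app_1 [simp]: "app 1 v = v"
  and app_add: "app x (v + w) = app x v + app x w"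
  and app_scale: "app x (scale c v) = scale c (app x v)"
  and scale_scale: "scale c (scale d v) = scale (c * d) v"
  and scale_1 [simp]: "scale 1 v = v"
  and scale_0 [simp]: "scale 0 v = 0"
  and app_0 [simp]: "app x 0 = 0"
  and scale_zero [simp]: "scale c 0 = 0"
  and app_sc3: "app (sc3 c) v = scale c v"
  by (simp_all add: v3_eq_iff algebra_simps)

lemma dot_tp3: "dot (app (tp3 x) v) w = dot v (app x w)"
  by (simp add: dot_def algebra_simps)

lemma det3_cols: "det3 (cols u v w) = dot (cross u v) w"
  by (simp add: det3_def cols_def dot_def cross_def algebra_simps)

lemma scale_eq_0: "scale c v = 0 \<longleftrightarrow> c = 0 \<or> v = 0" for c :: "'a::field"
  by (auto simp: v3_eq_iff)

lemma cross_eq_0: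
  fixes u v :: "'a::field v3"
  assumes "cross u v = 0" "u \<noteq> 0"
  shows "\<exists>c. v = scale c u"
proof -
  have e: "c2 u * c3 v = c3 u * c2 v" "c3 u * c1 v = c1 u * c3 v" "c1 u * c2 v = c2 u * c1 v"
    using assms(1) by (auto simp: cross_def v3_eq_iff)
  consider "c1 u \<noteq> 0" | "c2 u \<noteq> 0" | "c3 u \<noteq> 0" using assms(2) by (auto simp: v3_eq_iff)
  then show ?thesis
  proof cases
    case 1
    then show ?thesis using e by (intro exI[of _ "c1 v / c1 u"]) (simp add: v3_eq_iff field_simps)
  next
    case 2
    then show ?thesis using e by (intro exI[of _ "c2 v / c2 u"]) (simp add: v3_eq_iff field_simps)
  next
    case 3
    then show ?thesis using e by (intro exI[of _ "c3 v / c3 u"]) (simp add: v3_eq_iff field_simps)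
  qed
qed

text \<open>If two rows are independent, their cross product is orthogonal to both and, the triple
  product being the determinant, to the third row as well. Otherwise all rows are multiples of one
  vector, and anything orthogonal to that vector is killed.\<close>

lemma det3_eq_0_kernel:
  fixes x :: "'a::field m3"
  assumes "det3 x = 0"
  shows "\<exists>v. v \<noteq> 0 \<and> app x v = 0"
proof -
  define r where "r = V3 (b11 x) (b12 x) (b13 x)"
  define s where "s = V3 (b21 x) (b22 x) (b23 x)"
  define t where "t = V3 (b31 x) (b32 x) (b33 x)"
  have app: "app x v = V3 (dot r v) (dot s v) (dot t v)" for v
    by (simp add: v3_eq_iff dot_def r_def s_def t_def)
  have orth: "dot a (cross a b) = 0" "dot b (cross a b) = 0" for a b :: "'a v3"
    by (simp_all add: dot_def cross_def algebra_simps)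
  have d: "dot t (cross r s) = 0" "dot r (cross s t) = 0" "dot s (cross t r) = 0"
    using assms by (simp_all add: det3_def dot_def cross_def r_def s_def t_def algebra_simps)
  show ?thesis
  proof (cases "cross r s = 0 \<and> cross s t = 0 \<and> cross t r = 0")
    case False
    then show ?thesis using d orth by (auto simp: app zero_v3_def)
  next
    case True
    have ex: "\<exists>v. v \<noteq> 0 \<and> dot a v = 0" for a :: "'a v3"
    proof (cases "c1 a = 0 \<and> c2 a = 0")
      case True
      then show ?thesis by (intro exI[of _ "V3 1 0 0"]) (simp add: dot_def v3_eq_iff)
    next
      case False
      then show ?thesis
        by (intro exI[of _ "V3 (c2 a) (- c1 a) 0"]) (auto simp: dot_def v3_eq_iff)
    qed
    have anti: "cross b a = - cross a b" for a b :: "'a v3"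
      by (simp add: cross_def v3_eq_iff)
    obtain a where a: "\<exists>c. r = scale c a" "\<exists>c. s = scale c a" "\<exists>c. t = scale c a"
    proof -
      consider "r = 0" "s = 0" "t = 0" | "r \<noteq> 0" | "s \<noteq> 0" | "t \<noteq> 0" by blast
      then show thesis
      proof cases
        case 1 then show ?thesis using that[of 0] by (metis scale_0)
      next
        case 2 then show ?thesis using that[of r] True anti cross_eq_0 by (metis neg_equal_0_iff_equal scale_1)
      next
        case 3 then show ?thesis using that[of s] True anti cross_eq_0 by (metis neg_equal_0_iff_equal scale_1)
      next
        case 4 then show ?thesis using that[of t] True anti cross_eq_0 by (metis neg_equal_0_iff_equal scale_1)
      qed
    qed
    obtain v where v: "v \<noteq> 0" "dot a v = 0" using ex by blast
    have "dot (scale c a) v = c * dot a v" for c by (simp add: dot_def algebra_simps)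
    then have "dot r v = 0" "dot s v = 0" "dot t v = 0" using a v by auto
    then show ?thesis using v by (auto simp: app zero_v3_def)
  qed
qed

section \<open>Matrices of finite order\<close>

lemma map_m3_cpx_mult: "map_m3 cpx (x * y) = map_m3 cpx x * map_m3 cpx y"
  by (simp add: m3_eq_iff m3.map_sel cpx_mult cpx_add)

lemma map_m3_cpx_1: "map_m3 cpx 1 = 1"
  by (simp add: m3_eq_iff m3.map_sel)

lemma map_m3_cpx_power: "map_m3 cpx (x ^ n) = map_m3 cpx x ^ n"
  by (induction n) (simp_all add: map_m3_cpx_mult map_m3_cpx_1)

text \<open>One root comes from the fundamental theorem of algebra, the other two from the quadratic
  formula for the cofactor \<open>X^2 - s X + p\<close>.\<close>

lemma cubic_vieta:
  fixes t e d :: complex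
  obtains \<alpha> \<beta> \<gamma> where "t = \<alpha> + \<beta> + \<gamma>" "e = \<alpha> * \<beta> + \<beta> * \<gamma> + \<gamma> * \<alpha>" "d = \<alpha> * \<beta> * \<gamma>"
proof -
  have "\<not> constant (poly [:- d, e, - t, 1:])"
    by (simp add: constant_degree)
  then obtain \<alpha> where \<alpha>: "poly [:- d, e, - t, 1:] \<alpha> = 0"
    using fundamental_theorem_of_algebra by blast
  define s where "s = t - \<alpha>"
  define p where "p = e - \<alpha> * s"
  define q where "q = csqrt (s\<^sup>2 - 4 * p)"
  have q: "q * q = s * s - 4 * p"
    using power2_csqrt[of "s\<^sup>2 - 4 * p"] by (simp add: q_def power2_eq_square)
  have bc: "(s + q) / 2 * ((s - q) / 2) = p"
  proof -
    have "(s + q) / 2 * ((s - q) / 2) = (s * s - q * q) / 4" by (simp add: field_simps)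
    then show ?thesis by (simp add: q)
  qed
  have sum: "(s + q) / 2 + (s - q) / 2 = s" by (simp add: field_simps)
  show thesis
  proof (rule that[of \<alpha> "(s + q) / 2" "(s - q) / 2"])
    show "t = \<alpha> + (s + q) / 2 + (s - q) / 2" using sum by (simp add: s_def add.assoc)
    have "\<alpha> * ((s + q) / 2) + (s + q) / 2 * ((s - q) / 2) + (s - q) / 2 * \<alpha>
        = \<alpha> * ((s + q) / 2 + (s - q) / 2) + p" unfolding bc by (simp add: algebra_simps)
    also have "\<dots> = e" unfolding sum by (simp add: p_def)
    finally show "e = \<alpha> * ((s + q) / 2) + (s + q) / 2 * ((s - q) / 2) + (s - q) / 2 * \<alpha>" by simp
    have "\<alpha> * p = d" using \<alpha> by (simp add: p_def s_def algebra_simps)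
    then show "d = \<alpha> * ((s + q) / 2) * ((s - q) / 2)" using bc by (simp add: mult.assoc)
  qed
qed

lemma finite_order_eigenvalue:
  fixes M :: "complex m3"
  assumes "M ^ n = 1" "n > 0" "det3 (sc3 z - M) = 0"
  shows "norm z = 1"
proof -
  obtain v where v: "v \<noteq> 0" "app (sc3 z - M) v = 0" using det3_eq_0_kernel assms(3) by blast
  have Mv: "app M v = scale z v" using v(2) by (auto simp: v3_eq_iff algebra_simps)
  have "app (M ^ k) v = scale (z ^ k) v" for k
    by (induction k) (simp_all add: app_mult app_scale Mv scale_scale mult.commute)
  from this[of n] have "scale (z ^ n) v = scale 1 v" using assms(1) by simp
  then have "scale (z ^ n - 1) v = 0" by (simp add: v3_eq_iff algebra_simps)
  then have "z ^ n = 1" using v(1) by (simp add: scale_eq_0)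
  then have "norm z ^ n = 1" by (metis norm_one norm_power)
  then show ?thesis using assms(2) by (metis norm_ge_zero power_eq_imp_eq_base power_one zero_le_one)
qed

text \<open>The three eigenvalues lie on the unit circle, so their sum is at most three in absolute
  value. Conjugation inverts each of them, which turns the sum of the pairwise products into the
  product times the conjugate of the sum.\<close>

lemma finite_order_complex:
  fixes M :: "complex m3"
  assumes "M ^ n = 1" "n > 0"
  shows "norm (tr3 M) \<le> 3" "tr3 (adj3 M) = det3 M * cnj (tr3 M)"
proof -
  obtain \<alpha> \<beta> \<gamma> where r: "tr3 M = \<alpha> + \<beta> + \<gamma>" "tr3 (adj3 M) = \<alpha> * \<beta> + \<beta> * \<gamma> + \<gamma> * \<alpha>" "det3 M = \<alpha> * \<beta> * \<gamma>"
    using cubic_vieta by metis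
  have ch: "det3 (sc3 z - M) = z * z * z - tr3 M * (z * z) + tr3 (adj3 M) * z - det3 M" for z
    by (simp add: det3_def tr3_def adj3_def algebra_simps)
  have "det3 (sc3 z - M) = (z - \<alpha>) * (z - \<beta>) * (z - \<gamma>)" for z
    unfolding ch r by (simp add: algebra_simps)
  then have n: "norm \<alpha> = 1" "norm \<beta> = 1" "norm \<gamma> = 1"
    using finite_order_eigenvalue[OF assms] by auto
  then show "norm (tr3 M) \<le> 3"
    unfolding r using norm_triangle_ineq[of "\<alpha> + \<beta>" \<gamma>] norm_triangle_ineq[of \<alpha> \<beta>] by simp
  have c: "cnj \<alpha> * \<alpha> = 1" "cnj \<beta> * \<beta> = 1" "cnj \<gamma> * \<gamma> = 1"
    using n by (simp_all add: complex_norm_square[symmetric] mult.commute)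
  have "det3 M * cnj (tr3 M) = (cnj \<alpha> * \<alpha>) * (\<beta> * \<gamma>) + (cnj \<beta> * \<beta>) * (\<alpha> * \<gamma>) + (cnj \<gamma> * \<gamma>) * (\<alpha> * \<beta>)"
    unfolding r by (simp add: algebra_simps)
  then show "tr3 (adj3 M) = det3 M * cnj (tr3 M)"
    unfolding c r by (simp add: algebra_simps)
qed

lemma finite_order_qf:
  fixes M :: "qf m3"
  assumes "M ^ n = 1" "n > 0"
  shows "qnorm (tr3 M) \<le> 9" "tr3 (adj3 M) = det3 M * qconj (tr3 M)"
proof -
  let ?C = "map_m3 cpx M"
  have C: "?C ^ n = 1" by (metis assms(1) map_m3_cpx_1 map_m3_cpx_power)
  have t: "tr3 ?C = cpx (tr3 M)" "tr3 (adj3 ?C) = cpx (tr3 (adj3 M))" "det3 ?C = cpx (det3 M)"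
    by (simp_all add: tr3_def adj3_def det3_def m3.map_sel cpx_add cpx_mult cpx_diff)
  have "(norm (cpx (tr3 M)))\<^sup>2 \<le> 3\<^sup>2"
    using finite_order_complex(1)[OF C assms(2)] unfolding t by (rule power_mono) simp
  then have "(of_rat (qnorm (tr3 M)) :: real) \<le> of_rat 9" by (simp add: norm_cpx)
  then show "qnorm (tr3 M) \<le> 9" unfolding of_rat_less_eq .
  show "tr3 (adj3 M) = det3 M * qconj (tr3 M)"
    using finite_order_complex(2)[OF C assms(2)] unfolding t
    by (simp add: cpx_qconj[symmetric] cpx_mult[symmetric] inj_cpx)
qed

section \<open>Integrality of traces\<close>

definition zs :: "qf set" where "zs = {x. qre x \<in> \<int> \<and> qim x \<in> \<int>}"

lemma zs_closed:
  assumes "x \<in> zs" "y \<in> zs"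
  shows "x + y \<in> zs" "x * y \<in> zs"
  using assms by (auto simp: zs_def)

lemma zs_conj_norm:
  assumes "x \<in> zs"
  shows "qconj x \<in> zs" "qnorm x \<in> \<int>"
  using assms by (auto simp: zs_def qconj_def qnorm_def)

lemma zs_0: "0 \<in> zs" and zs_of_int: "of_int k \<in> zs" and zs_of_nat: "of_nat m \<in> zs"
  by (auto simp: zs_def of_nat_qf)

lemma zs_sum: "(\<And>i. i \<in> I \<Longrightarrow> f i \<in> zs) \<Longrightarrow> sum f I \<in> zs"
  by (induction I rule: infinite_finite_induct) (auto simp: zs_0 intro: zs_closed(1))

lemma rat_denom: "\<exists>p q :: int. q > 0 \<and> coprime p q \<and> r * of_int q = of_int p" for r :: rat
proof -
  obtain p q where "quotient_of r = (p, q)" by (cases "quotient_of r")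
  then show ?thesis using quotient_of_div quotient_of_denom_pos quotient_of_coprime
    by (intro exI[of _ p] exI[of _ q]) fastforce
qed

lemma common_denominator:
  assumes "finite (S :: qf set)"
  shows "\<exists>D :: int. D > 0 \<and> (\<forall>x \<in> S. of_int D * x \<in> zs)"
  using assms
proof (induction S)
  case empty
  show ?case by (intro exI[of _ 1]) simp
next
  case (insert x S)
  then obtain D :: int where D: "D > 0" "\<forall>x \<in> S. of_int D * x \<in> zs" by blast
  obtain p q p' q' where q: "q > 0" "qre x * of_int q = of_int p" "q' > 0" "qim x * of_int q' = of_int p'"
    using rat_denom by metis
  have e: "of_int (D * q * q') * x \<in> zs"
  proof -
    have "qre (of_int (D * q * q') * x) = of_int (D * q') * (qre x * of_int q)"
      "qim (of_int (D * q * q') * x) = of_int (D * q) * (qim x * of_int q')"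
      by (simp_all add: algebra_simps)
    moreover have "of_int (D * q') * (of_int p :: rat) \<in> \<int>" "of_int (D * q) * (of_int p' :: rat) \<in> \<int>"
      by (simp_all only: of_int_mult[symmetric] Ints_of_int)
    ultimately show ?thesis unfolding zs_def q by (simp del: of_int_mult qf_sel)
  qed
  have f: "of_int (D * q * q') * y \<in> zs" if "y \<in> S" for y
  proof -
    have "of_int (D * q * q') * y = of_int (q * q') * (of_int D * y)" by (simp add: algebra_simps)
    then show ?thesis using D that zs_closed(2) zs_of_int by metis
  qed
  show ?case using e f D q by (intro exI[of _ "D * q * q'"]) auto
qed

text \<open>If \<open>q\<close> is the reduced denominator of \<open>r\<close>, then
  \<open>q ^ m\<close> divides \<open>D\<close> for every \<open>m\<close>, so bounded denominators
  of all powers force \<open>q = 1\<close>.\<close>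

lemma rat_integral:
  fixes r :: rat and D :: int
  assumes "D \<noteq> 0" "\<And>m. of_int D * r ^ m \<in> \<int>"
  shows "r \<in> \<int>"
proof -
  obtain p q where q: "q > 0" "coprime p q" "r * of_int q = of_int p" using rat_denom by blast
  \<comment> \<open>This exponent is large enough, because \<open>2 ^ m\<close> exceeds
    \<open>m = \<bar>D\<bar>\<close>.\<close>
  define m where "m = nat \<bar>D\<bar>"
  obtain z where z: "of_int D * r ^ m = of_int z" using assms(2)[of m] Ints_cases by blast
  have "(of_int (D * p ^ m) :: rat) = of_int D * (r * of_int q) ^ m" by (simp add: q(3))
  also have "\<dots> = of_int (z * q ^ m)" using z by (simp add: power_mult_distrib mult.assoc[symmetric])
  finally have "D * p ^ m = z * q ^ m" unfolding of_int_eq_iff .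
  then have "q ^ m dvd D * p ^ m" by simp
  then have "q ^ m dvd D"
    using q(2) by (metis coprime_commute coprime_dvd_mult_left_iff coprime_power_left_iff coprime_power_right_iff)
  then have "q ^ m \<le> \<bar>D\<bar>" using dvd_imp_le_int[OF assms(1), of "q ^ m"] q(1) by (simp add: power_abs)
  have "q = 1"
  proof (rule ccontr)
    assume "q \<noteq> 1"
    then have "2 \<le> q" using q(1) by simp
    then have "(2 :: int) ^ m \<le> q ^ m" by (simp add: power_mono)
    moreover have "int m < 2 ^ m" by (metis of_nat_less_two_power)
    ultimately show False using \<open>q ^ m \<le> \<bar>D\<bar>\<close> by (simp add: m_def)
  qed
  then show ?thesis using q(3) by simp
qed

text \<open>Even powers of \<open>r\<close> are integers, and odd ones become integers after one
  factor of the denominator, so the denominators of all powers are bounded.\<close>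

lemma rat_sqrt_integral:
  fixes r :: rat
  assumes "r * r \<in> \<int>"
  shows "r \<in> \<int>"
proof -
  obtain p q where q: "q > 0" "r * of_int q = of_int p" using rat_denom by blast
  have even: "r ^ (2 * k) \<in> \<int>" for k
    using assms by (metis Ints_power power2_eq_square power_mult)
  have "of_int q * r ^ m \<in> \<int>" for m
  proof (cases "even m")
    case True then show ?thesis using even by (auto elim: evenE)
  next
    case False
    then obtain k where "m = Suc (2 * k)" by (metis oddE Suc_eq_plus1)
    then have "of_int q * r ^ m = (r * of_int q) * r ^ (2 * k)" by simp
    then show ?thesis using even q(2) by simp
  qed
  then show ?thesis using rat_integral q(1) by (metis less_irrefl)
qed

text \<open>The powers of the norm and of the trace of \<open>t\<close> have bounded denominators,
  so both are integers; the doubled second coordinate follows because 19 is prime. Halves cannot be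
  excluded, since \<open>(1 + sqrt(-19)) / 2\<close> is an algebraic integer.\<close>

lemma qf_integral:
  fixes t :: qf and D :: int
  assumes "D \<noteq> 0" "\<And>m. of_int D * t ^ m \<in> zs"
  shows "2 * qre t \<in> \<int>" "2 * qim t \<in> \<int>" "qnorm t \<in> \<int>"
proof -
  have np: "qnorm (x ^ m) = qnorm x ^ m" for x m
    by (induction m) (simp_all add: qnorm_mult, simp add: qnorm_def)
  show n: "qnorm t \<in> \<int>"
  proof (rule rat_integral)
    show "D * D \<noteq> 0" using assms(1) by simp
    show "of_int (D * D) * qnorm t ^ m \<in> \<int>" for m
    proof -
      have "qnorm (of_int D * t ^ m) = of_int (D * D) * qnorm t ^ m"
        unfolding qnorm_mult np by (simp add: qnorm_def)
      then show ?thesis using zs_conj_norm(2) assms(2) by metis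
    qed
  qed
  have cm: "qconj (x * y) = qconj x * qconj y" for x y by (simp add: qf_eq_iff qconj_def)
  have cp: "qconj (x ^ m) = qconj x ^ m" for x m
    by (induction m) (simp_all add: cm, simp add: qconj_def one_qf_def)
  have c: "of_int D * qconj t ^ m \<in> zs" for m
  proof -
    have "of_int D * qconj t ^ m = qconj (of_int D * t ^ m)"
      by (simp add: cm cp) (simp add: qconj_def of_int_qf)
    then show ?thesis using zs_conj_norm(1) assms(2) by simp
  qed
  show r: "2 * qre t \<in> \<int>"
  proof (rule rat_integral)
    show "D * D \<noteq> 0" using assms(1) by simp
    fix m
    \<comment> \<open>Each binomial term is a power of \<open>t\<close> times a power of its
      conjugate, and either absorbs one factor \<open>D\<close>.\<close>
    have "of_int (D * D) * (t + qconj t) ^ m =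
      (\<Sum>k\<le>m. of_nat (m choose k) * ((of_int D * t ^ k) * (of_int D * qconj t ^ (m - k))))"
      unfolding binomial_ring sum_distrib_left by (simp add: algebra_simps)
    also have "\<dots> \<in> zs"
      by (intro zs_sum zs_closed(2)[OF zs_of_nat] zs_closed(2)[OF assms(2) c])
    finally have z: "of_int (D * D) * (t + qconj t) ^ m \<in> zs" .
    have "t + qconj t = Qf (2 * qre t) 0" by (simp add: qf_eq_iff qconj_def)
    moreover have "Qf r 0 ^ k = Qf (r ^ k) 0" for r k
      by (induction k) (simp_all add: qf_eq_iff)
    ultimately have "qre (of_int (D * D) * (t + qconj t) ^ m) = of_int (D * D) * (2 * qre t) ^ m"
      by (simp add: of_int_qf[of "D * D"] del: of_int_mult)
    then show "of_int (D * D) * (2 * qre t) ^ m \<in> \<int>" using z unfolding zs_def by (metis mem_Collect_eq)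
  qed
  let ?u = "2 * qim t"
  have "19 * (?u * ?u) = 4 * qnorm t - (2 * qre t) * (2 * qre t)" by (simp add: qnorm_def)
  then have "19 * (?u * ?u) \<in> \<int>" using n r by (metis Ints_diff Ints_mult Ints_numeral)
  then obtain z where z: "19 * (?u * ?u) = of_int z" by (auto elim: Ints_cases)
  \<comment> \<open>\<open>19 * ?u\<close> has an integral square, so it is an integer
    \<open>w\<close>. As 19 divides \<open>w * w\<close> it divides \<open>w\<close>, and
    \<open>?u\<close> itself is integral.\<close>
  have zz: "(19 * ?u) * (19 * ?u) = of_int (19 * z)" using z by simp
  have "19 * ?u \<in> \<int>" by (rule rat_sqrt_integral) (simp only: zz Ints_of_int)
  then obtain w where w: "19 * ?u = of_int w" by (auto elim: Ints_cases)
  have "(of_int (w * w) :: rat) = of_int (19 * z)" using zz unfolding w by (simp only: of_int_mult)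
  then have "w * w = 19 * z" unfolding of_int_eq_iff .
  then have w0: "(w mod 19) * (w mod 19) mod 19 = 0" by (simp add: mod_mult_eq)
  have sq: "\<forall>r \<in> {0..18 :: int}. r * r mod 19 = 0 \<longrightarrow> r = 0" by code_simp
  have "w mod 19 \<in> {0..18}" using pos_mod_bound[of 19 w] pos_mod_sign[of 19 w] by simp
  from bspec[OF sq this] w0 have "w mod 19 = 0" by (rule mp)
  then have "19 dvd w" by (rule mod_0_imp_dvd)
  then obtain y where "w = 19 * y" by blast
  then have "?u = of_int y" using w by simp
  then show "?u \<in> \<int>" by (metis Ints_of_int)
qed

text \<open>The trace acts on \<open>\<Lambda>\<^sup>3\<close> of the space as the derivation induced by the matrix; hence
  multiplication by \<open>tr M\<close> preserves the additive group spanned by finitely many determinants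
  whose columns are images of the basis vectors under powers of \<open>M\<close>, and \<open>tr M\<close> is integral.\<close>

lemma finite_order_trace_integral:
  fixes M :: "qf m3"
  assumes "M ^ n = 1" "n > 0"
  shows "2 * qre (tr3 M) \<in> \<int>" "2 * qim (tr3 M) \<in> \<int>" "qnorm (tr3 M) \<in> \<int>"
proof -
  define f where "f a b c = det3 (cols (app (M ^ a) (V3 1 0 0)) (app (M ^ b) (V3 0 1 0)) (app (M ^ c) (V3 0 0 1)))" for a b c
  \<comment> \<open>Exponents matter only modulo \<open>n\<close>, so one denominator
    \<open>D\<close> serves all the determinants.\<close>
  have pm: "M ^ (a mod n) = M ^ a" for a
    by (metis assms(1) mod_mult_div_eq mult_1_right power_add power_mult power_one)
  have "f a b c \<in> (\<lambda>(a, b, c). f a b c) ` ({..<n} \<times> {..<n} \<times> {..<n})" for a b c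
    by (rule image_eqI[of _ _ "(a mod n, b mod n, c mod n)"]) (use assms(2) in \<open>auto simp: f_def pm\<close>)
  then obtain D :: int where D: "D > 0" "\<And>a b c. of_int D * f a b c \<in> zs"
    using common_denominator[of "(\<lambda>(a, b, c). f a b c) ` ({..<n} \<times> {..<n} \<times> {..<n})"] by blast
  have "tr3 M * det3 (cols x y z) = det3 (cols (app M x) y z) + det3 (cols x (app M y) z) + det3 (cols x y (app M z))" for x y z
    by (simp add: tr3_def det3_def cols_def algebra_simps)
  then have step: "tr3 M * f a b c = f (Suc a) b c + f a (Suc b) c + f a b (Suc c)" for a b c
    by (simp add: f_def app_mult)
  have "of_int D * (tr3 M ^ m * f a b c) \<in> zs" for m a b c
  proof (induction m arbitrary: a b c)
    case (Suc m)
    have "of_int D * (tr3 M ^ Suc m * f a b c) = of_int D * (tr3 M ^ m * (tr3 M * f a b c))"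
      by (simp add: algebra_simps)
    also have "\<dots> = of_int D * (tr3 M ^ m * f (Suc a) b c) + of_int D * (tr3 M ^ m * f a (Suc b) c)
      + of_int D * (tr3 M ^ m * f a b (Suc c))"
      unfolding step by (simp add: algebra_simps)
    finally show ?case using Suc zs_closed(1) by simp
  qed (simp add: D)
  \<comment> \<open>\<open>f 0 0 0\<close> is the determinant of the unit matrix.\<close>
  from this[of _ 0 0 0] have "of_int D * tr3 M ^ m \<in> zs" for m
    by (simp add: f_def det3_def cols_def)
  then show "2 * qre (tr3 M) \<in> \<int>" "2 * qim (tr3 M) \<in> \<int>" "qnorm (tr3 M) \<in> \<int>"
    using qf_integral[of D] D(1) by auto
qed

text \<open>Write the trace as \<open>(a + b * sqrt(-19)) / 2\<close>. The norm bound nine leaves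
  \<open>b = 0\<close>, or \<open>b\<close> equal to \<open>1\<close> or \<open>-1\<close> with
  \<open>a\<close> odd and at most three in absolute value. The latter are refuted by the traces of
  \<open>M ^ 2\<close> and \<open>M ^ 4\<close>, obtained from Newton's identity, in which the
  second symmetric function is the conjugate trace.\<close>

lemma SL3_trace_real_int:
  fixes M :: "qf m3"
  assumes "M ^ n = 1" "n > 0" "det3 M = 1"
  obtains k :: int where "tr3 M = of_int k" "\<bar>k\<bar> \<le> 3"
proof -
  define t where "t = tr3 M"
  obtain a b c where abc: "2 * qre t = of_int a" "2 * qim t = of_int b" "qnorm t = of_int c"
    using finite_order_trace_integral[OF assms(1,2)] unfolding t_def by (auto elim!: Ints_cases)
  have t: "t = Qf (of_int a / 2) (of_int b / 2)" using abc by (simp add: qf_eq_iff)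
  have "(of_int (a * a + 19 * (b * b)) :: rat) = of_int (4 * c)"
    using abc(3) unfolding t qnorm_def by (simp add: field_simps)
  then have abc': "a * a + 19 * (b * b) = 4 * c" unfolding of_int_eq_iff .
  have bound: "qnorm (tr3 (M ^ Suc k)) \<le> 9" for k
  proof (rule finite_order_qf)
    show "(M ^ Suc k) ^ n = 1" by (metis assms(1) mult.commute power_mult power_one)
  qed (use assms(2) in simp)
  have e: "tr3 (adj3 (M ^ Suc k)) = qconj (tr3 (M ^ Suc k))" for k
  proof -
    have "(M ^ Suc k) ^ n = 1" by (metis assms(1) mult.commute power_mult power_one)
    moreover have "det3 (M ^ Suc k) = 1" using assms(3) by (induction k) (simp_all add: det3_mult)
    ultimately show ?thesis using finite_order_qf(2)[of "M ^ Suc k" n] assms(2) by simp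
  qed
  define t2 where "t2 = t * t - 2 * qconj t"
  \<comment> \<open>The fourth power is needed for \<open>a = -3\<close>: there the square has trace
    \<open>(1 - b * sqrt(-19)) / 2\<close>, of norm only five.\<close>
  define t4 where "t4 = t2 * t2 - 2 * qconj t2"
  have t2: "t2 = tr3 (M * M)" using e[of 0] by (simp add: tr3_square t2_def t_def)
  have t4: "t4 = tr3 (M * M * (M * M))" using e[of 1] by (simp add: tr3_square t4_def t2)
  have bt: "qnorm t \<le> 9" "qnorm t2 \<le> 9" "qnorm t4 \<le> 9"
    using bound[of 0] bound[of 1] bound[of 3] unfolding t2 t4 t_def
    by (simp_all add: numeral_eq_Suc mult.assoc)
  have c9: "c \<le> 9" using bt(1) abc(3) by simp
  have sq: "0 \<le> a * a" "0 \<le> b * b" by simp_all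
  have sqb: "\<bar>x\<bar> < y" if "x * x < y * y" "0 \<le> y" for x y :: int
    using that abs_le_square_iff[of y x] by (simp add: power2_eq_square not_le[symmetric])
  have "b * b < 2 * 2" using abc' c9 sq by linarith
  then have "\<bar>b\<bar> < 2" by (rule sqb) simp
  then consider "b = 0" | "b = 1 \<or> b = -1" by linarith
  then have "b = 0"
  proof cases
    case 2
    then have bb: "b * b = 1" by auto
    have "a * a < 5 * 5" using abc' c9 bb by linarith
    then have "\<bar>a\<bar> < 5" by (rule sqb) simp
    then have "a = -4 \<or> a = -3 \<or> a = -2 \<or> a = -1 \<or> a = 0 \<or> a = 1 \<or> a = 2 \<or> a = 3 \<or> a = 4"
      by presburger
    moreover have "a * a + 19 = 4 * c" using abc' bb by simp
    ultimately have "a = -3 \<or> a = -1 \<or> a = 1 \<or> a = 3"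
      by (elim disjE) (simp_all, presburger+)
    then show ?thesis using 2 bt(2,3) unfolding t4_def t2_def t qnorm_def qconj_def
      by (elim disjE) (simp_all add: field_simps numeral_qf)
  qed simp
  then have "a * a = 4 * c" using abc' by simp
  then have "even a" by (metis dvd_triv_left even_mult_iff even_numeral)
  then obtain k where k: "a = 2 * k" by blast
  have tk: "t = of_int k" unfolding t k \<open>b = 0\<close> by (simp add: qf_eq_iff)
  have "k * k \<le> 9" using \<open>a * a = 4 * c\<close> c9 k by simp
  then have "k * k < 4 * 4" by simp
  then have "\<bar>k\<bar> < 4" by (rule sqb) simp
  then show thesis using that[of k] tk by (simp add: t_def)
qed

lemma of_nat_m3: "of_nat n = sc3 (of_nat n)"
  by (induction n) (simp_all add: m3_eq_iff)

lemma of_nat_mult_m3_eq_0: "of_nat n * x = 0 \<Longrightarrow> n > 0 \<Longrightarrow> x = 0" for x :: "qf m3"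
  by (auto simp: of_nat_m3 m3_eq_iff)

text \<open>With \<open>u * u * u = 0\<close> the expansion of \<open>(1 + u) ^ n\<close> leaves
  \<open>n u + c u^2 = 0\<close>. Multiplying by \<open>u\<close> kills \<open>u^2\<close> in
  characteristic zero, and what remains kills \<open>u\<close>.\<close>

lemma unipotent_finite_order:
  fixes M :: "qf m3"
  assumes "M ^ n = 1" "n > 0" "(M - 1) * (M - 1) * (M - 1) = 0"
  shows "M = 1"
proof -
  define u where "u = M - 1"
  have M: "M = 1 + u" and u3: "u * u * u = 0" using assms(3) by (simp_all add: u_def)
  have "\<exists>c. M ^ m = 1 + of_nat m * u + of_nat c * (u * u)" for m
  proof (induction m)
    case 0
    show ?case by (intro exI[of _ 0]) simp
  next
    case (Suc m)
    then obtain c where c: "M ^ m = 1 + of_nat m * u + of_nat c * (u * u)" by blast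
    have "M ^ Suc m = (1 + u) * (1 + of_nat m * u + of_nat c * (u * u))" using c M by simp
    also have "\<dots> = 1 + of_nat (Suc m) * u + of_nat (c + m) * (u * u) + of_nat c * (u * u * u)"
      by (simp add: distrib_left distrib_right of_nat_m3 m3_eq_iff)
    finally show ?case using u3 by (intro exI[of _ "c + m"]) simp
  qed
  then obtain c where "M ^ n = 1 + of_nat n * u + of_nat c * (u * u)" by blast
  then have e: "of_nat n * u + of_nat c * (u * u) = 0" using assms(1) by simp
  then have "(of_nat n * u + of_nat c * (u * u)) * u = 0" by simp
  then have "of_nat n * (u * u) + of_nat c * (u * u * u) = 0" by (simp add: algebra_simps)
  then have "u * u = 0" using of_nat_mult_m3_eq_0 assms(2) u3 by simp
  then have "u = 0" using e of_nat_mult_m3_eq_0 assms(2) by simp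
  then show ?thesis using M by simp
qed

text \<open>The square has trace \<open>k * k - 2 * k\<close>, which is again at most three, and
  this removes \<open>k = -2\<close> and \<open>k = -3\<close>. Trace three gives the characteristic
  polynomial \<open>(X - 1)^3\<close>, hence a unipotent matrix; trace \<open>-1\<close> gives trace
  three for the square.\<close>

theorem SL3_finite_order:
  fixes M :: "qf m3"
  assumes "M ^ n = 1" "n > 0" "det3 M = 1"
  shows "tr3 M \<in> {3, -1, 0, 1, 2}" "tr3 (adj3 M) = tr3 M" "tr3 M = 3 \<Longrightarrow> M = 1" "tr3 M = -1 \<Longrightarrow> M * M = 1"
proof -
  obtain k where k: "tr3 M = of_int k" "\<bar>k\<bar> \<le> 3" using SL3_trace_real_int[OF assms] .
  have "qconj (of_int k) = of_int k" by (simp add: qf_eq_iff qconj_def)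
  then show e: "tr3 (adj3 M) = tr3 M"
    using finite_order_qf(2)[OF assms(1,2)] assms(3) k by simp
  have M2: "(M * M) ^ n = 1" "det3 (M * M) = 1"
    using assms(1,3) by (metis mult.commute power2_eq_square power_mult power_one, simp add: det3_mult)
  obtain l where l: "tr3 (M * M) = of_int l" "\<bar>l\<bar> \<le> 3"
    using SL3_trace_real_int[OF M2(1) assms(2) M2(2)] .
  have "(of_int l :: qf) = of_int (k * k - 2 * k)"
    using l(1) unfolding tr3_square e k by simp
  then have lk: "l = k * k - 2 * k" unfolding of_int_eq_iff .
  have "k = -3 \<or> k = -2 \<or> k = -1 \<or> k = 0 \<or> k = 1 \<or> k = 2 \<or> k = 3" using k(2) by presburger
  then show "tr3 M \<in> {3, -1, 0, 1, 2}" using l(2) k(1) unfolding lk by (elim disjE) simp_all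
  have unip: "Y = 1" if "Y ^ n = 1" "det3 Y = 1" "tr3 Y = 3" "tr3 (adj3 Y) = 3" for Y :: "qf m3"
  proof -
    have s3: "sc3 3 * Z = Z + Z + Z" for Z :: "qf m3" by (simp add: m3_eq_iff)
    have "Y * Y * Y = (Y * Y + Y * Y + Y * Y) - (Y + Y + Y) + 1"
      using cayley_hamilton3[of Y] that(2-4) by (simp add: s3)
    then have "(Y - 1) * (Y - 1) * (Y - 1) = 0" by (simp add: algebra_simps)
    then show ?thesis using unipotent_finite_order that(1) assms(2) by blast
  qed
  show "M = 1" if "tr3 M = 3" using unip[OF assms(1,3) that] e that by simp
  show "M * M = 1" if "tr3 M = -1"
  proof (rule unip[OF M2])
    show "tr3 (M * M) = 3" using that e by (simp add: tr3_square)
    then show "tr3 (adj3 (M * M)) = 3"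
      using finite_order_qf(2)[OF M2(1) assms(2)] M2(2) by (simp add: qconj_def numeral_qf)
  qed
qed

section \<open>Square roots and roots of unity in the field\<close>

lemma qf_square_ne: "y * y \<noteq> - 3" "y * y \<noteq> - 4" for y :: qf
proof -
  \<comment> \<open>\<open>57 = 3 * 19\<close> and \<open>76 = 4 * 19\<close>: an element with
    square \<open>-3\<close> or \<open>-4\<close> is a rational multiple of
    \<open>sqrt(-19)\<close>, and 19 times its coordinate would square to one of these
    numbers.\<close>
  have sq: "w * w \<noteq> 57" "w * w \<noteq> 76" for w :: int
  proof -
    have "\<bar>w\<bar> < 9" if "w * w \<in> {57, 76}"
      using that abs_le_square_iff[of 9 w] by (auto simp: power2_eq_square not_le[symmetric])
    then have "w * w \<in> {57, 76} \<Longrightarrow> w \<in> set [-8..8]" by auto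
    moreover have "\<forall>w \<in> set [-8..8]. w * w \<noteq> 57 \<and> w * w \<noteq> (76 :: int)" by code_simp
    ultimately show "w * w \<noteq> 57" "w * w \<noteq> 76" by auto
  qed
  have ne: "qre y * qre y - 19 * (qim y * qim y) \<noteq> - of_int c"
    if yz: "qre y * qim y = 0" and c: "c > 0" "\<And>w :: int. w * w \<noteq> 19 * c" for c
  proof
    assume a: "qre y * qre y - 19 * (qim y * qim y) = - of_int c"
    show False
    proof (cases "qre y = 0")
      case True
      then have e: "(19 * qim y) * (19 * qim y) = of_int (19 * c)" using a by simp
      have "19 * qim y \<in> \<int>" by (rule rat_sqrt_integral) (simp only: e Ints_of_int)
      then obtain w where "19 * qim y = of_int w" by (rule Ints_cases)
      then have "(of_int (w * w) :: rat) = of_int (19 * c)" using e by (simp only: of_int_mult)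
      then show False unfolding of_int_eq_iff using c(2) by blast
    next
      case False
      then have "qre y * qre y = - of_int c" using a yz by simp
      moreover have "0 \<le> qre y * qre y" by simp
      ultimately show False using c(1) by simp
    qed
  qed
  have z: "qre y * qim y = 0" if "qim (y * y) = 0" using that by auto
  show "y * y \<noteq> - 3"
  proof
    assume e: "y * y = - 3"
    then have "qim (y * y) = 0" "qre (y * y) = - of_int 3" by (simp_all only: e) simp_all
    then show False using ne[OF z, of 3] sq(1) by simp
  qed
  show "y * y \<noteq> - 4"
  proof
    assume e: "y * y = - 4"
    then have "qim (y * y) = 0" "qre (y * y) = - of_int 4" by (simp_all only: e) simp_all
    then show False using ne[OF z, of 4] sq(2) by simp
  qed
qed

text \<open>The discriminants \<open>c * c - 4\<close> are \<open>-3\<close> and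
  \<open>-4\<close>.\<close>

lemma qf_no_root: "x * x - c * x + 1 \<noteq> 0" if "c \<in> {-1, 0, 1}" for x c :: qf
proof
  assume "x * x - c * x + 1 = 0"
  then have "4 * (x * x - c * x + 1) = 0" by simp
  then have e: "(2 * x - c) * (2 * x - c) = c * c - 4" by (simp add: algebra_simps)
  show False using that e qf_square_ne[of "2 * x - c"] by auto
qed

text \<open>The diagonal matrix with entries \<open>x\<close>, its inverse and \<open>1\<close> has
  determinant one and finite order. Its trace leaves five values of \<open>x + inverse x\<close>,
  and all but \<open>2\<close> and \<open>-2\<close> would make \<open>x\<close> a root of a
  quadratic without roots in the field.\<close>

lemma qf_root_of_unity:
  fixes x :: qf
  assumes "x ^ n = 1" "n > 0"
  shows "x = 1 \<or> x = -1"
proof -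
  have x0: "x \<noteq> 0" using assms by (auto simp: power_0_left)
  let ?M = "M3 x 0 0 0 (inverse x) 0 0 0 1"
  have "?M ^ k = M3 (x ^ k) 0 0 0 (inverse x ^ k) 0 0 0 1" for k
    by (induction k) (simp_all add: m3_eq_iff)
  then have "?M ^ n = 1" using assms by (simp add: m3_eq_iff power_inverse)
  moreover have "det3 ?M = 1" using x0 by (simp add: det3_def)
  ultimately have t: "x + inverse x + 1 \<in> {3, -1, 0, 1, 2}"
    using SL3_finite_order(1) assms(2) by (fastforce simp: tr3_def)
  have "x * (x + inverse x) = x * x + 1" using x0 by (simp add: algebra_simps)
  then have q: "x * x - (x + inverse x) * x + 1 = 0" by (simp add: algebra_simps)
  have "x + inverse x + 1 - 1 \<in> (\<lambda>y. y - 1) ` {3, -1, 0, 1, 2}" using t by (rule imageI)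
  then have "x + inverse x = 2 \<or> x + inverse x = -2 \<or> x + inverse x \<in> {-1, 0, 1}" by simp
  then consider "x + inverse x = 2" | "x + inverse x = -2" using qf_no_root q by blast
  then show ?thesis
  proof cases
    case 1
    then have "(x - 1) * (x - 1) = 0" using q by (simp add: algebra_simps)
    then show ?thesis by simp
  next
    case 2
    then have "(x + 1) * (x + 1) = 0" using q by (simp add: algebra_simps)
    then show ?thesis by (simp add: eq_neg_iff_add_eq_0)
  qed
qed

section \<open>Finite groups inside a monoid\<close>

text \<open>Finite groups of units are described inside a type of class \<open>monoid_mult\<close>,
  without carrier records; the same predicate serves matrices of both sizes.\<close>

definition fgrp :: "'a::monoid_mult set \<Rightarrow> bool" where
  "fgrp H \<longleftrightarrow> finite H \<and> 1 \<in> H \<and> (\<forall>x\<in>H. \<forall>y\<in>H. x * y \<in> H) \<and> (\<forall>x\<in>H. \<exists>y\<in>H. x * y = 1 \<and> y * x = 1)"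

lemma fgrpD:
  assumes "fgrp H"
  shows "finite H" "1 \<in> H" "\<And>x y. x \<in> H \<Longrightarrow> y \<in> H \<Longrightarrow> x * y \<in> H"
    "\<And>x. x \<in> H \<Longrightarrow> \<exists>y\<in>H. x * y = 1 \<and> y * x = 1"
  using assms by (auto simp: fgrp_def)

lemma fgrp_power: "fgrp H \<Longrightarrow> x \<in> H \<Longrightarrow> x ^ n \<in> H"
  by (induction n) (auto dest: fgrpD)

lemma left_inverse_power: "y * x = 1 \<Longrightarrow> y ^ n * x ^ n = 1" for x y :: "'a::monoid_mult"
proof (induction n)
  case (Suc n)
  have "y ^ Suc n * x ^ Suc n = y ^ n * (y * x) * x ^ n"
    by (simp only: power_Suc2[of y] power_Suc[of x] mult.assoc)
  then show ?case using Suc by simp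
qed simp

lemma fgrp_finite_order:
  assumes "fgrp H" "x \<in> H"
  obtains n where "n > 0" "x ^ n = 1"
proof -
  obtain y where y: "y * x = 1" using fgrpD(4)[OF assms] by blast
  have "range (\<lambda>n::nat. x ^ n) \<subseteq> H" using fgrp_power[OF assms] by blast
  then have "finite (range (\<lambda>n::nat. x ^ n))" using fgrpD(1)[OF assms(1)] finite_subset by blast
  then have "\<not> inj (\<lambda>n::nat. x ^ n)" using finite_imageD infinite_UNIV_nat by blast
  then obtain a b where "a \<noteq> b" "x ^ a = x ^ b" by (auto simp: inj_def)
  then obtain a b :: nat where ab: "a < b" "x ^ a = x ^ b" by (metis nat_neq_iff)
  have "x ^ b = x ^ a * x ^ (b - a)" using ab(1) by (metis add_diff_inverse_nat less_imp_not_less power_add)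
  then have "y ^ a * x ^ a = y ^ a * x ^ a * x ^ (b - a)" using ab(2) by (simp add: mult.assoc)
  then have "x ^ (b - a) = 1" unfolding left_inverse_power[OF y] by simp
  then show thesis using ab(1) that[of "b - a"] by simp
qed

section \<open>Finite groups of matrices of size two\<close>

text \<open>The embedding of finite subgroups of \<open>GL2\<close> in \<open>SL3\<close>. The
  corner ought to be the inverse determinant, but for matrices of finite order the determinant is
  its own inverse, and \<open>det2 A\<close> keeps the map polynomial.\<close>

definition iota :: "'a::comm_ring_1 m2 \<Rightarrow> 'a m3" where
  "iota A = M3 (det2 A) 0 0 0 (a11 A) (a12 A) 0 (a21 A) (a22 A)"

lemma iota_mult: "iota (A * B) = iota A * iota B"
  by (simp add: m3_eq_iff iota_def det2_mult)

lemma iota_1: "iota 1 = 1" by (simp add: m3_eq_iff iota_def)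

lemma iota_power: "iota (A ^ n) = iota A ^ n"
  by (induction n) (simp_all add: iota_mult iota_1)

lemma iota_inj: "iota A = iota B \<longleftrightarrow> A = B" by (auto simp: m3_eq_iff m2_eq_iff iota_def det2_def)

lemma det3_iota: "det3 (iota A) = det2 A * det2 A"
  by (simp add: det3_def iota_def det2_def algebra_simps)

lemma tr3_iota: "tr3 (iota A) = det2 A + tr2 A"
  by (simp add: tr3_def iota_def tr2_def algebra_simps)

lemma cayley_hamilton2: "A * A = sc2 (tr2 A) * A - sc2 (det2 A)"
  by (simp add: m2_eq_iff tr2_def det2_def algebra_simps)

text \<open>For traceless \<open>A\<close> and \<open>B\<close> it says that they anticommute
  exactly when \<open>tr2 (A * B) = 0\<close>, the form in which anticommutation is used
  below.\<close>

lemma cayley_hamilton2_polar: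
  "A * B + B * A = sc2 (tr2 A) * B + sc2 (tr2 B) * A + sc2 (tr2 (A * B) - tr2 A * tr2 B)"
  by (simp add: m2_eq_iff tr2_def algebra_simps)

lemma sc2_0 [simp]: "sc2 0 = 0" and sc2_minus: "sc2 (- c) = - sc2 c" by (simp_all add: m2_eq_iff)

lemma tr2_add_adj: "tr2 (A * B) + tr2 (A * adj2 B) = tr2 A * tr2 B"
  by (simp add: tr2_def algebra_simps)

lemma tr2_simps: "tr2 (adj2 A) = tr2 A" "tr2 (- A) = - tr2 A" "tr2 (A + B) = tr2 A + tr2 B"
  "tr2 (A - B) = tr2 A - tr2 B" "tr2 1 = 2"
  by (simp_all add: tr2_def)

lemma tr2_commute: "tr2 (A * B) = tr2 (B * A)"
  by (simp add: tr2_def algebra_simps)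

lemma det2_minus: "det2 (- A) = det2 A" by (simp add: det2_def)

lemma adj2_eq: "adj2 A = sc2 (tr2 A) - A"
  by (simp add: m2_eq_iff tr2_def)

lemma det2_power: "det2 (A ^ n) = det2 A ^ n"
  by (induction n) (simp_all add: det2_mult)

text \<open>Everything is read off \<open>iota A\<close>, whose trace is
  \<open>det2 A + tr2 A\<close>. In determinant \<open>-1\<close> the trace of \<open>A\<close> lies
  in \<open>{4, 0, 1, 2, 3}\<close>, and so does its negative because \<open>- A\<close> has finite
  order as well; only zero is left.\<close>

lemma GL2_finite_order:
  fixes A :: "qf m2"
  assumes "A ^ n = 1" "n > 0"
  shows "det2 A = 1 \<or> det2 A = -1"
    "det2 A = 1 \<Longrightarrow> tr2 A \<in> {2, -2, -1, 0, 1}"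
    "det2 A = 1 \<Longrightarrow> tr2 A = 2 \<Longrightarrow> A = 1"
    "det2 A = 1 \<Longrightarrow> tr2 A = -2 \<Longrightarrow> A = -1"
    "det2 A = -1 \<Longrightarrow> tr2 A = 0"
proof -
  have "det2 A ^ n = 1" using assms(1) by (metis det2_power det2_1)
  then show d: "det2 A = 1 \<or> det2 A = -1" using qf_root_of_unity assms(2) by blast
  have i: "iota A ^ n = 1" using assms(1) by (metis iota_power iota_1)
  have d3: "det3 (iota A) = 1" using d by (auto simp: det3_iota)
  note f = SL3_finite_order[OF i assms(2) d3, unfolded tr3_iota]
  have "det2 A + tr2 A - det2 A \<in> (\<lambda>y. y - det2 A) ` {3, -1, 0, 1, 2}" using f(1) by (rule imageI)
  then have t: "tr2 A \<in> (\<lambda>y. y - det2 A) ` {3, -1, 0, 1, 2}" by simp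
  then show "det2 A = 1 \<Longrightarrow> tr2 A \<in> {2, -2, -1, 0, 1}" by simp
  show "det2 A = 1 \<Longrightarrow> tr2 A = 2 \<Longrightarrow> A = 1"
    using f(3) iota_inj[of A 1] by (simp add: iota_1)
  show "A = -1" if "det2 A = 1" "tr2 A = -2"
  proof -
    have "iota (A * A) = iota 1" using f(4) that by (simp add: iota_1 iota_mult)
    then have "A * A = 1" unfolding iota_inj .
    then have "1 = sc2 (- 2) * A - 1" using cayley_hamilton2[of A] that by simp
    moreover have "y = -1" if "- (2 * y) = 2" for y :: qf
    proof -
      have "y = - (2 * y) / (- 2)" by simp
      then show ?thesis unfolding that by simp
    qed
    ultimately show ?thesis by (auto simp: m2_eq_iff)
  qed
  show "tr2 A = 0" if dm: "det2 A = -1"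
  proof -
    have "(- A) ^ (2 * n) = 1" using assms(1)
      by (simp add: power_mult power2_eq_square flip: power_mult_distrib)
         (metis mult.commute power2_eq_square power_mult power_one)
    then have i': "iota (- A) ^ (2 * n) = 1" by (metis iota_power iota_1)
    have "det3 (iota (- A)) = 1" using dm by (simp add: det3_iota det2_minus)
    note g = SL3_finite_order(1)[OF i' _ this, unfolded tr3_iota]
    have "tr2 A \<in> {4, 0, 1, 2, 3}" using t unfolding dm by simp
    moreover have "det2 (- A) + tr2 (- A) - det2 (- A) \<in> (\<lambda>y. y - det2 (- A)) ` {3, -1, 0, 1, 2}"
      using g assms(2) by (intro imageI) simp
    then have "- tr2 A \<in> {4, 0, 1, 2, 3}" unfolding det2_minus dm by (simp add: tr2_simps)
    ultimately show ?thesis by (elim insertE) (simp_all add: neg_eq_iff_add_eq_0)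
  qed
qed

section \<open>Finite subgroups of \<open>SL2\<close> over the field\<close>

definition sl2 :: "qf m2 set \<Rightarrow> bool" where
  "sl2 P \<longleftrightarrow> fgrp P \<and> (\<forall>A\<in>P. det2 A = 1)"

lemma sl2D:
  assumes "sl2 P"
  shows "fgrp P" "1 \<in> P" "\<And>x. x \<in> P \<Longrightarrow> det2 x = 1" "\<And>x y. x \<in> P \<Longrightarrow> y \<in> P \<Longrightarrow> x * y \<in> P"
    "\<And>x. x \<in> P \<Longrightarrow> adj2 x \<in> P" "\<And>x. x \<in> P \<Longrightarrow> x * adj2 x = 1 \<and> adj2 x * x = 1"
    "\<And>x. x \<in> P \<Longrightarrow> tr2 x \<in> {2, -2, -1, 0, 1}" "\<And>x. x \<in> P \<Longrightarrow> tr2 x = 2 \<Longrightarrow> x = 1"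
    "\<And>x. x \<in> P \<Longrightarrow> tr2 x = -2 \<Longrightarrow> x = -1"
proof -
  show fg: "fgrp P" and "1 \<in> P" and d: "\<And>x. x \<in> P \<Longrightarrow> det2 x = 1"
    using assms by (auto simp: sl2_def dest: fgrpD)
  show "\<And>x y. x \<in> P \<Longrightarrow> y \<in> P \<Longrightarrow> x * y \<in> P" using fgrpD(3)[OF fg] .
  show adj: "x * adj2 x = 1 \<and> adj2 x * x = 1" if "x \<in> P" for x
    using d[OF that] by (simp add: adj2_left adj2_right)
  show "adj2 x \<in> P" if "x \<in> P" for x
  proof -
    obtain y where y: "y \<in> P" "x * y = 1" using fgrpD(4)[OF fg \<open>x \<in> P\<close>] by blast
    have "adj2 x = adj2 x * (x * y)" using y by simp
    also have "\<dots> = y" using adj[OF that] by (simp flip: mult.assoc)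
    finally show ?thesis using y by simp
  qed
  fix x assume x: "x \<in> P"
  obtain n where "n > 0" "x ^ n = 1" using fgrp_finite_order[OF fg x] .
  then show "tr2 x \<in> {2, -2, -1, 0, 1}" "tr2 x = 2 \<Longrightarrow> x = 1" "tr2 x = -2 \<Longrightarrow> x = -1"
    using GL2_finite_order[of x n] d[OF x] by blast+
qed

lemma sl2_adj_unique:
  assumes "sl2 P" "x \<in> P" "y \<in> P" "x * y = 1"
  shows "x = adj2 y"
proof -
  have "x = x * (y * adj2 y)" using sl2D(6)[OF assms(1,3)] by simp
  also have "\<dots> = adj2 y" using assms(4) by (simp flip: mult.assoc)
  finally show ?thesis .
qed

text \<open>Within \<open>P\<close> the traces \<open>2\<close> and \<open>-2\<close> occur only at
  \<open>1\<close> and \<open>-1\<close>, so being an inverse up to sign can be tested on a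
  trace.\<close>

lemma sl2_tr_mult_2:
  assumes "sl2 P" "x \<in> P" "y \<in> P"
  shows "tr2 (x * y) = 2 \<Longrightarrow> x = adj2 y" "tr2 (x * y) = -2 \<Longrightarrow> x = - adj2 y"
proof -
  note xy = sl2D(4)[OF assms]
  show "x = adj2 y" if "tr2 (x * y) = 2"
    using sl2_adj_unique[OF assms] sl2D(8)[OF assms(1) xy that] by simp
  show "x = - adj2 y" if "tr2 (x * y) = -2"
  proof -
    have "x = x * (y * adj2 y)" using sl2D(6)[OF assms(1,3)] by simp
    also have "\<dots> = - adj2 y" using sl2D(9)[OF assms(1) xy that] by (simp flip: mult.assoc)
    finally show ?thesis .
  qed
qed

text \<open>The cyclic group generated by an element of order six: the relation
  \<open>g * g = g - 1\<close> makes its powers \<open>1, g, g - 1, -1, -g, 1 - g\<close>.\<close>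

definition Z6 :: "qf m2 \<Rightarrow> qf m2 set" where
  "Z6 g = {1, -1, g, -g, 1 - g, g - 1}"

lemma sl2_order6:
  assumes P: "sl2 P" and g: "g \<in> P" "tr2 g = 1"
  shows "g * g = g - 1" "adj2 g = 1 - g" "-1 \<in> P" "Z6 g \<subseteq> P" "\<And>y. y \<in> Z6 g \<Longrightarrow> y * g \<in> Z6 g \<and> y * (1 - g) \<in> Z6 g"
proof -
  show gg: "g * g = g - 1" using cayley_hamilton2[of g] g(2) sl2D(3)[OF P g(1)] by simp
  show a: "adj2 g = 1 - g" using adj2_eq[of g] g(2) by simp
  have "g * g * g = - 1" unfolding gg by (simp add: algebra_simps gg)
  then show m: "-1 \<in> P" using sl2D(4)[OF P] g(1) by metis
  have "- x \<in> P" if "x \<in> P" for x using sl2D(4)[OF P m that] by simp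
  then show "Z6 g \<subseteq> P" using m g(1) sl2D(2)[OF P] sl2D(5)[OF P g(1)] unfolding a Z6_def
    by (metis empty_subsetI insert_subset minus_diff_eq)
  have e: "(1 - g) * g = 1" "(g - 1) * g = -1" "g * (1 - g) = 1" "(1 - g) * (1 - g) = - g"
    "(g - 1) * (1 - g) = g"
    by (simp_all add: algebra_simps gg)
  show "y * g \<in> Z6 g \<and> y * (1 - g) \<in> Z6 g" if "y \<in> Z6 g" for y
    using that unfolding Z6_def by (elim insertE emptyE) (simp_all add: gg e)
qed

text \<open>Outside \<open>Z6 g\<close> all three traces lie in \<open>{-1, 0, 1}\<close>, and the
  last two add up to the first. Three odd values cannot satisfy this.\<close>

lemma sl2_trace_0_multiple:
  assumes P: "sl2 P" and g: "g \<in> P" "tr2 g = 1" and h: "h \<in> P" "h \<notin> Z6 g"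
  shows "tr2 h = 0 \<or> tr2 (h * g) = 0 \<or> tr2 (h * (1 - g)) = 0"
proof -
  note o = sl2_order6[OF P g]
  have ag: "1 - g \<in> P" using o(4) by (auto simp: Z6_def)
  have aa: "adj2 (1 - g) = g" unfolding o(2)[symmetric] by (simp add: m2_eq_iff)
  have s: "tr2 (h * g) + tr2 (h * (1 - g)) = tr2 h"
    using tr2_add_adj[of h g] g(2) unfolding o(2) by simp
  have "tr2 h \<noteq> 2" "tr2 h \<noteq> -2" using sl2D(8,9)[OF P h(1)] h(2) by (auto simp: Z6_def)
  moreover have "tr2 (h * g) \<noteq> 2" "tr2 (h * g) \<noteq> -2"
    using sl2_tr_mult_2[OF P h(1) g(1)] h(2) unfolding o(2) by (auto simp: Z6_def)
  moreover have "tr2 (h * (1 - g)) \<noteq> 2" "tr2 (h * (1 - g)) \<noteq> -2"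
    using sl2_tr_mult_2[OF P h(1) ag] h(2) unfolding aa by (auto simp: Z6_def)
  ultimately have "tr2 h \<in> {-1, 0, 1}" "tr2 (h * g) \<in> {-1, 0, 1}" "tr2 (h * (1 - g)) \<in> {-1, 0, 1}"
    using sl2D(7)[OF P h(1)] sl2D(7)[OF P sl2D(4)[OF P h(1) g(1)]] sl2D(7)[OF P sl2D(4)[OF P h(1) ag]]
    by auto
  then show ?thesis using s by auto
qed

text \<open>Otherwise \<open>t = tr2 (g * j)\<close> is \<open>1\<close> or \<open>-1\<close>, and
  the conjugate of \<open>j\<close> by \<open>g\<close> is traceless and orthogonal to
  \<open>j\<close>: the trace of their product is \<open>- tr2 g - t * t + 2 = 0\<close>. Such a
  pair is excluded by \<open>na\<close>.\<close>

lemma sl2_trace_0_orthogonal: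
  assumes P: "sl2 P" and g: "g \<in> P" "tr2 g = 1" and j: "j \<in> P" "tr2 j = 0"
    and na: "\<And>i j. i \<in> P \<Longrightarrow> j \<in> P \<Longrightarrow> tr2 i = 0 \<Longrightarrow> tr2 j = 0 \<Longrightarrow> tr2 (i * j) \<noteq> 0"
  shows "tr2 (g * j) = 0"
proof (rule ccontr)
  assume n: "tr2 (g * j) \<noteq> 0"
  note o = sl2_order6[OF P g]
  have gj: "g * j \<in> P" using sl2D(4)[OF P g(1) j(1)] .
  have "tr2 (g * j) \<noteq> 2" "tr2 (g * j) \<noteq> -2"
    using sl2_tr_mult_2[OF P g(1) j(1)] g(2) j(2) by (auto simp: tr2_simps)
  then have t: "tr2 (g * j) * tr2 (g * j) = 1" using n sl2D(7)[OF P gj] by auto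
  have ag: "1 - g \<in> P" using o(4) by (auto simp: Z6_def)
  let ?j = "g * j * (1 - g)"
  have "tr2 (j * ?j) = tr2 (j * g * j) - tr2 (j * (g * j) * g)" by (simp add: tr2_simps algebra_simps)
  also have "tr2 (j * g * j) = tr2 (j * j * g)" using tr2_commute[of "j * g" j] by (simp add: mult.assoc)
  also have "j * j = - 1" using cayley_hamilton2[of j] j(2) sl2D(3)[OF P j(1)] by simp
  also have "tr2 (j * (g * j) * g) = tr2 ((g * j) * (g * j))"
    using tr2_commute[of "j * (g * j)" g] by (simp add: mult.assoc)
  also have "\<dots> = tr2 (g * j) * tr2 (g * j) - 2"
    unfolding cayley_hamilton2[of "g * j"] sl2D(3)[OF P gj] by (simp add: tr2_def algebra_simps)
  finally have "tr2 (j * ?j) = 0" using t g(2) by (simp add: tr2_simps)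
  moreover have "tr2 ?j = 0"
    using tr2_commute[of "g * j" "1 - g"] j(2) sl2D(6)[OF P g(1)] unfolding o(2)
    by (simp flip: mult.assoc)
  moreover have "?j \<in> P" using sl2D(4)[OF P gj ag] .
  ultimately show False using na j by blast
qed

text \<open>Products are controlled by the identity \<open>tr2_add_adj\<close> together with the
  five possible traces. Traceless elements are square roots of \<open>-1\<close>, and two of them
  with traceless product generate a quaternion group; that case fixes no list of elements, since
  \<open>P\<close> may be larger than this group.\<close>

lemma sl2_cases:
  assumes P: "sl2 P"
  obtains (trivial) "P = {1}" | (center) "P = {1, -1}"
  | (order3) g where "g \<in> P" "tr2 g = -1" "P = {1, g, g * g}"
  | (order4) g where "g \<in> P" "tr2 g = 0" "P = {1, -1, g, -g}"
  | (order6) g where "g \<in> P" "tr2 g = 1" "P = Z6 g"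
  | (quaternion) i j where "i \<in> P" "j \<in> P" "tr2 i = 0" "tr2 j = 0" "tr2 (i * j) = 0"
  | (dicyclic) g j where "g \<in> P" "j \<in> P" "tr2 g = 1" "tr2 j = 0" "tr2 (g * j) = 0"
      "P = Z6 g \<union> (\<lambda>y. y * j) ` Z6 g"
proof -
  have sq0: "x * x = -1" if "x \<in> P" "tr2 x = 0" for x
    using cayley_hamilton2[of x] that sl2D(3)[OF P that(1)] by simp
  show thesis
  proof (cases "P \<subseteq> {1, -1}")
    case True
    then show ?thesis using trivial center sl2D(2)[OF P] by blast
  next
    case False
    then obtain g where g: "g \<in> P" "g \<noteq> 1" "g \<noteq> -1" by blast
    show ?thesis
    proof (cases "-1 \<in> P")
      case False
      \<comment> \<open>Trace zero would make the square of \<open>x\<close> equal to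
        \<open>-1\<close>, and trace one its cube.\<close>
      have m: "tr2 x = -1" if "x \<in> P" "x \<noteq> 1" for x
      proof -
        have "tr2 x \<noteq> 0" using sq0[OF that(1)] sl2D(4)[OF P that(1) that(1)] False by auto
        moreover have "tr2 x \<noteq> 1" using sl2_order6(3)[OF P that(1)] False by auto
        moreover have "x \<noteq> -1" using that False by blast
        ultimately show ?thesis using sl2D(7-9)[OF P that(1)] that(2) by blast
      qed
      have gg: "g * g = adj2 g"
        using cayley_hamilton2[of g] adj2_eq[of g] m[OF g(1,2)] sl2D(3)[OF P g(1)] by (simp add: sc2_minus)
      have ggP: "g * g \<in> P" using sl2D(4)[OF P g(1) g(1)] .
      have "h \<in> {1, g, g * g}" if h: "h \<in> P" for h
      proof (cases "h = 1")
        case False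
        \<comment> \<open>Each summand is \<open>-1\<close>, except for \<open>2\<close> at the
          identity, so one of the two products is the identity.\<close>
        have s: "tr2 (h * g) + tr2 (h * (g * g)) = 1"
          using tr2_add_adj[of h g] m[OF h False] m[OF g(1,2)] gg by simp
        have "tr2 (h * g) = 2 \<or> tr2 (h * (g * g)) = 2"
          using s m[OF sl2D(4)[OF P h g(1)]] m[OF sl2D(4)[OF P h ggP]]
          by (cases "h * g = 1"; cases "h * (g * g) = 1") (auto simp: tr2_simps)
        moreover have "adj2 (g * g) = g" unfolding gg by (simp add: m2_eq_iff)
        ultimately show ?thesis
          using sl2_tr_mult_2(1)[OF P h g(1)] sl2_tr_mult_2(1)[OF P h ggP] gg by auto
      qed simp
      then have "P = {1, g, g * g}" using g(1) ggP sl2D(2)[OF P] by blast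
      then show ?thesis using order3 g m by blast
    next
      case True
      have neg: "- x \<in> P" if "x \<in> P" for x using sl2D(4)[OF P True that] by simp
      show ?thesis
      proof (cases "\<exists>i\<in>P. \<exists>j\<in>P. tr2 i = 0 \<and> tr2 j = 0 \<and> tr2 (i * j) = 0")
        case True
        then show ?thesis using quaternion by blast
      next
        case False
        then have na: "\<And>i j. i \<in> P \<Longrightarrow> j \<in> P \<Longrightarrow> tr2 i = 0 \<Longrightarrow> tr2 j = 0 \<Longrightarrow> tr2 (i * j) \<noteq> 0" by blast
        show ?thesis
        proof (cases "\<exists>g\<in>P. tr2 g = 1")
          case False
          \<comment> \<open>The negative of an element of trace \<open>-1\<close> has trace
            \<open>1\<close>, which does not occur here.\<close>
          have z: "tr2 x = 0" if "x \<in> P" "x \<noteq> 1" "x \<noteq> -1" for x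
          proof -
            have "tr2 x \<noteq> -1" using neg[OF that(1)] False by (auto simp: tr2_simps)
            then show ?thesis using sl2D(7-9)[OF P that(1)] that False by blast
          qed
          have ag: "adj2 g = - g" using adj2_eq[of g] z[OF g] by simp
          have "h \<in> {1, -1, g, -g}" if h: "h \<in> P" for h
          proof (cases "h = 1 \<or> h = -1")
            case False
            then have "tr2 (h * g) \<noteq> 0" using na[OF h g(1)] z[OF h] z[OF g] by blast
            then have "h * g = 1 \<or> h * g = -1" using z[OF sl2D(4)[OF P h g(1)]] by blast
            then have "tr2 (h * g) = 2 \<or> tr2 (h * g) = -2" by (auto simp: tr2_simps)
            then show ?thesis using sl2_tr_mult_2[OF P h g(1)] unfolding ag by auto
          qed auto
          then have "P = {1, -1, g, -g}" using g neg True sl2D(2)[OF P] by blast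
          then show ?thesis using order4 z g by blast
        next
          case True
          then obtain g where g: "g \<in> P" "tr2 g = 1" by blast
          note o = sl2_order6[OF P g]
          note K = sl2_trace_0_multiple[OF P g]
          have ag: "1 - g \<in> P" using o(4) by (auto simp: Z6_def)
          have gag: "g * (1 - g) = 1" "(1 - g) * g = 1" using sl2D(6)[OF P g(1)] unfolding o(2) by auto
          show ?thesis
          proof (cases "\<exists>j\<in>P. tr2 j = 0")
            case False
            then have "P \<subseteq> Z6 g" using K sl2D(4)[OF P _ g(1)] sl2D(4)[OF P _ ag] by blast
            then show ?thesis using order6[OF g] o(4) by blast
          next
            case True
            then obtain j where j: "j \<in> P" "tr2 j = 0" by blast
            \<comment> \<open>Conjugation by a traceless element of \<open>P\<close> inverts
              \<open>g\<close>, that is, it exchanges \<open>g\<close> and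
              \<open>1 - g\<close>.\<close>
            have L: "tr2 (g * h) = 0" "h * g = (1 - g) * h" "g * h = h * (1 - g)" if h: "h \<in> P" "tr2 h = 0" for h
            proof -
              show l: "tr2 (g * h) = 0" using sl2_trace_0_orthogonal[OF P g h na] .
              have "g * h + h * g = h" using cayley_hamilton2_polar[of g h] g(2) h(2) l by simp
              then show "h * g = (1 - g) * h" "g * h = h * (1 - g)" by (simp_all add: algebra_simps)
            qed
            have jj: "j * j = -1" using sq0[OF j] .
            \<comment> \<open>An element outside \<open>Z6 g\<close> that commutes with
              \<open>g\<close> has a traceless multiple by a power of \<open>g\<close>, which still
              commutes with \<open>g\<close>; but traceless elements invert \<open>g\<close>, which
              would give \<open>g = 1 - g\<close>.\<close>
            have com: "y \<in> Z6 g" if y: "y \<in> P" "g * y = y * g" for y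
            proof (rule ccontr)
              assume "y \<notin> Z6 g"
              then have "\<exists>z\<in>P. tr2 z = 0 \<and> g * z = z * g"
              proof -
                have c: "g * (1 - g) = (1 - g) * g" by (simp add: algebra_simps)
                have "y * g \<in> P" "g * (y * g) = y * g * g" "y * (1 - g) \<in> P" "g * (y * (1 - g)) = y * (1 - g) * g"
                  using sl2D(4)[OF P y(1) g(1)] sl2D(4)[OF P y(1) ag] y(2) c by (metis mult.assoc)+
                then show ?thesis using K[OF y(1) \<open>y \<notin> Z6 g\<close>] y by blast
              qed
              then obtain z where z: "z \<in> P" "tr2 z = 0" "g * z = z * g" by blast
              then have e: "z * g = z * (1 - g)" using L(3) by metis
              have "adj2 z * (z * g) = adj2 z * (z * (1 - g))" unfolding e ..
              then have "g = 1 - g" using sl2D(6)[OF P z(1)] by (simp flip: mult.assoc)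
              then have "g * (1 - g) = g * g" by simp
              then have "1 = g - 1" unfolding gag o(1) .
              then have "tr2 (1 :: qf m2) = tr2 (g - 1)" by simp
              then show False using g(2) by (simp add: tr2_simps)
            qed
            \<comment> \<open>Both \<open>h\<close> and \<open>j\<close> invert \<open>g\<close>, so
              the quotient \<open>h * (- j)\<close> commutes with \<open>g\<close>.\<close>
            have h0: "h \<in> (\<lambda>y. y * j) ` Z6 g" if h: "h \<in> P" "tr2 h = 0" for h
            proof -
              have "g * (h * (- j)) = h * ((1 - g) * (- j))" using L(3)[OF h] by (simp flip: mult.assoc)
              also have "(1 - g) * (- j) = (- j) * g" using L(2)[OF j] by simp
              finally have "h * (- j) \<in> Z6 g"
                using com[of "h * (- j)"] sl2D(4)[OF P h(1) neg[OF j(1)]] by (simp add: mult.assoc)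
              moreover have "h = h * (- j) * j" using jj by (simp add: mult.assoc)
              ultimately show ?thesis by blast
            qed
            have "h \<in> Z6 g \<union> (\<lambda>y. y * j) ` Z6 g" if h: "h \<in> P" for h
            proof (rule ccontr)
              assume n: "\<not> ?thesis"
              then consider "tr2 (h * g) = 0" | "tr2 (h * (1 - g)) = 0" using K[OF h] h0[OF h] by blast
              then show False
              proof cases
                case 1
                then obtain y where y: "y \<in> Z6 g" "h * g = y * j" using h0[OF sl2D(4)[OF P h g(1)]] by blast
                have "h = h * g * (1 - g)" using gag by (simp add: mult.assoc)
                also have "\<dots> = y * g * j" unfolding y(2) using L(3)[OF j] by (simp add: mult.assoc)
                finally show False using n o(5)[OF y(1)] by blast
              next
                case 2
                then obtain y where y: "y \<in> Z6 g" "h * (1 - g) = y * j" using h0[OF sl2D(4)[OF P h ag]] by blast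
                have "h = h * (1 - g) * g" using gag by (simp add: mult.assoc)
                also have "\<dots> = y * (1 - g) * j" unfolding y(2) using L(2)[OF j] by (simp add: mult.assoc)
                finally show False using n o(5)[OF y(1)] by blast
              qed
            qed
            moreover have "Z6 g \<union> (\<lambda>y. y * j) ` Z6 g \<subseteq> P" using o(4) sl2D(4)[OF P _ j(1)] by blast
            ultimately show ?thesis using dicyclic[OF g(1) j(1) g(2) j(2) L(1)[OF j]] by blast
          qed
        qed
      qed
    qed
  qed
qed

section \<open>Groups with a subgroup of index at most two\<close>

text \<open>The membership rule makes \<open>N0\<close> the kernel of a homomorphism to a group of
  order two, which treats \<open>N0 = N\<close> and index two alike.\<close>

definition gp :: "'a::monoid_mult set \<Rightarrow> 'a set \<Rightarrow> bool" where
  "gp N N0 \<longleftrightarrow> fgrp N \<and> N0 \<subseteq> N \<and> (\<forall>x\<in>N. \<forall>y\<in>N. x * y \<in> N0 \<longleftrightarrow> (x \<in> N0 \<longleftrightarrow> y \<in> N0))"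

definition simconj :: "'a::monoid_mult set \<Rightarrow> 'a set \<Rightarrow> 'a set \<Rightarrow> 'a set \<Rightarrow> bool" where
  "simconj N N0 M M0 \<longleftrightarrow> (\<exists>b b'. b * b' = 1 \<and> b' * b = 1 \<and>
     M = (\<lambda>x. b * x * b') ` N \<and> M0 = (\<lambda>x. b * x * b') ` N0)"

lemma gpD:
  assumes "gp N N0"
  shows "fgrp N" "N0 \<subseteq> N" "\<And>x y. x \<in> N \<Longrightarrow> y \<in> N \<Longrightarrow> x * y \<in> N0 \<longleftrightarrow> (x \<in> N0 \<longleftrightarrow> y \<in> N0)" "1 \<in> N0"
proof -
  show "fgrp N" "N0 \<subseteq> N" and m: "\<And>x y. x \<in> N \<Longrightarrow> y \<in> N \<Longrightarrow> x * y \<in> N0 \<longleftrightarrow> (x \<in> N0 \<longleftrightarrow> y \<in> N0)"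
    using assms by (auto simp: gp_def)
  then show "1 \<in> N0" using m[of 1 1] fgrpD(2) by force
qed

lemma simconj_refl: "simconj N N0 N N0"
  unfolding simconj_def by (intro exI[of _ 1]) simp

lemma conj_cancel:
  assumes "b' * b = (1::'a::monoid_mult)"
  shows "b' * (b * x * b') * b = x"
proof -
  have "b' * (b * x * b') * b = (b' * b) * x * (b' * b)" by (simp only: mult.assoc)
  then show ?thesis using assms by simp
qed

lemma conj_mult:
  assumes "b' * b = (1::'a::monoid_mult)"
  shows "b * (x * y) * b' = (b * x * b') * (b * y * b')"
proof -
  have "(b * x * b') * (b * y * b') = b * x * (b' * b) * y * b'" by (simp only: mult.assoc)
  then show ?thesis using assms by (simp add: mult.assoc)
qed

lemma conj_power:
  assumes "b' * b = (1::'a::monoid_mult)" "b * b' = 1"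
  shows "b * (x ^ n) * b' = (b * x * b') ^ n"
  by (induction n) (simp_all add: assms conj_mult)

lemma simconj_sym: "simconj N N0 M M0 \<Longrightarrow> simconj M M0 N N0"
  unfolding simconj_def
proof (elim exE conjE)
  fix b b' assume "b * b' = 1" "b' * b = 1" "M = (\<lambda>x. b * x * b') ` N" "M0 = (\<lambda>x. b * x * b') ` N0"
  then show "\<exists>b b'. b * b' = 1 \<and> b' * b = 1 \<and> N = (\<lambda>x. b * x * b') ` M \<and> N0 = (\<lambda>x. b * x * b') ` M0"
    by (intro exI[of _ b'] exI[of _ b]) (simp add: image_image conj_cancel)
qed

lemma simconj_trans: "simconj N N0 M M0 \<Longrightarrow> simconj M M0 L L0 \<Longrightarrow> simconj N N0 L L0"
  unfolding simconj_def
proof (elim exE conjE)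
  fix b b' c c'
  assume h: "b * b' = 1" "b' * b = 1" "M = (\<lambda>x. b * x * b') ` N" "M0 = (\<lambda>x. b * x * b') ` N0"
    "c * c' = 1" "c' * c = 1" "L = (\<lambda>x. c * x * c') ` M" "L0 = (\<lambda>x. c * x * c') ` M0"
  have "c * b * (b' * c') = c * (b * b') * c'" "b' * c' * (c * b) = b' * (c' * c) * b"
    by (simp_all only: mult.assoc)
  then have "c * b * (b' * c') = 1" "b' * c' * (c * b) = 1" using h by simp_all
  then show "\<exists>b b'. b * b' = 1 \<and> b' * b = 1 \<and> L = (\<lambda>x. b * x * b') ` N \<and> L0 = (\<lambda>x. b * x * b') ` N0"
    using h by (intro exI[of _ "c * b"] exI[of _ "b' * c'"]) (simp add: image_image mult.assoc)
qed

lemma inj_conj: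
  assumes "b' * b = (1::'a::monoid_mult)"
  shows "inj_on (\<lambda>x. b * x * b') A"
  by (rule inj_on_inverseI[where g = "\<lambda>x. b' * x * b"]) (rule conj_cancel[OF assms])

lemma fgrp_conj:
  assumes "b * b' = 1" "b' * b = 1" "fgrp N"
  shows "fgrp ((\<lambda>x. b * x * b') ` N)"
  unfolding fgrp_def
proof (intro conjI ballI)
  show "finite ((\<lambda>x. b * x * b') ` N)" using fgrpD(1)[OF assms(3)] by simp
  show "1 \<in> (\<lambda>x. b * x * b') ` N"
    by (rule image_eqI[of _ _ 1]) (simp_all add: assms fgrpD(2))
next
  fix x y assume "x \<in> (\<lambda>x. b * x * b') ` N" "y \<in> (\<lambda>x. b * x * b') ` N"
  then show "x * y \<in> (\<lambda>x. b * x * b') ` N"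
    using fgrpD(3)[OF assms(3)] by (auto simp: conj_mult[OF assms(2), symmetric])
next
  fix x assume "x \<in> (\<lambda>x. b * x * b') ` N"
  then obtain z where z: "z \<in> N" "x = b * z * b'" by blast
  obtain y where y: "y \<in> N" "z * y = 1" "y * z = 1" using fgrpD(4)[OF assms(3) z(1)] by blast
  show "\<exists>y\<in>(\<lambda>x. b * x * b') ` N. x * y = 1 \<and> y * x = 1"
    using y z(2) assms(1) by (intro bexI[of _ "b * y * b'"]) (auto simp: conj_mult[OF assms(2), symmetric])
qed

lemma gp_simconj:
  assumes "gp N N0" "simconj N N0 M M0"
  shows "gp M M0"
proof -
  obtain b b' where b: "b * b' = 1" "b' * b = 1" "M = (\<lambda>x. b * x * b') ` N" "M0 = (\<lambda>x. b * x * b') ` N0"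
    using assms(2) unfolding simconj_def by blast
  have i: "b * x * b' \<in> M0 \<longleftrightarrow> x \<in> N0" if "x \<in> N" for x
    unfolding b(4) using inj_onD[OF inj_conj[OF b(2), of UNIV]] by blast
  show ?thesis
    unfolding gp_def
  proof (intro conjI ballI)
    show "fgrp M" unfolding b(3) by (rule fgrp_conj[OF b(1,2) gpD(1)[OF assms(1)]])
    show "M0 \<subseteq> M" using gpD(2)[OF assms(1)] b by blast
    fix x y assume "x \<in> M" "y \<in> M"
    then obtain u v where "u \<in> N" "v \<in> N" "x = b * u * b'" "y = b * v * b'" using b by blast
    then show "x * y \<in> M0 \<longleftrightarrow> (x \<in> M0 \<longleftrightarrow> y \<in> M0)"
      using i gpD(3)[OF assms(1)] fgrpD(3)[OF gpD(1)[OF assms(1)]] by (simp flip: conj_mult[OF b(2)])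
  qed
qed

section \<open>Enumerated cyclic and dihedral-type groups with a parity character\<close>

definition cyc :: "'a::monoid_mult \<Rightarrow> nat \<Rightarrow> nat \<Rightarrow> 'a list" where
  "cyc g m e = map (\<lambda>a. g ^ a) (filter (\<lambda>a. even (e * a)) [0..<m])"

text \<open>Kept are the words on which the character sending \<open>g\<close> to
  \<open>(-1)^e\<close> and \<open>x\<close> to \<open>(-1)^f\<close> is trivial. The relations are
  not built in: dihedral, quaternion and dicyclic groups all share this normal form.\<close>

definition dih :: "'a::monoid_mult \<Rightarrow> 'a \<Rightarrow> nat \<Rightarrow> nat \<Rightarrow> nat \<Rightarrow> 'a list" where
  "dih g x m e f = map (\<lambda>(a, b). g ^ a * x ^ b)
     (filter (\<lambda>(a, b). even (e * a + f * b)) (List.product [0..<m] [0..<2]))"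

lemma set_cyc: "set (cyc g m e) = {g ^ a | a. a < m \<and> even (e * a)}"
  by (auto simp: cyc_def)

lemma set_dih: "set (dih g x m e f) = {g ^ a * x ^ b | a b. a < m \<and> b < 2 \<and> even (e * a + f * b)}"
proof -
  have "set (filter (\<lambda>(a, b). even (e * a + f * b)) (List.product [0..<m] [0..<2]))
    = {(a, b). a < m \<and> b < 2 \<and> even (e * a + f * b)}" by auto
  then show ?thesis unfolding dih_def set_map by fast
qed

lemma set_dih_00: "set (dih g x m 0 0) = set (cyc g m 0) \<union> (\<lambda>y. y * x) ` set (cyc g m 0)"
proof (intro equalityI subsetI)
  fix z assume "z \<in> set (dih g x m 0 0)"
  then obtain a b where ab: "z = g ^ a * x ^ b" "a < m" "b < 2" unfolding set_dih by blast
  then consider "z = g ^ a" | "z = g ^ a * x" by (cases b) (auto simp: less_Suc_eq numeral_2_eq_2)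
  then show "z \<in> set (cyc g m 0) \<union> (\<lambda>y. y * x) ` set (cyc g m 0)"
    using ab(2) unfolding set_cyc by cases auto
next
  fix z assume "z \<in> set (cyc g m 0) \<union> (\<lambda>y. y * x) ` set (cyc g m 0)"
  then obtain a where a: "a < m" "z = g ^ a \<or> z = g ^ a * x" unfolding set_cyc by blast
  have "\<exists>b. b < 2 \<and> z = g ^ a * x ^ b"
    using a(2) by (auto intro: exI[of _ 0] exI[of _ 1])
  then show "z \<in> set (dih g x m 0 0)" using a(1) unfolding set_dih by fastforce
qed

lemma conj_cyc:
  assumes "b * b' = 1" "b' * b = (1::'a::monoid_mult)"
  shows "(\<lambda>x. b * x * b') ` set (cyc g m e) = set (cyc (b * g * b') m e)"
  unfolding set_cyc by (auto simp: conj_power[OF assms(2,1)] image_def)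

lemma conj_dih:
  assumes "b * b' = 1" "b' * b = (1::'a::monoid_mult)"
  shows "(\<lambda>x. b * x * b') ` set (dih g x m e f) = set (dih (b * g * b') (b * x * b') m e f)"
proof -
  have e: "b * (g ^ i * x ^ k) * b' = (b * g * b') ^ i * (b * x * b') ^ k" for i k
    by (simp only: conj_power[OF assms(2,1)] conj_mult[OF assms(2)])
  show ?thesis unfolding set_dih by (simp only: e[symmetric]) blast
qed

lemma gp_power:
  assumes "gp P P0" "g \<in> P"
  shows "g ^ a \<in> P0 \<longleftrightarrow> even ((if g \<in> P0 then 0 else 1 :: nat) * a)"
proof (induction a)
  case (Suc a)
  then show ?case using gpD(3)[OF assms(1,2) fgrp_power[OF gpD(1)[OF assms(1)] assms(2)], of a] by auto
qed (simp add: gpD(4)[OF assms(1)])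

lemma gp_cyc:
  assumes "gp P P0" "g \<in> P" "P = set (cyc g m 0)"
  shows "P0 = set (cyc g m (if g \<in> P0 then 0 else 1))"
proof -
  have "P0 = {z \<in> P. z \<in> P0}" using gpD(2)[OF assms(1)] by blast
  also have "\<dots> = set (cyc g m (if g \<in> P0 then 0 else 1))"
    unfolding assms(3) set_cyc by (auto simp: gp_power[OF assms(1,2)])
  finally show ?thesis .
qed

text \<open>A subgroup of index at most two is the kernel of a sign character, which is determined
  by its values on generators.\<close>

lemma gp_dih:
  assumes "gp P P0" "g \<in> P" "x \<in> P" "P = set (dih g x m 0 0)"
  shows "P0 = set (dih g x m (if g \<in> P0 then 0 else 1) (if x \<in> P0 then 0 else 1))"
proof -
  define e f where "e = (if g \<in> P0 then 0 else 1 :: nat)" and "f = (if x \<in> P0 then 0 else 1 :: nat)"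
  have pw: "g ^ a * x ^ b \<in> P0 \<longleftrightarrow> even (e * a + f * b)" for a b
    using gpD(3)[OF assms(1)] fgrp_power[OF gpD(1)[OF assms(1)]] assms(2,3)
      gp_power[OF assms(1,2), of a] gp_power[OF assms(1,3), of b] unfolding e_def f_def by (metis even_add)
  have "P0 = {z \<in> P. z \<in> P0}" using gpD(2)[OF assms(1)] by blast
  also have "\<dots> = set (dih g x m e f)"
  proof -
    have "P = {g ^ a * x ^ b | a b. a < m \<and> b < 2}" unfolding assms(4) set_dih by simp
    then show ?thesis unfolding set_dih using pw by blast
  qed
  finally show ?thesis unfolding e_def f_def .
qed

section \<open>Simultaneous conjugacy of anticommuting matrices\<close>

definition sm2 :: "'a::comm_ring_1 \<Rightarrow> 'a m2 \<Rightarrow> 'a m2" where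
  "sm2 k A = M2 (k * a11 A) (k * a12 A) (k * a21 A) (k * a22 A)"

lemma sm2_sel [simp]: "a11 (sm2 k A) = k * a11 A" "a12 (sm2 k A) = k * a12 A"
  "a21 (sm2 k A) = k * a21 A" "a22 (sm2 k A) = k * a22 A"
  by (simp_all add: sm2_def)

lemma sm2_mult: "sm2 k A * B = sm2 k (A * B)" "A * sm2 k B = sm2 k (A * B)"
  "sm2 k (A + B) = sm2 k A + sm2 k B" "sm2 k (A - B) = sm2 k A - sm2 k B" "sm2 k (- A) = - sm2 k A"
  "sm2 k (sm2 l A) = sm2 (k * l) A"
  by (simp_all add: m2_eq_iff algebra_simps)

lemma sm2_2_cancel: "sm2 2 A = sm2 2 B \<Longrightarrow> A = B" for A B :: "qf m2"
  by (simp add: m2_eq_iff)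

lemma det2_inverse:
  fixes T :: "'a::field m2"
  assumes "det2 T \<noteq> 0"
  obtains T' where "T * T' = 1" "T' * T = 1"
proof
  show "T * sm2 (1 / det2 T) (adj2 T) = 1" "sm2 (1 / det2 T) (adj2 T) * T = 1"
    using assms unfolding sm2_mult adj2_right adj2_left by (simp_all add: m2_eq_iff)
qed

text \<open>A nonzero singular \<open>T\<close> has a line as kernel, and the intertwining relation
  makes this line invariant under \<open>w\<close>. Then \<open>w\<close> has an eigenvalue in the
  field whose square is \<open>- k\<close>, which the choice of \<open>k\<close> forbids.\<close>

lemma intertwiner_nonsingular:
  fixes T w w' :: "qf m2"
  assumes "T \<noteq> 0" "T * w = w' * T" "tr2 w = 0" "w * w = sm2 (- k) 1" "k \<in> {3, 4}"
  shows "det2 T \<noteq> 0"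
proof
  assume d: "det2 T = 0"
  have ns: "y * y \<noteq> - k" for y using qf_square_ne[of y] assms(5) by auto
  have ww: "a22 w = - a11 w" "a11 w * a11 w + a12 w * a21 w = - k"
    using assms(3,4) by (simp_all add: tr2_def m2_eq_iff add_eq_0_iff)
  obtain p q where pq: "p \<noteq> 0 \<or> q \<noteq> 0" "a11 T * p + a12 T * q = 0" "a21 T * p + a22 T * q = 0"
  proof (cases "a11 T = 0 \<and> a12 T = 0")
    case True
    then show ?thesis using that[of "a22 T" "- a21 T"] assms(1) by (auto simp: m2_eq_iff)
  next
    case False
    then show ?thesis using that[of "a12 T" "- a11 T"] d by (auto simp: det2_def algebra_simps)
  qed
  let ?u = "a11 w * p + a12 w * q" and ?v = "a21 w * p + a22 w * q"
  have "a11 T * ?u + a12 T * ?v = a11 (T * w) * p + a12 (T * w) * q" by (simp add: algebra_simps)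
  also have "\<dots> = a11 w' * (a11 T * p + a12 T * q) + a12 w' * (a21 T * p + a22 T * q)"
    unfolding assms(2) by (simp add: algebra_simps)
  finally have e1: "a11 T * ?u + a12 T * ?v = 0" using pq by simp
  have "a21 T * ?u + a22 T * ?v = a21 (T * w) * p + a22 (T * w) * q" by (simp add: algebra_simps)
  also have "\<dots> = a21 w' * (a11 T * p + a12 T * q) + a22 w' * (a21 T * p + a22 T * q)"
    unfolding assms(2) by (simp add: algebra_simps)
  finally have e2: "a21 T * ?u + a22 T * ?v = 0" using pq by simp
  have dep: "p * v - q * u = 0"
    if "a * p + b * q = 0" "a * u + b * v = 0" "a \<noteq> 0 \<or> b \<noteq> 0" for a b u v
  proof -
    have "a * (p * v - q * u) = v * (a * p + b * q) - q * (a * u + b * v)"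
      "b * (p * v - q * u) = p * (a * u + b * v) - u * (a * p + b * q)" by (simp_all add: algebra_simps)
    then show ?thesis using that by auto
  qed
  have "a11 T \<noteq> 0 \<or> a12 T \<noteq> 0 \<or> a21 T \<noteq> 0 \<or> a22 T \<noteq> 0" using assms(1) by (auto simp: m2_eq_iff)
  then have l: "p * ?v - q * ?u = 0" using dep e1 e2 pq by blast
  \<comment> \<open>For the eigenvector \<open>(p, q)\<close> the second coordinate of its image is
    the eigenvalue times \<open>q\<close>, so this quantity squares to
    \<open>- k * (q * q)\<close>.\<close>
  have "(a21 w * p - a11 w * q) * (a21 w * p - a11 w * q)
     = a21 w * (p * ?v - q * ?u) + (a11 w * a11 w + a12 w * a21 w) * (q * q)"
    unfolding ww(1) by (simp add: algebra_simps)
  then have s: "(a21 w * p - a11 w * q) * (a21 w * p - a11 w * q) = - k * (q * q)" unfolding l ww(2) by simp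
  show False
  proof (cases "q = 0")
    case True
    then show False using s pq(1) ww(2) ns[of "a11 w"] by simp
  next
    case False
    let ?y = "(a21 w * p - a11 w * q) / q"
    have "?y * ?y = - k" using s False by simp
    then show False using ns by blast
  qed
qed

text \<open>The intertwiner is obtained by averaging an elementary matrix over the basis
  \<open>1, w, x, wx\<close> of the quaternion algebra; the sum of its relevant entries over all elementary
  matrices is \<open>4 k \<delta>\<close>, because only the identity has nonzero trace.\<close>

lemma anticommuting_pairs_conj:
  fixes w x w' x' :: "qf m2"
  assumes w: "tr2 w = 0" "w * w = sm2 (- k) 1" and x: "tr2 x = 0" "x * x = sm2 (- d) 1" and wx: "x * w = - (w * x)" 
    and w': "w' * w' = sm2 (- k) 1" and x': "x' * x' = sm2 (- d) 1" and wx': "x' * w' = - (w' * x')"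
    and k: "k \<in> {3, 4}" and d: "d \<noteq> 0"
  obtains T where "det2 T \<noteq> 0" "T * w = w' * T" "T * x = x' * T"
proof -
  \<comment> \<open>The sum of \<open>e' * Y * inverse e\<close> over corresponding basis elements,
    cleared by \<open>k * d\<close>: the inverses of \<open>w\<close>, \<open>x\<close> and
    \<open>w * x\<close> are \<open>- w / k\<close>, \<open>- x / d\<close> and
    \<open>- (w * x) / (k * d)\<close>.\<close>
  define f where "f Y = sm2 (k * d) Y - sm2 d (w' * Y * w) - sm2 k (x' * Y * x) - w' * x' * Y * (w * x)" for Y
  have r: "w * (w * Z) = sm2 (- k) Z" "w' * (w' * Z) = sm2 (- k) Z" "x * (x * Z) = sm2 (- d) Z"
    "x' * (x' * Z) = sm2 (- d) Z" "x * (w * Z) = - (w * (x * Z))" "x' * (w' * Z) = - (w' * (x' * Z))" for Z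
    using w(2) w' x(2) x' wx wx' by (simp_all add: sm2_mult flip: mult.assoc)
  have i1: "f Y * w = w' * f Y" and i2: "f Y * x = x' * f Y" for Y
    unfolding f_def
    by (simp_all add: sm2_mult left_diff_distrib right_diff_distrib mult.assoc r w(2) w' x(2) x' wx wx')
       (simp_all add: m2_eq_iff algebra_simps)
  have wx0: "tr2 (w * x) = 0"
  proof -
    have "tr2 (w * x) = - tr2 (w * x)" using tr2_commute[of w x] wx by (simp add: tr2_simps)
    then have "2 * tr2 (w * x) = 0" by (simp add: algebra_simps eq_neg_iff_add_eq_0)
    then show ?thesis by simp
  qed
  have "a11 (f (M2 1 0 0 0)) + a12 (f (M2 0 1 0 0)) + a21 (f (M2 0 0 1 0)) + a22 (f (M2 0 0 0 1))
    = 4 * (k * d) - d * (tr2 w' * tr2 w) - k * (tr2 x' * tr2 x) - tr2 (w' * x') * tr2 (w * x)"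
    unfolding f_def by (simp add: tr2_def algebra_simps)
  also have "\<dots> = 4 * (k * d)" unfolding w x wx0 by simp
  also have "\<dots> \<noteq> 0" using k d by auto
  finally have "f (M2 1 0 0 0) \<noteq> 0 \<or> f (M2 0 1 0 0) \<noteq> 0 \<or> f (M2 0 0 1 0) \<noteq> 0 \<or> f (M2 0 0 0 1) \<noteq> 0"
    by auto
  then obtain Y where "f Y \<noteq> 0" by blast
  then show thesis using that[of "f Y"] i1 i2 intertwiner_nonsingular[OF _ i1 w k] by blast
qed

text \<open>Completing the square: \<open>2 g - c\<close> is traceless with square
  \<open>c * c - 4\<close>, and trace orthogonality makes it anticommute with \<open>x\<close>. The
  pair thus becomes a quaternion basis, and two such bases with the same squares are simultaneously
  conjugate.\<close>

lemma generators_conj: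
  fixes g x g' x' :: "qf m2"
  assumes g: "det2 g = 1" "tr2 g = c" and g': "det2 g' = 1" "tr2 g' = c" and c: "c \<in> {-1, 0, 1}"
    and x: "det2 x = d" "tr2 x = 0" "tr2 (g * x) = 0" and x': "det2 x' = d" "tr2 x' = 0" "tr2 (g' * x') = 0"
    and d: "d \<noteq> 0"
  obtains b b' where "b * b' = 1" "b' * b = 1" "b * g * b' = g'" "b * x * b' = x'"
proof -
  have gen: "tr2 (sm2 2 g - sc2 c) = 0" "(sm2 2 g - sc2 c) * (sm2 2 g - sc2 c) = sm2 (- (4 - c * c)) 1"
     "x * x = sm2 (- d) 1" "x * (sm2 2 g - sc2 c) = - ((sm2 2 g - sc2 c) * x)"
    if "det2 g = 1" "tr2 g = c" "det2 x = d" "tr2 x = 0" "tr2 (g * x) = 0" for g x :: "qf m2"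
  proof -
    show "tr2 (sm2 2 g - sc2 c) = 0" using that(2) by (simp add: tr2_def flip: distrib_left)
    have "(sm2 2 g - sc2 c) * (sm2 2 g - sc2 c) = sm2 4 (g * g - sc2 c * g) + sc2 (c * c)"
      by (simp add: m2_eq_iff algebra_simps)
    then show "(sm2 2 g - sc2 c) * (sm2 2 g - sc2 c) = sm2 (- (4 - c * c)) 1"
      unfolding cayley_hamilton2[of g] that by (simp add: m2_eq_iff)
    show "x * x = sm2 (- d) 1" using cayley_hamilton2[of x] that by (simp add: m2_eq_iff)
    have "g * x + x * g = sm2 c x" using cayley_hamilton2_polar[of g x] that by (simp add: m2_eq_iff)
    moreover have "x * (sm2 2 g - sc2 c) + (sm2 2 g - sc2 c) * x = sm2 2 (g * x + x * g - sm2 c x)"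
      by (simp add: m2_eq_iff algebra_simps)
    ultimately have "x * (sm2 2 g - sc2 c) + (sm2 2 g - sc2 c) * x = 0" by (simp add: m2_eq_iff)
    then show "x * (sm2 2 g - sc2 c) = - ((sm2 2 g - sc2 c) * x)" by (simp add: eq_neg_iff_add_eq_0)
  qed
  have k: "4 - c * c \<in> {3, 4}" using c by auto
  note G = gen[OF g x] and G' = gen[OF g' x']
  obtain T where T: "det2 T \<noteq> 0" "T * (sm2 2 g - sc2 c) = (sm2 2 g' - sc2 c) * T" "T * x = x' * T"
    using anticommuting_pairs_conj[OF G(1,2) x(2) G(3,4) G'(2-4) k d] .
  obtain T' where T': "T * T' = 1" "T' * T = 1" using det2_inverse T(1) .
  have "sm2 2 (T * g) = T * (sm2 2 g - sc2 c) + sm2 c T" by (simp add: m2_eq_iff algebra_simps)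
  also have "\<dots> = sm2 2 (g' * T)" unfolding T by (simp add: m2_eq_iff algebra_simps)
  finally have "T * g = g' * T" by (rule sm2_2_cancel)
  then have "T * g * T' = g'" "T * x * T' = x'" using T(3) T'(1) by (simp_all add: mult.assoc)
  then show thesis using that T' by blast
qed

text \<open>Rational canonical form: the first basis vector \<open>e1\<close> is not an eigenvector,
  since the characteristic polynomial has no root, so \<open>e1\<close> and \<open>g e1\<close> form
  a basis.\<close>

lemma order_346_conj:
  fixes g :: "qf m2"
  assumes "det2 g = 1" "tr2 g = c" "c \<in> {-1, 0, 1}"
  obtains b b' where "b * b' = 1" "b' * b = 1" "b * g * b' = M2 0 (-1) 1 c"
proof -
  have t: "a22 g = c - a11 g" using assms(2) by (auto simp: tr2_def)
  have d: "a11 g * (c - a11 g) - a12 g * a21 g = 1" using assms(1) by (simp add: det2_def t)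
  have "a21 g \<noteq> 0"
  proof
    assume "a21 g = 0"
    then have "a11 g * a11 g - c * a11 g + 1 = 0" using d by (simp add: algebra_simps)
    then show False using qf_no_root assms(3) by blast
  qed
  \<comment> \<open>The columns of this matrix are \<open>e1\<close> and
    \<open>g e1\<close>.\<close>
  then have "det2 (M2 1 (a11 g) 0 (a21 g)) \<noteq> 0" by (simp add: det2_def)
  then obtain T' where T': "M2 1 (a11 g) 0 (a21 g) * T' = 1" "T' * M2 1 (a11 g) 0 (a21 g) = 1"
    using det2_inverse by blast
  have "g * M2 1 (a11 g) 0 (a21 g) = M2 1 (a11 g) 0 (a21 g) * M2 0 (-1) 1 c"
    using d by (simp add: m2_eq_iff t algebra_simps)
  then have "T' * g * M2 1 (a11 g) 0 (a21 g) = T' * M2 1 (a11 g) 0 (a21 g) * M2 0 (-1) 1 c"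
    by (simp only: mult.assoc)
  then have "T' * g * M2 1 (a11 g) 0 (a21 g) = M2 0 (-1) 1 c" unfolding T'(2) by simp
  then show thesis using that T' by blast
qed

lemma reflection_conj:
  fixes r :: "qf m2"
  assumes "det2 r = -1" "tr2 r = 0"
  obtains b b' where "b * b' = 1" "b' * b = 1" "b * r * b' = M2 1 0 0 (-1)"
proof -
  have t: "a22 r = - a11 r" using assms(2) by (simp add: tr2_def add_eq_0_iff)
  have "- (a11 r * a11 r + a12 r * a21 r) = -1" using assms(1) by (simp add: det2_def t)
  then have d: "a11 r * a11 r + a12 r * a21 r = 1" by (simp only: neg_equal_iff_equal)
  have "\<exists>B. det2 B \<noteq> 0 \<and> r * B = B * M2 1 0 0 (-1)"
  proof (cases "a12 r = 0")
    case False
    \<comment> \<open>The columns are eigenvectors for \<open>1\<close> and \<open>-1\<close>. They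
      become dependent when \<open>a12 r = 0\<close>, hence the separate witnesses below.\<close>
    show ?thesis
      by (rule exI[of _ "M2 (a12 r) (a12 r) (1 - a11 r) (- 1 - a11 r)"])
        (use False d in \<open>simp add: det2_def m2_eq_iff t algebra_simps\<close>)
  next
    case True
    then have "(a11 r - 1) * (a11 r + 1) = 0" using d by (simp add: algebra_simps)
    then have "a11 r = 1 \<or> a11 r = -1" by (simp add: eq_neg_iff_add_eq_0)
    then show ?thesis
    proof
      assume "a11 r = 1"
      then show ?thesis using True t
        by (intro exI[of _ "M2 2 0 (a21 r) 1"]) (simp add: det2_def m2_eq_iff algebra_simps)
    next
      assume "a11 r = -1"
      then show ?thesis using True t
        by (intro exI[of _ "M2 0 2 1 (- a21 r)"]) (simp add: det2_def m2_eq_iff algebra_simps)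
    qed
  qed
  then obtain B where B: "det2 B \<noteq> 0" "r * B = B * M2 1 0 0 (-1)" by blast
  obtain B' where B': "B * B' = 1" "B' * B = 1" using det2_inverse B(1) .
  have "B' * r * B = B' * B * M2 1 0 0 (-1)" by (simp only: B(2) mult.assoc)
  then have "B' * r * B = M2 1 0 0 (-1)" unfolding B'(2) by simp
  then show thesis using that B' by blast
qed

section \<open>Quaternions in doubled coordinates\<close>

type_synonym iquad = "int \<times> int \<times> int \<times> int"

definition qmul :: "iquad \<Rightarrow> iquad \<Rightarrow> iquad" where
  "qmul = (\<lambda>(a, b, c, d) (a', b', c', d').
    (a * a' - b * b' - c * c' - d * d', a * b' + b * a' + c * d' - d * c',
     a * c' - b * d' + c * a' + d * b', a * d' + b * c' - c * b' + d * a'))"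

text \<open>On doubled coordinates \<open>qmul\<close> yields four times the product, which is twice
  its doubled coordinates. So \<open>r\<close> encodes the product of \<open>p\<close> and
  \<open>q\<close> exactly when \<open>qdbl r = qmul p q\<close>.\<close>

definition qdbl :: "iquad \<Rightarrow> iquad" where
  "qdbl = (\<lambda>(a, b, c, d). (2 * a, 2 * b, 2 * c, 2 * d))"

text \<open>Twice the unit Hurwitz quaternions; the first eight are twice \<open>\<plusminus>1, \<plusminus>i, \<plusminus>j, \<plusminus>k\<close>.\<close>

definition lipschitz :: "iquad list" where
  "lipschitz = [(2,0,0,0), (-2,0,0,0), (0,2,0,0), (0,-2,0,0), (0,0,2,0), (0,0,-2,0), (0,0,0,2), (0,0,0,-2)]"

definition hurwitz_odd :: "iquad list" where
  "hurwitz_odd = List.product [-1, 1] (List.product [-1, 1] (List.product [-1, 1] [-1, 1]))"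

definition hurwitz :: "iquad list" where "hurwitz = lipschitz @ hurwitz_odd"

lemma hurwitz_norm:
  assumes "a \<in> {-2..2}" "b \<in> {-2..2}" "c \<in> {-2..2}" "d \<in> {-2..2}" "a * a + b * b + c * c + d * d = 4"
  shows "(a, b, c, d) \<in> set hurwitz"
proof -
  have chk: "\<forall>a\<in>set [-2..2]. \<forall>b\<in>set [-2..2]. \<forall>c\<in>set [-2..2]. \<forall>d\<in>set [-2..2].
      a * a + b * b + c * c + d * d = 4 \<longrightarrow> List.member hurwitz (a, b, c, d)" by code_simp
  have "a \<in> set [-2..2]" "b \<in> set [-2..2]" "c \<in> set [-2..2]" "d \<in> set [-2..2]"
    using assms(1-4) by (simp_all only: set_upto)
  from chk[rule_format, OF this assms(5)] show ?thesis by simp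
qed

text \<open>\<open>h\<close> stands for one half, which undoes the doubling of the
  coordinates.\<close>

definition qev :: "'a::comm_ring_1 \<Rightarrow> 'a m2 \<Rightarrow> 'a m2 \<Rightarrow> iquad \<Rightarrow> 'a m2" where
  "qev h i j = (\<lambda>(a, b, c, d). sm2 h (sm2 (of_int a) 1 + sm2 (of_int b) i + sm2 (of_int c) j + sm2 (of_int d) (i * j)))"

lemma qev_mult:
  assumes ij: "i * i = -1" "j * j = -1" "j * i = - (i * j)" and h: "2 * h = 1" and r: "qdbl r = qmul p q"
  shows "qev h i j p * qev h i j q = qev h i j r"
proof -
  define Q where "Q = (\<lambda>(a, b, c, d). sm2 (of_int a :: 'a) 1 + sm2 (of_int b) i + sm2 (of_int c) j + sm2 (of_int d) (i * j))"
  have qQ: "qev h i j s = sm2 h (Q s)" for s by (simp add: qev_def Q_def split: prod.split)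
  have rules: "i * (i * Z) = - Z" "j * (j * Z) = - Z" "j * (i * Z) = - (i * (j * Z))" for Z
    using ij by (simp_all flip: mult.assoc)
  have "Q p * Q q = Q (qmul p q)"
    by (cases p; cases q)
      (simp add: Q_def qmul_def sm2_mult distrib_left distrib_right mult.assoc ij rules,
       simp add: m2_eq_iff algebra_simps)
  also have "\<dots> = sm2 2 (Q r)"
    unfolding r[symmetric] by (cases r) (simp add: Q_def qdbl_def m2_eq_iff algebra_simps)
  finally have "Q p * Q q = sm2 2 (Q r)" .
  then have "qev h i j p * qev h i j q = sm2 (h * (2 * h)) (Q r)"
    by (simp add: qQ sm2_mult) (simp add: mult_ac)
  then show ?thesis by (simp add: qQ h)
qed

section \<open>Classification in dimension two\<close>

text \<open>The companion matrix of \<open>X^2 - c X + 1\<close>; \<open>rs c\<close> is a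
  reflection that inverts it.\<close>

definition gs :: "qf \<Rightarrow> qf m2" where "gs c = M2 0 (-1) 1 c"
definition rs :: "qf \<Rightarrow> qf m2" where "rs c = M2 1 c 0 (-1)"
text \<open>A symmetric traceless matrix with first row \<open>p, q\<close> is orthogonal to
  \<open>gs 0\<close> and has determinant \<open>-(p^2 + q^2)\<close>. The numbers
  \<open>(1 + sqrt(-19)) / 6\<close> and \<open>(1 - sqrt(-19)) / 6\<close> solve
  \<open>p^2 + q^2 = -1\<close>.\<close>

definition js0 :: "qf m2" where
  "js0 = M2 (Qf (1/6) (1/6)) (Qf (1/6) (-1/6)) (Qf (1/6) (-1/6)) (Qf (-1/6) (-1/6))"
text \<open>Traceless, of determinant one and orthogonal to \<open>gs 1\<close>, so it squares to
  \<open>-1\<close> and inverts \<open>gs 1\<close>. Its existence splits the quaternion algebra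
  \<open>(-1, -3)\<close> over the field.\<close>

definition js1 :: "qf m2" where
  "js1 = M2 (Qf (-1/4) (1/4)) (Qf (1/4) (1/4)) (Qf (1/2) 0) (Qf (1/4) (-1/4))"
definition refl0 :: "qf m2" where "refl0 = M2 1 0 0 (-1)"

definition sls :: "qf m2 list" where "sls = map (qev (Qf (1/2) 0) (gs 0) js0) hurwitz"

text \<open>The parameters \<open>(1, 1)\<close> do not occur in the dihedral families: replacing
  the reflection \<open>x\<close> by \<open>g * x\<close> turns them into \<open>(1, 0)\<close>. An
  element of order three lies in every subgroup of index two, hence \<open>e = 0\<close> there. The
  first nine pairs consist of diagonal matrices; some of them fuse in dimension three.\<close>

definition std2 :: "(qf m2 list \<times> qf m2 list) list" where
  "std2 = [([1], [1]), ([1, -1], [1, -1]), ([1, -1], [1]), ([1, refl0], [1, refl0]), ([1, refl0], [1]),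
    ([1, -1, refl0, -refl0], [1, -1, refl0, -refl0]), ([1, -1, refl0, -refl0], [1, -1]),
    ([1, -1, refl0, -refl0], [1, refl0]), ([1, -1, refl0, -refl0], [1, -refl0]),
    (cyc (gs (-1)) 3 0, cyc (gs (-1)) 3 0),
    (cyc (gs 0) 4 0, cyc (gs 0) 4 0), (cyc (gs 0) 4 0, cyc (gs 0) 4 1),
    (cyc (gs 1) 6 0, cyc (gs 1) 6 0), (cyc (gs 1) 6 0, cyc (gs 1) 6 1),
    (dih (gs (-1)) (rs (-1)) 3 0 0, dih (gs (-1)) (rs (-1)) 3 0 0),
    (dih (gs (-1)) (rs (-1)) 3 0 0, dih (gs (-1)) (rs (-1)) 3 0 1),
    (dih (gs 0) (rs 0) 4 0 0, dih (gs 0) (rs 0) 4 0 0),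
    (dih (gs 0) (rs 0) 4 0 0, dih (gs 0) (rs 0) 4 0 1),
    (dih (gs 0) (rs 0) 4 0 0, dih (gs 0) (rs 0) 4 1 0),
    (dih (gs 1) (rs 1) 6 0 0, dih (gs 1) (rs 1) 6 0 0),
    (dih (gs 1) (rs 1) 6 0 0, dih (gs 1) (rs 1) 6 0 1),
    (dih (gs 1) (rs 1) 6 0 0, dih (gs 1) (rs 1) 6 1 0),
    (dih (gs 0) js0 4 0 0, dih (gs 0) js0 4 0 0), (dih (gs 0) js0 4 0 0, dih (gs 0) js0 4 0 1),
    (dih (gs 1) js1 6 0 0, dih (gs 1) js1 6 0 0), (dih (gs 1) js1 6 0 0, dih (gs 1) js1 6 0 1),
    (sls, sls)]"

definition is_std2 :: "qf m2 set \<Rightarrow> qf m2 set \<Rightarrow> bool" where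
  "is_std2 P P0 \<longleftrightarrow> (\<exists>(Q, Q0) \<in> set std2. simconj P P0 (set Q) (set Q0))"

lemma is_std2_I: "simconj P P0 (set Q) (set Q0) \<Longrightarrow> (Q, Q0) \<in> set std2 \<Longrightarrow> is_std2 P P0"
  unfolding is_std2_def by blast

lemma is_std2_simconj: "simconj P P0 Q Q0 \<Longrightarrow> is_std2 Q Q0 \<Longrightarrow> is_std2 P P0"
  unfolding is_std2_def using simconj_trans by fast

lemma std_generators:
  "det2 (gs c) = 1" "tr2 (gs c) = c" "det2 (rs c) = -1" "tr2 (rs c) = 0" "tr2 (gs c * rs c) = 0"
  "det2 js0 = 1" "tr2 js0 = 0" "tr2 (gs 0 * js0) = 0" "det2 js1 = 1" "tr2 js1 = 0" "tr2 (gs 1 * js1) = 0"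
  by (simp_all add: gs_def rs_def js0_def js1_def det2_def tr2_def qf_eq_iff)

lemma is_std2_cyc:
  assumes "det2 g = 1" "tr2 g = c" "c \<in> {-1, 0, 1}"
    "(cyc (gs c) m 0, cyc (gs c) m e) \<in> set std2"
  shows "is_std2 (set (cyc g m 0)) (set (cyc g m e))"
proof -
  obtain b b' where "b * b' = 1" "b' * b = 1" "b * g * b' = gs c"
    using order_346_conj[OF assms(1-3)] unfolding gs_def .
  then have "simconj (set (cyc g m 0)) (set (cyc g m e)) (set (cyc (gs c) m 0)) (set (cyc (gs c) m e))"
    unfolding simconj_def by (intro exI[of _ b] exI[of _ b'] conjI) (simp_all add: conj_cyc)
  then show ?thesis using is_std2_I assms(4) by blast
qed

lemma is_std2_dih:
  assumes "det2 g = 1" "tr2 g = c" "c \<in> {-1, 0, 1}" "det2 x = d" "tr2 x = 0" "tr2 (g * x) = 0" "d \<noteq> 0"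
    "det2 y = d" "tr2 y = 0" "tr2 (gs c * y) = 0"
    "(dih (gs c) y m 0 0, dih (gs c) y m e f) \<in> set std2"
  shows "is_std2 (set (dih g x m 0 0)) (set (dih g x m e f))"
proof -
  obtain b b' where "b * b' = 1" "b' * b = 1" "b * g * b' = gs c" "b * x * b' = y"
    using generators_conj[OF assms(1,2) std_generators(1,2) assms(3-6,8-10,7)] .
  then have "simconj (set (dih g x m 0 0)) (set (dih g x m e f)) (set (dih (gs c) y m 0 0)) (set (dih (gs c) y m e f))"
    unfolding simconj_def by (intro exI[of _ b] exI[of _ b'] conjI) (simp_all add: conj_dih)
  then show ?thesis using is_std2_I assms(11) by blast
qed

lemma cyc_small:
  fixes g :: "qf m2"
  assumes "det2 g = 1"
  shows "tr2 g = -1 \<Longrightarrow> set (cyc g 3 0) = {1, g, g * g} \<and> g ^ 3 = 1"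
    "tr2 g = 0 \<Longrightarrow> set (cyc g 4 0) = {1, -1, g, -g} \<and> g ^ 2 = -1"
    "tr2 g = 1 \<Longrightarrow> set (cyc g 6 0) = Z6 g \<and> g ^ 3 = -1"
proof -
  have u: "[0..<3] = [0, 1, 2]" "[0..<4] = [0, 1, 2, 3]" "[0..<6] = [0, 1, 2, 3, 4, 5 :: nat]"
    by (simp_all add: upt_rec)
  have p: "g ^ 2 = g * g" "g ^ 3 = g * g * g" "g ^ 4 = g * g * (g * g)" "g ^ 5 = g * g * (g * g) * g"
    by (simp_all add: numeral_eq_Suc mult.assoc)
  show "set (cyc g 3 0) = {1, g, g * g} \<and> g ^ 3 = 1" if "tr2 g = -1"
  proof -
    have gg: "g * g = - g - 1" using cayley_hamilton2[of g] that assms by (simp add: sc2_minus)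
    have "g * g * g = 1" unfolding gg by (simp add: algebra_simps gg)
    then show ?thesis unfolding cyc_def u by (simp add: p)
  qed
  show "set (cyc g 4 0) = {1, -1, g, -g} \<and> g ^ 2 = -1" if "tr2 g = 0"
  proof -
    have gg: "g * g = - 1" using cayley_hamilton2[of g] that assms by simp
    then show ?thesis unfolding cyc_def u by (auto simp: p)
  qed
  show "set (cyc g 6 0) = Z6 g \<and> g ^ 3 = -1" if "tr2 g = 1"
  proof -
    have gg: "g * g = g - 1" using cayley_hamilton2[of g] that assms by simp
    have "g * g * g = -1" "g * g * (g * g) = - g" "g * g * (g * g) * g = 1 - g"
      unfolding gg by (simp_all add: algebra_simps gg)
    then show ?thesis unfolding cyc_def u Z6_def by (auto simp: p gg)
  qed
qed

text \<open>The basis \<open>1, i, j, ij\<close> is orthogonal for the trace form, so doubled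
  coordinates are traces; the minus signs come from \<open>i\<close>, \<open>j\<close> and
  \<open>ij\<close> having square \<open>-1\<close>.\<close>

lemma js0_basis: "sm2 2 x = sc2 (tr2 x) - sm2 (tr2 (x * gs 0)) (gs 0) - sm2 (tr2 (x * js0)) js0
    - sm2 (tr2 (x * (gs 0 * js0))) (gs 0 * js0)"
  by (simp add: m2_eq_iff qf_eq_iff tr2_def gs_def js0_def field_simps)

lemma std_quaternion: "gs 0 * gs 0 = -1" "js0 * js0 = -1" "js0 * gs 0 = - (gs 0 * js0)" "2 * Qf (1/2) 0 = 1"
  by (simp_all add: m2_eq_iff qf_eq_iff gs_def js0_def)

abbreviation qst :: "iquad \<Rightarrow> qf m2" where "qst \<equiv> qev (Qf (1/2) 0) (gs 0) js0"

lemma qst_lipschitz: "qst ` set lipschitz =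
    {1, -1, gs 0, - gs 0, js0, - js0, gs 0 * js0, - (gs 0 * js0)}"
proof -
  have h: "sm2 (Qf (1/2) 0) (sm2 2 x) = x" "sm2 (Qf (1/2) 0) (sm2 (- 2) x) = - x"
    "sm2 0 x = 0" for x :: "qf m2"
    by (simp_all add: m2_eq_iff qf_eq_iff)
  show ?thesis by (simp add: lipschitz_def qev_def h)
qed

lemma qst_norm: "det2 (qst (a, b, c, d)) * 4 = of_int (a * a + b * b + c * c + d * d)"
  by (simp add: qev_def det2_def gs_def js0_def qf_eq_iff algebra_simps)

text \<open>Up to sign, the doubled quaternion coordinates of \<open>x\<close> are the traces of
  \<open>x\<close>, \<open>x i\<close>, \<open>x j\<close> and \<open>x i j\<close>, hence integers
  between \<open>-2\<close> and \<open>2\<close>. Determinant one makes their squares add up to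
  four, and only the 24 Hurwitz units remain.\<close>

lemma sl2_qst:
  assumes P: "sl2 P" "gs 0 \<in> P" "js0 \<in> P" and x: "x \<in> P"
  shows "x \<in> set sls"
proof -
  have i: "\<exists>k \<in> {-2..2}. tr2 y = of_int k" if "y \<in> P" for y
  proof -
    have "tr2 y \<in> of_int ` {2, -2, -1, 0, 1 :: int}" using sl2D(7)[OF P(1) that] by simp
    then obtain k where k: "tr2 y = of_int k" "k \<in> {2, -2, -1, 0, 1 :: int}" by (rule imageE)
    have "-2 \<le> k \<and> k \<le> 2" using k(2) unfolding insert_iff empty_iff by presburger
    then have "k \<in> {-2..2}" by (simp only: atLeastAtMost_iff)
    with k(1) show ?thesis by (rule bexI)
  qed
  obtain a where a: "a \<in> {-2..2}" "tr2 x = of_int a" using i x by blast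
  obtain b where b: "b \<in> {-2..2}" "tr2 (x * gs 0) = of_int b" using i x P sl2D(4) by metis
  obtain c where c: "c \<in> {-2..2}" "tr2 (x * js0) = of_int c" using i x P sl2D(4) by metis
  obtain d where d: "d \<in> {-2..2}" "tr2 (x * (gs 0 * js0)) = of_int d" using i x P sl2D(4) by metis
  have "x = sm2 (Qf (1/2) 0) (sm2 2 x)" by (simp add: m2_eq_iff qf_eq_iff)
  also have "\<dots> = qst (a, - b, - c, - d)"
    unfolding js0_basis a b c d by (simp add: qev_def m2_eq_iff)
  finally have xq: "x = qst (a, - b, - c, - d)" .
  then have "(of_int 4 :: qf) = of_int (a * a + b * b + c * c + d * d)"
    using qst_norm[of a "- b" "- c" "- d"] sl2D(3)[OF P(1) x] by simp
  then have "a * a + b * b + c * c + d * d = 4" unfolding of_int_eq_iff by simp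
  then have "(a, - b, - c, - d) \<in> set hurwitz" using a b c d by (intro hurwitz_norm) auto
  then show ?thesis unfolding sls_def xq by simp
qed

lemma qst_mult: "qdbl r = qmul p q \<Longrightarrow> qst p * qst q = qst r"
  using qev_mult std_quaternion by blast

lemma hurwitz_closed:
  assumes "p \<in> set hurwitz" "q \<in> set hurwitz"
  obtains r where "r \<in> set hurwitz" "qdbl r = qmul p q"
proof -
  have "list_all (\<lambda>p. list_all (\<lambda>q. list_ex (\<lambda>r. qdbl r = qmul p q) hurwitz) hurwitz) hurwitz"
    by code_simp
  then show thesis using assms that unfolding list_all_iff list_ex_iff by blast
qed

lemma qmul_qdbl: "qmul (qdbl p) q = qdbl (qmul p q)" "qmul p (qdbl q) = qdbl (qmul p q)"
  by (cases p; cases q; simp add: qmul_def qdbl_def algebra_simps)+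

lemma qdbl_inj: "qdbl p = qdbl q \<longleftrightarrow> p = q"
  by (cases p; cases q) (simp add: qdbl_def)

text \<open>The eight units of \<open>lipschitz\<close> form a normal subgroup of index three, and
  any further unit \<open>h\<close> generates the quotient, so \<open>u\<close> lies in the coset of
  \<open>1\<close>, \<open>h\<close> or \<open>h^2\<close>.\<close>

lemma hurwitz_generation:
  assumes h: "h \<in> set hurwitz_odd" and "u \<in> set hurwitz"
  obtains v where "v \<in> set lipschitz" "u = v \<or> qdbl u = qmul h v \<or> (\<exists>w. qdbl w = qmul h h \<and> qdbl u = qmul w v)"
proof -
  \<comment> \<open>A product of three doubled factors is four times the doubled result, whence the
    second \<open>qdbl\<close>.\<close>
  have "list_all (\<lambda>h. list_all (\<lambda>u. list_ex (\<lambda>v. u = v \<or> qdbl u = qmul h v \<or>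
     qdbl (qdbl u) = qmul (qmul h h) v) lipschitz) hurwitz) hurwitz_odd" by code_simp
  then obtain v where v: "v \<in> set lipschitz" "u = v \<or> qdbl u = qmul h v \<or> qdbl (qdbl u) = qmul (qmul h h) v"
    using assms unfolding list_all_iff list_ex_iff by blast
  have "h \<in> set hurwitz" using h by (simp add: hurwitz_def)
  then obtain w where w: "qdbl w = qmul h h" using hurwitz_closed by blast
  then have "qdbl (qdbl u) = qmul (qmul h h) v \<longleftrightarrow> qdbl u = qmul w v"
    by (simp only: w[symmetric] qmul_qdbl qdbl_inj)
  then show thesis using that v w by blast
qed

text \<open>Squares lie in every subgroup of index at most two, so this shows that the binary
  tetrahedral group has no subgroup of index two.\<close>

lemma sls_squares:
  assumes "x \<in> set sls"
  obtains y z where "y \<in> set sls" "z \<in> set sls" "x = y * y * (z * z)"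
proof -
  obtain u where u: "u \<in> set hurwitz" "x = qst u" using assms unfolding sls_def by auto
  have "list_all (\<lambda>u. list_ex (\<lambda>y. list_ex (\<lambda>z. qdbl (qdbl (qdbl u)) = qmul (qmul y y) (qmul z z)) hurwitz) hurwitz) hurwitz"
    by code_simp
  then obtain y z where yz: "y \<in> set hurwitz" "z \<in> set hurwitz" "qdbl (qdbl (qdbl u)) = qmul (qmul y y) (qmul z z)"
    using u(1) unfolding list_all_iff list_ex_iff by blast
  obtain v w where vw: "qdbl v = qmul y y" "qdbl w = qmul z z" using hurwitz_closed yz by metis
  have "qdbl u = qmul v w" using yz(3) by (simp only: vw[symmetric] qmul_qdbl qdbl_inj)
  then have "x = qst y * qst y * (qst z * qst z)"
    unfolding u(2) qst_mult[OF vw(1)] qst_mult[OF vw(2)] by (simp add: qst_mult)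
  then show thesis using that[of "qst y" "qst z"] yz unfolding sls_def by simp
qed

lemma gp_squares:
  assumes "gp P P0" "x \<in> P"
  shows "x * x \<in> P0"
  using gpD(3)[OF assms assms(2)] by simp

text \<open>After conjugation the group lies between the quaternion group and the binary tetrahedral
  group, and any Hurwitz unit with odd doubled coordinates already generates the latter. In the
  quaternion group one of \<open>i\<close>, \<open>j\<close>, \<open>ij\<close> lies in
  \<open>P0\<close>, and it is renamed as the first generator.\<close>

lemma is_std2_quaternion:
  assumes gp: "gp P P0" and P: "sl2 P" and ij: "i \<in> P" "j \<in> P" "tr2 i = 0" "tr2 j = 0" "tr2 (i * j) = 0"
  shows "is_std2 P P0"
proof -
  obtain b b' where b: "b * b' = 1" "b' * b = 1" "b * i * b' = gs 0" "b * j * b' = js0"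
    using generators_conj[OF _ ij(3) _ _ _ _ ij(4,5), of "gs 0" 1 js0] sl2D(3)[OF P] ij std_generators by auto
  define Q where "Q = (\<lambda>x. b * x * b') ` P"
  define Q0 where "Q0 = (\<lambda>x. b * x * b') ` P0"
  have sc: "simconj P P0 Q Q0" unfolding simconj_def Q_def Q0_def using b by blast
  have gQ: "gp Q Q0" using gp_simconj[OF gp sc] .
  have "det2 b * det2 b' = 1" using b(1) by (metis det2_1 det2_mult)
  then have Q: "sl2 Q" using gpD(1)[OF gQ] sl2D(3)[OF P]
    unfolding sl2_def Q_def by (auto simp: det2_mult mult.commute)
  have g: "gs 0 \<in> Q" "js0 \<in> Q" using b ij unfolding Q_def by (metis image_eqI)+
  have sub: "Q \<subseteq> qst ` set hurwitz" using sl2_qst[OF Q g] unfolding sls_def by auto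
  have m1: "-1 \<in> Q" using sl2D(4)[OF Q g(1) g(1)] std_quaternion by simp
  have neg: "- y \<in> Q" if "y \<in> Q" for y using sl2D(4)[OF Q m1 that] by simp
  have lip: "qst ` set lipschitz \<subseteq> Q"
    unfolding qst_lipschitz using g m1 neg sl2D(2)[OF Q] sl2D(4)[OF Q g] by simp
  have "is_std2 Q Q0"
  proof (cases "\<exists>h \<in> set hurwitz_odd. qst h \<in> Q")
    case True
    then obtain h where h: "h \<in> set hurwitz_odd" "qst h \<in> Q" by blast
    have "qst u \<in> Q" if u: "u \<in> set hurwitz" for u
    proof -
      obtain v where v: "v \<in> set lipschitz" "u = v \<or> qdbl u = qmul h v \<or> (\<exists>w. qdbl w = qmul h h \<and> qdbl u = qmul w v)"
        using hurwitz_generation[OF h(1) u] .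
      have vQ: "qst v \<in> Q" using lip v(1) by blast
      from v(2) show ?thesis
      proof (elim disjE exE conjE)
        assume "qdbl u = qmul h v"
        then show ?thesis using qst_mult[of u h v] sl2D(4)[OF Q h(2) vQ] by simp
      next
        fix w assume w: "qdbl w = qmul h h" "qdbl u = qmul w v"
        then have "qst u = qst h * qst h * qst v" using qst_mult by metis
        then show ?thesis using sl2D(4)[OF Q sl2D(4)[OF Q h(2) h(2)] vQ] by simp
      qed (use vQ in simp)
    qed
    then have Qs: "Q = set sls" using sub unfolding sls_def by auto
    have "x \<in> Q0" if "x \<in> Q" for x
    proof -
      obtain y z where yz: "y \<in> Q" "z \<in> Q" "x = y * y * (z * z)" using sls_squares[of x] \<open>x \<in> Q\<close> unfolding Qs by metis
      then show ?thesis using gpD(3)[OF gQ sl2D(4)[OF Q yz(1,1)] sl2D(4)[OF Q yz(2,2)]] gp_squares[OF gQ] by simp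
    qed
    then have "Q0 = Q" using gpD(2)[OF gQ] by blast
    then show ?thesis unfolding \<open>Q0 = Q\<close> Qs by (intro is_std2_I[OF simconj_refl]) (simp_all add: std2_def)
  next
    case False
    then have "Q \<subseteq> qst ` set lipschitz" using sub unfolding hurwitz_def by auto
    then have Q8: "Q = {1, -1, gs 0, - gs 0, js0, - js0, gs 0 * js0, - (gs 0 * js0)}"
      using lip unfolding qst_lipschitz by blast
    have dih: "Q = set (dih i j 4 0 0)" if "det2 i = 1" "tr2 i = 0" "Q = {1, -1, i, - i, j, - j, i * j, - (i * j)}" for i j
      unfolding that(3) set_dih_00 using cyc_small(2)[OF that(1,2)] by (simp add: insert_commute)
    note r = std_quaternion(1-3)
    have r3: "gs 0 * js0 * gs 0 = js0" using r by (simp add: mult.assoc) (simp flip: mult.assoc)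
    obtain i j where ij: "i \<in> Q" "j \<in> Q" "det2 i = 1" "tr2 i = 0" "det2 j = 1" "tr2 j = 0" "tr2 (i * j) = 0"
       "Q = {1, -1, i, - i, j, - j, i * j, - (i * j)}" "i \<in> Q0"
    proof -
      have ijQ: "gs 0 * js0 \<in> Q" using sl2D(4)[OF Q g] .
      have t: "tr2 (js0 * gs 0) = 0" using tr2_commute std_generators(8) by metis
      have t3: "tr2 (gs 0 * js0 * gs 0) = 0" unfolding r3 by (rule std_generators)
      consider "gs 0 \<in> Q0" | "js0 \<in> Q0" | "gs 0 * js0 \<in> Q0" using gpD(3)[OF gQ g] by blast
      then show thesis
      proof cases
        case 1
        then show ?thesis using that[OF g] Q8 std_generators by simp
      next
        case 2
        have "Q = {1, -1, js0, - js0, gs 0, - gs 0, js0 * gs 0, - (js0 * gs 0)}"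
          unfolding Q8 r by auto
        then show ?thesis using that[OF g(2) g(1)] 2 t std_generators by simp
      next
        case 3
        have "Q = {1, -1, gs 0 * js0, - (gs 0 * js0), gs 0, - gs 0, gs 0 * js0 * gs 0, - (gs 0 * js0 * gs 0)}"
          unfolding Q8 r3 by auto
        then show ?thesis using that[OF ijQ g(1)] 3 t3 sl2D(3)[OF Q] ijQ std_generators by simp
      qed
    qed
    have Qd: "Q = set (dih i j 4 0 0)" using dih ij by blast
    define e where "e = (if j \<in> Q0 then 0 else 1 :: nat)"
    have Q0: "Q0 = set (dih i j 4 0 e)"
      using gp_dih[OF gQ ij(1,2) Qd] ij(9) by (simp add: e_def)
    have e: "e = 0 \<or> e = 1" by (simp add: e_def)
    show ?thesis
      unfolding Qd Q0 using ij(3-7) std_generators e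
      by (intro is_std2_dih[where c = 0 and d = 1 and y = js0]) (auto simp: std2_def)
  qed
  then show ?thesis using is_std2_simconj[OF sc] by blast
qed

lemma gp_even_power:
  assumes "gp P P0" "g \<in> P" "g ^ 3 \<in> P0"
  shows "g \<in> P0"
  using gp_power[OF assms(1,2), of 3] assms(3) by (simp split: if_splits)

lemma is_std2_sl2:
  assumes gp: "gp P P0" and P: "sl2 P"
  shows "is_std2 P P0"
  using P
proof (cases rule: sl2_cases)
  case trivial
  then have "P0 = {1}" using gpD(2,4)[OF gp] by blast
  then show ?thesis unfolding trivial by (intro is_std2_I[of _ _ "[1]" "[1]"]) (simp_all add: simconj_refl std2_def)
next
  case center
  then consider "P0 = {1}" | "P0 = {1, -1}" using gpD(2,4)[OF gp] by blast
  then show ?thesis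
  proof cases
    case 1
    then show ?thesis unfolding center by (intro is_std2_I[of _ _ "[1, -1]" "[1]"]) (simp_all add: simconj_refl std2_def)
  next
    case 2
    then show ?thesis unfolding center by (intro is_std2_I[of _ _ "[1, -1]" "[1, -1]"]) (simp_all add: simconj_refl std2_def)
  qed
next
  case (order3 g)
  note c = cyc_small(1)[OF sl2D(3)[OF P order3(1)] order3(2)]
  have Pc: "P = set (cyc g 3 0)" using c order3(3) by simp
  have "g \<in> P0" using gp_even_power[OF gp order3(1)] c gpD(4)[OF gp] by simp
  then have P0: "P0 = set (cyc g 3 0)" using gp_cyc[OF gp order3(1) Pc] by simp
  show ?thesis unfolding P0 unfolding Pc using order3 sl2D(3)[OF P order3(1)]
    by (intro is_std2_cyc[where c = "-1"]) (auto simp: std2_def)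
next
  case (order4 g)
  have Pc: "P = set (cyc g 4 0)" using cyc_small(2)[OF sl2D(3)[OF P order4(1)] order4(2)] order4(3) by simp
  define e where "e = (if g \<in> P0 then 0 else 1 :: nat)"
  have P0: "P0 = set (cyc g 4 e)" using gp_cyc[OF gp order4(1) Pc] by (simp add: e_def)
  have e: "e = 0 \<or> e = 1" by (simp add: e_def)
  show ?thesis unfolding P0 Pc using order4(2) sl2D(3)[OF P order4(1)] e
    by (intro is_std2_cyc[where c = 0]) (auto simp: std2_def)
next
  case (order6 g)
  have Pc: "P = set (cyc g 6 0)" using cyc_small(3)[OF sl2D(3)[OF P order6(1)] order6(2)] order6(3) by simp
  define e where "e = (if g \<in> P0 then 0 else 1 :: nat)"
  have P0: "P0 = set (cyc g 6 e)" using gp_cyc[OF gp order6(1) Pc] by (simp add: e_def)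
  have e: "e = 0 \<or> e = 1" by (simp add: e_def)
  show ?thesis unfolding P0 Pc using order6(2) sl2D(3)[OF P order6(1)] e
    by (intro is_std2_cyc[where c = 1]) (auto simp: std2_def)
next
  case (quaternion i j)
  then show ?thesis using is_std2_quaternion[OF gp P] by blast
next
  case (dicyclic g j)
  note c = cyc_small(3)[OF sl2D(3)[OF P dicyclic(1)] dicyclic(3)]
  have Pd: "P = set (dih g j 6 0 0)" unfolding set_dih_00 using c dicyclic(6) by simp
  have "j * j = -1" using cayley_hamilton2[of j] dicyclic(4) sl2D(3)[OF P dicyclic(2)] by simp
  then have "g \<in> P0" using gp_even_power[OF gp dicyclic(1)] c gp_squares[OF gp dicyclic(2)] by simp
  define e where "e = (if j \<in> P0 then 0 else 1 :: nat)"
  have P0: "P0 = set (dih g j 6 0 e)"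
    using gp_dih[OF gp dicyclic(1,2) Pd] \<open>g \<in> P0\<close> by (simp add: e_def)
  have e: "e = 0 \<or> e = 1" by (simp add: e_def)
  show ?thesis unfolding P0 Pd
    using dicyclic(3-5) sl2D(3)[OF P dicyclic(1)] sl2D(3)[OF P dicyclic(2)] std_generators e
    by (intro is_std2_dih[where c = 1 and d = 1 and y = js1]) (auto simp: std2_def)
qed

text \<open>For \<open>x\<close> of determinant \<open>-1\<close> and \<open>A\<close> in
  \<open>P1\<close> the product \<open>x * A\<close> again squares to one, so conjugation by
  \<open>x\<close> inverts all of \<open>P1\<close>. Hence \<open>P1\<close> is abelian, which rules
  out the quaternion and dicyclic cases.\<close>

lemma is_std2_reflection:
  assumes gp: "gp P P0" and P1: "P1 = {A \<in> P. det2 A = 1}" and x: "x \<in> P" "det2 x \<noteq> 1"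
  shows "is_std2 P P0"
proof -
  note fg = gpD(1)[OF gp]
  have fo: "det2 A = 1 \<or> det2 A = -1" "det2 A = -1 \<Longrightarrow> tr2 A = 0" if A: "A \<in> P" for A
  proof -
    obtain n where "n > 0" "A ^ n = 1" using fgrp_finite_order[OF fg A] .
    then show "det2 A = 1 \<or> det2 A = -1" "det2 A = -1 \<Longrightarrow> tr2 A = 0"
      using GL2_finite_order(1,5) by blast+
  qed
  have refl2: "A * A = 1" if "A \<in> P" "det2 A = -1" for A
    using cayley_hamilton2[of A] fo(2)[OF that] that by (simp add: sc2_minus)
  have inv: "B \<in> P1" if "A \<in> P1" "B \<in> P" "A * B = 1" for A B
    using that det2_mult[of A B] unfolding P1 by simp
  have "fgrp P1" unfolding fgrp_def
  proof (intro conjI ballI)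
    show "finite P1" "1 \<in> P1" using fgrpD(1,2)[OF fg] unfolding P1 by auto
    show "A * B \<in> P1" if "A \<in> P1" "B \<in> P1" for A B
      using that fgrpD(3)[OF fg] unfolding P1 by (simp add: det2_mult)
    show "\<exists>B\<in>P1. A * B = 1 \<and> B * A = 1" if "A \<in> P1" for A
      using inv[OF that] fgrpD(4)[OF fg, of A] that unfolding P1 by blast
  qed
  then have sl: "sl2 P1" unfolding sl2_def P1 by simp
  have com: "A * B = B * A" if A: "A \<in> P1" and B: "B \<in> P1" for A B
  proof -
    have dx: "det2 x = -1" using fo(1)[OF x(1)] x(2) by simp
    have xx: "x * x = 1" using refl2 x(1) dx by blast
    have inv: "x * A * x = adj2 A" if "A \<in> P1" for A
    proof -
      have "x * A \<in> P" "det2 (x * A) = -1" using that x(1) dx fgrpD(3)[OF fg] unfolding P1 by (simp_all add: det2_mult)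
      then have "x * A * (x * A) = 1" using refl2 by blast
      then have "x * A * x * (A * adj2 A) = adj2 A" by (simp flip: mult.assoc)
      then show ?thesis using sl2D(6)[OF sl that] by simp
    qed
    have "adj2 (A * B) = x * (A * B) * x" using inv sl2D(4)[OF sl A B] by simp
    also have "\<dots> = (x * A * x) * (x * B * x)" using xx by (metis mult.assoc mult_1_right)
    also have "\<dots> = adj2 A * adj2 B" using inv A B by simp
    also have "\<dots> = adj2 (B * A)" by (simp add: m2_eq_iff algebra_simps)
    finally have "adj2 (adj2 (A * B)) = adj2 (adj2 (B * A))" by simp
    moreover have "adj2 (adj2 Y) = Y" for Y :: "qf m2" by (simp add: m2_eq_iff)
    ultimately show ?thesis by simp
  qed
  have split: "P = P1 \<union> (\<lambda>A. A * y) ` P1" if y: "y \<in> P" "det2 y = -1" for y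
  proof (intro equalityI subsetI)
    fix A assume A: "A \<in> P"
    show "A \<in> P1 \<union> (\<lambda>A. A * y) ` P1"
    proof (cases "det2 A = 1")
      case False
      then have "A * y \<in> P1" using fo(1)[OF A] A y fgrpD(3)[OF fg] unfolding P1 by (auto simp: det2_mult)
      moreover have "A = A * y * y" using refl2[OF y] by (simp add: mult.assoc)
      ultimately show ?thesis by blast
    qed (use A P1 in simp)
  qed (use y P1 fgrpD(3)[OF fg] in auto)
  have dx: "det2 x = -1" using fo(1)[OF x(1)] x(2) by simp
  have dihedral: "is_std2 P P0"
    if g: "g \<in> P1" "tr2 g = c" "P1 = set (cyc g m 0)" and c: "c \<in> {-1, 0, 1}"
     and std: "\<And>e f. (e, f) \<in> {(0, 0), (0, 1), (1, 0)} \<Longrightarrow> (c = -1 \<Longrightarrow> e = 0) \<Longrightarrow> (dih (gs c) (rs c) m 0 0, dih (gs c) (rs c) m e f) \<in> set std2"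
    for g c m
  proof -
    have gP: "g \<in> P" "det2 g = 1" using g(1) unfolding P1 by simp_all
    \<comment> \<open>If neither \<open>g\<close> nor \<open>x\<close> lies in \<open>P0\<close>,
      their product does; taking it as the reflection avoids the parameters
      \<open>(1, 1)\<close>.\<close>
    obtain y where y: "y \<in> P" "det2 y = -1" "g \<notin> P0 \<Longrightarrow> y \<in> P0"
    proof (cases "g \<notin> P0 \<and> x \<notin> P0")
      case True
      then show ?thesis using that[of "g * x"] gpD(3)[OF gp gP(1) x(1)] fgrpD(3)[OF fg gP(1) x(1)] gP dx by (simp add: det2_mult)
    qed (use that[of x] x(1) dx in blast)
    have gy: "tr2 (g * y) = 0" using fo(2)[OF fgrpD(3)[OF fg gP(1) y(1)]] gP y by (simp add: det2_mult)
    have Pd: "P = set (dih g y m 0 0)" unfolding set_dih_00 using split[OF y(1,2)] g(3) by simp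
    have "g \<in> P0" if "c = -1"
      using gp_even_power[OF gp gP(1)] cyc_small(1)[OF gP(2)] g(2) that gpD(4)[OF gp] by simp
    moreover define e f where "e = (if g \<in> P0 then 0 else 1 :: nat)" and "f = (if y \<in> P0 then 0 else 1 :: nat)"
    ultimately have s: "(dih (gs c) (rs c) m 0 0, dih (gs c) (rs c) m e f) \<in> set std2"
      using y(3) by (intro std) auto
    have P0: "P0 = set (dih g y m e f)"
      using gp_dih[OF gp gP(1) y(1) Pd] by (simp add: e_def f_def)
    show ?thesis
      unfolding P0 Pd
      using is_std2_dih[OF gP(2) g(2) c y(2) fo(2)[OF y(1,2)] gy _ std_generators(3-5) s] by simp
  qed
  \<comment> \<open>Groups of order two and four are listed through indices, so that one conjugation
    of \<open>x\<close> to \<open>refl0\<close> carries the list for \<open>x\<close> to the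
    standard list.\<close>
  have conj: "is_std2 P P0" if "P = set (map f Q)" "P0 = set (map f Q0)" "(map h Q, map h Q0) \<in> set std2"
     "\<And>b b' y. b * b' = 1 \<Longrightarrow> b' * b = 1 \<Longrightarrow> b * x * b' = refl0 \<Longrightarrow> y \<in> set Q \<union> set Q0 \<Longrightarrow> b * f y * b' = h y" for f h and Q Q0 :: "nat list"
  proof -
    obtain b b' where b: "b * b' = 1" "b' * b = 1" "b * x * b' = refl0"
      using reflection_conj[OF dx fo(2)[OF x(1) dx]] unfolding refl0_def .
    have "(\<lambda>x. b * x * b') ` P = set (map h Q)" "(\<lambda>x. b * x * b') ` P0 = set (map h Q0)"
      using that(4)[OF b] unfolding that(1,2) by (auto simp: image_image cong: image_cong)
    then have "simconj P P0 (set (map h Q)) (set (map h Q0))"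
      unfolding simconj_def using b by metis
    then show ?thesis using is_std2_I that(3) by blast
  qed
  show ?thesis
    using sl
  proof (cases rule: sl2_cases)
    case trivial
    then have P: "P = {1, x}" using split[OF x(1) dx] by auto
    then consider "P0 = {1}" | "P0 = {1, x}" using gpD(2,4)[OF gp] by blast
    then show ?thesis
    proof cases
      case 1
      show ?thesis unfolding 1 P
        by (rule conj[unfolded 1 P, of "\<lambda>n. if n = 0 then 1 else x" "[0, 1]" "[0]" "\<lambda>n. if n = 0 then 1 else refl0"])
          (auto simp: std2_def)
    next
      case 2
      show ?thesis unfolding 2 P
        by (rule conj[unfolded 2 P, of "\<lambda>n. if n = 0 then 1 else x" "[0, 1]" "[0, 1]" "\<lambda>n. if n = 0 then 1 else refl0"])
          (auto simp: std2_def)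
    qed
  next
    case center
    let ?f = "\<lambda>r n. if n = (0::nat) then 1 else if n = 1 then -1 else if n = 2 then r else (- r :: qf m2)"
    have P: "P = {1, -1, x, -x}" using center split[OF x(1) dx] by auto
    have m: "-1 \<in> P" using P by simp
    have "- x \<in> P0 \<longleftrightarrow> (-1 \<in> P0 \<longleftrightarrow> x \<in> P0)" using gpD(3)[OF gp m x(1)] by simp
    then consider "P0 = {1, -1, x, -x}" | "P0 = {1, -1}" | "P0 = {1, x}" | "P0 = {1, -x}"
      using gpD(2,4)[OF gp] unfolding P by blast
    then show ?thesis
    proof cases
      case 1
      show ?thesis unfolding 1 P
        by (rule conj[unfolded 1 P, of "?f x" "[0, 1, 2, 3]" "[0, 1, 2, 3]" "?f refl0"]) (auto simp: std2_def)
    next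
      case 2
      show ?thesis unfolding 2 P
        by (rule conj[unfolded 2 P, of "?f x" "[0, 1, 2, 3]" "[0, 1]" "?f refl0"]) (auto simp: std2_def)
    next
      case 3
      show ?thesis unfolding 3 P
        by (rule conj[unfolded 3 P, of "?f x" "[0, 1, 2, 3]" "[0, 2]" "?f refl0"]) (auto simp: std2_def)
    next
      case 4
      show ?thesis unfolding 4 P
        by (rule conj[unfolded 4 P, of "?f x" "[0, 1, 2, 3]" "[0, 3]" "?f refl0"]) (auto simp: std2_def)
    qed
  next
    case (order3 g)
    then show ?thesis using cyc_small(1)[OF sl2D(3)[OF sl order3(1)] order3(2)]
      by (intro dihedral[of g "-1" 3]) (auto simp: std2_def)
  next
    case (order4 g)
    then show ?thesis using cyc_small(2)[OF sl2D(3)[OF sl order4(1)] order4(2)]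
      by (intro dihedral[of g 0 4]) (auto simp: std2_def)
  next
    case (order6 g)
    then show ?thesis using cyc_small(3)[OF sl2D(3)[OF sl order6(1)] order6(2)]
      by (intro dihedral[of g 1 6]) (auto simp: std2_def)
  next
    case (quaternion i j)
    have "j * i = - (i * j)"
      using cayley_hamilton2_polar[of i j] quaternion by (simp add: eq_neg_iff_add_eq_0 add.commute)
    \<comment> \<open>\<open>i\<close> and \<open>j\<close> would both commute and
      anticommute.\<close>
    then have "i * j = - (i * j)" using com[OF quaternion(1,2)] by simp
    then have "i * j + i * j = 0" by (simp only: eq_neg_iff_add_eq_0)
    moreover have "sm2 2 (i * j) = i * j + i * j" by (simp add: m2_eq_iff algebra_simps)
    ultimately have "det2 (sm2 2 (i * j)) = 0" by (simp add: det2_def)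
    moreover have "det2 (sm2 2 A) = 4 * det2 A" for A :: "qf m2" by (simp add: det2_def algebra_simps)
    ultimately show ?thesis using sl2D(3)[OF sl sl2D(4)[OF sl quaternion(1,2)]] by simp
  next
    case (dicyclic g j)
    have "j * g + g * j = j"
      using cayley_hamilton2_polar[of g j] dicyclic by (simp add: add.commute)
    then have "j * (g + g) = j" using com[OF dicyclic(1,2)] by (simp add: distrib_left)
    then have "adj2 j * (j * (g + g)) = adj2 j * j" by simp
    then have "g + g = 1" using sl2D(6)[OF sl dicyclic(2)] by (simp flip: mult.assoc)
    then have "det2 (g + g) = 1" by simp
    moreover have "det2 (g + g) = 4 * det2 g" by (simp add: det2_def)
    ultimately show ?thesis using sl2D(3)[OF sl dicyclic(1)] by simp
  qed
qed

theorem GL2_pairs: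
  assumes "gp P (P0 :: qf m2 set)"
  shows "is_std2 P P0"
proof (cases "\<exists>x\<in>P. det2 x \<noteq> 1")
  case True
  then show ?thesis using is_std2_reflection[OF assms] by blast
next
  case False
  then show ?thesis using is_std2_sl2[OF assms] gpD(1)[OF assms] unfolding sl2_def by blast
qed

section \<open>Reducible subgroups\<close>

definition red :: "qf m3 set \<Rightarrow> bool" where
  "red N \<longleftrightarrow> (\<exists>u. u \<noteq> 0 \<and> (\<forall>g\<in>N. \<exists>c. app g u = scale c u))"

lemma det3_inverse:
  fixes B :: "'a::field m3"
  assumes "det3 B \<noteq> 0"
  obtains B' where "B * B' = 1" "B' * B = 1"
proof
  have e: "adj3 B * sc3 (1 / det3 B) = sc3 (1 / det3 B) * adj3 B" by (rule sc3_commute[symmetric])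
  show "B * (adj3 B * sc3 (1 / det3 B)) = 1"
    using assms by (simp add: mult.assoc[symmetric] adj3_right sc3_mult[symmetric])
  show "(adj3 B * sc3 (1 / det3 B)) * B = 1"
    unfolding e using assms by (simp add: mult.assoc adj3_left sc3_mult[symmetric])
qed

lemma app_sum: "app (\<Sum>g\<in>A. f g) u = (\<Sum>g\<in>A. app (f g) u)"
proof -
  have "app (x + y) u = app x u + app y u" for x y by (simp add: v3_eq_iff algebra_simps)
  moreover have "app 0 u = 0" by (simp add: v3_eq_iff)
  ultimately show ?thesis by (induction A rule: infinite_finite_induct) simp_all
qed

lemma scale_eq_iff: "scale c u = scale d u \<longleftrightarrow> c = d \<or> u = 0" for c :: "'a::field"
  by (auto simp: v3_eq_iff)

lemma eigenvalue_pm1: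
  assumes "fgrp (N :: qf m3 set)" "g \<in> N" "u \<noteq> 0" "app g u = scale c u"
  shows "c = 1 \<or> c = -1"
proof -
  obtain n where n: "n > 0" "g ^ n = 1" using fgrp_finite_order assms(1,2) .
  have "app (g ^ k) u = scale (c ^ k) u" for k
    by (induction k) (simp_all add: app_mult app_scale assms(4) scale_scale mult.commute)
  from this[of n] have "scale (c ^ n) u = scale 1 u" using n by simp
  then have "c ^ n = 1" using assms(3) by (simp add: scale_eq_iff del: scale_1)
  then show ?thesis using qf_root_of_unity n(1) by blast
qed

text \<open>Maschke's theorem for an invariant line: averaging the group elements against the character
  of the line gives a matrix whose rows are eigenvectors of the transposed group.\<close>

lemma maschke_line:
  fixes N :: "qf m3 set"
  assumes fg: "fgrp N" and u: "u \<noteq> 0" "\<And>g. g \<in> N \<Longrightarrow> \<exists>c. app g u = scale c u"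
  obtains w where "dot w u \<noteq> 0" "\<And>g. g \<in> N \<Longrightarrow> \<exists>c. app g u = scale c u \<and> app (tp3 g) w = scale c w"
proof -
  \<comment> \<open>On an invariant line the group acts by \<open>1\<close> and \<open>-1\<close>,
    so the character is its own inverse and the average can be written without inverses.\<close>
  define ch where "ch g = (if app g u = u then 1 else -1 :: qf)" for g
  have ch: "app g u = scale (ch g) u" if g: "g \<in> N" for g
  proof -
    obtain c where c: "app g u = scale c u" using u(2) g by blast
    then have "c = 1 \<or> c = -1" using eigenvalue_pm1[OF fg g u(1)] by blast
    then show ?thesis using c by (auto simp: ch_def)
  qed
  have ch2: "ch g * ch g = 1" for g by (simp add: ch_def)
  have chm: "ch (g * h) = ch g * ch h" if "g \<in> N" "h \<in> N" for g h
  proof -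
    have "scale (ch (g * h)) u = scale (ch g * ch h) u"
      using ch[OF fgrpD(3)[OF fg that]] ch[OF that(1)] ch[OF that(2)]
      by (simp add: app_mult app_scale scale_scale mult.commute)
    then show ?thesis using u(1) by (simp add: scale_eq_iff)
  qed
  define E where "E = (\<Sum>g\<in>N. sc3 (ch g) * g)"
  have Eh: "E * h = sc3 (ch h) * E" if h: "h \<in> N" for h
  proof -
    obtain k where k: "k \<in> N" "h * k = 1" "k * h = 1" using fgrpD(4)[OF fg h] by blast
    have bij: "bij_betw (\<lambda>g. g * h) N N"
      by (rule bij_betw_byWitness[where f' = "\<lambda>g. g * k"])
        (use fgrpD(3)[OF fg] h k in \<open>auto simp: mult.assoc\<close>)
    have "E * h = (\<Sum>g\<in>N. sc3 (ch g) * (g * h))" unfolding E_def by (simp add: sum_distrib_right mult.assoc)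
    also have "\<dots> = (\<Sum>g\<in>N. sc3 (ch h) * (sc3 (ch (g * h)) * (g * h)))"
    proof (rule sum.cong[OF HOL.refl])
      fix g assume g: "g \<in> N"
      have "sc3 (ch h) * (sc3 (ch (g * h)) * (g * h)) = sc3 (ch h * ch h * ch g) * (g * h)"
        unfolding chm[OF g h] by (simp add: sc3_mult mult.assoc[symmetric]) (simp add: sc3_mult[symmetric] mult_ac)
      then show "sc3 (ch g) * (g * h) = sc3 (ch h) * (sc3 (ch (g * h)) * (g * h))" by (simp add: ch2)
    qed
    also have "\<dots> = sc3 (ch h) * (\<Sum>g\<in>N. sc3 (ch (g * h)) * (g * h))" by (simp add: sum_distrib_left)
    also have "(\<Sum>g\<in>N. sc3 (ch (g * h)) * (g * h)) = E"
      unfolding E_def by (rule sum.reindex_bij_betw[OF bij])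
    finally show ?thesis .
  qed
  have "app E u = (\<Sum>g\<in>N. u)"
    unfolding E_def app_sum by (rule sum.cong[OF HOL.refl]) (simp add: app_mult ch app_sc3 scale_scale ch2)
  also have "\<dots> = scale (of_nat (card N)) u"
    by (induction N rule: infinite_finite_induct) (simp_all add: v3_eq_iff algebra_simps)
  finally have Eu: "app E u = scale (of_nat (card N)) u" .
  have "card N \<noteq> 0" using fgrpD(1,2)[OF fg] by auto
  then have "app E u \<noteq> 0" unfolding Eu using u(1) by (simp add: scale_eq_0)
  moreover have "\<exists>e. dot e y \<noteq> 0" if ny: "y \<noteq> 0" for y :: "qf v3"
  proof -
    consider "c1 y \<noteq> 0" | "c2 y \<noteq> 0" | "c3 y \<noteq> 0" using ny by (auto simp: v3_eq_iff)
    then show ?thesis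
    proof cases
      case 1 then show ?thesis by (intro exI[of _ "V3 1 0 0"]) (simp add: dot_def)
    next
      case 2 then show ?thesis by (intro exI[of _ "V3 0 1 0"]) (simp add: dot_def)
    next
      case 3 then show ?thesis by (intro exI[of _ "V3 0 0 1"]) (simp add: dot_def)
    qed
  qed
  ultimately obtain e where e: "dot e (app E u) \<noteq> 0" by blast
  show thesis
  proof
    show "dot (app (tp3 E) e) u \<noteq> 0" unfolding dot_tp3 by (rule e)
    fix g assume g: "g \<in> N"
    have "app (tp3 g) (app (tp3 E) e) = app (tp3 (E * g)) e" by (simp add: tp3_mult app_mult)
    also have "\<dots> = scale (ch g) (app (tp3 E) e)"
      unfolding Eh[OF g] by (simp add: v3_eq_iff algebra_simps)
    finally show "\<exists>c. app g u = scale c u \<and> app (tp3 g) (app (tp3 E) e) = scale c (app (tp3 E) e)"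
      using ch[OF g] by blast
  qed
qed

lemma fgrp_tp3: "fgrp N \<Longrightarrow> fgrp (tp3 ` N)"
  unfolding fgrp_def
proof (intro conjI ballI; (elim conjE)?)
  have t1: "tp3 1 = 1" by (simp add: m3_eq_iff)
  show "1 \<in> tp3 ` N" if "1 \<in> N" using that t1 by (metis image_eqI)
  show "x * y \<in> tp3 ` N" if "\<forall>x\<in>N. \<forall>y\<in>N. x * y \<in> N" "x \<in> tp3 ` N" "y \<in> tp3 ` N" for x y
    using that by (auto simp: tp3_mult[symmetric])
  show "\<exists>y\<in>tp3 ` N. x * y = 1 \<and> y * x = 1"
    if inv: "\<forall>x\<in>N. \<exists>y\<in>N. x * y = 1 \<and> y * x = 1" and x: "x \<in> tp3 ` N" for x
  proof -
    obtain z where z: "z \<in> N" "x = tp3 z" using x by blast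
    obtain y where "y \<in> N" "z * y = 1" "y * z = 1" using inv z(1) by blast
    then show ?thesis using z(2) t1 by (intro bexI[of _ "tp3 y"]) (auto simp: tp3_mult[symmetric])
  qed
qed simp

text \<open>An eigenvector of the transposed group describes an invariant plane. Maschke's theorem
  for the transposed group then returns an eigenvector of the group itself.\<close>

lemma left_eigenvector_red:
  assumes "fgrp N" "w \<noteq> 0" "\<And>g. g \<in> N \<Longrightarrow> \<exists>c. app (tp3 g) w = scale c w"
  shows "red N"
proof -
  obtain u where u: "dot u w \<noteq> 0" "\<And>g. g \<in> tp3 ` N \<Longrightarrow> \<exists>c. app g w = scale c w \<and> app (tp3 g) u = scale c u"
    using maschke_line[OF fgrp_tp3[OF assms(1)] assms(2)] assms(3) by blast
  have "u \<noteq> 0" using u(1) by (auto simp: dot_def)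
  moreover have "\<exists>c. app g u = scale c u" if "g \<in> N" for g
    using u(2)[of "tp3 g"] that by auto
  ultimately show ?thesis unfolding red_def by blast
qed

text \<open>The vectors span the plane orthogonal to \<open>w\<close> and are chosen with cross
  product a nonzero multiple of \<open>w\<close>, so their determinant with \<open>u\<close> is a
  multiple of \<open>dot w u\<close>. Which pair works depends on a nonvanishing coordinate of
  \<open>w\<close>.\<close>

lemma complement_basis:
  fixes u w :: "'a::field v3"
  assumes "dot w u \<noteq> 0"
  obtains v v' where "dot w v = 0" "dot w v' = 0" "det3 (cols u v v') \<noteq> 0"
proof -
  have d: "det3 (cols u v v') = dot u (cross v v')" for v v'
    by (simp add: det3_def cols_def dot_def cross_def algebra_simps)
  have s: "dot u (scale k w) = k * dot w u" for k by (simp add: dot_def algebra_simps)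
  obtain a b c where w: "w = V3 a b c" by (cases w)
  have "a \<noteq> 0 \<or> b \<noteq> 0 \<or> c \<noteq> 0" using assms by (auto simp: w dot_def)
  moreover have "thesis" if "dot w v = 0" "dot w v' = 0" "cross v v' = scale k w" "k \<noteq> 0" for v v' k
    using \<open>\<And>v v'. dot w v = 0 \<Longrightarrow> dot w v' = 0 \<Longrightarrow> det3 (cols u v v') \<noteq> 0 \<Longrightarrow> thesis\<close>[OF that(1,2)]
      that(3,4) assms by (simp add: d s)
  from this[of "V3 (- b) a 0" "V3 (- c) 0 a" a] this[of "V3 b (- a) 0" "V3 0 (- c) b" "- b"]
    this[of "V3 c 0 (- a)" "V3 0 c (- b)" c]
  have "a \<noteq> 0 \<Longrightarrow> thesis" "b \<noteq> 0 \<Longrightarrow> thesis" "c \<noteq> 0 \<Longrightarrow> thesis"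
    by (simp_all add: w dot_def cross_def v3_eq_iff)
  ultimately show thesis by blast
qed

text \<open>A basis made of the invariant vector \<open>u\<close> and the complementary plane gives
  blocks \<open>c\<close> and \<open>A\<close>. Determinant one and \<open>c * c = 1\<close> yield
  \<open>det2 A = c\<close>, which is the shape of \<open>iota A\<close>.\<close>

lemma red_block:
  assumes "fgrp N" "red N" "\<And>g. g \<in> N \<Longrightarrow> det3 g = 1"
  obtains b b' where "b * b' = 1" "b' * b = 1" "\<And>g. g \<in> N \<Longrightarrow> \<exists>A. b * g * b' = iota A"
proof -
  obtain u where u: "u \<noteq> 0" "\<And>g. g \<in> N \<Longrightarrow> \<exists>c. app g u = scale c u" using assms(2) unfolding red_def by blast
  obtain w where w: "dot w u \<noteq> 0" "\<And>g. g \<in> N \<Longrightarrow> \<exists>c. app g u = scale c u \<and> app (tp3 g) w = scale c w"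
    using maschke_line[OF assms(1) u] by blast
  obtain v v' where v: "dot w v = 0" "dot w v' = 0" "det3 (cols u v v') \<noteq> 0" using complement_basis w(1) .
  define B where "B = cols u v v'"
  obtain B' where B': "B * B' = 1" "B' * B = 1" using det3_inverse v(3) unfolding B_def .
  let ?e = "V3 1 0 0 :: qf v3"
  have Be: "app B ?e = u" by (simp add: v3_eq_iff B_def cols_def)
  have "app (tp3 B) w = scale (dot w u) ?e"
    using v(1,2) by (simp add: v3_eq_iff B_def cols_def dot_def algebra_simps)
  then have "app (tp3 B') (app (tp3 B) w) = scale (dot w u) (app (tp3 B') ?e)" by (simp add: app_scale)
  moreover have "tp3 B' * tp3 B = 1" unfolding tp3_mult[symmetric] B'(1) by (simp add: m3_eq_iff)
  ultimately have "w = scale (dot w u) (app (tp3 B') ?e)" by (simp add: app_mult[symmetric])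
  then have "scale (inverse (dot w u)) w = scale (inverse (dot w u) * dot w u) (app (tp3 B') ?e)"
    by (metis scale_scale)
  then have Be': "app (tp3 B') ?e = scale (inverse (dot w u)) w" using w(1) by simp
  show thesis
  proof (rule that[OF B'(2,1)])
    fix g assume g: "g \<in> N"
    obtain c where c: "app g u = scale c u" "app (tp3 g) w = scale c w" using w(2) g by blast
    let ?M = "B' * g * B"
    have "app ?M ?e = scale c (app (B' * B) ?e)" by (simp add: app_mult Be c app_scale)
    then have r1: "app ?M ?e = scale c ?e" unfolding B'(2) by simp
    have "app (tp3 ?M) ?e = app (tp3 B) (app (tp3 g) (app (tp3 B') ?e))" by (simp add: tp3_mult app_mult)
    also have "\<dots> = scale c (app (tp3 B) (app (tp3 B') ?e))" by (simp add: Be' app_scale c scale_scale mult.commute)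
    also have "\<dots> = scale c (app (tp3 (B' * B)) ?e)" by (simp add: tp3_mult app_mult)
    also have "\<dots> = scale c ?e" unfolding B'(2) by (simp add: v3_eq_iff)
    finally have r2: "app (tp3 ?M) ?e = scale c ?e" .
    have M: "b11 ?M = c" "b21 ?M = 0" "b31 ?M = 0" "b12 ?M = 0" "b13 ?M = 0"
      using r1 r2 unfolding v3_eq_iff by (simp_all del: m3_sel)
    have "det3 B' * det3 B = 1" using B'(2) by (metis det3_1 det3_mult)
    then have d: "det3 ?M = 1" using assms(3)[OF g] by (simp add: det3_mult mult.commute)
    have cc: "c * c = 1" using eigenvalue_pm1[OF assms(1) g u(1) c(1)] by auto
    define A where "A = M2 (b22 ?M) (b23 ?M) (b32 ?M) (b33 ?M)"
    have "c * det2 A = 1" using d unfolding det3_def M det2_def A_def by simp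
    then have "c * c * det2 A = c" by (simp add: mult.assoc)
    then have "det2 A = c" using cc by simp
    then have "?M = iota A" unfolding m3_eq_iff iota_def using M by (simp add: A_def del: m3_sel)
    then show "\<exists>A. ?M = iota A" by blast
  qed
qed

lemma gp_iota_preimage:
  fixes P :: "qf m2 set"
  assumes "gp (iota ` P) (iota ` P0)"
  shows "gp P P0"
proof -
  have i: "iota x \<in> iota ` A \<longleftrightarrow> x \<in> A" for x :: "qf m2" and A by (auto simp: iota_inj)
  have i1: "1 \<in> iota ` A \<longleftrightarrow> 1 \<in> A" for A :: "qf m2 set" using i[of 1 A] by (simp add: iota_1)
  note g = gpD[OF assms]
  note f = fgrpD[OF g(1)]
  show ?thesis unfolding gp_def fgrp_def
  proof (intro conjI ballI)
    show "finite P" using f(1) by (rule finite_imageD) (auto simp: inj_on_def iota_inj)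
    show "1 \<in> P" using f(2) i1 by simp
    show "x * y \<in> P" if "x \<in> P" "y \<in> P" for x y
      using f(3)[of "iota x" "iota y"] that by (simp only: i iota_mult[symmetric])
    show "\<exists>y\<in>P. x * y = 1 \<and> y * x = 1" if "x \<in> P" for x
    proof -
      have "iota x \<in> iota ` P" using that by simp
      then obtain y where y: "y \<in> P" "iota x * iota y = 1" "iota y * iota x = 1" using f(4) by blast
      then have "iota (x * y) = iota 1" "iota (y * x) = iota 1" by (simp_all add: iota_mult iota_1)
      then show ?thesis using y(1) by (auto simp: iota_inj)
    qed
    show "P0 \<subseteq> P" using g(2) i by blast
    show "x * y \<in> P0 \<longleftrightarrow> (x \<in> P0 \<longleftrightarrow> y \<in> P0)" if "x \<in> P" "y \<in> P" for x y
      using g(3)[of "iota x" "iota y"] that by (simp only: i iota_mult[symmetric])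
  qed
qed

lemma simconj_iota:
  assumes "simconj P P0 Q Q0"
  shows "simconj (iota ` P) (iota ` P0) (iota ` Q) (iota ` Q0)"
proof -
  obtain b b' where b: "b * b' = 1" "b' * b = 1" "Q = (\<lambda>x. b * x * b') ` P" "Q0 = (\<lambda>x. b * x * b') ` P0"
    using assms unfolding simconj_def by blast
  have "iota b * iota b' = 1" "iota b' * iota b = 1" by (simp_all add: iota_mult[symmetric] b iota_1)
  then show ?thesis unfolding simconj_def b(3,4)
    by (intro exI[of _ "iota b"] exI[of _ "iota b'"]) (simp add: image_image iota_mult)
qed

text \<open>Monomial matrices carrying \<open>a\<close>, \<open>b\<close>, \<open>c\<close> in
  columns one, two, three. The index runs over the permutations: cyclic ones for
  \<open>k < 3\<close>, transpositions after that.\<close>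

definition pm :: "nat \<Rightarrow> 'a::comm_ring_1 \<Rightarrow> 'a \<Rightarrow> 'a \<Rightarrow> 'a m3" where
  "pm k a b c = (if k = 0 then M3 a 0 0 0 b 0 0 0 c else if k = 1 then M3 0 0 c a 0 0 0 b 0
     else if k = 2 then M3 0 b 0 0 0 c a 0 0 else if k = 3 then M3 a 0 0 0 0 c 0 b 0
     else if k = 4 then M3 0 0 c 0 b 0 a 0 0 else M3 0 b 0 a 0 0 0 0 c)"

text \<open>Cyclic permutation matrices with signs of product one form the rotation group of the
  tetrahedron. The signed transpositions of \<open>oct_odd\<close>, with sign product
  \<open>-1\<close>, complete it to the rotation group of the octahedron.\<close>

definition tet :: "'a::comm_ring_1 m3 list" where
  "tet = map (\<lambda>(k, a, b). pm k a b (a * b)) (List.product [0, 1, 2] (List.product [1, -1] [1, -1]))"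

definition oct_odd :: "'a::comm_ring_1 m3 list" where
  "oct_odd = map (\<lambda>(k, a, b). pm k a b (- a * b)) (List.product [3, 4, 5] (List.product [1, -1] [1, -1]))"

text \<open>Under \<open>iota\<close> the matrices \<open>-1\<close>, \<open>refl0\<close> and
  \<open>- refl0\<close> become the half-turns about the three coordinate axes, which can be
  permuted; so five of the first nine pairs of \<open>std2\<close> suffice.\<close>

definition std3 :: "(qf m3 list \<times> qf m3 list) list" where
  "std3 = map (map_prod (map iota) (map iota))
     ([([1], [1]), ([1, -1], [1, -1]), ([1, -1], [1]),
       ([1, -1, refl0, -refl0], [1, -1, refl0, -refl0]), ([1, -1, refl0, -refl0], [1, -1])] @ drop 9 std2)
     @ [(tet, tet), (tet @ oct_odd, tet @ oct_odd), (tet @ oct_odd, tet)]"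

definition is_std3 :: "qf m3 set \<Rightarrow> qf m3 set \<Rightarrow> bool" where
  "is_std3 N N0 \<longleftrightarrow> (\<exists>(Q, Q0) \<in> set std3. simconj N N0 (set Q) (set Q0))"

lemma is_std3_I: "simconj N N0 (set Q) (set Q0) \<Longrightarrow> (Q, Q0) \<in> set std3 \<Longrightarrow> is_std3 N N0"
  unfolding is_std3_def by blast

lemma is_std3_simconj: "simconj N N0 M M0 \<Longrightarrow> is_std3 M M0 \<Longrightarrow> is_std3 N N0"
  unfolding is_std3_def using simconj_trans by fast

lemma is_std3_iota_std2:
  assumes "(Q, Q0) \<in> set std2"
  shows "is_std3 (iota ` set Q) (iota ` set Q0)"
proof -
  have I: "is_std3 (iota ` set Q) (iota ` set Q0)"
    if "(Q, Q0) \<in> set ([([1], [1]), ([1, -1], [1, -1]), ([1, -1], [1]),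
       ([1, -1, refl0, -refl0], [1, -1, refl0, -refl0]), ([1, -1, refl0, -refl0], [1, -1])] @ drop 9 std2)" for Q Q0
  proof (rule is_std3_I)
    show "simconj (iota ` set Q) (iota ` set Q0) (set (map iota Q)) (set (map iota Q0))"
      by (simp add: simconj_refl)
    show "(map iota Q, map iota Q0) \<in> set std3"
      using imageI[OF that, of "map_prod (map iota) (map iota)"] unfolding std3_def set_append set_map by simp
  qed
  have c: "is_std3 (iota ` set Q) (iota ` set Q0)"
    if "b * b = 1" "(\<lambda>x. b * iota x * b) ` set Q = iota ` set R" "(\<lambda>x. b * iota x * b) ` set Q0 = iota ` set R0"
      "is_std3 (iota ` set R) (iota ` set R0)" for b :: "qf m3" and Q Q0 R R0
    by (rule is_std3_simconj[OF _ that(4)]) (use that(1-3) in \<open>auto simp: simconj_def image_image intro!: exI[of _ b]\<close>)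
  have e: "std2 = take 9 std2 @ drop 9 std2" by simp
  consider "(Q, Q0) \<in> set (take 9 std2)" | "(Q, Q0) \<in> set (drop 9 std2)"
    using assms by (subst (asm) e) (simp only: set_append Un_iff, blast)
  then show ?thesis
  proof cases
    case 2
    then show ?thesis by (intro I) simp
  next
    case 1
    have t: "take 9 std2 = [([1], [1]), ([1, -1], [1, -1]), ([1, -1], [1]), ([1, refl0], [1, refl0]), ([1, refl0], [1]),
      ([1, -1, refl0, -refl0], [1, -1, refl0, -refl0]), ([1, -1, refl0, -refl0], [1, -1]),
      ([1, -1, refl0, -refl0], [1, refl0]), ([1, -1, refl0, -refl0], [1, -refl0])]"
      unfolding std2_def by simp
    note d = iota_def det2_def refl0_def m3_eq_iff pm_def
    \<comment> \<open>Conjugation by a transposition of coordinates moves \<open>iota refl0\<close>,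
      or \<open>iota (- refl0)\<close> in \<open>r4\<close>, to \<open>iota (-1)\<close>.\<close>
    have r1: "is_std3 (iota ` set [1, refl0]) (iota ` set [1, refl0])"
      by (rule c[where b = "pm 5 1 1 1" and R = "[1, -1]" and ?R0.0 = "[1, -1]"], simp add: d, (auto simp: d)[1], (auto simp: d)[1], rule I, simp)
    have r2: "is_std3 (iota ` set [1, refl0]) (iota ` set [1])"
      by (rule c[where b = "pm 5 1 1 1" and R = "[1, -1]" and ?R0.0 = "[1]"], simp add: d, (auto simp: d)[1], (auto simp: d)[1], rule I, simp)
    have r3: "is_std3 (iota ` set [1, -1, refl0, - refl0]) (iota ` set [1, refl0])"
      by (rule c[where b = "pm 5 1 1 1" and R = "[1, -1, refl0, - refl0]" and ?R0.0 = "[1, -1]"], simp add: d, (auto simp: d)[1], (auto simp: d)[1], rule I, simp)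
    have r4: "is_std3 (iota ` set [1, -1, refl0, - refl0]) (iota ` set [1, - refl0])"
      by (rule c[where b = "pm 4 1 1 1" and R = "[1, -1, refl0, - refl0]" and ?R0.0 = "[1, -1]"], simp add: d, (auto simp: d)[1], (auto simp: d)[1], rule I, simp)
    have i: "is_std3 (iota ` set [1]) (iota ` set [1])" "is_std3 (iota ` set [1, -1]) (iota ` set [1, -1])"
      "is_std3 (iota ` set [1, -1]) (iota ` set [1])"
      "is_std3 (iota ` set [1, -1, refl0, - refl0]) (iota ` set [1, -1, refl0, - refl0])"
      "is_std3 (iota ` set [1, -1, refl0, - refl0]) (iota ` set [1, -1])"
      by (rule I, simp)+
    show ?thesis using 1 unfolding t unfolding list.set(2) list.set(1) insert_iff empty_iff
      by (elim disjE FalseE Pair_inject) (simp_all only: r1 r2 r3 r4 i)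
  qed
qed

theorem SL3_reducible_pairs:
  assumes "gp N N0" "red N" "\<And>g. g \<in> N \<Longrightarrow> det3 g = 1"
  shows "is_std3 N N0"
proof -
  obtain b b' where b: "b * b' = 1" "b' * b = 1" "\<And>g. g \<in> N \<Longrightarrow> \<exists>A. b * g * b' = iota A"
    using red_block[OF gpD(1)[OF assms(1)] assms(2,3)] by blast
  define P where "P = {A. iota A \<in> (\<lambda>x. b * x * b') ` N}"
  define P0 where "P0 = {A. iota A \<in> (\<lambda>x. b * x * b') ` N0}"
  have im: "(\<lambda>x. b * x * b') ` N = iota ` P" "(\<lambda>x. b * x * b') ` N0 = iota ` P0"
  proof -
    have "S = iota ` {A. iota A \<in> S}" if "S \<subseteq> range iota" for S using that by blast
    moreover have "(\<lambda>x. b * x * b') ` N \<subseteq> range iota" using b(3) by blast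
    moreover from this have "(\<lambda>x. b * x * b') ` N0 \<subseteq> range iota" using gpD(2)[OF assms(1)] by blast
    ultimately show "(\<lambda>x. b * x * b') ` N = iota ` P" "(\<lambda>x. b * x * b') ` N0 = iota ` P0"
      unfolding P_def P0_def by simp_all
  qed
  have sc: "simconj N N0 (iota ` P) (iota ` P0)" unfolding simconj_def im[symmetric] using b(1,2) by blast
  have "gp P P0" by (rule gp_iota_preimage[OF gp_simconj[OF assms(1) sc]])
  then obtain Q Q0 where Q: "(Q, Q0) \<in> set std2" "simconj P P0 (set Q) (set Q0)"
    using GL2_pairs unfolding is_std2_def by blast
  show ?thesis
    using is_std3_simconj[OF sc is_std3_simconj[OF simconj_iota[OF Q(2)] is_std3_iota_std2[OF Q(1)]]] .
qed

section \<open>Monomial subgroups\<close>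

lemma pm_simps:
  "pm 0 a b c = M3 a 0 0 0 b 0 0 0 c" "pm 1 a b c = M3 0 0 c a 0 0 0 b 0" "pm (Suc 0) a b c = M3 0 0 c a 0 0 0 b 0"
  "pm 2 a b c = M3 0 b 0 0 0 c a 0 0" "pm 3 a b c = M3 a 0 0 0 0 c 0 b 0"
  "pm 4 a b c = M3 0 0 c 0 b 0 a 0 0" "pm 5 a b c = M3 0 b 0 a 0 0 0 0 c"
  by (simp_all add: pm_def)

lemma less_6_cases: "(k::nat) < 6 \<longleftrightarrow> k = 0 \<or> k = 1 \<or> k = 2 \<or> k = 3 \<or> k = 4 \<or> k = 5"
  by presburger

lemma det3_pm: "det3 (pm k a b c) = (if k < 3 then a * b * c else - (a * b * c))"
  by (simp add: pm_def det3_def)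

lemma pm_left_cycle:
  "pm 1 1 1 1 * pm 0 a b c = pm 1 a b c" "pm 2 1 1 1 * pm 0 a b c = pm 2 a b c"
  "pm 2 1 1 1 * pm 1 a b c = pm 0 a b c" "pm 1 1 1 1 * pm 2 a b c = pm 0 a b c"
  "pm 1 1 1 1 * pm 4 a b c = pm 3 a b c" "pm 2 1 1 1 * pm 5 a b c = pm 3 a b c"
  "pm 2 1 1 1 * pm 3 a b c = pm 4 a b c" "pm 1 1 1 1 * pm 3 a b c = pm 5 a b c"
  "pm 1 1 1 1 * pm 1 1 1 (1 :: 'a :: comm_ring_1) = pm 2 1 1 1"
  by (simp_all add: pm_simps m3_eq_iff)

lemma image_triple:
  "(\<lambda>(k, a, b). f k a b) ` (K \<times> A \<times> B) = {f k a b | k a b. k \<in> K \<and> a \<in> A \<and> b \<in> B}"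
proof (intro equalityI subsetI)
  fix x assume "x \<in> {f k a b | k a b. k \<in> K \<and> a \<in> A \<and> b \<in> B}"
  then obtain k a b where "x = f k a b" "(k, a, b) \<in> K \<times> A \<times> B" by blast
  then show "x \<in> (\<lambda>(k, a, b). f k a b) ` (K \<times> A \<times> B)" by (intro image_eqI[of _ _ "(k, a, b)"]) simp_all
qed auto

lemma set_tet: "set tet = {pm k a b (a * b) | k a b. k < 3 \<and> a \<in> {1, -1} \<and> b \<in> {1, -1}}"
proof -
  have "(k::nat) \<in> {0, 1, 2} \<longleftrightarrow> k < 3" for k by auto
  then have "{0, 1, 2 :: nat} = {..<3}" by blast
  then have "set tet = (\<lambda>(k, a, b). pm k a b (a * b)) ` ({..<3} \<times> {1, -1} \<times> {1, -1})"
    unfolding tet_def set_map set_product by (simp only: list.set)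
  then show ?thesis unfolding image_triple lessThan_iff .
qed

lemma set_oct_odd: "set oct_odd = {pm k a b (- a * b) | k a b. k \<in> {3, 4, 5} \<and> a \<in> {1, -1} \<and> b \<in> {1, -1}}"
proof -
  have "set oct_odd = (\<lambda>(k, a, b). pm k a b (- a * b)) ` ({3, 4, 5} \<times> {1, -1} \<times> {1, -1})"
    unfolding oct_odd_def set_map set_product by (simp only: list.set)
  then show ?thesis unfolding image_triple .
qed

lemma tet_I: "k < 3 \<Longrightarrow> a \<in> {1, -1} \<Longrightarrow> b \<in> {1, -1} \<Longrightarrow> c = a * b \<Longrightarrow> pm k a b c \<in> set tet"
  unfolding set_tet by blast

lemma sign_square: "a \<in> {1, -1} \<Longrightarrow> a * a = 1" for a :: qf by auto

lemma tet_sign: 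
  fixes a b c :: qf
  assumes "a \<in> {1, -1}" "b \<in> {1, -1}" "a * b * c = 1"
  shows "c = a * b"
proof -
  have "c = (a * a) * (b * b) * c" using sign_square assms(1,2) by simp
  also have "\<dots> = a * b * (a * b * c)" by (simp only: mult_ac)
  finally show ?thesis using assms(3) by simp
qed

text \<open>\<open>oct_odd\<close> is a single coset of \<open>tet\<close>, so one of its elements
  together with closure under \<open>tet\<close> produces all of it.\<close>

lemma oct_odd_closure:
  assumes t: "t \<in> S" "t \<in> set oct_odd" and cl: "\<And>x z. x \<in> S \<Longrightarrow> z \<in> set tet \<Longrightarrow> x * z \<in> S \<and> z * x \<in> S"
  shows "set (oct_odd :: qf m3 list) \<subseteq> S"
proof -
  have C: "pm 1 1 1 1 \<in> set tet" "pm 2 1 1 1 \<in> set tet" by (auto intro: tet_I)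
  obtain k a b where k: "t = pm k a b (- a * b)" "k \<in> {3, 4, 5}" and ab: "a \<in> {1, -1}" "b \<in> {1, -1}"
    using t(2) unfolding set_oct_odd by blast
  have t3: "pm 3 a b (- a * b) \<in> S"
    using k(2) t(1) cl[OF t(1) C(1)] cl[OF t(1) C(2)] unfolding k(1) by (auto simp: pm_left_cycle simp del: One_nat_def)
  have p3: "pm 3 x y (- x * y) \<in> S" if xy: "x \<in> {1, -1}" "y \<in> {1, -1}" for x y
  proof -
    have "pm 0 (a * x) (b * y) (a * x * (b * y)) \<in> set tet" using ab xy by (intro tet_I) auto
    then have "pm 3 a b (- a * b) * pm 0 (a * x) (b * y) (a * x * (b * y)) \<in> S" using cl t3 by blast
    moreover have "pm 3 a b (- a * b) * pm 0 (a * x) (b * y) (a * x * (b * y)) = pm 3 x y (- x * y)"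
    proof -
      have "a * (a * x) = x" "b * (b * y) = y" "- (a * b) * (a * x * (b * y)) = - (x * y)"
        using ab by auto
      then show ?thesis by (simp add: pm_simps m3_eq_iff)
    qed
    ultimately show ?thesis by simp
  qed
  have p45: "pm 4 x y (- x * y) \<in> S" "pm 5 x y (- x * y) \<in> S" if xy: "x \<in> {1, -1}" "y \<in> {1, -1}" for x y
    using cl[OF p3[OF xy] C(2)] cl[OF p3[OF xy] C(1)] by (simp_all only: pm_left_cycle)
  show ?thesis
  proof
    fix z :: "qf m3" assume "z \<in> set oct_odd"
    then obtain k x y where z: "z = pm k x y (- x * y)" "k \<in> {3, 4, 5}" "x \<in> {1, -1}" "y \<in> {1, -1}"
      unfolding set_oct_odd by blast
    from z(2) show "z \<in> S" using p3[OF z(3,4)] p45[OF z(3,4)] unfolding z(1) by auto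
  qed
qed

text \<open>There are only six underlying permutations, so a larger group contains a nontrivial
  diagonal matrix. Its entries are signs; conjugating it with the cyclic permutation yields all
  diagonal sign matrices of determinant one, hence all of \<open>tet\<close>. What is left over lies
  in \<open>oct_odd\<close>.\<close>

lemma monomial_pairs_normalized:
  assumes gp: "gp N N0" and det: "\<And>g. g \<in> N \<Longrightarrow> det3 g = 1"
    and mono: "\<And>g. g \<in> N \<Longrightarrow> \<exists>k<6. \<exists>a b c. g = pm k a b c" and card: "card N > 6"
    and C: "pm 1 1 1 1 \<in> N"
  shows "is_std3 N (N0 :: qf m3 set)"
proof -
  note fg = gpD(1)[OF gp]
  note mul = fgrpD(3)[OF fg]
  have C2: "pm 2 1 1 1 \<in> N" using mul[OF C C] unfolding pm_left_cycle .
  have ev: "c = 1 \<or> c = -1" if "g \<in> N" "app g u = scale c u" "u \<noteq> 0" for g u c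
    using eigenvalue_pm1[OF fg that(1,3,2)] .
  have diag: "a \<in> {1, -1} \<and> b \<in> {1, -1} \<and> c \<in> {1, -1} \<and> c = a * b" if "pm 0 a b c \<in> N" for a b c
  proof -
    have "a = 1 \<or> a = -1" by (rule ev[OF that, of "V3 1 0 0"]) (simp_all add: pm_simps v3_eq_iff)
    moreover have "b = 1 \<or> b = -1" by (rule ev[OF that, of "V3 0 1 0"]) (simp_all add: pm_simps v3_eq_iff)
    moreover have "c = 1 \<or> c = -1" by (rule ev[OF that, of "V3 0 0 1"]) (simp_all add: pm_simps v3_eq_iff)
    moreover have "a * b * c = 1" using det[OF that] by (simp add: det3_pm)
    ultimately show ?thesis using tet_sign[of a b c] by auto
  qed
  have "\<exists>a b c. pm 0 a b c \<in> N \<and> pm 0 a b c \<noteq> 1"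
  proof (rule ccontr)
    assume n: "\<not> ?thesis"
    \<comment> \<open>\<open>sh\<close> recovers the permutation from the positions of nonzero
      entries; elements with equal permutations differ by a diagonal factor.\<close>
    define sh where "sh g = (if b11 g \<noteq> 0 then if b22 g \<noteq> 0 then 0 else 3 else if b21 g \<noteq> 0 then if b32 g \<noteq> 0 then 1 else 5
      else if b12 g \<noteq> 0 then 2 else 4 :: nat)" for g :: "qf m3"
    have sh: "sh (pm k a b c) = k" if "k < 6" "a * b * c \<noteq> 0" for k a b c
      using that unfolding less_6_cases by (auto simp: sh_def pm_simps)
    have nz: "a * b * c \<noteq> 0" if "pm k a b c \<in> N" for k a b c
      using det[OF that] by (auto simp: det3_pm split: if_splits)
    have q: "\<exists>x y z. pm k a b c = pm 0 x y z * pm k a' b' c'" if "k < 6" "a' * b' * c' \<noteq> 0" for k and a b c a' b' c' :: qf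
      using that unfolding less_6_cases
      by (elim disjE) ((rule exI[of _ "if k \<in> {0, 3} then a / a' else if k \<in> {1, 4} then c / c' else b / b'"],
         rule exI[of _ "if k \<in> {0, 4} then b / b' else if k \<in> {1, 5} then a / a' else c / c'"],
         rule exI[of _ "if k \<in> {0, 5} then c / c' else if k \<in> {1, 3} then b / b' else a / a'"],
         simp add: pm_simps m3_eq_iff)+)
    have "inj_on sh N"
    proof (rule inj_onI)
      fix g h assume gh: "g \<in> N" "h \<in> N" "sh g = sh h"
      obtain k a b c where g: "k < 6" "g = pm k a b c" using mono gh(1) by blast
      obtain l a' b' c' where h: "l < 6" "h = pm l a' b' c'" using mono gh(2) by blast
      have "k = l" using gh g h sh nz by metis
      then obtain x y z where e: "g = pm 0 x y z * h" using q[OF h(1)] nz gh(2) g h by metis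
      obtain h' where h': "h' \<in> N" "h * h' = 1" using fgrpD(4)[OF fg gh(2)] by blast
      have "pm 0 x y z = g * h'" using e h' by (simp add: mult.assoc)
      then have "pm 0 x y z = 1" using n mul[OF gh(1) h'(1)] by metis
      then show "g = h" using e by simp
    qed
    moreover have "sh ` N \<subseteq> {..<6}" by (auto simp: sh_def)
    ultimately have "card N \<le> card {..<6::nat}" by (metis card_inj_on_le finite_lessThan)
    then show False using card by simp
  qed
  then obtain a b c where d: "pm 0 a b c \<in> N" "pm 0 a b c \<noteq> 1" by blast
  have sh: "pm 0 c a b \<in> N" if "pm 0 a b c \<in> N" for a b c
  proof -
    have "pm 1 1 1 1 * pm 0 a b c * pm 2 1 1 1 \<in> N" using mul C C2 that by blast
    then show ?thesis by (simp add: pm_simps times_m3_def)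
  qed
  have "(a, b, c) \<in> {(1, -1, -1), (-1, 1, -1), (-1, -1, 1)}"
    using diag[OF d(1)] d(2) by (auto simp: pm_simps m3_eq_iff)
  then have V: "pm 0 1 (-1) (-1) \<in> N" "pm 0 (-1) 1 (-1) \<in> N" "pm 0 (-1) (-1) 1 \<in> N"
    using d(1) sh[OF d(1)] sh[OF sh[OF d(1)]] by auto
  have one: "pm 0 1 1 1 \<in> N" using fgrpD(2)[OF fg] by (simp add: pm_simps one_m3_def)
  have p0: "pm 0 x y (x * y) \<in> N" if "x \<in> {1, -1}" "y \<in> {1, -1}" for x y
    using that V one by auto
  have sub: "set tet \<subseteq> N"
  proof
    fix z :: "qf m3" assume "z \<in> set tet"
    then obtain k x y where z: "z = pm k x y (x * y)" "k < 3" and xy: "x \<in> {1, -1}" "y \<in> {1, -1}" unfolding set_tet by blast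
    have "pm 1 x y (x * y) \<in> N" "pm 2 x y (x * y) \<in> N"
      using mul[OF C p0[OF xy]] mul[OF C2 p0[OF xy]] by (simp_all only: pm_left_cycle)
    moreover have "k = 0 \<or> k = 1 \<or> k = 2" using z(2) by presburger
    ultimately show "z \<in> N" using p0[OF xy] unfolding z(1) by auto
  qed
  have p3: "pm 3 a b c \<in> N \<Longrightarrow> a \<in> {1, -1} \<and> b \<in> {1, -1} \<and> c = - a * b" for a b c
  proof -
    assume g: "pm 3 a b c \<in> N"
    have abc: "a * b * c = -1" using det[OF g] by (simp add: det3_pm) (metis add.inverse_inverse)
    have a: "a = 1 \<or> a = -1" by (rule ev[OF g, of "V3 1 0 0"]) (simp_all add: pm_simps v3_eq_iff)
    \<comment> \<open>The square of \<open>pm 3 a b c\<close> itself only constrains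
      \<open>b * c\<close>. Composing with the cycle gives a transposition that fixes another
      coordinate, and its square has \<open>a * b\<close> on the diagonal.\<close>
    have "pm 3 a b c * pm 1 1 1 1 * (pm 3 a b c * pm 1 1 1 1) \<in> N" using mul g C by blast
    moreover have "pm 3 a b c * pm 1 1 1 1 * (pm 3 a b c * pm 1 1 1 1) = pm 0 (a * b) (c * c) (a * b)"
      by (simp add: pm_simps m3_eq_iff mult_ac)
    ultimately have "a * b \<in> {1, -1}" using diag by metis
    then have b: "b \<in> {1, -1}" using a by (auto simp: minus_equation_iff)
    have "(a * b * c = 1) \<or> a * b * (- c) = 1" using abc by simp
    then have "- c = a * b" using tet_sign[of a b "- c"] a b abc by auto
    then show ?thesis using a b by (auto simp: minus_equation_iff)
  qed
  have ev_or_odd: "g \<in> set tet \<or> g \<in> set oct_odd" if g: "g \<in> N" for g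
  proof -
    obtain k a b c where k: "k < 6" "g = pm k a b c" using mono g by blast
    have e: "pm k a b c \<in> set tet" if "pm 0 a b c \<in> N" "k < 3"
      using diag[OF that(1)] that(2) by (intro tet_I) auto
    have o: "pm k a b c \<in> set oct_odd" if "pm 3 a b c \<in> N" "k \<in> {3, 4, 5}"
      using p3[OF that(1)] that(2) unfolding set_oct_odd by blast
    have m: "pm 1 1 1 1 * g \<in> N" "pm 2 1 1 1 * g \<in> N" using mul C C2 g by blast+
    from k(1) show ?thesis
      unfolding less_6_cases using g m e o unfolding k(2) by (elim disjE) (simp_all add: pm_left_cycle del: One_nat_def)
  qed
  have tet0: "z \<in> N0" if z: "z \<in> set tet" for z
  proof -
    have cyc: "pm k x y (x * y) \<in> N0" if "k \<in> {1, 2}" "x \<in> {1, -1}" "y \<in> {1, -1}" for k x y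
    proof -
      let ?z = "pm k x y (x * y) :: qf m3"
      have zN: "?z \<in> N" using sub tet_I[of k x y "x * y"] that by auto
      \<comment> \<open>An element of order three equals its fourth power, which is a
        square.\<close>
      have "?z = ?z * ?z * (?z * ?z)" using that by (auto simp: pm_simps m3_eq_iff)
      then show ?thesis using gp_squares[OF gp mul[OF zN zN]] by simp
    qed
    obtain k x y where k: "z = pm k x y (x * y)" "k < 3" "x \<in> {1, -1}" "y \<in> {1, -1}" using z unfolding set_tet by blast
    have p0: "pm 0 x y (x * y) \<in> N0"
    proof -
      have "pm 2 1 1 1 * pm 1 x y (x * y) \<in> N0"
        using gpD(3)[OF gp, of "pm 2 1 1 1" "pm 1 x y (x * y)"] cyc[of 2 1 1] cyc[of 1 x y] k gpD(2)[OF gp] by auto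
      then show ?thesis by (simp only: pm_left_cycle)
    qed
    have "k = 0 \<or> k = 1 \<or> k = 2" using k(2) by presburger
    then show ?thesis using p0 cyc[of 1 x y] cyc[of 2 x y] k unfolding k(1) by auto
  qed
  show ?thesis
  proof (cases "\<exists>t\<in>N. t \<in> set oct_odd")
    case False
    then have "N = set tet" "N0 = set tet" using ev_or_odd sub tet0 gpD(2)[OF gp] by blast+
    then show ?thesis using is_std3_I[OF simconj_refl, of tet tet] by (simp add: std3_def)
  next
    case True
    then have "set oct_odd \<subseteq> N" using oct_odd_closure[of _ N] mul sub by blast
    then have N: "N = set (tet @ oct_odd)" using ev_or_odd sub by auto
    show ?thesis
    proof (cases "\<exists>t\<in>N0. t \<in> set oct_odd")
      case True
      then obtain t where t: "t \<in> N0" "t \<in> set oct_odd" by blast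
      have "set oct_odd \<subseteq> N0"
        by (rule oct_odd_closure[OF t]) (use gpD(2,3)[OF gp] sub tet0 in blast)
      then have "N0 = set (tet @ oct_odd)" using N tet0 gpD(2)[OF gp] by auto
      then show ?thesis using is_std3_I[OF simconj_refl, of "tet @ oct_odd" "tet @ oct_odd"] N by (simp add: std3_def)
    next
      case False
      then have "N0 = set tet" using ev_or_odd tet0 gpD(2)[OF gp] by blast
      then show ?thesis using is_std3_I[OF simconj_refl, of "tet @ oct_odd" "tet"] N by (simp add: std3_def)
    qed
  qed
qed

text \<open>Elements moving the first basis line to the second and to the third are three-cycles or
  yield one by composition or squaring. A diagonal change of basis turns it into a permutation
  matrix.\<close>

lemma monomial_pairs:
  assumes gp: "gp N N0" and det: "\<And>g. g \<in> N \<Longrightarrow> det3 g = 1"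
    and mono: "\<And>g. g \<in> N \<Longrightarrow> \<exists>k<6. \<exists>a b c. g = pm k a b c" and card: "card N > 6"
    and tr: "g \<in> N" "b21 g \<noteq> 0" "h \<in> N" "b31 h \<noteq> 0"
  shows "is_std3 N (N0 :: qf m3 set)"
proof -
  note fg = gpD(1)[OF gp]
  have "\<exists>a b c. pm 1 a b c \<in> N"
  proof -
    obtain k a b c where k: "k < 6" "g = pm k a b c" using mono tr(1) by blast
    obtain l d e f where l: "l < 6" "h = pm l d e f" using mono tr(3) by blast
    have k': "k = 1 \<or> k = 5" using k(1) tr(2) unfolding k(2) less_6_cases by (auto simp: pm_simps)
    have l': "l = 2 \<or> l = 4" using l(1) tr(4) unfolding l(2) less_6_cases by (auto simp: pm_simps)
    have "pm 2 d e f * pm 2 d e f = pm 1 (d * f) (e * d) (f * e)" "pm 4 d e f * pm 5 a b c = pm 1 (a * e) (b * d) (c * f)"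
      by (simp_all add: pm_simps m3_eq_iff mult_ac)
    moreover have "k = 1 \<Longrightarrow> g = pm 1 a b c" "k = 5 \<Longrightarrow> g = pm 5 a b c" "l = 2 \<Longrightarrow> h = pm 2 d e f" "l = 4 \<Longrightarrow> h = pm 4 d e f"
      using k(2) l(2) by simp_all
    ultimately show ?thesis
      using k' l' tr(1,3) fgrpD(3)[OF fg tr(3,3)] fgrpD(3)[OF fg tr(3,1)] by metis
  qed
  then obtain a b c where C: "pm 1 a b c \<in> N" by blast
  have abc: "a * b * c = 1" using det[OF C] by (simp add: det3_pm)
  then have nz: "a \<noteq> 0" "b \<noteq> 0" "c \<noteq> 0" by auto
  \<comment> \<open>This scaling turns the first two entries of the cycle into one, and
    \<open>a * b * c = 1\<close> does the same for the third.\<close>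
  let ?s = "pm 0 1 (1 / a) (1 / (a * b)) :: qf m3" and ?s' = "pm 0 1 a (a * b)"
  have ss: "?s * ?s' = 1" "?s' * ?s = 1" using nz by (simp_all add: pm_simps m3_eq_iff)
  define M where "M = (\<lambda>x. ?s * x * ?s') ` N"
  define M0 where "M0 = (\<lambda>x. ?s * x * ?s') ` N0"
  have sc: "simconj N N0 M M0" unfolding simconj_def M_def M0_def using ss by blast
  have gpM: "gp M M0" by (rule gp_simconj[OF gp sc])
  have "is_std3 M M0"
  proof (rule monomial_pairs_normalized[OF gpM])
    have "det3 ?s * det3 ?s' = 1" using ss(1) by (metis det3_1 det3_mult)
    then show "det3 g = 1" if "g \<in> M" for g
      using that det unfolding M_def by (auto simp: det3_mult mult_ac)
    show "\<exists>k<6. \<exists>a b c. g = pm k a b c" if gM: "g \<in> M" for g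
    proof -
      obtain x where x: "x \<in> N" "g = ?s * x * ?s'" using gM unfolding M_def by blast
      obtain k p q r where k: "k < 6" "x = pm k p q r" using mono x(1) by blast
      have "\<exists>p' q' r'. g = pm k p' q' r'"
        using k(1) unfolding x(2) k(2) less_6_cases by (elim disjE) (simp_all add: pm_simps times_m3_def)
      then show ?thesis using k(1) by blast
    qed
    show "card M > 6" unfolding M_def using card card_image[OF inj_conj[OF ss(2), of N]] by simp
    have "?s * pm 1 a b c * ?s' = pm 1 1 1 1" using nz abc
      by (simp add: pm_simps m3_eq_iff mult_ac)
    then show "pm 1 1 1 1 \<in> M" unfolding M_def using C by (metis image_eqI)
  qed
  then show ?thesis using is_std3_simconj[OF sc] by blast
qed

lemma permuted_basis_monomial:
  fixes M :: "qf m3"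
  assumes "det3 M \<noteq> 0" "\<And>e. e \<in> {V3 1 0 0, V3 0 1 0, V3 0 0 1} \<Longrightarrow> \<exists>e' \<in> {V3 1 0 0, V3 0 1 0, V3 0 0 1}. \<exists>c. app M e = scale c e'"
  shows "\<exists>k<6. \<exists>a b c. M = pm k a b c"
proof -
  have L: "\<exists>x. (b11 M = x \<and> b21 M = 0 \<and> b31 M = 0) \<or> (b11 M = 0 \<and> b21 M = x \<and> b31 M = 0) \<or> (b11 M = 0 \<and> b21 M = 0 \<and> b31 M = x)"
    using assms(2)[of "V3 1 0 0"] by (auto simp: v3_eq_iff)
  have L2: "\<exists>x. (b12 M = x \<and> b22 M = 0 \<and> b32 M = 0) \<or> (b12 M = 0 \<and> b22 M = x \<and> b32 M = 0) \<or> (b12 M = 0 \<and> b22 M = 0 \<and> b32 M = x)"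
    using assms(2)[of "V3 0 1 0"] by (auto simp: v3_eq_iff)
  have L3: "\<exists>x. (b13 M = x \<and> b23 M = 0 \<and> b33 M = 0) \<or> (b13 M = 0 \<and> b23 M = x \<and> b33 M = 0) \<or> (b13 M = 0 \<and> b23 M = 0 \<and> b33 M = x)"
    using assms(2)[of "V3 0 0 1"] by (auto simp: v3_eq_iff)
  have D: "M = pm 0 (b11 M) (b22 M) (b33 M) \<or> M = pm 1 (b21 M) (b32 M) (b13 M) \<or> M = pm 2 (b31 M) (b12 M) (b23 M)
    \<or> M = pm 3 (b11 M) (b32 M) (b23 M) \<or> M = pm 4 (b31 M) (b22 M) (b13 M) \<or> M = pm 5 (b21 M) (b12 M) (b33 M)"
    using L L2 L3 assms(1) by (elim exE disjE conjE) (simp_all add: det3_def m3_eq_iff pm_simps)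
  have ex: "\<exists>k<6. \<exists>a b c. M = pm k a b c" if "M = pm k a b c" "k < 6" for k a b c using that by blast
  from D show ?thesis by (elim disjE) ((erule ex, simp)+)
qed

section \<open>Irreducible subgroups: counting axes\<close>

definition Ax :: "qf m3 \<Rightarrow> qf v3 set" where "Ax g = {v. app g v = v}"
text \<open>The whole line through \<open>u\<close>, zero included.\<close>

definition ray :: "qf v3 \<Rightarrow> qf v3 set" where "ray u = range (\<lambda>c. scale c u)"
definition act :: "qf m3 \<Rightarrow> qf v3 set \<Rightarrow> qf v3 set" where "act g L = app g ` L"

lemma act_ray: "act g (ray u) = ray (app g u)"
  unfolding act_def ray_def image_image by (simp only: app_scale)

lemma act_mult: "act (g * h) L = act g (act h L)"
  by (auto simp: act_def app_mult)

lemma act_1: "act 1 L = L" by (simp add: act_def)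

lemma ray_self: "u \<in> ray u" unfolding ray_def by (metis rangeI scale_1)

lemma ray_eq:
  assumes "u \<in> ray v" "u \<noteq> 0"
  shows "ray u = ray v"
proof -
  obtain c where c: "u = scale c v" using assms(1) unfolding ray_def by blast
  then have c0: "c \<noteq> 0" using assms(2) by auto
  have "scale d v \<in> ray u" for d
    unfolding ray_def c by (rule range_eqI[of _ _ "d / c"]) (simp add: scale_scale c0)
  moreover have "scale d u \<in> ray v" for d unfolding ray_def c by (simp add: scale_scale)
  ultimately show ?thesis unfolding ray_def by auto
qed

lemma dot_nonzero: "y \<noteq> 0 \<Longrightarrow> \<exists>e. dot y e \<noteq> 0" for y :: "qf v3"
proof -
  assume ny: "y \<noteq> 0"
  consider "c1 y \<noteq> 0" | "c2 y \<noteq> 0" | "c3 y \<noteq> 0" using ny by (auto simp: v3_eq_iff)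
  then show ?thesis
  proof cases
    case 1 then show ?thesis by (intro exI[of _ "V3 1 0 0"]) (simp add: dot_def)
  next
    case 2 then show ?thesis by (intro exI[of _ "V3 0 1 0"]) (simp add: dot_def)
  next
    case 3 then show ?thesis by (intro exI[of _ "V3 0 0 1"]) (simp add: dot_def)
  qed
qed

text \<open>Data of one orbit of axes: \<open>n\<close> is the group order, \<open>s\<close> the
  length of the orbit, \<open>m\<close> the order of the pointwise stabiliser of an axis. The
  stabiliser of the line is that group or twice as large, as elements act on the line by signs. The
  bound \<open>s \<ge> 3\<close> comes from irreducibility, \<open>m \<noteq> 5\<close> from the
  absence of elements of order five.\<close>

definition datum :: "nat \<Rightarrow> nat \<Rightarrow> nat \<Rightarrow> bool" where
  "datum n s m \<longleftrightarrow> s \<ge> 3 \<and> m \<ge> 2 \<and> m \<noteq> 5 \<and> (s * m = n \<or> 2 * (s * m) = n)"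

lemma datum_sub: "datum n s m \<Longrightarrow> s * (m - 1) = s * m - s \<and> 2 * s \<le> s * m"
  unfolding datum_def by (auto simp: diff_mult_distrib2)

text \<open>Each orbit accounts for a quarter of \<open>n\<close>, so four orbits would exceed the
  total \<open>n - 1\<close>.\<close>

lemma datum_quarter:
  assumes "datum n s m"
  shows "n \<le> 4 * (s * (m - 1))"
proof -
  have "s * m = n \<or> 2 * (s * m) = n" using assms unfolding datum_def by blast
  then show ?thesis using datum_sub[OF assms] by linarith
qed

lemma datum_1: "datum n s m \<Longrightarrow> s * (m - 1) \<noteq> n - 1"
  using datum_sub[of n s m] unfolding datum_def by auto

text \<open>The survivor is \<open>m = 3\<close>, \<open>k = 2\<close>, \<open>n = 12\<close>, the
  tetrahedron: four axes of order three that are never reversed, and three half-turn axes.\<close>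

lemma datum_2_mixed:
  assumes "datum n s m" "datum n t k" "s * m = n" "2 * (t * k) = n" "s * (m - 1) + t * (k - 1) = n - 1"
  shows "t = 3 \<and> n > 6"
proof -
  note d = datum_sub[OF assms(1)] datum_sub[OF assms(2)]
  have l: "s \<ge> 3" "t \<ge> 3" "m \<ge> 2" "k \<ge> 2" using assms(1,2) unfolding datum_def by auto
  have e: "s + t = t * k + 1" using assms(3-5) d l by linarith
  consider (a) "m = 2" | (b) "m = 3" | (c) "m \<ge> 4" using l by linarith
  then show ?thesis
  proof cases
    case a
    then show ?thesis using e assms(3)[unfolded a] assms(4) l by linarith
  next
    case b
    have "k = 2 \<or> 3 \<le> k" using l by linarith
    then show ?thesis
    proof
      assume k: "k = 2" then show ?thesis using assms(3)[unfolded b] e[unfolded k] assms(4)[unfolded k] l by linarith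
    next
      assume "3 \<le> k"
      then have "t * 3 \<le> t * k" by simp
      then show ?thesis using assms(3)[unfolded b] e assms(4) l by linarith
    qed
  next
    case c
    then have "s * 4 \<le> s * m" by simp
    then show ?thesis using d e assms(3,4) l by linarith
  qed
qed

lemma datum_2:
  assumes "datum n s m" "datum n t k" "s * (m - 1) + t * (k - 1) = n - 1"
  shows "(s = 3 \<or> t = 3) \<and> n > 6"
proof -
  note d = datum_sub[OF assms(1)] datum_sub[OF assms(2)]
  have l: "s \<ge> 3" "t \<ge> 3" using assms(1,2) unfolding datum_def by auto
  consider "s * m = n" "t * k = n" | "s * m = n" "2 * (t * k) = n" | "2 * (s * m) = n" "t * k = n"
    | "2 * (s * m) = n" "2 * (t * k) = n" using assms(1,2) unfolding datum_def by blast
  then show ?thesis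
  proof cases
    case 1 then show ?thesis using d l assms(3) by linarith
  next
    case 2 then show ?thesis using datum_2_mixed[OF assms(1,2) 2 assms(3)] by blast
  next
    case 3
    have "t * (k - 1) + s * (m - 1) = n - 1" using assms(3) by simp
    then show ?thesis using datum_2_mixed[OF assms(2,1) 3(2,1)] by blast
  next
    case 4 then show ?thesis using d l assms(3) by linarith
  qed
qed

text \<open>All axes turn out to be reversible, and the equation is that of spherical triangles.
  Here \<open>m2 = 2\<close> would give a fixed axis and \<open>m3 = 3\<close> an orbit of length
  two; \<open>m3 = 5\<close> is the icosahedron, and \<open>m3 = 4\<close> the octahedron with its
  three fourfold axes.\<close>

lemma datum_3_sorted:
  assumes "datum n s1 m1" "datum n s2 m2" "datum n s3 m3"
    "s1 * (m1 - 1) + s2 * (m2 - 1) + s3 * (m3 - 1) = n - 1" "m1 \<le> m2" "m2 \<le> m3"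
  shows "s3 = 3 \<and> n > 6"
proof -
  note d = datum_sub[OF assms(1)] datum_sub[OF assms(2)] datum_sub[OF assms(3)]
  have l: "s1 \<ge> 3" "s2 \<ge> 3" "s3 \<ge> 3" "m1 \<ge> 2" "m2 \<ge> 2" "m3 \<ge> 2" "m3 \<noteq> 5"
    and c: "s1 * m1 = n \<or> 2 * (s1 * m1) = n" "s2 * m2 = n \<or> 2 * (s2 * m2) = n" "s3 * m3 = n \<or> 2 * (s3 * m3) = n"
    using assms(1-3) unfolding datum_def by auto
  note q = datum_quarter[OF assms(1)] datum_quarter[OF assms(2)] datum_quarter[OF assms(3)]
  \<comment> \<open>An orbit of axes that are not reversed would contribute half of
    \<open>n\<close>, and the other two a quarter each.\<close>
  have n: "s1 * m1 \<noteq> n" using d(1) q(2,3) l assms(4) by linarith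
  have n': "s2 * m2 \<noteq> n" using d(2) q(1,3) l assms(4) by linarith
  have n'': "s3 * m3 \<noteq> n" using d(3) q(1,2) l assms(4) by linarith
  have p: "2 * (s1 * m1) = n" "2 * (s2 * m2) = n" "2 * (s3 * m3) = n"
    using c n n' n'' by blast+
  have e: "s1 + s2 + s3 = s1 * m1 + 1" using p d l assms(4) by linarith
  have m1: "m1 = 2"
  proof (rule ccontr)
    assume "m1 \<noteq> 2"
    then have "3 \<le> m1" "3 \<le> m2" "3 \<le> m3" using l assms(5,6) by linarith+
    then have "s1 * 3 \<le> s1 * m1" "s2 * 3 \<le> s2 * m2" "s3 * 3 \<le> s3 * m3" by simp_all
    then show False using e p by linarith
  qed
  note p1 = p(1)[unfolded m1] and e1 = e[unfolded m1]
  have m2: "m2 = 3"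
  proof (rule ccontr)
    assume "m2 \<noteq> 3"
    then consider "m2 = 2" | "4 \<le> m2" "4 \<le> m3" using l assms(6) by linarith
    then show False
    proof cases
      case 1 then show False using e1 p1 p(2)[unfolded 1] l by linarith
    next
      case 2
      then have "s2 * 4 \<le> s2 * m2" "s3 * 4 \<le> s3 * m3" by simp_all
      then show False using e1 p1 p(2,3) by linarith
    qed
  qed
  note p2 = p(2)[unfolded m2]
  consider "m3 = 3" | "m3 = 4" | "6 \<le> m3" using assms(6) \<open>m2 = 3\<close> l by linarith
  then show ?thesis
  proof cases
    case 1 then show ?thesis using e1 p1 p2 p(3)[unfolded 1] l by linarith
  next
    case 2 then show ?thesis using e1 p1 p2 p(3)[unfolded 2] l by linarith
  next
    case 3
    then have "s3 * 6 \<le> s3 * m3" by simp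
    then show ?thesis using e1 p1 p2 p(3) l by linarith
  qed
qed

lemma datum_3:
  assumes "datum n s1 m1" "datum n s2 m2" "datum n s3 m3"
    "s1 * (m1 - 1) + s2 * (m2 - 1) + s3 * (m3 - 1) = n - 1"
  shows "(s1 = 3 \<or> s2 = 3 \<or> s3 = 3) \<and> n > 6"
proof -
  note d = datum_3_sorted
  consider "m1 \<le> m2" "m2 \<le> m3" | "m1 \<le> m3" "m3 \<le> m2" | "m2 \<le> m1" "m1 \<le> m3" | "m2 \<le> m3" "m3 \<le> m1"
    | "m3 \<le> m1" "m1 \<le> m2" | "m3 \<le> m2" "m2 \<le> m1" by linarith
  then show ?thesis
  proof cases
    case 1 then show ?thesis using d[OF assms(1,2,3)] assms(4) by simp
  next
    case 2 then show ?thesis using d[OF assms(1,3,2)] assms(4) by (simp add: add_ac)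
  next
    case 3 then show ?thesis using d[OF assms(2,1,3)] assms(4) by (simp add: add_ac)
  next
    case 4 then show ?thesis using d[OF assms(2,3,1)] assms(4) by (simp add: add_ac)
  next
    case 5 then show ?thesis using d[OF assms(3,1,2)] assms(4) by (simp add: add_ac)
  next
    case 6 then show ?thesis using d[OF assms(3,2,1)] assms(4) by (simp add: add_ac)
  qed
qed

definition mgroup :: "'a::monoid_mult set \<Rightarrow> 'a monoid" where
  "mgroup H = \<lparr>carrier = H, monoid.mult = (*), one = 1\<rparr>"

lemma mgroup_simps [simp]: "carrier (mgroup H) = H" "x \<otimes>\<^bsub>mgroup H\<^esub> y = x * y" "\<one>\<^bsub>mgroup H\<^esub> = 1"
  by (simp_all add: mgroup_def)

lemma group_mgroup: "fgrp H \<Longrightarrow> group (mgroup H)"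
  by (rule groupI) (auto simp: mult.assoc dest: fgrpD)

lemma fgrp_pow_card:
  assumes "fgrp H" "x \<in> H"
  shows "x ^ card H = 1"
proof -
  interpret group "mgroup H" by (rule group_mgroup[OF assms(1)])
  have "x [^]\<^bsub>mgroup H\<^esub> n = x ^ n" for n :: nat
    by (induction n) (simp_all add: power_commutes)
  then show ?thesis using pow_order_eq_1[of x] assms(2) by (simp add: order_def)
qed

section \<open>The rotation axes of an irreducible group\<close>

locale irreducible =
  fixes N :: "qf m3 set"
  assumes fg: "fgrp N" and det: "\<And>g. g \<in> N \<Longrightarrow> det3 g = 1" and irr: "\<not> red N"
begin

lemma inv: "g \<in> N \<Longrightarrow> \<exists>g'\<in>N. g * g' = 1 \<and> g' * g = 1" using fgrpD(4)[OF fg] .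
lemma mul: "g \<in> N \<Longrightarrow> h \<in> N \<Longrightarrow> g * h \<in> N" using fgrpD(3)[OF fg] .

lemma SL3: 
  assumes "g \<in> N"
  shows "tr3 g \<in> {3, -1, 0, 1, 2}" "tr3 (adj3 g) = tr3 g" "tr3 g = 3 \<Longrightarrow> g = 1" "tr3 g = -1 \<Longrightarrow> g * g = 1"
proof -
  obtain n where "n > 0" "g ^ n = 1" using fgrp_finite_order[OF fg assms] .
  then show "tr3 g \<in> {3, -1, 0, 1, 2}" "tr3 (adj3 g) = tr3 g" "tr3 g = 3 \<Longrightarrow> g = 1" "tr3 g = -1 \<Longrightarrow> g * g = 1"
    using SL3_finite_order[OF _ _ det[OF assms]] by blast+
qed

text \<open>For traces \<open>0\<close>, \<open>1\<close> and \<open>2\<close> the characteristic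
  polynomial divides \<open>X^3 - 1\<close>, \<open>X^4 - 1\<close> and \<open>X^6 - 1\<close>. The
  bound serves to exclude order five.\<close>

lemma power_12:
  assumes "g \<in> N"
  shows "g ^ 12 = 1"
proof -
  have e: "g ^ 12 = (g * g) ^ 6" "g ^ 12 = (g * g * g) ^ 4" "g ^ 12 = (g * g * g * g) ^ 3"
    "g ^ 12 = (g * g * g * (g * g * g)) ^ 2"
    by (simp_all add: power_mult[symmetric] flip: power2_eq_square power3_eq_cube)
      (simp_all add: numeral_eq_Suc mult.assoc)
  have ch: "g * g * g = sc3 (tr3 g) * (g * g) - sc3 (tr3 g) * g + 1"
    using cayley_hamilton3[of g] SL3(2)[OF assms] det[OF assms] by simp
  consider "g = 1" | "g * g = 1" | "tr3 g = 0" | "tr3 g = 1" | "tr3 g = 2" using SL3[OF assms] by blast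
  then show ?thesis
  proof cases
    case 1 then show ?thesis by simp
  next
    case 2 then show ?thesis unfolding e(1) by simp
  next
    case 3 then show ?thesis using ch unfolding e(2) by simp
  next
    case 4
    then have c: "g * g * g = g * g - g + 1" using ch by simp
    have c': "g * (g * g) = g * g - g + 1" using c by (simp add: mult.assoc)
    have "g * g * g * g = 1" unfolding c by (simp add: algebra_simps c')
    then show ?thesis unfolding e(3) by simp
  next
    case 5
    then have c: "g * g * g = g * g + g * g - g - g + 1" using ch by (simp add: m3_eq_iff)
    have c': "g * (g * g) = g * g + g * g - g - g + 1" using c by (simp add: mult.assoc)
    have "g * g * g * (g * g * g) = 1" unfolding c by (simp add: algebra_simps c')
    then show ?thesis unfolding e(4) by simp
  qed
qed

text \<open>Determinant one and \<open>tr3 (adj3 g) = tr3 g\<close> make \<open>1\<close> an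
  eigenvalue. Two independent fixed vectors would force trace three, since the trace acts on
  determinants as a derivation, and hence the identity.\<close>

lemma Ax_ray:
  assumes g: "g \<in> N" "g \<noteq> 1"
  obtains u where "u \<noteq> 0" "Ax g = ray u"
proof -
  have "det3 (g - 1) = det3 g - tr3 (adj3 g) + tr3 g - 1"
    by (simp add: det3_def tr3_def adj3_def algebra_simps)
  then have "det3 (g - 1) = 0" using det SL3 g by simp
  then obtain u where u: "u \<noteq> 0" "app (g - 1) u = 0" using det3_eq_0_kernel by blast
  have gu: "app g u = u" using u(2) by (simp add: v3_eq_iff algebra_simps)
  have "v \<in> ray u" if v: "app g v = v" for v
  proof (rule ccontr)
    assume "v \<notin> ray u"
    then have "cross u v \<noteq> 0" using cross_eq_0[of u v] u(1) unfolding ray_def by blast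
    then obtain e where e: "dot (cross u v) e \<noteq> 0" using dot_nonzero by blast
    have "tr3 g * det3 (cols u v e) = det3 (cols (app g u) v e) + det3 (cols u (app g v) e) + det3 (cols u v (app g e))"
      by (simp add: tr3_def det3_def cols_def algebra_simps)
    moreover have "det3 (cols (app g u) (app g v) (app g e)) = det3 g * det3 (cols u v e)"
      by (simp add: det3_def cols_def algebra_simps)
    ultimately have "(tr3 g - 3) * det3 (cols u v e) = 0"
      using det g(1) gu v by (simp add: algebra_simps)
    then have "tr3 g = 3" using e by (simp add: det3_cols)
    then show False using SL3(3) g by blast
  qed
  moreover have "app g v = v" if "v \<in> ray u" for v
    using that gu unfolding ray_def by (auto simp: app_scale)
  ultimately have "Ax g = ray u" unfolding Ax_def by blast
  then show thesis using that u(1) by blast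
qed

definition axes :: "qf v3 set set" where "axes = Ax ` (N - {1})"
definition FixL :: "qf v3 set \<Rightarrow> qf m3 set" where "FixL L = {g \<in> N. L \<subseteq> Ax g}"
definition Orb :: "qf v3 set \<Rightarrow> qf v3 set set" where "Orb L = (\<lambda>g. act g L) ` N"

lemma finite_N: "finite N" using fgrpD(1)[OF fg] .

lemma axes_ray: "L \<in> axes \<Longrightarrow> \<exists>u. u \<noteq> 0 \<and> L = ray u"
proof -
  assume "L \<in> axes"
  then obtain g where "g \<in> N" "g \<noteq> 1" "L = Ax g" unfolding axes_def by blast
  then show ?thesis using Ax_ray[of g] by metis
qed

lemma FixL_ray: "FixL (ray u) = {g \<in> N. app g u = u}"
proof -
  have "ray u \<subseteq> Ax g \<longleftrightarrow> app g u = u" for g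
  proof
    show "app g u = u" if "ray u \<subseteq> Ax g" using that ray_self[of u] unfolding Ax_def by blast
    show "ray u \<subseteq> Ax g" if "app g u = u" using that unfolding Ax_def ray_def by (auto simp only: app_scale)
  qed
  then show ?thesis unfolding FixL_def by simp
qed

lemma Ax_conj:
  assumes "g * g' = 1" "g' * g = 1"
  shows "Ax (g * x * g') = act g (Ax x)"
proof -
  have c: "app g' (app g y) = y" "app g (app g' y) = y" for y
    by (simp_all only: app_mult[symmetric] assms app_1)
  show ?thesis
  proof (intro equalityI subsetI)
    fix v assume "v \<in> Ax (g * x * g')"
    then have "app g (app x (app g' v)) = v" by (simp only: Ax_def app_mult mem_Collect_eq)
    then have "app x (app g' v) = app g' v" using c(1) by metis
    then show "v \<in> act g (Ax x)" unfolding act_def Ax_def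
      by (intro image_eqI[of _ _ "app g' v"]) (simp_all only: c mem_Collect_eq)
  next
    fix v assume "v \<in> act g (Ax x)"
    then obtain w where "app x w = w" "v = app g w" unfolding act_def Ax_def by blast
    then show "v \<in> Ax (g * x * g')" unfolding Ax_def by (simp only: app_mult c mem_Collect_eq)
  qed
qed

lemma act_axes:
  assumes "g \<in> N" "L \<in> axes"
  shows "act g L \<in> axes"
proof -
  obtain x where x: "x \<in> N" "x \<noteq> 1" "L = Ax x" using assms(2) unfolding axes_def by blast
  obtain g' where g': "g' \<in> N" "g * g' = 1" "g' * g = 1" using inv[OF assms(1)] by blast
  have "g * x * g' \<noteq> 1" using conj_cancel[OF g'(3), of x] x(2) g' by auto
  then show ?thesis unfolding axes_def x(3) Ax_conj[OF g'(2,3), symmetric] using mul assms(1) x g' by blast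
qed

lemma Orb_axes: "L \<in> axes \<Longrightarrow> Orb L \<subseteq> axes" unfolding Orb_def using act_axes by blast
lemma Orb_self: "L \<in> Orb L" unfolding Orb_def using fgrpD(2)[OF fg] act_1 by (metis image_eqI)

lemma Orb_eq:
  assumes "M \<in> Orb L"
  shows "Orb M = Orb L"
proof -
  obtain g where g: "g \<in> N" "M = act g L" using assms unfolding Orb_def by blast
  obtain g' where g': "g' \<in> N" "g * g' = 1" "g' * g = 1" using inv[OF g(1)] by blast
  have L: "L = act g' M" unfolding g(2) act_mult[symmetric] g' act_1 ..
  show ?thesis
  proof (intro equalityI subsetI)
    fix K assume "K \<in> Orb M"
    then obtain h where "h \<in> N" "K = act h M" unfolding Orb_def by blast
    then show "K \<in> Orb L" unfolding Orb_def g(2) act_mult[symmetric] using mul g(1) by blast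
  next
    fix K assume "K \<in> Orb L"
    then obtain h where "h \<in> N" "K = act h L" unfolding Orb_def by blast
    then have "K = act (h * g') M" "h * g' \<in> N" using L mul g'(1) by (simp_all add: act_mult)
    then show "K \<in> Orb M" unfolding Orb_def by blast
  qed
qed

lemma FixL_conj_card:
  assumes "M \<in> Orb L"
  shows "card (FixL M) = card (FixL L)"
proof -
  obtain g where g: "g \<in> N" "M = act g L" using assms unfolding Orb_def by blast
  obtain g' where g': "g' \<in> N" "g * g' = 1" "g' * g = 1" using inv[OF g(1)] by blast
  have sub: "act g L \<subseteq> act g K \<longleftrightarrow> L \<subseteq> K" for K
  proof -
    have "act g' (act g K) = K" for K unfolding act_mult[symmetric] g' act_1 ..
    then show ?thesis unfolding act_def by (metis image_mono)
  qed
  have "FixL M = (\<lambda>x. g * x * g') ` FixL L"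
  proof (intro equalityI subsetI)
    fix x assume x: "x \<in> FixL M"
    have e: "x = g * (g' * x * g) * g'" using conj_cancel[OF g'(2), of x] by simp
    have "act g L \<subseteq> act g (Ax (g' * x * g))"
      using x unfolding FixL_def g(2) Ax_conj[OF g'(2,3), symmetric] e[symmetric] by simp
    then have "g' * x * g \<in> FixL L" unfolding sub FixL_def using x mul g(1) g'(1) unfolding FixL_def by blast
    then show "x \<in> (\<lambda>x. g * x * g') ` FixL L" using e by blast
  next
    fix x assume "x \<in> (\<lambda>x. g * x * g') ` FixL L"
    then obtain y where y: "y \<in> FixL L" "x = g * y * g'" by blast
    have "act g L \<subseteq> Ax x" unfolding y(2) Ax_conj[OF g'(2,3)] sub using y(1) unfolding FixL_def by blast
    moreover have "x \<in> N" unfolding y(2) using y(1) mul g(1) g'(1) unfolding FixL_def by blast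
    ultimately show "x \<in> FixL M" unfolding FixL_def g(2) by blast
  qed
  then show ?thesis using card_image[OF inj_conj[OF g'(3)]] by simp
qed

lemma orbit_stabilizer: "card N = card (Orb L) * card {g \<in> N. act g L = L}"
proof -
  have fib: "card {g \<in> N. act g L = M} = card {g \<in> N. act g L = L}" if "M \<in> Orb L" for M
  proof -
    obtain g where g: "g \<in> N" "M = act g L" using \<open>M \<in> Orb L\<close> unfolding Orb_def by blast
    obtain g' where g': "g' \<in> N" "g * g' = 1" "g' * g = 1" using inv[OF g(1)] by blast
    have i: "act g' (act g K) = K" for K unfolding act_mult[symmetric] g' act_1 ..
    have "bij_betw (\<lambda>h. g * h) {g \<in> N. act g L = L} {g \<in> N. act g L = M}"
      by (rule bij_betw_byWitness[where f' = "\<lambda>h. g' * h"])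
        (use mul g g' i in \<open>auto simp: act_mult mult.assoc[symmetric]\<close>)
    then show ?thesis by (rule bij_betw_same_card[symmetric])
  qed
  have "card N = (\<Sum>g\<in>N. 1)" by simp
  also have "\<dots> = (\<Sum>M\<in>Orb L. \<Sum>g\<in>{g \<in> N. act g L = M}. 1)"
    unfolding Orb_def by (rule sum.image_gen[OF finite_N])
  also have "\<dots> = (\<Sum>M\<in>Orb L. card {g \<in> N. act g L = L})" using fib by simp
  finally show ?thesis by simp
qed

text \<open>An element preserving the line multiplies \<open>u\<close> by \<open>1\<close> or
  \<open>-1\<close>, and the pointwise stabiliser is the kernel of this sign.\<close>

lemma stabilizer_card:
  assumes "u \<noteq> 0" "L = ray u"
  shows "card {g \<in> N. act g L = L} = card (FixL L) \<or> card {g \<in> N. act g L = L} = 2 * card (FixL L)"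
proof -
  let ?S = "{g \<in> N. act g L = L}"
  have pm: "app g u = u \<or> app g u = - u" if "g \<in> ?S" for g
  proof -
    have "app g u \<in> ray u" using that ray_self unfolding assms(2) act_ray by auto
    then obtain c where c: "app g u = scale c u" unfolding ray_def by blast
    then have "c = 1 \<or> c = -1" using eigenvalue_pm1[OF fg _ assms(1)] that by blast
    then show ?thesis using c by (auto simp: v3_eq_iff)
  qed
  have F: "FixL L = {g \<in> N. app g u = u}" unfolding assms(2) FixL_ray ..
  have FS: "FixL L \<subseteq> ?S" unfolding F unfolding assms(2) by (auto simp: act_ray)
  show ?thesis
  proof (cases "\<exists>s\<in>?S. app s u = - u")
    case False
    then have "?S = FixL L" using pm FS unfolding F by blast
    then show ?thesis by simp
  next
    case True
    then obtain s where s: "s \<in> N" "act s L = L" "app s u = - u" by blast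
    obtain s' where s': "s' \<in> N" "s * s' = 1" "s' * s = 1" using inv[OF s(1)] by blast
    have n: "app g (- v) = - app g v" for g v by (simp add: v3_eq_iff)
    have s'u: "app s' u = - u"
    proof -
      have "app s' (app s u) = u" using s'(3) by (simp add: app_mult[symmetric])
      then show ?thesis unfolding s(3) n by (metis minus_minus)
    qed
    have u2: "u \<noteq> - u"
    proof
      assume "u = - u"
      then have "scale 2 u = 0" by (auto simp: v3_eq_iff eq_neg_iff_add_eq_0)
      then show False using assms(1) by (simp add: scale_eq_0)
    qed
    have e: "?S = FixL L \<union> (\<lambda>g. s * g) ` FixL L"
    proof (intro equalityI subsetI)
      fix g assume g: "g \<in> ?S"
      show "g \<in> FixL L \<union> (\<lambda>g. s * g) ` FixL L"
      proof (cases "app g u = u")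
        case False
        then have "app g u = - u" using pm[OF g] by blast
        then have "s' * g \<in> FixL L" using mul[OF s'(1)] g unfolding F by (simp add: app_mult n s'u)
        moreover have "g = s * (s' * g)" using s'(2) by (simp add: mult.assoc[symmetric])
        ultimately show ?thesis by blast
      qed (use g F in auto)
    next
      fix g assume "g \<in> FixL L \<union> (\<lambda>g. s * g) ` FixL L"
      then show "g \<in> ?S" using FS mul[OF s(1)] s(2) by (auto simp: act_mult)
    qed
    have "FixL L \<inter> (\<lambda>g. s * g) ` FixL L = {}" unfolding F using s(3) u2 by (auto simp: app_mult)
    moreover have "card ((\<lambda>g. s * g) ` FixL L) = card (FixL L)"
      by (rule card_image) (rule inj_on_inverseI[where g = "\<lambda>g. s' * g"], use s'(3) in \<open>simp add: mult.assoc[symmetric]\<close>)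
    moreover have "finite (FixL L)" using finite_N unfolding FixL_def by simp
    ultimately have "card ?S = 2 * card (FixL L)" unfolding e by (simp add: card_Un_disjoint)
    then show ?thesis by blast
  qed
qed

text \<open>If all images of \<open>u\<close> stayed in the plane spanned by \<open>u\<close> and
  \<open>app g u\<close>, the normal of that plane would be an eigenvector of the transposed group,
  and the group would be reducible.\<close>

lemma orbit_basis:
  assumes "u \<noteq> 0"
  obtains g h where "g \<in> N" "h \<in> N" "det3 (cols u (app g u) (app h u)) \<noteq> 0"
proof -
  have "\<exists>g\<in>N. cross u (app g u) \<noteq> 0"
    using irr assms cross_eq_0[of u] unfolding red_def by blast
  then obtain g where g: "g \<in> N" "cross u (app g u) \<noteq> 0" by blast
  let ?w = "cross u (app g u)"
  have "\<exists>h\<in>N. dot ?w (app h u) \<noteq> 0"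
  proof (rule ccontr)
    assume n: "\<not> ?thesis"
    have "\<exists>c. app (tp3 h) ?w = scale c ?w" if h: "h \<in> N" for h
    proof (rule cross_eq_0[OF _ g(2)])
      let ?y = "app (tp3 h) ?w"
      have "dot u ?y = 0" "dot (app g u) ?y = 0"
      proof -
        have c: "dot a b = dot b a" for a b :: "qf v3" by (simp add: dot_def mult.commute)
        show "dot u ?y = 0" using n h by (subst c) (simp add: dot_tp3)
        show "dot (app g u) ?y = 0" using n mul[OF h g(1)] by (subst c) (simp add: dot_tp3 app_mult[symmetric])
      qed
      \<comment> \<open>By the double cross product formula, a vector orthogonal to both spanning
        vectors is parallel to the normal.\<close>
      moreover have "cross (cross a b) y = scale (dot a y) b - scale (dot b y) a" for a b y :: "qf v3"
        by (simp add: v3_eq_iff cross_def dot_def algebra_simps)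
      ultimately show "cross ?w ?y = 0" by simp
    qed
    then show False using left_eigenvector_red[OF fg g(2)] irr by blast
  qed
  then show thesis using that g(1) by (auto simp: det3_cols)
qed

lemma cols_dependent: "det3 (cols u v w) \<noteq> 0 \<Longrightarrow> ray u \<noteq> ray v \<and> ray v \<noteq> ray w \<and> ray u \<noteq> ray w"
proof -
  assume d: "det3 (cols u v w) \<noteq> 0"
  have "u \<notin> ray v" "v \<notin> ray w" "u \<notin> ray w"
    using d unfolding ray_def by (auto simp: det3_def cols_def algebra_simps)
  then show ?thesis using ray_self by metis
qed

lemma orbit_datum:
  assumes "L \<in> axes"
  shows "datum (card N) (card (Orb L)) (card (FixL L))"
proof -
  obtain u where u: "u \<noteq> 0" "L = ray u" using axes_ray[OF assms] by blast
  have finO: "finite (Orb L)" unfolding Orb_def using finite_N by simp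
  obtain g h where gh: "g \<in> N" "h \<in> N" "det3 (cols u (app g u) (app h u)) \<noteq> 0" using orbit_basis[OF u(1)] .
  have "{ray u, ray (app g u), ray (app h u)} \<subseteq> Orb L"
    unfolding Orb_def u(2) act_ray using gh(1,2) fgrpD(2)[OF fg] by (auto intro: image_eqI[of _ _ 1])
  then have "card {ray u, ray (app g u), ray (app h u)} \<le> card (Orb L)" by (rule card_mono[OF finO])
  then have s: "3 \<le> card (Orb L)" using cols_dependent[OF gh(3)] by simp
  obtain x where x: "x \<in> N" "x \<noteq> 1" "L = Ax x" using assms unfolding axes_def by blast
  have finF: "finite (FixL L)" using finite_N unfolding FixL_def by simp
  have oneF: "1 \<in> FixL L" unfolding FixL_def Ax_def using fgrpD(2)[OF fg] by simp
  have "{1, x} \<subseteq> FixL L" using oneF x unfolding FixL_def by simp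
  then have "card {1, x} \<le> card (FixL L)" by (rule card_mono[OF finF])
  then have m: "2 \<le> card (FixL L)" using x(2) by simp
  have F: "FixL L = {g \<in> N. app g u = u}" unfolding u(2) FixL_ray ..
  have fgF: "fgrp (FixL L)" unfolding fgrp_def
  proof (intro conjI ballI finF oneF)
    show "a * b \<in> FixL L" if "a \<in> FixL L" "b \<in> FixL L" for a b using that mul unfolding F by (simp add: app_mult)
    show "\<exists>b\<in>FixL L. a * b = 1 \<and> b * a = 1" if a: "a \<in> FixL L" for a
    proof -
      obtain b where b: "b \<in> N" "a * b = 1" "b * a = 1" using inv a unfolding F by blast
      have "app (b * a) u = app b u" using a unfolding F by (simp add: app_mult)
      then show ?thesis using b unfolding F by (intro bexI[of _ b]) simp_all
    qed
  qed
  have m5: "card (FixL L) \<noteq> 5"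
  proof
    assume c: "card (FixL L) = 5"
    have xF: "x \<in> FixL L" using \<open>{1, x} \<subseteq> FixL L\<close> by simp
    have x5: "x ^ 5 = 1" using fgrp_pow_card[OF fgF xF] unfolding c .
    \<comment> \<open>\<open>25\<close> is a multiple of five and one more than a multiple of
      twelve.\<close>
    have "x ^ 25 = x * (x ^ 12) ^ 2" by (simp add: power_mult[symmetric] flip: power_Suc)
    moreover have "x ^ 25 = (x ^ 5) ^ 5" by (simp add: power_mult[symmetric])
    ultimately show False using x5 power_12[OF x(1)] x(2) by simp
  qed
  have "card (Orb L) * card (FixL L) = card N \<or> 2 * (card (Orb L) * card (FixL L)) = card N"
    using stabilizer_card[OF u] orbit_stabilizer[of L] by (elim disjE) simp_all
  then show ?thesis unfolding datum_def using s m m5 by blast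
qed

text \<open>Each nontrivial element has exactly one axis, so the pointwise stabilisers without the
  identity partition the nontrivial elements.\<close>

lemma axes_count: "(\<Sum>L\<in>axes. card (FixL L) - 1) = card N - 1"
proof -
  have un: "N - {1} = (\<Union>L\<in>axes. FixL L - {1})"
    unfolding axes_def FixL_def by auto
  have uniq: "L = Ax g" if La: "L \<in> axes" and gL: "g \<in> FixL L" and g1: "g \<noteq> 1" for L g
  proof -
    obtain u where u: "u \<noteq> 0" "L = ray u" using axes_ray La by blast
    have gN: "g \<in> N" "L \<subseteq> Ax g" using gL unfolding FixL_def by auto
    obtain v where v: "Ax g = ray v" using Ax_ray[OF gN(1) g1] .
    then have "u \<in> ray v" using gN(2) ray_self u(2) by blast
    then show ?thesis using ray_eq u v by simp
  qed
  have "card (N - {1}) = (\<Sum>L\<in>axes. card (FixL L - {1}))"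
    unfolding un
  proof (rule card_UN_disjoint)
    show "finite axes" unfolding axes_def using finite_N by simp
    show "\<forall>L\<in>axes. finite (FixL L - {1})" using finite_N unfolding FixL_def by simp
    show "\<forall>L\<in>axes. \<forall>M\<in>axes. L \<noteq> M \<longrightarrow> (FixL L - {1}) \<inter> (FixL M - {1}) = {}" using uniq by blast
  qed
  moreover have "1 \<in> FixL L" for L unfolding FixL_def Ax_def using fgrpD(2)[OF fg] by simp
  ultimately show ?thesis using fgrpD(2)[OF fg] finite_N by (simp add: FixL_def)
qed

lemma orbit_sum:
  "(\<Sum>M\<in>Orb L. card (FixL M) - 1) = card (Orb L) * (card (FixL L) - 1)"
  using FixL_conj_card[of _ L] by simp

text \<open>Orbits are removed from the set of axes one at a time; this ends after at most three,
  and the arithmetic of \<open>datum\<close> supplies an orbit of length three.\<close>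

lemma exists_orbit_3: "(\<exists>L\<in>axes. card (Orb L) = 3) \<and> card N > 6"
proof -
  let ?n = "card N"
  let ?f = "\<lambda>L. card (FixL L) - 1"
  let ?F = "\<lambda>L. card (Orb L) * (card (FixL L) - 1)"
  have finX: "finite axes" unfolding axes_def using finite_N by simp
  have split: "sum ?f Y = ?F L + sum ?f (Y - Orb L)" if "L \<in> axes" "Orb L \<subseteq> Y" "Y \<subseteq> axes" for L Y
    using sum.subset_diff[OF that(2) finite_subset[OF that(3) finX], of ?f]
    by (simp only: orbit_sum add.commute)
  have sub: "Orb M \<subseteq> Y - Orb L" if M: "M \<in> Y - Orb L" and cl: "\<And>K. K \<in> Y \<Longrightarrow> Orb K \<subseteq> Y" for L M Y
  proof
    fix K assume K: "K \<in> Orb M"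
    have "K \<notin> Orb L"
    proof
      assume "K \<in> Orb L"
      then have "Orb M = Orb L" using Orb_eq[OF K] Orb_eq[of K L] by simp
      then show False using M Orb_self[of M] by simp
    qed
    then show "K \<in> Y - Orb L" using cl[of M] M K by auto
  qed
  have "N \<noteq> {1}"
  proof
    assume "N = {1}"
    then have "red N" unfolding red_def by (intro exI[of _ "V3 1 0 0"]) (auto simp: v3_eq_iff intro: exI[of _ 1])
    then show False using irr by blast
  qed
  then obtain x where "x \<in> N" "x \<noteq> 1" using fgrpD(2)[OF fg] by blast
  then obtain L1 where L1: "L1 \<in> axes" unfolding axes_def by blast
  have n1: "?n \<ge> 1" using fgrpD(2)[OF fg] finite_N by (simp add: Suc_le_eq card_gt_0_iff) blast
  have c1: "?F L1 + sum ?f (axes - Orb L1) = ?n - 1"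
    using split[OF L1 Orb_axes[OF L1]] axes_count by simp
  show ?thesis
  proof (cases "axes - Orb L1 = {}")
    case True
    have "sum ?f (axes - Orb L1) = 0" unfolding True by simp
    then show ?thesis using c1 datum_1[OF orbit_datum[OF L1]] by linarith
  next
    case False
    then obtain L2 where L2: "L2 \<in> axes - Orb L1" by blast
    have cl1: "Orb K \<subseteq> axes - Orb L1" if "K \<in> axes - Orb L1" for K using sub[OF that Orb_axes] .
    have c2: "?F L1 + ?F L2 + sum ?f (axes - Orb L1 - Orb L2) = ?n - 1"
    proof -
      have "axes - Orb L1 \<subseteq> axes" "L2 \<in> axes" using L2 by blast+
      then have "sum ?f (axes - Orb L1) = ?F L2 + sum ?f (axes - Orb L1 - Orb L2)"
        using split cl1[OF L2] by blast
      then show ?thesis using c1 by linarith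
    qed
    show ?thesis
    proof (cases "axes - Orb L1 - Orb L2 = {}")
      case True
      have "sum ?f (axes - Orb L1 - Orb L2) = 0" unfolding True by simp
      then have "?F L1 + ?F L2 = ?n - 1" using c2 by linarith
      then show ?thesis using datum_2[OF orbit_datum orbit_datum, of L1 L2] L1 L2 by blast
    next
      case False
      then obtain L3 where L3: "L3 \<in> axes - Orb L1 - Orb L2" by blast
      have cl2: "Orb K \<subseteq> axes - Orb L1 - Orb L2" if "K \<in> axes - Orb L1 - Orb L2" for K using sub[OF that cl1] .
      have c3: "?F L1 + ?F L2 + ?F L3 + sum ?f (axes - Orb L1 - Orb L2 - Orb L3) = ?n - 1"
      proof -
        have "axes - Orb L1 - Orb L2 \<subseteq> axes" "L3 \<in> axes" using L3 by blast+
        then have "sum ?f (axes - Orb L1 - Orb L2) = ?F L3 + sum ?f (axes - Orb L1 - Orb L2 - Orb L3)"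
          using split cl2[OF L3] by blast
        then show ?thesis using c2 by linarith
      qed
      show ?thesis
      proof (cases "axes - Orb L1 - Orb L2 - Orb L3 = {}")
        case True
        have "sum ?f (axes - Orb L1 - Orb L2 - Orb L3) = 0" unfolding True by simp
        then have "?F L1 + ?F L2 + ?F L3 = ?n - 1" using c3 by linarith
        then show ?thesis using datum_3[OF orbit_datum orbit_datum orbit_datum, of L1 L2 L3] L1 L2 L3 by blast
      next
        case False
        then obtain L4 where L4: "L4 \<in> axes - Orb L1 - Orb L2 - Orb L3" by blast
        have o4: "Orb L4 \<subseteq> axes - Orb L1 - Orb L2 - Orb L3" using sub[OF L4 cl2] .
        have "axes - Orb L1 - Orb L2 - Orb L3 \<subseteq> axes" "L4 \<in> axes" using L4 by blast+
        then have "sum ?f (axes - Orb L1 - Orb L2 - Orb L3) = ?F L4 + sum ?f (axes - Orb L1 - Orb L2 - Orb L3 - Orb L4)"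
          using split o4 by blast
        then have "?F L1 + ?F L2 + ?F L3 + ?F L4 \<le> ?n - 1" using c3 by linarith
        moreover have "?n \<le> 4 * ?F L" if "L \<in> axes" for L using datum_quarter[OF orbit_datum[OF that]] .
        from this[of L1] this[of L2] this[of L3] this[of L4]
        have "?n \<le> 4 * ?F L1" "?n \<le> 4 * ?F L2" "?n \<le> 4 * ?F L3" "?n \<le> 4 * ?F L4" using L1 L2 L3 L4 by auto
        ultimately show ?thesis using n1 by linarith
      qed
    qed
  qed
qed

text \<open>The three lines of a short orbit span the space and are permuted by the group, so in a
  basis chosen on them the group is monomial.\<close>

lemma is_std3_irreducible:
  assumes "gp N N0"
  shows "is_std3 N N0"
proof -
  obtain L where L: "L \<in> axes" "card (Orb L) = 3" using exists_orbit_3 by blast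
  obtain u where u: "u \<noteq> 0" "L = ray u" using axes_ray[OF L(1)] by blast
  obtain g h where gh: "g \<in> N" "h \<in> N" "det3 (cols u (app g u) (app h u)) \<noteq> 0" using orbit_basis[OF u(1)] .
  have finO: "finite (Orb L)" unfolding Orb_def using finite_N by simp
  have "{ray u, ray (app g u), ray (app h u)} \<subseteq> Orb L"
    unfolding Orb_def u(2) act_ray using gh(1,2) fgrpD(2)[OF fg] by (auto intro: image_eqI[of _ _ 1])
  moreover have "card {ray u, ray (app g u), ray (app h u)} = 3" using cols_dependent[OF gh(3)] by simp
  ultimately have O: "Orb L = {ray u, ray (app g u), ray (app h u)}"
    using card_subset_eq[OF finO] L(2) by metis
  define B where "B = cols u (app g u) (app h u)"
  obtain B' where B': "B * B' = 1" "B' * B = 1" using det3_inverse gh(3) unfolding B_def .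
  have Be: "app B (V3 1 0 0) = u" "app B (V3 0 1 0) = app g u" "app B (V3 0 0 1) = app h u"
    by (simp_all add: B_def cols_def v3_eq_iff)
  have B'u: "app B' u = V3 1 0 0" "app B' (app g u) = V3 0 1 0" "app B' (app h u) = V3 0 0 1"
  proof -
    have "app B' (app B y) = y" for y by (simp only: app_mult[symmetric] B'(2) app_1)
    from this[of "V3 1 0 0"] this[of "V3 0 1 0"] this[of "V3 0 0 1"]
    show "app B' u = V3 1 0 0" "app B' (app g u) = V3 0 1 0" "app B' (app h u) = V3 0 0 1"
      unfolding Be by blast+
  qed
  define M where "M = (\<lambda>x. B' * x * B) ` N"
  define M0 where "M0 = (\<lambda>x. B' * x * B) ` N0"
  have sc: "simconj N N0 M M0" unfolding simconj_def M_def M0_def using B' by blast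
  have perm: "\<exists>y \<in> {u, app g u, app h u}. \<exists>c. app k x = scale c y" if k: "k \<in> N" and x: "x \<in> {u, app g u, app h u}" for k x
  proof -
    have "ray x \<in> Orb L" using x unfolding O by blast
    then obtain l where l: "l \<in> N" "ray x = act l L" unfolding Orb_def by blast
    have "ray (app k x) = act (k * l) L" unfolding act_ray[symmetric] l(2) act_mult ..
    then have "ray (app k x) \<in> Orb L" unfolding Orb_def using mul[OF k l(1)] by blast
    then obtain y where "y \<in> {u, app g u, app h u}" "ray (app k x) = ray y" unfolding O by blast
    then show ?thesis using ray_self[of "app k x"] unfolding ray_def by blast
  qed
  have dB: "det3 B' * det3 B = 1" using B'(2) by (metis det3_1 det3_mult)
  have detM: "det3 x = 1" if "x \<in> M" for x
    using that det dB unfolding M_def by (auto simp: det3_mult mult_ac)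
  have "is_std3 M M0"
  proof (rule monomial_pairs[OF gp_simconj[OF assms sc] detM])
    show "\<exists>k<6. \<exists>a b c. x = pm k a b c" if x: "x \<in> M" for x
    proof (rule permuted_basis_monomial)
      show "det3 x \<noteq> 0" using detM[OF x] by simp
      obtain k where k: "k \<in> N" "x = B' * k * B" using x unfolding M_def by blast
      fix e :: "qf v3" assume e: "e \<in> {V3 1 0 0, V3 0 1 0, V3 0 0 1}"
      have "app B e \<in> {u, app g u, app h u}" using e Be by auto
      then obtain y c where y: "y \<in> {u, app g u, app h u}" "app k (app B e) = scale c y" using perm[OF k(1)] by blast
      have "app x e = scale c (app B' y)" unfolding k(2) by (simp add: app_mult y(2) app_scale)
      moreover have "app B' y \<in> {V3 1 0 0, V3 0 1 0, V3 0 0 1}" using y(1) B'u by auto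
      ultimately show "\<exists>e'\<in>{V3 1 0 0, V3 0 1 0, V3 0 0 1}. \<exists>c. app x e = scale c e'" by blast
    qed
    show "card M > 6" unfolding M_def using exists_orbit_3 card_image[OF inj_conj[OF B'(1)], of N] by simp
    show "B' * g * B \<in> M" "B' * h * B \<in> M" unfolding M_def using gh by blast+
    have "app (B' * g * B) (V3 1 0 0) = V3 0 1 0" "app (B' * h * B) (V3 1 0 0) = V3 0 0 1"
      by (simp_all add: app_mult Be B'u)
    then show "b21 (B' * g * B) \<noteq> 0" "b31 (B' * h * B) \<noteq> 0" by (simp_all add: v3_eq_iff del: m3_sel)
  qed
  then show ?thesis using is_std3_simconj[OF sc] by blast
qed

end

theorem SL3_pairs:
  assumes "gp N N0" "\<And>g. g \<in> N \<Longrightarrow> det3 g = 1"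
  shows "is_std3 N N0"
proof (cases "red N")
  case True
  then show ?thesis using SL3_reducible_pairs assms by blast
next
  case False
  then interpret irreducible N using gpD(1)[OF assms(1)] assms(2) by unfold_locales
  show ?thesis using is_std3_irreducible[OF assms(1)] .
qed

section \<open>Invariants of the standard pairs\<close>

definition tau :: "'a::monoid_mult set \<Rightarrow> nat \<times> nat" where
  "tau N = (card N, card {x \<in> N. x * x = 1})"

lemma tau_conj:
  assumes "b * b' = 1" "b' * b = (1::'a::monoid_mult)"
  shows "tau ((\<lambda>x. b * x * b') ` N) = tau N"
proof -
  let ?f = "\<lambda>x. b * x * b'"
  have inj: "inj_on ?f A" for A by (rule inj_conj[OF assms(2)])
  have "?f x * ?f x = 1 \<longleftrightarrow> x * x = 1" for x
  proof -
    have "?f x * ?f x = ?f (x * x)" by (rule conj_mult[OF assms(2), symmetric])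
    moreover have "?f 1 = 1" using assms(1) by simp
    ultimately show ?thesis using inj_onD[OF inj[of UNIV], of "x * x" 1] by auto
  qed
  then have "{y \<in> ?f ` N. y * y = 1} = ?f ` {x \<in> N. x * x = 1}" by auto
  then show ?thesis unfolding tau_def by (simp add: card_image[OF inj])
qed

lemma tau_simconj: "simconj N N0 M M0 \<Longrightarrow> tau M = tau N \<and> tau M0 = tau N0"
  unfolding simconj_def using tau_conj by metis

text \<open>Left inverses may be sought in the whole monoid: they make left translation injective on
  the finite set \<open>S\<close>, hence onto, and this brings inverses into
  \<open>S\<close>.\<close>

lemma fgrp_I:
  assumes "finite S" "1 \<in> S" "\<And>x y. x \<in> S \<Longrightarrow> y \<in> S \<Longrightarrow> x * y \<in> S"
    "\<And>x. x \<in> S \<Longrightarrow> \<exists>z. z * x = (1::'a::monoid_mult)"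
  shows "fgrp S"
proof -
  have "\<exists>y\<in>S. x * y = 1 \<and> y * x = 1" if x: "x \<in> S" for x
  proof -
    have right: "\<exists>y\<in>S. x * y = 1" if x: "x \<in> S" for x
    proof -
      obtain z where z: "z * x = 1" using assms(4)[OF x] by blast
      have "inj_on (\<lambda>y. x * y) S"
        by (rule inj_on_inverseI[where g = "\<lambda>y. z * y"]) (simp add: z mult.assoc[symmetric])
      then have "(\<lambda>y. x * y) ` S = S" using assms(1,3) x by (intro endo_inj_surj) auto
      then have "1 \<in> (\<lambda>y. x * y) ` S" using assms(2) by simp
      then show ?thesis by auto
    qed
    obtain y where y: "y \<in> S" "x * y = 1" using right x by blast
    obtain w where w: "y * w = 1" using right y(1) by blast
    have "w = x * y * w" using y by simp
    then have "w = x" using w by (simp add: mult.assoc)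
    then show ?thesis using y w by blast
  qed
  then show ?thesis unfolding fgrp_def using assms by blast
qed

text \<open>The matrices are coded injectively by a list \<open>I\<close> with multiplication
  \<open>m\<close>. Closure, the parity character \<open>par\<close> and both entries of
  \<open>tau\<close> become list computations on the codes.\<close>

lemma realization:
  fixes \<rho> :: "'i \<Rightarrow> 'a::monoid_mult"
  assumes inj: "inj_on \<rho> (set I)" and dist: "distinct I"
    and one: "u \<in> set I" "\<rho> u = 1"
    and mult: "\<And>p q. p \<in> set I \<Longrightarrow> q \<in> set I \<Longrightarrow> \<rho> p * \<rho> q = \<rho> (m p q)"
    and inv: "\<And>p. p \<in> set I \<Longrightarrow> \<exists>z. z * \<rho> p = 1"
    and closed: "list_all (\<lambda>p. list_all (\<lambda>q. List.member I (m p q) \<and> par (m p q) = (par p = par q)) I) I"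
  shows "gp (\<rho> ` set I) (\<rho> ` {p \<in> set I. par p})"
    "tau (\<rho> ` set I) = (length I, length (filter (\<lambda>p. m p p = u) I))"
    "tau (\<rho> ` {p \<in> set I. par p}) = (length (filter par I), length (filter (\<lambda>p. m p p = u) (filter par I)))"
proof -
  have cl: "m p q \<in> set I" "par (m p q) = (par p = par q)" if "p \<in> set I" "q \<in> set I" for p q
    using closed that unfolding list_all_iff List.member_iff by blast+
  have i: "\<rho> p \<in> \<rho> ` {p \<in> set I. par p} \<longleftrightarrow> par p" if "p \<in> set I" for p
    using inj_onD[OF inj] that by auto
  show "gp (\<rho> ` set I) (\<rho> ` {p \<in> set I. par p})"
    unfolding gp_def
  proof (intro conjI ballI)
    show "fgrp (\<rho> ` set I)"
    proof (rule fgrp_I)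
      show "1 \<in> \<rho> ` set I" using one by force
    qed (use mult cl inv in auto)
    fix x y assume "x \<in> \<rho> ` set I" "y \<in> \<rho> ` set I"
    then obtain p q where pq: "p \<in> set I" "q \<in> set I" "x = \<rho> p" "y = \<rho> q" by blast
    show "x * y \<in> \<rho> ` {p \<in> set I. par p} \<longleftrightarrow> (x \<in> \<rho> ` {p \<in> set I. par p} \<longleftrightarrow> y \<in> \<rho> ` {p \<in> set I. par p})"
      unfolding pq(3,4) mult[OF pq(1,2)] i[OF pq(1)] i[OF pq(2)] i[OF cl(1)[OF pq(1,2)]] by (rule cl(2)[OF pq(1,2)])
  qed auto
  have t: "tau (\<rho> ` set J) = (length J, length (filter (\<lambda>p. m p p = u) J))" if J: "set J \<subseteq> set I" "distinct J" for J
  proof -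
    have injJ: "inj_on \<rho> A" if "A \<subseteq> set I" for A using inj inj_on_subset that by blast
    have "\<rho> p * \<rho> p = 1 \<longleftrightarrow> m p p = u" if "p \<in> set I" for p
      unfolding mult[OF that that] one(2)[symmetric] using inj_onD[OF inj _ cl(1)[OF that that] one(1)] by auto
    then have "{x \<in> \<rho> ` set J. x * x = 1} = \<rho> ` set (filter (\<lambda>p. m p p = u) J)" using J(1) by auto
    moreover have "card (\<rho> ` set (filter (\<lambda>p. m p p = u) J)) = length (filter (\<lambda>p. m p p = u) J)"
    proof -
      have "set (filter (\<lambda>p. m p p = u) J) \<subseteq> set I" using J(1) by auto
      then show ?thesis using card_image[OF injJ] distinct_card[OF distinct_filter[OF J(2)]] by metis
    qed
    moreover have "card (\<rho> ` set J) = length J" using card_image[OF injJ[OF J(1)]] distinct_card[OF J(2)] by simp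
    ultimately show ?thesis unfolding tau_def by simp
  qed
  show "tau (\<rho> ` set I) = (length I, length (filter (\<lambda>p. m p p = u) I))" using t dist by blast
  show "tau (\<rho> ` {p \<in> set I. par p}) = (length (filter par I), length (filter (\<lambda>p. m p p = u) (filter par I)))"
    using t[OF filter_is_subset distinct_filter[OF dist], of par] by (simp only: set_filter)
qed

section \<open>Invariants of the concrete groups\<close>

definition good :: "'a::monoid_mult set \<Rightarrow> 'a set \<Rightarrow> (nat \<times> nat) \<times> (nat \<times> nat) \<Rightarrow> bool" where
  "good P P0 l \<longleftrightarrow> gp P P0 \<and> (tau P, tau P0) = l"

lemma cyc_good:
  fixes g :: "qf m2"
  assumes m: "m > 0" "g ^ m = 1" "distinct (map (\<lambda>a. g ^ a) [0..<m])"
    and closed: "list_all (\<lambda>p. list_all (\<lambda>q. List.member [0..<m] ((p + q) mod m)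
        \<and> even (e * ((p + q) mod m)) = (even (e * p) = even (e * q))) [0..<m]) [0..<m]"
    and l: "l = ((m, length (filter (\<lambda>p. (p + p) mod m = 0) [0..<m])),
      (length (filter (\<lambda>a. even (e * a)) [0..<m]), length (filter (\<lambda>p. (p + p) mod m = 0) (filter (\<lambda>a. even (e * a)) [0..<m]))))"
  shows "good (set (cyc g m 0)) (set (cyc g m e)) l"
proof -
  have pm: "g ^ (a mod m) = g ^ a" for a
    by (metis m(2) mod_mult_div_eq mult_1_right power_add power_mult power_one)
  have "g ^ (m - 1) * g = 1" using m by (metis Suc_pred power_Suc2 One_nat_def)
  then have inv: "\<exists>z. z * g ^ p = 1" for p using left_inverse_power by blast
  have c: "set (cyc g m 0) = (\<lambda>a. g ^ a) ` set [0..<m]" "set (cyc g m e) = (\<lambda>a. g ^ a) ` {p \<in> set [0..<m]. even (e * p)}"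
    unfolding cyc_def by simp_all
  have inj: "inj_on (\<lambda>a. g ^ a) (set [0..<m])" using m(3) by (simp add: distinct_map)
  have mult: "g ^ p * g ^ q = g ^ ((p + q) mod m)" for p q by (simp add: pm power_add)
  have "0 \<in> set [0..<m]" using m(1) by simp
  note r = realization[where \<rho> = "\<lambda>a. g ^ a" and I = "[0..<m]" and u = 0 and m = "\<lambda>p q. (p + q) mod m" and par = "\<lambda>a. even (e * a)",
      OF inj distinct_upt this power_0 mult inv closed]
  show ?thesis unfolding good_def c l r(2,3) using r(1) by simp
qed

text \<open>The table of the group with \<open>g^m = 1\<close>, \<open>x g = g^-1 x\<close> and
  \<open>x^2 = g^c\<close>, where \<open>(a, b)\<close> codes \<open>g ^ a * x ^ b\<close> and
  \<open>m - 1\<close> replaces the exponent \<open>-1\<close>. Dihedral groups have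
  \<open>c = 0\<close>, quaternion and dicyclic ones \<open>c = m div 2\<close>.\<close>

definition mcm :: "nat \<Rightarrow> nat \<Rightarrow> nat \<times> nat \<Rightarrow> nat \<times> nat \<Rightarrow> nat \<times> nat" where
  "mcm m c = (\<lambda>(a, b) (a', b'). if b = 0 then ((a + a') mod m, b')
     else if b' = 0 then ((a + (m - 1) * a') mod m, 1) else ((a + (m - 1) * a' + c) mod m, 0))"

definition mcI :: "nat \<Rightarrow> (nat \<times> nat) list" where "mcI m = List.product [0..<m] [0..<2]"

text \<open>The relations bring every product to the normal form \<open>g ^ a * x ^ b\<close>. The
  normal forms are distinct because the powers of \<open>g\<close> are, and \<open>x\<close> is not
  among them.\<close>

lemma dih_presentation:
  fixes g x :: "'a::monoid_mult"
  assumes m: "m > 0" "g ^ m = 1" "distinct (map (\<lambda>a. g ^ a) [0..<m])"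
    and x: "x * g = g ^ (m - 1) * x" "x * x = g ^ c" "x \<notin> set (cyc g m 0)"
  shows "inj_on (\<lambda>p. g ^ fst p * x ^ snd p) (set (mcI m))"
    "\<And>p q. p \<in> set (mcI m) \<Longrightarrow> q \<in> set (mcI m) \<Longrightarrow>
      (g ^ fst p * x ^ snd p) * (g ^ fst q * x ^ snd q) = g ^ fst (mcm m c p q) * x ^ snd (mcm m c p q)"
    "\<And>p. p \<in> set (mcI m) \<Longrightarrow> \<exists>z. z * (g ^ fst p * x ^ snd p) = 1"
    "set (dih g x m e f) = (\<lambda>p. g ^ fst p * x ^ snd p) ` {p \<in> set (mcI m). even (e * fst p + f * snd p)}"
proof -
  define \<rho> where "\<rho> p = g ^ fst p * x ^ snd p" for p
  have pm: "g ^ (a mod m) = g ^ a" for a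
    by (metis m(2) mod_mult_div_eq mult_1_right power_add power_mult power_one)
  have gi: "g ^ (m - 1) * g = 1" using m by (metis Suc_pred power_Suc2 One_nat_def)
  have xg: "x * g ^ k = g ^ ((m - 1) * k) * x" for k
  proof (induction k)
    case (Suc k)
    have "x * g ^ Suc k = x * g ^ k * g" by (simp only: power_Suc2 mult.assoc)
    also have "\<dots> = g ^ ((m - 1) * k) * g ^ (m - 1) * x" unfolding Suc by (simp only: mult.assoc x(1))
    also have "\<dots> = g ^ ((m - 1) * Suc k) * x" by (simp only: power_add[symmetric] mult_Suc_right add.commute)
    finally show ?case .
  qed simp
  have mI: "set (mcI m) = {..<m} \<times> {..<2}" unfolding mcI_def by auto
  have inj1: "a = a'" if "g ^ a = g ^ a'" "a < m" "a' < m" for a a'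
    using m(3) that unfolding distinct_map inj_on_def by auto
  have xinv: "\<exists>z. z * x = 1"
  proof -
    have "(g ^ (m - 1)) ^ c * x * x = 1" using left_inverse_power[OF gi, of c] by (simp add: mult.assoc x(2))
    then show ?thesis by blast
  qed
  have gx: "g ^ a \<noteq> g ^ a' * x" for a a'
  proof
    assume "g ^ a = g ^ a' * x"
    then have "(g ^ (m - 1)) ^ a' * g ^ a = x" using left_inverse_power[OF gi, of a'] by (simp add: mult.assoc[symmetric])
    then have "x = g ^ (((m - 1) * a' + a) mod m)" by (simp add: pm power_add power_mult)
    then have "x \<in> set (cyc g m 0)" unfolding set_cyc using m(1) by force
    then show False using x(3) by blast
  qed
  have injr: "inj_on \<rho> (set (mcI m))"
  proof (rule inj_onI)
    fix p q assume pq: "p \<in> set (mcI m)" "q \<in> set (mcI m)" "\<rho> p = \<rho> q"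
    obtain a b a' b' where p: "p = (a, b)" "q = (a', b')" by (metis surj_pair)
    have lt: "a < m" "a' < m" "b < 2" "b' < 2" using pq(1,2) unfolding p mI by auto
    have e: "g ^ a * x ^ b = g ^ a' * x ^ b'" using pq(3) by (simp add: \<rho>_def p)
    consider "b = 0" "b' = 0" | "b = 0" "b' = 1" | "b = 1" "b' = 0" | "b = 1" "b' = 1" using lt(3,4) by linarith
    then show "p = q"
    proof cases
      case 1 then show ?thesis using e inj1[OF _ lt(1,2)] by (simp add: p)
    next
      case 2 then show ?thesis using e gx[of a a'] by simp
    next
      case 3 then show ?thesis using e gx[of a' a] by simp
    next
      case 4
      have "x * x * (g ^ (m - 1)) ^ c = 1"
        unfolding x(2) by (metis gi left_inverse_power power_commutes power_commuting_commutes power_mult power_mult_distrib mult.commute power_add)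
      then have "g ^ a * x * (x * (g ^ (m - 1)) ^ c) = g ^ a" "g ^ a' * x * (x * (g ^ (m - 1)) ^ c) = g ^ a'"
        by (simp_all add: mult.assoc)
      then have "g ^ a = g ^ a'" using e 4 by (metis power_one_right)
      then show ?thesis using inj1[OF _ lt(1,2)] 4 by (simp add: p)
    qed
  qed
  have mult: "\<rho> p * \<rho> q = \<rho> (mcm m c p q)" if "p \<in> set (mcI m)" "q \<in> set (mcI m)" for p q
  proof -
    obtain a b a' b' where p: "p = (a, b)" "q = (a', b')" by (metis surj_pair)
    have lt: "b < 2" "b' < 2" using that unfolding p mI by auto
    consider "b = 0" | "b = 1" "b' = 0" | "b = 1" "b' = 1" using lt by linarith
    then show ?thesis
    proof cases
      case 1 then show ?thesis by (simp add: \<rho>_def p mcm_def pm power_add mult.assoc)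
    next
      case 2
      have "g ^ a * x * g ^ a' = g ^ (a + (m - 1) * a') * x" by (simp only: mult.assoc xg power_add)
      then show ?thesis using 2 by (simp add: \<rho>_def p mcm_def pm)
    next
      case 3
      have "g ^ a * x * (g ^ a' * x) = g ^ a * (x * g ^ a') * x" by (simp only: mult.assoc)
      also have "\<dots> = g ^ (a + (m - 1) * a') * (x * x)" by (simp only: xg mult.assoc power_add)
      also have "\<dots> = g ^ (a + (m - 1) * a' + c)" by (simp only: x(2) power_add)
      finally show ?thesis using 3 by (simp add: \<rho>_def p mcm_def pm)
    qed
  qed
  have inv: "\<exists>z. z * \<rho> p = 1" if "p \<in> set (mcI m)" for p
  proof -
    obtain y where y: "y * x = 1" using xinv by blast
    have "y ^ snd p * (g ^ (m - 1)) ^ fst p * \<rho> p = y ^ snd p * ((g ^ (m - 1)) ^ fst p * g ^ fst p) * x ^ snd p"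
      by (simp only: \<rho>_def mult.assoc)
    also have "\<dots> = 1" unfolding left_inverse_power[OF gi] by (simp add: left_inverse_power[OF y])
    finally show ?thesis by blast
  qed
  show "set (dih g x m e f) = (\<lambda>p. g ^ fst p * x ^ snd p) ` {p \<in> set (mcI m). even (e * fst p + f * snd p)}"
    unfolding dih_def mcI_def by (force simp: case_prod_beta)
  show "inj_on (\<lambda>p. g ^ fst p * x ^ snd p) (set (mcI m))"
    "\<And>p q. p \<in> set (mcI m) \<Longrightarrow> q \<in> set (mcI m) \<Longrightarrow>
      (g ^ fst p * x ^ snd p) * (g ^ fst q * x ^ snd q) = g ^ fst (mcm m c p q) * x ^ snd (mcm m c p q)"
    "\<And>p. p \<in> set (mcI m) \<Longrightarrow> \<exists>z. z * (g ^ fst p * x ^ snd p) = 1"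
    using injr mult inv unfolding \<rho>_def by blast+
qed

lemma dih_good:
  fixes g x :: "qf m2"
  assumes m: "m > 0" "g ^ m = 1" "distinct (map (\<lambda>a. g ^ a) [0..<m])"
    and x: "x * g = g ^ (m - 1) * x" "x * x = g ^ c" "x \<notin> set (cyc g m 0)"
    and closed: "list_all (\<lambda>p. list_all (\<lambda>q. List.member (mcI m) (mcm m c p q)
        \<and> even (e * fst (mcm m c p q) + f * snd (mcm m c p q)) = (even (e * fst p + f * snd p) = even (e * fst q + f * snd q))) (mcI m)) (mcI m)"
    and l: "l = ((length (mcI m), length (filter (\<lambda>p. mcm m c p p = (0, 0)) (mcI m))),
      (length (filter (\<lambda>p. even (e * fst p + f * snd p)) (mcI m)),
       length (filter (\<lambda>p. mcm m c p p = (0, 0)) (filter (\<lambda>p. even (e * fst p + f * snd p)) (mcI m)))))"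
  shows "good (set (dih g x m 0 0)) (set (dih g x m e f)) l"
proof -
  let ?r = "\<lambda>p. g ^ fst p * x ^ snd p"
  note pr = dih_presentation[OF m x]
  note d = pr(4)
  have d0: "set (dih g x m 0 0) = ?r ` set (mcI m)" unfolding d by simp
  have "distinct (mcI m)" unfolding mcI_def by (intro distinct_product) simp_all
  note r = realization[where \<rho> = ?r and I = "mcI m" and u = "(0, 0)" and m = "mcm m c" and par = "\<lambda>p. even (e * fst p + f * snd p)",
      OF pr(1) this _ _ pr(2,3) closed]
  have "(0, 0) \<in> set (mcI m)" "?r (0, 0) = 1" using m(1) unfolding mcI_def by simp_all
  note r = r[OF this]
  show ?thesis unfolding good_def d0 d l using r by simp
qed

definition qhalf :: "iquad \<Rightarrow> iquad" where
  "qhalf = (\<lambda>(a, b, c, d). (a div 2, b div 2, c div 2, d div 2))"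

lemma qhalf_qdbl: "qhalf (qdbl p) = p" by (cases p) (simp add: qhalf_def qdbl_def)

lemma det2_qst: "u \<in> set hurwitz \<Longrightarrow> det2 (qst u) = 1"
proof -
  assume u: "u \<in> set hurwitz"
  have "list_all (\<lambda>(a, b, c, d). a * a + b * b + c * c + d * d = 4) hurwitz" by code_simp
  then obtain a b c d where "u = (a, b, c, d)" "a * a + b * b + c * c + d * d = 4"
    using u unfolding list_all_iff by (cases u) auto
  then show ?thesis using qst_norm[of a b c d] by simp
qed

text \<open>The determinant is a positive definite form in the coordinates, so the difference of two
  codes with equal value is zero.\<close>

lemma inj_qst: "inj qst"
proof (rule injI)
  fix p q assume e: "qst p = qst q"
  obtain a b c d where p1: "p = (a, b, c, d)" by (metis prod_cases4)
  obtain a' b' c' d' where p2: "q = (a', b', c', d')" by (metis prod_cases4)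
  note p = p1 p2
  have "qst (a - a', b - b', c - c', d - d') = qst p - qst q"
    unfolding p qev_def by (simp add: sm2_mult m2_eq_iff algebra_simps)
  then have "det2 (qst (a - a', b - b', c - c', d - d')) = 0" using e by (simp add: det2_def)
  then have "(of_int ((a - a') * (a - a') + (b - b') * (b - b') + (c - c') * (c - c') + (d - d') * (d - d')) :: qf) = of_int 0"
    using qst_norm[of "a - a'" "b - b'" "c - c'" "d - d'"] by simp
  then have z: "(a - a') * (a - a') + (b - b') * (b - b') + (c - c') * (c - c') + (d - d') * (d - d') = 0"
    unfolding of_int_eq_iff .
  have "0 \<le> y * y" for y :: int by simp
  from this[of "a - a'"] this[of "b - b'"] this[of "c - c'"] this[of "d - d'"] z
  have "(a - a') * (a - a') = 0" "(b - b') * (b - b') = 0" "(c - c') * (c - c') = 0" "(d - d') * (d - d') = 0"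
    by linarith+
  then show "p = q" by (simp add: p)
qed

lemma sls_good: "good (set sls) (set sls) ((24, 2), (24, 2))"
proof -
  have cl: "list_all (\<lambda>p. list_all (\<lambda>q. List.member hurwitz (qhalf (qmul p q)) \<and> True = (True = True)) hurwitz) hurwitz"
    by code_simp
  have inj: "inj_on qst (set hurwitz)" using inj_qst inj_on_subset by blast
  have dist: "distinct hurwitz" by code_simp
  have one: "(2, 0, 0, 0) \<in> set hurwitz" "qst (2, 0, 0, 0) = 1"
    by (simp_all add: hurwitz_def lipschitz_def qev_def m2_eq_iff qf_eq_iff)
  have mult: "qst p * qst q = qst (qhalf (qmul p q))" if pq: "p \<in> set hurwitz" "q \<in> set hurwitz" for p q
  proof -
    obtain r where r: "r \<in> set hurwitz" "qdbl r = qmul p q" using hurwitz_closed[OF pq] by metis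
    then show ?thesis using qst_mult qhalf_qdbl by metis
  qed
  have inv: "\<exists>z. z * qst p = 1" if "p \<in> set hurwitz" for p
    using adj2_left[of "qst p"] det2_qst[OF that] by auto
  note r = realization[OF inj dist one mult inv cl]
  have "length hurwitz = 24" "length (filter (\<lambda>p. qhalf (qmul p p) = (2, 0, 0, 0)) hurwitz) = 2" by code_simp+
  then show ?thesis using r unfolding good_def sls_def by simp
qed

lemma m3_of_int: "map_m3 of_int (x * y) = (map_m3 of_int x * map_m3 of_int y :: qf m3)" "map_m3 of_int 1 = (1 :: qf m3)"
  by (simp_all add: m3_eq_iff m3.map_sel)

text \<open>Over the integers these matrices can be multiplied by evaluation; the results return
  along \<open>of_int\<close>.\<close>

lemma tet_oct_of_int:
  "(tet :: qf m3 list) = map (map_m3 of_int) (tet :: int m3 list)"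
  "(oct_odd :: qf m3 list) = map (map_m3 of_int) (oct_odd :: int m3 list)"
  by (simp_all add: tet_def oct_odd_def pm_simps)

lemma int_m3_good:
  fixes I :: "int m3 list"
  assumes closed: "list_all (\<lambda>p. list_all (\<lambda>q. List.member I (p * q) \<and> par (p * q) = (par p = par q)) I) I"
    and I: "distinct I" "1 \<in> set I" "list_all (\<lambda>p. det3 p = 1) I"
  shows "good (map_m3 of_int ` set I :: qf m3 set) (map_m3 of_int ` {p \<in> set I. par p})
    ((length I, length (filter (\<lambda>p. p * p = 1) I)), (length (filter par I), length (filter (\<lambda>p. p * p = 1) (filter par I))))"
proof -
  have inj: "inj_on (map_m3 of_int :: int m3 \<Rightarrow> qf m3) (set I)" by (rule inj_onI) (simp add: m3_eq_iff m3.map_sel)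
  have inv: "\<exists>z. z * (map_m3 of_int p :: qf m3) = 1" if "p \<in> set I" for p
  proof -
    have "map_m3 of_int (adj3 p) * (map_m3 of_int p :: qf m3) = 1"
      using I(3) that unfolding m3_of_int[symmetric] adj3_left list_all_iff by (simp add: m3_of_int(2))
    then show ?thesis by blast
  qed
  note r = realization[OF inj I(1,2) m3_of_int(2) m3_of_int(1)[symmetric] inv closed]
  then show ?thesis unfolding good_def by (simp del: filter_filter)
qed

lemma tet_good: "good (set tet :: qf m3 set) (set tet) ((12, 4), (12, 4))"
proof -
  have c: "list_all (\<lambda>p. list_all (\<lambda>q. List.member tet (p * q) \<and> True = (True = True)) tet) (tet :: int m3 list)" by code_simp
  have d: "distinct (tet :: int m3 list)" by code_simp
  have o: "List.member (tet :: int m3 list) 1" by code_simp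
  have e: "list_all (\<lambda>p. det3 p = 1) (tet :: int m3 list)" by code_simp
  have n: "length (tet :: int m3 list) = 12 \<and> length (filter (\<lambda>p. p * p = 1) (tet :: int m3 list)) = 4" by code_simp
  show ?thesis using int_m3_good[OF c d _ e] o n unfolding tet_oct_of_int by simp
qed

lemma oct_good: "good (set (tet @ oct_odd) :: qf m3 set) (set (tet @ oct_odd)) ((24, 10), (24, 10))"
   "good (set (tet @ oct_odd) :: qf m3 set) (set tet) ((24, 10), (12, 4))"
proof -
  define I where "I = (tet @ oct_odd :: int m3 list)"
  have c: "list_all (\<lambda>p. list_all (\<lambda>q. List.member I (p * q) \<and> List.member tet (p * q) = (List.member tet p = List.member tet q)) I) I"
    unfolding I_def by code_simp
  then have c': "list_all (\<lambda>p. list_all (\<lambda>q. List.member I (p * q) \<and> True = (True = True)) I) I"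
    unfolding list_all_iff by blast
  have d: "distinct I" unfolding I_def by code_simp
  have o: "List.member I 1" unfolding I_def by code_simp
  have e: "list_all (\<lambda>p. det3 p = 1) I" unfolding I_def by code_simp
  have n: "length I = 24 \<and> length (filter (\<lambda>p. p * p = 1) I) = 10" unfolding I_def by code_simp
  have n': "length (filter (List.member tet) I) = 12 \<and> length (filter (\<lambda>p. p * p = 1) (filter (List.member tet) I)) = 4"
    unfolding I_def by code_simp
  have s: "map_m3 of_int ` set I = set (tet @ oct_odd :: qf m3 list)"
    unfolding I_def by (simp add: tet_oct_of_int image_Un)
  have s': "map_m3 of_int ` {p \<in> set I. List.member tet p} = set (tet :: qf m3 list)"
    unfolding I_def by (auto simp: tet_oct_of_int)
  show "good (set (tet @ oct_odd) :: qf m3 set) (set (tet @ oct_odd)) ((24, 10), (24, 10))"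
    using int_m3_good[OF c' d _ e] o n s by simp
  show "good (set (tet @ oct_odd) :: qf m3 set) (set tet) ((24, 10), (12, 4))"
    using int_m3_good[OF c d _ e] o unfolding s s' n[THEN conjunct1] n[THEN conjunct2] n'[THEN conjunct1] n'[THEN conjunct2]
    by simp
qed

lemma distinct_powers:
  "distinct (map (\<lambda>a. (1 :: qf m2) ^ a) [0..<1])" "distinct (map (\<lambda>a. (-1 :: qf m2) ^ a) [0..<2])"
  "distinct (map (\<lambda>a. gs (-1) ^ a) [0..<3])" "distinct (map (\<lambda>a. gs 0 ^ a) [0..<4])"
  "distinct (map (\<lambda>a. gs 1 ^ a) [0..<6])"
  by (simp_all add: upt_rec numeral_eq_Suc gs_def m2_eq_iff)

lemma gs_powers: "gs (-1) ^ 3 = 1" "gs 0 ^ 4 = 1" "gs 1 ^ 6 = 1" "gs 0 ^ 2 = -1" "gs 1 ^ 3 = -1"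
  by (simp_all add: numeral_eq_Suc gs_def m2_eq_iff)

lemma gs_conj:
  "rs (-1) * gs (-1) = gs (-1) ^ (3 - 1) * rs (-1)" "rs 0 * gs 0 = gs 0 ^ (4 - 1) * rs 0"
  "rs 1 * gs 1 = gs 1 ^ (6 - 1) * rs 1" "js0 * gs 0 = gs 0 ^ (4 - 1) * js0" "js1 * gs 1 = gs 1 ^ (6 - 1) * js1"
  "rs (-1) * rs (-1) = gs (-1) ^ 0" "rs 0 * rs 0 = gs 0 ^ 0" "rs 1 * rs 1 = gs 1 ^ 0"
  "js0 * js0 = gs 0 ^ 2" "js1 * js1 = gs 1 ^ 3"
  by (simp_all add: numeral_eq_Suc gs_def rs_def js0_def js1_def m2_eq_iff qf_eq_iff)

lemma not_in_cyc:
  "refl0 \<notin> set (cyc (-1) 2 0)" "rs (-1) \<notin> set (cyc (gs (-1)) 3 0)" "rs 0 \<notin> set (cyc (gs 0) 4 0)" "rs 1 \<notin> set (cyc (gs 1) 6 0)"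
  "js0 \<notin> set (cyc (gs 0) 4 0)" "js1 \<notin> set (cyc (gs 1) 6 0)"
proof -
  have d: "det2 y = 1" if "det2 g = 1" "y \<in> set (cyc g m 0)" for y g :: "qf m2" and m
    using that unfolding set_cyc by (auto simp: det2_power)
  have "det2 (-1 :: qf m2) = 1" "det2 refl0 \<noteq> 1" by (simp_all add: det2_def refl0_def)
  then show "refl0 \<notin> set (cyc (-1) 2 0)" using d by blast
  show "rs (-1) \<notin> set (cyc (gs (-1)) 3 0)" "rs 0 \<notin> set (cyc (gs 0) 4 0)" "rs 1 \<notin> set (cyc (gs 1) 6 0)"
    using d[OF std_generators(1)] std_generators(3) by fastforce+
  show "js0 \<notin> set (cyc (gs 0) 4 0)"
    using cyc_small(2)[of "gs 0"] std_generators by (simp add: gs_def js0_def m2_eq_iff qf_eq_iff)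
  show "js1 \<notin> set (cyc (gs 1) 6 0)"
    using cyc_small(3)[of "gs 1"] std_generators by (simp add: Z6_def gs_def js1_def m2_eq_iff qf_eq_iff)
qed

lemma cyc_goods:
  "good (set (cyc 1 1 0)) (set (cyc (1 :: qf m2) 1 0)) ((1, 1), (1, 1))"
  "good (set (cyc (-1) 2 0)) (set (cyc (-1 :: qf m2) 2 0)) ((2, 2), (2, 2))"
  "good (set (cyc (-1) 2 0)) (set (cyc (-1 :: qf m2) 2 1)) ((2, 2), (1, 1))"
  "good (set (cyc (gs (-1)) 3 0)) (set (cyc (gs (-1)) 3 0)) ((3, 1), (3, 1))"
  "good (set (cyc (gs 0) 4 0)) (set (cyc (gs 0) 4 0)) ((4, 2), (4, 2))"
  "good (set (cyc (gs 0) 4 0)) (set (cyc (gs 0) 4 1)) ((4, 2), (2, 2))"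
  "good (set (cyc (gs 1) 6 0)) (set (cyc (gs 1) 6 0)) ((6, 2), (6, 2))"
  "good (set (cyc (gs 1) 6 0)) (set (cyc (gs 1) 6 1)) ((6, 2), (3, 1))"
  subgoal by (rule cyc_good[OF _ _ distinct_powers(1)]) (simp, simp, code_simp, code_simp)
  subgoal by (rule cyc_good[OF _ _ distinct_powers(2)]) (simp, simp, code_simp, code_simp)
  subgoal by (rule cyc_good[OF _ _ distinct_powers(2)]) (simp, simp, code_simp, code_simp)
  subgoal by (rule cyc_good[OF _ gs_powers(1) distinct_powers(3)]) (simp, code_simp, code_simp)
  subgoal by (rule cyc_good[OF _ gs_powers(2) distinct_powers(4)]) (simp, code_simp, code_simp)
  subgoal by (rule cyc_good[OF _ gs_powers(2) distinct_powers(4)]) (simp, code_simp, code_simp)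
  subgoal by (rule cyc_good[OF _ gs_powers(3) distinct_powers(5)]) (simp, code_simp, code_simp)
  subgoal by (rule cyc_good[OF _ gs_powers(3) distinct_powers(5)]) (simp, code_simp, code_simp)
  done

lemma refl0_conj: "refl0 * -1 = (-1) ^ (2 - 1) * refl0" "refl0 * refl0 = (-1) ^ 0" "(-1 :: qf m2) ^ 2 = 1"
  by (simp_all add: refl0_def m2_eq_iff)

lemma dih_goods:
  "good (set (dih (-1) refl0 2 0 0)) (set (dih (-1) refl0 2 0 0)) ((4, 4), (4, 4))"
  "good (set (dih (-1) refl0 2 0 0)) (set (dih (-1) refl0 2 0 1)) ((4, 4), (2, 2))"
  "good (set (dih (gs (-1)) (rs (-1)) 3 0 0)) (set (dih (gs (-1)) (rs (-1)) 3 0 0)) ((6, 4), (6, 4))"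
  "good (set (dih (gs (-1)) (rs (-1)) 3 0 0)) (set (dih (gs (-1)) (rs (-1)) 3 0 1)) ((6, 4), (3, 1))"
  "good (set (dih (gs 0) (rs 0) 4 0 0)) (set (dih (gs 0) (rs 0) 4 0 0)) ((8, 6), (8, 6))"
  "good (set (dih (gs 0) (rs 0) 4 0 0)) (set (dih (gs 0) (rs 0) 4 0 1)) ((8, 6), (4, 2))"
  "good (set (dih (gs 0) (rs 0) 4 0 0)) (set (dih (gs 0) (rs 0) 4 1 0)) ((8, 6), (4, 4))"
  "good (set (dih (gs 1) (rs 1) 6 0 0)) (set (dih (gs 1) (rs 1) 6 0 0)) ((12, 8), (12, 8))"
  "good (set (dih (gs 1) (rs 1) 6 0 0)) (set (dih (gs 1) (rs 1) 6 0 1)) ((12, 8), (6, 2))"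
  "good (set (dih (gs 1) (rs 1) 6 0 0)) (set (dih (gs 1) (rs 1) 6 1 0)) ((12, 8), (6, 4))"
  "good (set (dih (gs 0) js0 4 0 0)) (set (dih (gs 0) js0 4 0 0)) ((8, 2), (8, 2))"
  "good (set (dih (gs 0) js0 4 0 0)) (set (dih (gs 0) js0 4 0 1)) ((8, 2), (4, 2))"
  "good (set (dih (gs 1) js1 6 0 0)) (set (dih (gs 1) js1 6 0 0)) ((12, 2), (12, 2))"
  "good (set (dih (gs 1) js1 6 0 0)) (set (dih (gs 1) js1 6 0 1)) ((12, 2), (6, 2))"
  subgoal by (rule dih_good[OF _ refl0_conj(3) distinct_powers(2) refl0_conj(1,2) not_in_cyc(1)]) (simp, code_simp, code_simp)
  subgoal by (rule dih_good[OF _ refl0_conj(3) distinct_powers(2) refl0_conj(1,2) not_in_cyc(1)]) (simp, code_simp, code_simp)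
  subgoal by (rule dih_good[OF _ gs_powers(1) distinct_powers(3) gs_conj(1,6) not_in_cyc(2)]) (simp, code_simp, code_simp)
  subgoal by (rule dih_good[OF _ gs_powers(1) distinct_powers(3) gs_conj(1,6) not_in_cyc(2)]) (simp, code_simp, code_simp)
  subgoal by (rule dih_good[OF _ gs_powers(2) distinct_powers(4) gs_conj(2,7) not_in_cyc(3)]) (simp, code_simp, code_simp)
  subgoal by (rule dih_good[OF _ gs_powers(2) distinct_powers(4) gs_conj(2,7) not_in_cyc(3)]) (simp, code_simp, code_simp)
  subgoal by (rule dih_good[OF _ gs_powers(2) distinct_powers(4) gs_conj(2,7) not_in_cyc(3)]) (simp, code_simp, code_simp)
  subgoal by (rule dih_good[OF _ gs_powers(3) distinct_powers(5) gs_conj(3,8) not_in_cyc(4)]) (simp, code_simp, code_simp)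
  subgoal by (rule dih_good[OF _ gs_powers(3) distinct_powers(5) gs_conj(3,8) not_in_cyc(4)]) (simp, code_simp, code_simp)
  subgoal by (rule dih_good[OF _ gs_powers(3) distinct_powers(5) gs_conj(3,8) not_in_cyc(4)]) (simp, code_simp, code_simp)
  subgoal by (rule dih_good[OF _ gs_powers(2) distinct_powers(4) gs_conj(4,9) not_in_cyc(5)]) (simp, code_simp, code_simp)
  subgoal by (rule dih_good[OF _ gs_powers(2) distinct_powers(4) gs_conj(4,9) not_in_cyc(5)]) (simp, code_simp, code_simp)
  subgoal by (rule dih_good[OF _ gs_powers(3) distinct_powers(5) gs_conj(5,10) not_in_cyc(6)]) (simp, code_simp, code_simp)
  subgoal by (rule dih_good[OF _ gs_powers(3) distinct_powers(5) gs_conj(5,10) not_in_cyc(6)]) (simp, code_simp, code_simp)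
  done

section \<open>The complete list of labels in \<open>SL3\<close>\<close>

lemma good_iota:
  fixes P :: "qf m2 set"
  assumes "good P P0 l"
  shows "good (iota ` P) (iota ` P0) l" "\<And>g. g \<in> iota ` P \<Longrightarrow> det3 g = 1"
proof -
  have gp: "gp P P0" using assms unfolding good_def by blast
  have inj: "inj_on iota A" for A :: "qf m2 set" by (auto simp: inj_on_def iota_inj)
  have i: "iota x \<in> iota ` A \<longleftrightarrow> x \<in> A" for x :: "qf m2" and A by (auto simp: iota_inj)
  note f = fgrpD[OF gpD(1)[OF gp]]
  have "gp (iota ` P) (iota ` P0)" unfolding gp_def
  proof (intro conjI ballI)
    show "fgrp (iota ` P)"
    proof (rule fgrp_I)
      show "finite (iota ` P)" using f(1) by simp
      show "1 \<in> iota ` P" using f(2) iota_1 by (metis image_eqI)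
      show "x * y \<in> iota ` P" if "x \<in> iota ` P" "y \<in> iota ` P" for x y
        using that f(3) by (auto simp: iota_mult[symmetric])
      fix x assume "x \<in> iota ` P"
      then obtain p where p: "p \<in> P" "x = iota p" by blast
      obtain q where "q * p = 1" using f(4)[OF p(1)] by blast
      then have "iota q * x = 1" unfolding p(2) iota_mult[symmetric] by (simp add: iota_1)
      then show "\<exists>z. z * x = 1" by blast
    qed
    show "iota ` P0 \<subseteq> iota ` P" using gpD(2)[OF gp] by blast
    fix x y assume "x \<in> iota ` P" "y \<in> iota ` P"
    then obtain p q where pq: "p \<in> P" "q \<in> P" "x = iota p" "y = iota q" by blast
    show "x * y \<in> iota ` P0 \<longleftrightarrow> (x \<in> iota ` P0 \<longleftrightarrow> y \<in> iota ` P0)"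
      unfolding pq iota_mult[symmetric] i using gpD(3)[OF gp pq(1,2)] .
  qed
  moreover have "tau (iota ` A) = tau A" for A :: "qf m2 set"
  proof -
    have "iota x * iota x = 1 \<longleftrightarrow> x * x = 1" for x :: "qf m2"
      using iota_inj[of "x * x" 1] by (simp add: iota_mult iota_1)
    then have "{y \<in> iota ` A. y * y = 1} = iota ` {x \<in> A. x * x = 1}" by auto
    then show ?thesis unfolding tau_def by (simp add: card_image[OF inj])
  qed
  ultimately show "good (iota ` P) (iota ` P0) l" using assms unfolding good_def by simp
  fix g assume "g \<in> iota ` P"
  then obtain p where p: "p \<in> P" "g = iota p" by blast
  obtain n where "n > 0" "p ^ n = 1" using fgrp_finite_order[OF gpD(1)[OF gp] p(1)] .
  then show "det3 g = 1" unfolding p(2) det3_iota using GL2_finite_order(1) by fastforce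
qed

text \<open>Aligned with \<open>std3\<close>: each entry holds the \<open>tau\<close> values of the
  standard pair at the same position.\<close>

definition pair_labels :: "((nat \<times> nat) \<times> (nat \<times> nat)) list" where
  "pair_labels = [((1, 1), (1, 1)), ((2, 2), (2, 2)), ((2, 2), (1, 1)), ((4, 4), (4, 4)), ((4, 4), (2, 2)),
    ((3, 1), (3, 1)), ((4, 2), (4, 2)), ((4, 2), (2, 2)), ((6, 2), (6, 2)), ((6, 2), (3, 1)),
    ((6, 4), (6, 4)), ((6, 4), (3, 1)), ((8, 6), (8, 6)), ((8, 6), (4, 2)), ((8, 6), (4, 4)),
    ((12, 8), (12, 8)), ((12, 8), (6, 2)), ((12, 8), (6, 4)), ((8, 2), (8, 2)), ((8, 2), (4, 2)),
    ((12, 2), (12, 2)), ((12, 2), (6, 2)), ((24, 2), (24, 2)),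
    ((12, 4), (12, 4)), ((24, 10), (24, 10)), ((24, 10), (12, 4))]"

definition std_good :: "qf m3 list \<times> qf m3 list \<Rightarrow> (nat \<times> nat) \<times> (nat \<times> nat) \<Rightarrow> bool" where
  "std_good = (\<lambda>(Q, Q0) l. good (set Q) (set Q0) l \<and> (\<forall>g\<in>set Q. det3 g = 1))"

lemma std_good_iota: "good (set Q) (set Q0) l \<Longrightarrow> std_good (map iota Q, map iota Q0) l"
  using good_iota(1)[of "set Q" "set Q0" l] good_iota(2)[of "set Q" "set Q0" l] unfolding std_good_def by simp

lemma std3_good: "list_all2 std_good std3 pair_labels"
proof -
  \<comment> \<open>The five diagonal pairs are rewritten as cyclic and dihedral lists with
    generator \<open>-1\<close>, whose labels are already computed.\<close>
  have one: "set (cyc 1 1 0) = set [1 :: qf m2]" "set (cyc (-1) 2 0) = set [1, -1 :: qf m2]" "set (cyc (-1) 2 1) = set [1 :: qf m2]"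
    "set (dih (-1) refl0 2 0 0) = set [1, -1, refl0, - refl0]" "set (dih (-1) refl0 2 0 1) = set [1, -1 :: qf m2]"
  proof -
    have u: "[0..<1] = [0::nat]" "[0..<2] = [0, 1::nat]" by (simp_all add: upt_rec)
    show "set (cyc 1 1 0) = set [1 :: qf m2]" "set (cyc (-1) 2 0) = set [1, -1 :: qf m2]" "set (cyc (-1) 2 1) = set [1 :: qf m2]"
      unfolding cyc_def u by simp_all
    show "set (dih (-1) refl0 2 0 0) = set [1, -1, refl0, - refl0]" "set (dih (-1) refl0 2 0 1) = set [1, -1 :: qf m2]"
      unfolding dih_def u by (simp_all add: insert_commute)
  qed
  note s = cyc_goods(1-3)[unfolded one, THEN std_good_iota] dih_goods(1,2)[unfolded one, THEN std_good_iota]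
  have a: "list_all2 std_good (map (map_prod (map iota) (map iota)) [([1], [1]), ([1, -1], [1, -1]), ([1, -1], [1]),
       ([1, -1, refl0, -refl0], [1, -1, refl0, -refl0]), ([1, -1, refl0, -refl0], [1, -1])])
       [((1, 1), (1, 1)), ((2, 2), (2, 2)), ((2, 2), (1, 1)), ((4, 4), (4, 4)), ((4, 4), (2, 2))]"
    using s by (simp only: list.map map_prod_simp list_all2_Cons list_all2_Nil simp_thms)
  have b: "list_all2 std_good (map (map_prod (map iota) (map iota)) (drop 9 std2)) (take 18 (drop 5 pair_labels))"
    using cyc_goods(4-8) dih_goods(3-14) sls_good by (simp add: std2_def pair_labels_def std_good_iota)
  have t: "det3 g = 1" if "g \<in> set tet" for g :: "qf m3"
    using that unfolding set_tet by (auto simp: det3_pm)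
  have o: "det3 g = 1" if "g \<in> set oct_odd" for g :: "qf m3"
    using that unfolding set_oct_odd by (auto simp: det3_pm)
  have c: "list_all2 std_good [(tet, tet), (tet @ oct_odd, tet @ oct_odd), (tet @ oct_odd, tet)] (drop 23 pair_labels)"
    using tet_good oct_good t o by (auto simp: pair_labels_def std_good_def)
  have p: "pair_labels = ([((1, 1), (1, 1)), ((2, 2), (2, 2)), ((2, 2), (1, 1)), ((4, 4), (4, 4)), ((4, 4), (2, 2))] @
      take 18 (drop 5 pair_labels)) @ drop 23 pair_labels"
    by (simp add: pair_labels_def)
  show ?thesis unfolding std3_def map_append by (subst p, rule list_all2_appendI[OF list_all2_appendI[OF a b] c])
qed

lemma distinct_pair_labels: "distinct pair_labels" by code_simp

lemma gp_label:
  fixes N N0 :: "qf m3 set"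
  assumes "gp N N0" "\<And>g. g \<in> N \<Longrightarrow> det3 g = 1"
  obtains Q Q0 :: "qf m3 list" where "simconj N N0 (set Q) (set Q0)" "(Q, Q0) \<in> set std3" "std_good (Q, Q0) (tau N, tau N0)"
    "(tau N, tau N0) \<in> set pair_labels"
proof -
  obtain Q Q0 :: "qf m3 list" where Q: "(Q, Q0) \<in> set std3" "simconj N N0 (set Q) (set Q0)"
    using SL3_pairs[OF assms] unfolding is_std3_def by blast
  then obtain i where "i < length std3" "std3 ! i = (Q, Q0)" unfolding in_set_conv_nth by blast
  then have l: "pair_labels ! i \<in> set pair_labels" "std_good (Q, Q0) (pair_labels ! i)"
    using std3_good unfolding list_all2_conv_all_nth by auto
  have e: "pair_labels ! i = (tau N, tau N0)" using l(2) tau_simconj[OF Q(2)] unfolding std_good_def good_def by simp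
  show thesis using that[OF Q(2,1)] l unfolding e by blast
qed

text \<open>Both pairs are conjugate to entries of \<open>std3\<close>, and since the labels of the
  entries are distinct it is the same entry. This turns the list of normal forms into a complete
  numerical invariant.\<close>

lemma gp_classification:
  fixes N N0 M M0 :: "qf m3 set"
  assumes "gp N N0" "\<And>g. g \<in> N \<Longrightarrow> det3 g = 1" "gp M M0" "\<And>g. g \<in> M \<Longrightarrow> det3 g = 1"
    "tau N = tau M" "tau N0 = tau M0"
  shows "simconj N N0 M M0"
proof -
  obtain Q Q0 :: "qf m3 list" where Q: "simconj N N0 (set Q) (set Q0)" "(Q, Q0) \<in> set std3" "std_good (Q, Q0) (tau N, tau N0)"
    using gp_label[OF assms(1,2)] .
  obtain R R0 :: "qf m3 list" where R: "simconj M M0 (set R) (set R0)" "(R, R0) \<in> set std3" "std_good (R, R0) (tau M, tau M0)"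
    using gp_label[OF assms(3,4)] .
  obtain i where i: "i < length std3" "std3 ! i = (Q, Q0)" using Q(2) by (metis in_set_conv_nth)
  obtain j where j: "j < length std3" "std3 ! j = (R, R0)" using R(2) by (metis in_set_conv_nth)
  have u: "l = l'" if "std_good p l" "std_good p l'" for p l l'
    using that unfolding std_good_def good_def by (auto split: prod.splits)
  have len: "length std3 = length pair_labels" using std3_good by (rule list_all2_lengthD)
  have "std_good (std3 ! k) (pair_labels ! k)" if "k < length std3" for k
    using std3_good that unfolding list_all2_conv_all_nth by blast
  then have "pair_labels ! i = (tau N, tau N0)" "pair_labels ! j = (tau M, tau M0)"
    using u i j Q(3) R(3) by metis+
  then have "i = j" using nth_eq_iff_index_eq[OF distinct_pair_labels] i(1) j(1) len assms(5,6) by metis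
  then have "set Q = set R" "set Q0 = set R0" using i j by auto
  then show ?thesis using simconj_trans[OF Q(1)] simconj_sym[OF R(1)] by simp
qed

section \<open>Subgroups of \<open>GL\<^sub>3\<close>\<close>

definition nrm :: "qf m3 \<Rightarrow> qf m3" where "nrm h = (if det3 h = 1 then h else - h)"
definition spart :: "qf m3 set \<Rightarrow> qf m3 set" where "spart H = {h \<in> H. det3 h = 1}"
definition label :: "qf m3 set \<Rightarrow> ((nat \<times> nat) \<times> (nat \<times> nat)) \<times> bool" where
  "label H = ((tau (nrm ` H), tau (spart H)), -1 \<in> H)"

lemma fgrp_det3:
  assumes "fgrp (H :: qf m3 set)" "h \<in> H"
  shows "det3 h = 1 \<or> det3 h = -1"
proof -
  obtain n where n: "n > 0" "h ^ n = 1" using fgrp_finite_order[OF assms] .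
  have "det3 (h ^ n) = det3 h ^ n" by (induction n) (simp_all add: det3_mult)
  then show ?thesis using n qf_root_of_unity by (metis det3_1)
qed

lemma nrm_mult:
  assumes "fgrp H" "h \<in> H" "k \<in> H"
  shows "nrm (h * k) = nrm h * nrm k"
  using fgrp_det3[OF assms(1,2)] fgrp_det3[OF assms(1,3)] by (auto simp: nrm_def det3_mult)

lemma det3_nrm: "fgrp H \<Longrightarrow> h \<in> H \<Longrightarrow> det3 (nrm h) = 1"
  using fgrp_det3[of H h] by (auto simp: nrm_def det3_minus)

lemma neg_mem:
  assumes "fgrp H" "h \<in> H"
  shows "- h \<in> H \<longleftrightarrow> -1 \<in> (H :: qf m3 set)"
proof
  obtain k where k: "k \<in> H" "h * k = 1" using fgrpD(4)[OF assms] by blast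
  show "-1 \<in> H" if "- h \<in> H" using fgrpD(3)[OF assms(1) that k(1)] k(2) by simp
  show "- h \<in> H" if "-1 \<in> H" using fgrpD(3)[OF assms(1) that assms(2)] by simp
qed

lemma nrm_spart:
  assumes "fgrp H" "h \<in> H"
  shows "nrm h \<in> spart H \<longleftrightarrow> det3 h = 1 \<or> -1 \<in> H"
  using neg_mem[OF assms] det3_nrm[OF assms] assms(2) by (auto simp: spart_def nrm_def)

lemma gp_nrm:
  assumes "fgrp H"
  shows "gp (nrm ` H) (spart H)" "\<And>g. g \<in> nrm ` H \<Longrightarrow> det3 g = 1"
proof -
  note f = fgrpD[OF assms]
  show "gp (nrm ` H) (spart H)" unfolding gp_def
  proof (intro conjI ballI)
    show "fgrp (nrm ` H)"
    proof (rule fgrp_I)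
      show "finite (nrm ` H)" using f(1) by simp
      show "1 \<in> nrm ` H" using f(2) by (intro image_eqI[of _ _ 1]) (simp_all add: nrm_def)
      show "x * y \<in> nrm ` H" if "x \<in> nrm ` H" "y \<in> nrm ` H" for x y
        using that f(3) by (auto simp: nrm_mult[OF assms, symmetric])
      fix x assume "x \<in> nrm ` H"
      then have "det3 x = 1" using det3_nrm[OF assms] by blast
      then have "adj3 x * x = 1" by (simp add: adj3_left)
      then show "\<exists>z. z * x = 1" by blast
    qed
    show "spart H \<subseteq> nrm ` H" unfolding spart_def by (auto simp: nrm_def image_iff intro!: bexI)
    fix x y assume "x \<in> nrm ` H" "y \<in> nrm ` H"
    then obtain h k where hk: "h \<in> H" "k \<in> H" "x = nrm h" "y = nrm k" by blast
    show "x * y \<in> spart H \<longleftrightarrow> (x \<in> spart H \<longleftrightarrow> y \<in> spart H)"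
      unfolding hk(3,4) nrm_mult[OF assms hk(1,2), symmetric] nrm_spart[OF assms hk(1)] nrm_spart[OF assms hk(2)]
        nrm_spart[OF assms f(3)[OF hk(1,2)]]
      using fgrp_det3[OF assms hk(1)] fgrp_det3[OF assms hk(2)] by (auto simp: det3_mult)
  qed
  show "\<And>g. g \<in> nrm ` H \<Longrightarrow> det3 g = 1" using det3_nrm[OF assms] by blast
qed

text \<open>The inverse of the passage from a subgroup to its pair: elements outside
  \<open>N0\<close> return with a sign, unless \<open>-1\<close> is present, when both signs
  occur.\<close>

definition build :: "qf m3 set \<Rightarrow> qf m3 set \<Rightarrow> bool \<Rightarrow> qf m3 set" where
  "build N N0 b = (if b then N \<union> uminus ` N else N0 \<union> uminus ` (N - N0))"

lemma build_nrm:
  assumes "fgrp H"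
  shows "H = build (nrm ` H) (spart H) (-1 \<in> H)"
proof (cases "-1 \<in> H")
  case True
  have n: "- h \<in> H" if "h \<in> H" for h using neg_mem[OF assms that] True by simp
  have "h \<in> nrm ` H \<union> uminus ` nrm ` H" if "h \<in> H" for h
  proof (cases "det3 h = 1")
    case True then show ?thesis using that by (intro UnI1 image_eqI[of _ _ h]) (simp_all add: nrm_def)
  next
    case d: False
    have "h = - nrm h" using d by (simp add: nrm_def)
    then show ?thesis using imageI[OF imageI[OF that, of nrm], of uminus] by simp
  qed
  moreover have m: "nrm h \<in> H" if "h \<in> H" for h using n[OF that] that by (simp add: nrm_def)
  have "nrm ` H \<union> uminus ` nrm ` H \<subseteq> H" by (auto intro: n m)
  ultimately show ?thesis using True unfolding build_def by auto
next
  case False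
  show ?thesis unfolding build_def using False
  proof (simp, intro equalityI subsetI)
    fix h assume h: "h \<in> H"
    show "h \<in> spart H \<union> uminus ` (nrm ` H - spart H)"
    proof (cases "det3 h = 1")
      case True then show ?thesis using h by (simp add: spart_def)
    next
      case d: False
      have "nrm h = - h" using d by (simp add: nrm_def)
      moreover have "nrm h \<notin> spart H" using nrm_spart[OF assms h] d False by simp
      ultimately have "nrm h \<in> nrm ` H - spart H" using h by blast
      from imageI[OF this, of uminus] show ?thesis using \<open>nrm h = - h\<close> by simp
    qed
  next
    fix h assume "h \<in> spart H \<union> uminus ` (nrm ` H - spart H)"
    then show "h \<in> H" unfolding spart_def nrm_def by (auto split: if_splits)
  qed
qed

lemma build_conj:
  assumes "b' * b = (1 :: qf m3)" "N0 \<subseteq> N"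
  shows "build ((\<lambda>x. b * x * b') ` N) ((\<lambda>x. b * x * b') ` N0) c = (\<lambda>x. b * x * b') ` build N N0 c"
proof -
  have "(\<lambda>x. b * x * b') ` N - (\<lambda>x. b * x * b') ` N0 = (\<lambda>x. b * x * b') ` (N - N0)"
    using inj_on_image_set_diff[OF inj_conj[OF assms(1), of UNIV], of N N0] by auto
  moreover have "uminus ` (\<lambda>x. b * x * b') ` A = (\<lambda>x. b * x * b') ` uminus ` A" for A :: "qf m3 set"
    by (simp add: image_image)
  ultimately show ?thesis unfolding build_def by (simp add: image_Un)
qed

text \<open>\<open>build\<close> commutes with conjugation, so a conjugation of the pairs carries
  the groups along. Conversely determinants, and with them \<open>nrm\<close> and
  \<open>spart\<close>, are respected by conjugation.\<close>

theorem label_complete: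
  assumes "fgrp H" "fgrp H'"
  shows "label H = label H' \<longleftrightarrow> (\<exists>b b'. b * b' = 1 \<and> b' * b = 1 \<and> H' = (\<lambda>x. b * x * b') ` H)"
proof
  assume l: "label H = label H'"
  then have "simconj (nrm ` H) (spart H) (nrm ` H') (spart H')"
    using gp_classification[OF gp_nrm[OF assms(1)] gp_nrm[OF assms(2)]] by (simp add: label_def)
  then obtain b b' where b: "b * b' = 1" "b' * b = 1" "nrm ` H' = (\<lambda>x. b * x * b') ` nrm ` H"
     "spart H' = (\<lambda>x. b * x * b') ` spart H" unfolding simconj_def by blast
  have "H' = build (nrm ` H') (spart H') (-1 \<in> H')" by (rule build_nrm[OF assms(2)])
  also have "\<dots> = (\<lambda>x. b * x * b') ` build (nrm ` H) (spart H) (-1 \<in> H)"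
    unfolding b(3,4) using build_conj[OF b(2) gpD(2)[OF gp_nrm(1)[OF assms(1)]]] l by (simp add: label_def)
  also have "\<dots> = (\<lambda>x. b * x * b') ` H" using build_nrm[OF assms(1)] by simp
  finally show "\<exists>b b'. b * b' = 1 \<and> b' * b = 1 \<and> H' = (\<lambda>x. b * x * b') ` H" using b by blast
next
  assume "\<exists>b b'. b * b' = 1 \<and> b' * b = 1 \<and> H' = (\<lambda>x. b * x * b') ` H"
  then obtain b b' where b: "b * b' = 1" "b' * b = 1" "H' = (\<lambda>x. b * x * b') ` H" by blast
  let ?f = "\<lambda>x. b * x * b'"
  have "det3 b * det3 b' = 1" using b(1) by (metis det3_1 det3_mult)
  then have d: "det3 (?f x) = det3 x" for x by (simp add: det3_mult mult_ac)
  then have "nrm (?f x) = ?f (nrm x)" for x unfolding nrm_def by simp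
  then have "nrm ` H' = ?f ` nrm ` H" unfolding b(3) image_image by simp
  moreover have "spart H' = ?f ` spart H" unfolding b(3) spart_def by (auto simp: d)
  moreover have "-1 \<in> H' \<longleftrightarrow> -1 \<in> H"
  proof -
    have e: "?f (-1) = -1" using b(1) by simp
    have "?f y \<in> ?f ` H \<longleftrightarrow> y \<in> H" for y
      using inj_onD[OF inj_conj[OF b(2), of UNIV]] by blast
    from this[of "-1"] show ?thesis unfolding e b(3) .
  qed
  ultimately show "label H = label H'" unfolding label_def using tau_conj[OF b(1,2)] by simp
qed

text \<open>In the presence of \<open>-1\<close> one has \<open>N = N0\<close>; on labels this is
  the condition \<open>s = t\<close>, since a proper subgroup has smaller order.\<close>

definition all_labels :: "(((nat \<times> nat) \<times> (nat \<times> nat)) \<times> bool) list" where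
  "all_labels = map (\<lambda>l. (l, False)) pair_labels @ map (\<lambda>l. (l, True)) (filter (\<lambda>(s, t). s = t) pair_labels)"

lemma label_mem:
  assumes "fgrp H"
  shows "label H \<in> set all_labels"
proof -
  have m: "(tau (nrm ` H), tau (spart H)) \<in> set pair_labels" using gp_label[OF gp_nrm[OF assms]] by blast
  have "nrm ` H = spart H" if "-1 \<in> H"
    using gpD(2)[OF gp_nrm(1)[OF assms]] nrm_spart[OF assms] that by blast
  then show ?thesis using m unfolding label_def all_labels_def by auto
qed

lemma build_label:
  assumes gp: "gp N N0" and det: "\<And>g. g \<in> N \<Longrightarrow> det3 g = 1" and b: "b \<Longrightarrow> N0 = N"
  shows "fgrp (build N N0 b)" "nrm ` build N N0 b = N" "spart (build N N0 b) = N0" "-1 \<in> build N N0 b \<longleftrightarrow> b"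
proof -
  note f = fgrpD[OF gpD(1)[OF gp]]
  have sub: "N0 \<subseteq> N" using gpD(2)[OF gp] .
  let ?H = "build N N0 b"
  have mem: "x \<in> ?H \<longleftrightarrow> (x \<in> N0 \<or> (- x \<in> N \<and> (b \<or> - x \<notin> N0)))" for x
  proof -
    have u: "x \<in> uminus ` A \<longleftrightarrow> - x \<in> A" for A :: "qf m3 set" by (auto simp: image_iff intro: bexI[of _ "- x"])
    show ?thesis using b unfolding build_def by (cases b) (simp_all add: u)
  qed
  have dm: "det3 x = -1" if "- x \<in> N" for x using det[OF that] by (simp add: det3_minus) (metis minus_minus)
  show "nrm ` ?H = N"
  proof (intro equalityI subsetI)
    fix y assume "y \<in> nrm ` ?H"
    then obtain x where "x \<in> ?H" "y = nrm x" by blast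
    then show "y \<in> N" using mem[of x] det dm sub by (auto simp: nrm_def)
  next
    fix y assume y: "y \<in> N"
    show "y \<in> nrm ` ?H"
    proof (cases "y \<in> N0")
      case True
      then show ?thesis using mem[of y] det[OF y] by (intro image_eqI[of _ _ y]) (simp_all add: nrm_def)
    next
      case False
      then show ?thesis using mem[of "- y"] det[OF y] y by (intro image_eqI[of _ _ "- y"]) (simp_all add: nrm_def det3_minus)
    qed
  qed
  show "spart ?H = N0" unfolding spart_def using mem dm det sub by force
  show "-1 \<in> ?H \<longleftrightarrow> b" using mem[of "-1"] det[of "-1"] sub f(2) gpD(4)[OF gp] by (auto simp: det3_minus)
  show "fgrp ?H"
  proof (rule fgrp_I)
    show "finite ?H" using f(1) finite_subset[OF sub f(1)] unfolding build_def by simp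
    show "1 \<in> ?H" using mem gpD(4)[OF gp] by simp
    show "\<exists>z. z * x = 1" if "x \<in> ?H" for x
    proof -
      have "adj3 x * x = sc3 (det3 x)" by (rule adj3_left)
      moreover have "det3 x = 1 \<or> det3 x = -1" using that mem det dm sub by blast
      moreover have "sc3 (-1) = (- 1 :: qf m3)" by (simp add: m3_eq_iff)
      ultimately have "adj3 x * x = 1 \<or> (- adj3 x) * x = 1" by auto
      then show ?thesis by blast
    qed
    fix x y assume xy: "x \<in> ?H" "y \<in> ?H"
    note p = f(3)[of x y] f(3)[of "- x" y] f(3)[of x "- y"] f(3)[of "- x" "- y"]
    note q = gpD(3)[OF gp, of x y] gpD(3)[OF gp, of "- x" y] gpD(3)[OF gp, of x "- y"] gpD(3)[OF gp, of "- x" "- y"]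
    show "x * y \<in> ?H"
    proof (cases b)
      case True
      then show ?thesis using xy p b[OF True] unfolding mem by auto
    next
      case False
      then show ?thesis using xy p q sub unfolding mem by auto
    qed
  qed
qed

lemma label_exists:
  assumes "l \<in> set all_labels"
  obtains H where "fgrp H" "label H = l"
proof -
  obtain p c where l: "l = (p, c)" by (cases l)
  have p: "p \<in> set pair_labels" "c \<Longrightarrow> fst p = snd p" using assms unfolding l all_labels_def by auto
  obtain Q Q0 where Q: "std_good (Q, Q0) p"
    using std3_good p(1) unfolding list_all2_conv_all_nth in_set_conv_nth by (metis surj_pair)
  have gp: "gp (set Q) (set Q0)" and t: "(tau (set Q), tau (set Q0)) = p" and d: "\<And>g. g \<in> set Q \<Longrightarrow> det3 g = 1"
    using Q unfolding std_good_def good_def by auto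
  have full: "gp (set Q) (set Q)" using gp fgrpD(3)[OF gpD(1)[OF gp]] unfolding gp_def by blast
  show thesis
  proof (cases c)
    case True
    let ?B = "build (set Q) (set Q) True"
    have B: "fgrp ?B" "nrm ` ?B = set Q" "spart ?B = set Q" "-1 \<in> ?B" using build_label[OF full d, of True] by simp_all
    have "tau (set Q) = fst p" "tau (set Q) = snd p" using t p(2)[OF True] by auto
    then have "label ?B = l" using B True unfolding label_def l by (cases p) simp
    then show ?thesis using that B(1) by blast
  next
    case False
    let ?B = "build (set Q) (set Q0) False"
    have B: "fgrp ?B" "nrm ` ?B = set Q" "spart ?B = set Q0" "-1 \<notin> ?B" using build_label[OF gp d, of False] by simp_all
    then have "label ?B = l" using False t unfolding label_def l by simp
    then show ?thesis using that B(1) by blast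
  qed
qed

section \<open>Isomorphism types\<close>

definition base :: "nat \<times> nat \<Rightarrow> ('c, 'd) monoid_scheme \<Rightarrow> bool" where
  "base s T \<longleftrightarrow> (\<forall>N :: qf m3 set. fgrp N \<longrightarrow> (\<forall>g\<in>N. det3 g = 1) \<longrightarrow> tau N = s \<longrightarrow> mgroup N \<cong> T)"

text \<open>The pairs \<open>(N, N)\<close> with a given \<open>tau\<close> form one conjugacy
  class, so a single realisation coded by \<open>A\<close>, together with a bijection
  \<open>\<sigma>\<close> of the codes with \<open>T\<close>, settles the type of all of
  them.\<close>

lemma base_realize:
  fixes \<rho> :: "'i \<Rightarrow> qf m3"
  assumes good: "good (\<rho> ` A) (\<rho> ` A) (s, s)" and det: "\<And>g. g \<in> \<rho> ` A \<Longrightarrow> det3 g = 1"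
    and inj: "inj_on \<rho> A" and bij: "bij_betw \<sigma> A (carrier T)"
    and m: "\<And>p q. p \<in> A \<Longrightarrow> q \<in> A \<Longrightarrow> m p q \<in> A"
    and \<rho>: "\<And>p q. p \<in> A \<Longrightarrow> q \<in> A \<Longrightarrow> \<rho> p * \<rho> q = \<rho> (m p q)"
    and \<sigma>: "\<And>p q. p \<in> A \<Longrightarrow> q \<in> A \<Longrightarrow> \<sigma> (m p q) = \<sigma> p \<otimes>\<^bsub>T\<^esub> \<sigma> q"
  shows "base s T"
  unfolding base_def
proof (intro allI impI)
  fix N :: "qf m3 set"
  assume N: "fgrp N" "\<forall>g\<in>N. det3 g = 1" "tau N = s"
  have gpN: "gp N N" using N(1) unfolding gp_def fgrp_def by blast
  have gpA: "gp (\<rho> ` A) (\<rho> ` A)" "tau (\<rho> ` A) = s" using good unfolding good_def by auto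
  have "simconj N N (\<rho> ` A) (\<rho> ` A)"
    by (rule gp_classification[OF gpN _ gpA(1) det]) (use N gpA(2) in auto)
  then obtain b b' where b: "b * b' = 1" "b' * b = 1" "\<rho> ` A = (\<lambda>x. b * x * b') ` N"
    unfolding simconj_def by blast
  define f where "f x = b * x * b'" for x
  define r where "r = inv_into A \<rho>"
  have fN: "f x \<in> \<rho> ` A" if "x \<in> N" for x using that unfolding b(3) f_def by blast
  have bf: "bij_betw f N (\<rho> ` A)" unfolding bij_betw_def using inj_conj[OF b(2), of N] b(3) by (simp add: f_def[abs_def])
  have br: "bij_betw r (\<rho> ` A) A" unfolding r_def using inj by (simp add: bij_betw_inv_into inj_on_imp_bij_betw)
  have rA: "r y \<in> A" "\<rho> (r y) = y" if "y \<in> \<rho> ` A" for y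
    using that unfolding r_def by (simp_all add: inv_into_into f_inv_into_f)
  have "\<sigma> (r (f (x * y))) = \<sigma> (r (f x)) \<otimes>\<^bsub>T\<^esub> \<sigma> (r (f y))" if "x \<in> N" "y \<in> N" for x y
  proof -
    have "f (x * y) = f x * f y" unfolding f_def by (rule conj_mult[OF b(2)])
    also have "\<dots> = \<rho> (m (r (f x)) (r (f y)))" using \<rho> rA fN that by metis
    finally have "r (f (x * y)) = m (r (f x)) (r (f y))"
      unfolding r_def using inv_into_f_f[OF inj] m rA fN that unfolding r_def by metis
    then show ?thesis using \<sigma> rA fN that by simp
  qed
  moreover have "bij_betw (\<sigma> \<circ> (r \<circ> f)) N (carrier T)" using bij_betw_trans[OF bij_betw_trans[OF bf br] bij] .
  ultimately have "\<sigma> \<circ> (r \<circ> f) \<in> iso (mgroup N) T" unfolding iso_def hom_def by (auto dest: bij_betwE)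
  then show "mgroup N \<cong> T" by (rule is_isoI)
qed

lemma iota_cong:
  fixes f :: "'i \<Rightarrow> qf m2"
  shows "inj_on (\<lambda>p. iota (f p)) A \<longleftrightarrow> inj_on f A"
  by (auto simp: inj_on_def iota_inj)

lemma cyc_base:
  assumes m: "m > 0" "g ^ m = 1" "distinct (map (\<lambda>a. (g :: qf m2) ^ a) [0..<m])"
    and good: "good (set (cyc g m 0)) (set (cyc g m 0)) (s, s)"
  shows "base s (Cyc m)"
proof (rule base_realize[where \<rho> = "\<lambda>a. iota (g ^ a)" and A = "{..<m}" and \<sigma> = int and m = "\<lambda>p q. (p + q) mod m"])
  have i: "(\<lambda>a. iota (g ^ a)) ` {..<m} = iota ` set (cyc g m 0)" unfolding set_cyc by auto
  show "good ((\<lambda>a. iota (g ^ a)) ` {..<m}) ((\<lambda>a. iota (g ^ a)) ` {..<m}) (s, s)" unfolding i by (rule good_iota(1)[OF good])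
  show "det3 h = 1" if "h \<in> (\<lambda>a. iota (g ^ a)) ` {..<m}" for h using good_iota(2)[OF good] that unfolding i .
  show "inj_on (\<lambda>a. iota (g ^ a)) {..<m}" using m(3) unfolding iota_cong distinct_map by (simp add: atLeast0LessThan)
  show "bij_betw int {..<m} (carrier (Cyc m))"
    using m(1) by (auto simp: carrier_integer_mod_group bij_betw_def image_int_atLeastLessThan atLeast0LessThan[symmetric])
  have pm: "g ^ (a mod m) = g ^ a" for a
    by (metis m(2) mod_mult_div_eq mult_1_right power_add power_mult power_one)
  show "iota (g ^ p) * iota (g ^ q) = iota (g ^ ((p + q) mod m))" for p q
    by (simp add: pm power_add iota_mult)
qed (use m(1) in \<open>auto simp: zmod_int\<close>)

lemma mcI_closed: "p \<in> set (mcI m) \<Longrightarrow> q \<in> set (mcI m) \<Longrightarrow> mcm m c p q \<in> set (mcI m)"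
  by (auto simp: mcI_def mcm_def split: prod.splits)

lemma dih_base:
  fixes g x :: "qf m2"
  assumes m: "m > 0" "g ^ m = 1" "distinct (map (\<lambda>a. g ^ a) [0..<m])"
    and x: "x * g = g ^ (m - 1) * x" "x * x = g ^ c" "x \<notin> set (cyc g m 0)"
    and good: "good (set (dih g x m 0 0)) (set (dih g x m 0 0)) (s, s)"
    and bij: "bij_betw \<sigma> (set (mcI m)) (carrier T)"
    and \<sigma>: "\<And>p q. p \<in> set (mcI m) \<Longrightarrow> q \<in> set (mcI m) \<Longrightarrow> \<sigma> (mcm m c p q) = \<sigma> p \<otimes>\<^bsub>T\<^esub> \<sigma> q"
  shows "base s T"
proof (rule base_realize[where \<rho> = "\<lambda>p. iota (g ^ fst p * x ^ snd p)", OF _ _ _ bij mcI_closed _ \<sigma>])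
  note pr = dih_presentation[OF m x]
  have i: "(\<lambda>p. iota (g ^ fst p * x ^ snd p)) ` set (mcI m) = iota ` set (dih g x m 0 0)"
    unfolding pr(4) by (simp add: image_image)
  show "good ((\<lambda>p. iota (g ^ fst p * x ^ snd p)) ` set (mcI m)) ((\<lambda>p. iota (g ^ fst p * x ^ snd p)) ` set (mcI m)) (s, s)"
    unfolding i by (rule good_iota(1)[OF good])
  show "det3 h = 1" if "h \<in> (\<lambda>p. iota (g ^ fst p * x ^ snd p)) ` set (mcI m)" for h using good_iota(2)[OF good] that unfolding i .
  show "inj_on (\<lambda>p. iota (g ^ fst p * x ^ snd p)) (set (mcI m))" unfolding iota_cong by (rule pr(1))
  show "iota (g ^ fst p * x ^ snd p) * iota (g ^ fst q * x ^ snd q) = iota (g ^ fst (mcm m c p q) * x ^ snd (mcm m c p q))"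
    if "p \<in> set (mcI m)" "q \<in> set (mcI m)" for p q
    unfolding iota_mult[symmetric] pr(2)[OF that] ..
qed

section \<open>Finite models of the target groups\<close>

lemma bij_betw_lists:
  assumes "distinct (map \<sigma> I)" "list_all (\<lambda>p. List.member J (\<sigma> p)) I" "length J = length I"
  shows "bij_betw \<sigma> (set I) (set J)"
proof -
  have "inj_on \<sigma> (set I)" using assms(1) by (simp add: distinct_map)
  moreover have sub: "\<sigma> ` set I \<subseteq> set J" using assms(2) by (auto simp: list_all_iff List.member_iff)
  moreover have "card (set J) \<le> card (\<sigma> ` set I)"
    using card_length[of J] distinct_card[OF assms(1)] assms(3) by simp
  ultimately show ?thesis unfolding bij_betw_def using card_seteq[OF _ sub] by blast
qed

text \<open>Explicit models of the groups over the integers, on which the homomorphism property is a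
  finite computation.\<close>

definition cycL :: "nat \<Rightarrow> int list" where "cycL m = [0..int m - 1]"
definition cmul :: "nat \<Rightarrow> int \<Rightarrow> int \<Rightarrow> int" where "cmul m x y = (x + y) mod int m"
definition sdL :: "nat \<Rightarrow> nat \<Rightarrow> (int \<times> int) list" where "sdL m k = List.product (cycL m) (cycL k)"
definition sdmul :: "nat \<Rightarrow> nat \<Rightarrow> int \<times> int \<Rightarrow> int \<times> int \<Rightarrow> int \<times> int" where
  "sdmul m k p q = ((fst p + (if even (snd p) then fst q else - fst q)) mod int m, (snd p + snd q) mod int k)"
definition dpmul :: "('a \<Rightarrow> 'a \<Rightarrow> 'a) \<Rightarrow> ('b \<Rightarrow> 'b \<Rightarrow> 'b) \<Rightarrow> 'a \<times> 'b \<Rightarrow> 'a \<times> 'b \<Rightarrow> 'a \<times> 'b" where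
  "dpmul f h p q = (f (fst p) (fst q), h (snd p) (snd q))"

text \<open>Replaces the carrier and the operation of \<open>T\<close> by a list and a function on
  which evaluation works.\<close>

definition model :: "('c, 'd) monoid_scheme \<Rightarrow> 'c list \<Rightarrow> ('c \<Rightarrow> 'c \<Rightarrow> 'c) \<Rightarrow> bool" where
  "model T J f \<longleftrightarrow> carrier T = set J \<and> (\<forall>x\<in>set J. \<forall>y\<in>set J. x \<otimes>\<^bsub>T\<^esub> y = f x y)"

lemma model_Cyc: "m > 0 \<Longrightarrow> model (Cyc m) (cycL m) (cmul m)"
  by (auto simp: model_def carrier_integer_mod_group cycL_def cmul_def)

lemma model_sd: "m > 0 \<Longrightarrow> k > 0 \<Longrightarrow> model (Cyc_inversion_Cyc m k) (sdL m k) (sdmul m k)"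
  using model_Cyc[of m] model_Cyc[of k]
  by (auto simp: model_def Cyc_inversion_Cyc_def semidirect_product_def sdL_def sdmul_def cmul_def mod_add_right_eq)

lemma model_DirProd:
  "model S J f \<Longrightarrow> model T J' f' \<Longrightarrow> model (S \<times>\<times> T) (List.product J J') (dpmul f f')"
  by (auto simp: model_def dpmul_def DirProd_def)

lemma model_iso:
  assumes "model S I f" "model T J f'" "distinct (map \<sigma> I)" "list_all (\<lambda>p. List.member J (\<sigma> p)) I" "length J = length I"
    "list_all (\<lambda>p. list_all (\<lambda>q. \<sigma> (f p q) = f' (\<sigma> p) (\<sigma> q)) I) I"
  shows "S \<cong> T"
proof -
  have "\<sigma> (x \<otimes>\<^bsub>S\<^esub> y) = \<sigma> x \<otimes>\<^bsub>T\<^esub> \<sigma> y" if "x \<in> set I" "y \<in> set I" for x y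
    using assms(1,2,4,6) that unfolding model_def list_all_iff List.member_iff by simp
  moreover have b: "bij_betw \<sigma> (set I) (set J)" by (rule bij_betw_lists[OF assms(3-5)])
  ultimately have "\<sigma> \<in> iso S T" using assms(1,2) unfolding model_def iso_def hom_def by (auto dest: bij_betwE)
  then show ?thesis by (rule is_isoI)
qed

lemma dih_base_model:
  fixes g x :: "qf m2"
  assumes m: "m > 0" "g ^ m = 1" "distinct (map (\<lambda>a. g ^ a) [0..<m])"
    and x: "x * g = g ^ (m - 1) * x" "x * x = g ^ c" "x \<notin> set (cyc g m 0)"
    and good: "good (set (dih g x m 0 0)) (set (dih g x m 0 0)) (s, s)"
    and T: "model T J f"
    and l: "distinct (map \<sigma> (mcI m))" "list_all (\<lambda>p. List.member J (\<sigma> p)) (mcI m)" "length J = length (mcI m)"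
      "list_all (\<lambda>p. list_all (\<lambda>q. \<sigma> (mcm m c p q) = f (\<sigma> p) (\<sigma> q)) (mcI m)) (mcI m)"
  shows "base s T"
proof (rule dih_base[OF m x good])
  show "bij_betw \<sigma> (set (mcI m)) (carrier T)" using bij_betw_lists[OF l(1-3)] T unfolding model_def by simp
  show "\<sigma> (mcm m c p q) = \<sigma> p \<otimes>\<^bsub>T\<^esub> \<sigma> q" if "p \<in> set (mcI m)" "q \<in> set (mcI m)" for p q
    using l(2,4) T that unfolding model_def list_all_iff List.member_iff by simp
qed

subsection \<open>Permutation groups\<close>

definition permL :: "nat \<Rightarrow> nat list list" where
  "permL n = filter distinct (List.n_lists n [1..<Suc n])"
definition pcomp :: "nat list \<Rightarrow> nat list \<Rightarrow> nat list" where
  "pcomp p q = map (\<lambda>i. p ! (i - 1)) q"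
definition perm :: "nat list \<Rightarrow> nat \<Rightarrow> nat" where
  "perm p = (\<lambda>i. if i \<in> {1..length p} then p ! (i - 1) else i)"

lemma permL_iff: "p \<in> set (permL n) \<longleftrightarrow> distinct p \<and> length p = n \<and> set p \<subseteq> {1..n}"
  unfolding permL_def by (auto simp: set_n_lists)

lemma perm_permutes:
  assumes "p \<in> set (permL n)"
  shows "perm p permutes {1..n}"
proof (rule bij_imp_permutes)
  have p: "distinct p" "length p = n" "set p \<subseteq> {1..n}" using assms by (simp_all add: permL_iff)
  have "p ! (i - 1) \<in> set p" if "i \<in> {1..n}" for i using that p(2) by (intro nth_mem) auto
  then have s: "perm p ` {1..n} \<subseteq> {1..n}" using p unfolding perm_def by auto
  have i: "inj_on (perm p) {1..n}"
  proof (rule inj_onI)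
    fix i j assume ij: "i \<in> {1..n}" "j \<in> {1..n}" "perm p i = perm p j"
    then have "p ! (i - 1) = p ! (j - 1)" using p(2) by (simp add: perm_def)
    then have "i - 1 = j - 1" using nth_eq_iff_index_eq[OF p(1), of "i - 1" "j - 1"] ij p(2) by auto
    then show "i = j" using ij by auto
  qed
  show "bij_betw (perm p) {1..n} {1..n}" unfolding bij_betw_def using i endo_inj_surj[OF _ s i] by simp
  show "perm p x = x" if "x \<notin> {1..n}" for x using that p(2) by (auto simp: perm_def)
qed

lemma perm_pcomp:
  assumes "p \<in> set (permL n)" "q \<in> set (permL n)"
  shows "perm (pcomp p q) = perm p \<circ> perm q"
proof
  fix i
  have p: "length p = n" "length q = n" "set q \<subseteq> {1..n}" using assms by (simp_all add: permL_iff)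
  show "perm (pcomp p q) i = (perm p \<circ> perm q) i"
  proof (cases "i \<in> {1..n}")
    case True
    then have "q ! (i - 1) \<in> {1..n}" using p nth_mem[of "i - 1" q] by force
    then show ?thesis using True p by (auto simp: perm_def pcomp_def)
  next
    case False
    then show ?thesis using p by (auto simp: perm_def pcomp_def)
  qed
qed

lemma bij_perm: "bij_betw perm (set (permL n)) {p. p permutes {1..n}}"
proof (rule bij_betwI')
  show "(perm p = perm q) = (p = q)" if "p \<in> set (permL n)" "q \<in> set (permL n)" for p q
  proof
    assume e: "perm p = perm q"
    have l: "length p = n" "length q = n" using that by (simp_all add: permL_iff)
    show "p = q"
    proof (rule nth_equalityI)
      fix i assume "i < length p"
      then show "p ! i = q ! i" using fun_cong[OF e, of "Suc i"] l by (simp add: perm_def)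
    qed (simp add: l)
  qed simp
  show "perm p \<in> {p. p permutes {1..n}}" if "p \<in> set (permL n)" for p using perm_permutes[OF that] by simp
  fix f assume "f \<in> {p. p permutes {1..n}}"
  then have f: "f permutes {1..n}" by simp
  define p where "p = map f [1..<Suc n]"
  have "set p = {1..n}" unfolding p_def using permutes_image[OF f] by (simp add: atLeastLessThanSuc_atLeastAtMost del: upt_Suc)
  moreover have "distinct p" unfolding p_def using permutes_inj_on[OF f] by (simp add: distinct_map del: upt_Suc)
  moreover have "length p = n" unfolding p_def by (simp del: upt_Suc)
  ultimately have "p \<in> set (permL n)" by (simp add: permL_iff)
  moreover have "perm p = f"
  proof
    fix i
    show "perm p i = f i" using permutes_not_in[OF f, of i] by (auto simp: perm_def p_def simp del: upt_Suc)
  qed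
  ultimately show "\<exists>p\<in>set (permL n). f = perm p" by blast
qed

lemma perm_list_bij:
  assumes "distinct (map \<sigma> I)" "list_all (\<lambda>p. List.member (permL n) (\<sigma> p)) I" "length (permL n) = length I"
  shows "bij_betw (perm \<circ> \<sigma>) (set I) (carrier (sym_group n))"
  using bij_betw_trans[OF bij_betw_lists[OF assms] bij_perm] by (simp add: sym_group_def)

lemma sym3_base: "base (6, 4) (sym_group 3)"
proof -
  \<comment> \<open>\<open>g\<close> goes to the three-cycle \<open>[2, 3, 1]\<close> and
    \<open>x\<close> to the transposition \<open>[2, 1, 3]\<close>.\<close>
  define s where "s p = (pcomp [2, 3, 1] ^^ fst p) ((pcomp [2, 1, 3] ^^ snd p) [1, 2, 3])" for p
  have l: "distinct (map s (mcI 3))" "list_all (\<lambda>p. List.member (permL 3) (s p)) (mcI 3)" "length (permL 3) = length (mcI 3)"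
    unfolding s_def by code_simp+
  have h: "list_all (\<lambda>p. list_all (\<lambda>q. s (mcm 3 0 p q) = pcomp (s p) (s q)) (mcI 3)) (mcI 3)"
    unfolding s_def by code_simp
  show ?thesis
  proof (rule dih_base[OF _ gs_powers(1) distinct_powers(3) gs_conj(1,6) not_in_cyc(2) dih_goods(3) perm_list_bij[OF l]])
    show "(perm \<circ> s) (mcm 3 0 p q) = (perm \<circ> s) p \<otimes>\<^bsub>sym_group 3\<^esub> (perm \<circ> s) q"
      if "p \<in> set (mcI 3)" "q \<in> set (mcI 3)" for p q
      using l(2) h that perm_pcomp[of "s p" 3 "s q"] unfolding list_all_iff List.member_iff by (simp add: sym_group_mult)
  qed simp
qed

text \<open>The symmetric group on four letters permutes the vertices of a tetrahedron
  \<open>(\<plusminus>1, \<plusminus>1, \<plusminus>1)\<close>; the sign makes the determinant one.\<close>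

definition vert :: "nat \<Rightarrow> nat \<Rightarrow> int" where
  "vert a i = (if i = 1 then 1 else if i = a then 1 else -1)"
text \<open>An entry of one quarter of the sum of the matrices \<open>v(p i) v(i)^T\<close> over the
  vertices. As the vertices add up to zero and have inner products \<open>3\<close> and
  \<open>-1\<close>, this matrix maps vertex \<open>i\<close> to vertex \<open>p i\<close>.
  Coordinates are numbered 2, 3, 4 after the vertex, besides the first, that is positive
  there.\<close>

definition rot0 :: "nat list \<Rightarrow> nat \<Rightarrow> nat \<Rightarrow> int" where
  "rot0 p a b = (vert a (p ! 0) * vert b 1 + vert a (p ! 1) * vert b 2 + vert a (p ! 2) * vert b 3 + vert a (p ! 3) * vert b 4) div 4"
definition rot :: "nat list \<Rightarrow> int m3" where
  "rot p = (let M = M3 (rot0 p 2 2) (rot0 p 2 3) (rot0 p 2 4) (rot0 p 3 2) (rot0 p 3 3) (rot0 p 3 4) (rot0 p 4 2) (rot0 p 4 3) (rot0 p 4 4)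
     in if det3 M = 1 then M else - M)"

text \<open>Tabulated, so that evaluation does not unfold \<open>rot\<close> at a variable.\<close>

definition rotL :: "(nat list \<times> int m3) list" where "rotL = zip (permL 4) (map rot (permL 4))"
text \<open>Evenness is read off the rotation: even permutations are those whose matrix lies in
  \<open>tet\<close>.\<close>

definition evenL :: "nat list list" where "evenL = map fst (filter (\<lambda>(p, M). List.member tet M) rotL)"

lemma set_rotL: "set rotL = (\<lambda>p. (p, rot p)) ` set (permL 4)"
  unfolding rotL_def by (simp add: zip_map2 zip_same_conv_map image_image)

lemma pcomp_closed:
  assumes "p \<in> set (permL n)" "q \<in> set (permL n)"
  shows "pcomp p q \<in> set (permL n)"
proof -
  have p: "distinct p" "length p = n" "set p \<subseteq> {1..n}" "distinct q" "length q = n" "set q \<subseteq> {1..n}"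
    using assms by (simp_all add: permL_iff)
  have "inj_on (\<lambda>i. p ! (i - 1)) (set q)"
  proof (rule inj_onI)
    fix i j assume ij: "i \<in> set q" "j \<in> set q" "p ! (i - 1) = p ! (j - 1)"
    then have "i \<in> {1..n}" "j \<in> {1..n}" using p(6) by blast+
    then have "i - 1 = j - 1" using nth_eq_iff_index_eq[OF p(1), of "i - 1" "j - 1"] ij(3) p(2) by auto
    then show "i = j" using \<open>i \<in> {1..n}\<close> \<open>j \<in> {1..n}\<close> by auto
  qed
  moreover have "p ! (i - 1) \<in> {1..n}" if "i \<in> set q" for i
  proof -
    have "i \<in> {1..n}" using that p(6) by blast
    then have "p ! (i - 1) \<in> set p" using p(2) by (intro nth_mem) auto
    then show ?thesis using p(3) by blast
  qed
  ultimately show ?thesis using p by (auto simp: permL_iff pcomp_def distinct_map)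
qed

lemma bij_rot: "bij_betw rot (set (permL 4)) (set (tet @ oct_odd))"
proof (rule bij_betw_lists)
  show "distinct (map rot (permL 4))" by code_simp
  have "list_all (List.member (tet @ oct_odd)) (map rot (permL 4))" by code_simp
  then show "list_all (\<lambda>p. List.member (tet @ oct_odd) (rot p)) (permL 4)" by (simp add: list_all_iff)
  show "length (tet @ oct_odd :: int m3 list) = length (permL 4)" by code_simp
qed

lemma rot_pcomp:
  assumes "p \<in> set (permL 4)" "q \<in> set (permL 4)"
  shows "rot (pcomp p q) = rot p * rot q"
proof -
  have "list_all (\<lambda>(p, M). list_all (\<lambda>(q, N). List.member rotL (pcomp p q, M * N)) rotL) rotL" by code_simp
  then have "(pcomp p q, rot p * rot q) \<in> set rotL"
    using assms unfolding list_all_iff List.member_iff set_rotL by auto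
  then show ?thesis unfolding set_rotL by auto
qed

abbreviation rotq :: "nat list \<Rightarrow> qf m3" where "rotq p \<equiv> map_m3 of_int (rot p)"

lemma inj_rotq: "inj_on rotq (set (permL 4))"
proof -
  have "inj (map_m3 of_int :: int m3 \<Rightarrow> qf m3)" by (rule injI) (simp add: m3_eq_iff m3.map_sel)
  then show ?thesis using bij_rot unfolding bij_betw_def inj_on_def by blast
qed

lemma det_oct: "g \<in> set (tet @ oct_odd) \<Longrightarrow> det3 (g :: qf m3) = 1"
  unfolding set_append set_tet set_oct_odd by (auto simp: det3_pm)

lemma sym4_base: "base (24, 10) (sym_group 4)"
proof (rule base_realize[where \<rho> = rotq and A = "set (permL 4)" and \<sigma> = perm and m = pcomp])
  have "rotq ` set (permL 4) = map_m3 of_int ` rot ` set (permL 4)" by (simp add: image_image)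
  also have "\<dots> = set (tet @ oct_odd)"
    using bij_rot unfolding bij_betw_def by (simp add: tet_oct_of_int image_Un)
  finally have i: "rotq ` set (permL 4) = set (tet @ oct_odd)" .
  show "good (rotq ` set (permL 4)) (rotq ` set (permL 4)) ((24, 10), (24, 10))" unfolding i by (rule oct_good(1))
  show "det3 g = 1" if "g \<in> rotq ` set (permL 4)" for g using det_oct that unfolding i .
  show "bij_betw perm (set (permL 4)) (carrier (sym_group 4))" using bij_perm by (simp add: sym_group_def)
qed (simp_all add: inj_rotq pcomp_closed rot_pcomp m3_of_int(1) perm_pcomp sym_group_mult)

lemma evenL_iff: "p \<in> set evenL \<longleftrightarrow> p \<in> set (permL 4) \<and> rot p \<in> set tet"
  unfolding evenL_def by (force simp: List.member_iff set_rotL)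

text \<open>Even permutations are products of two squares; the others differ from them by a transposition.\<close>

lemma evenperm_iff:
  assumes p: "p \<in> set (permL 4)"
  shows "evenperm (perm p) \<longleftrightarrow> p \<in> set evenL"
proof -
  have pp: "permutation (perm q)" if "q \<in> set (permL 4)" for q
    using perm_permutes[OF that] by (auto intro: permutes_imp_permutation)
  have comp: "evenperm (perm (pcomp q r)) \<longleftrightarrow> evenperm (perm q) = evenperm (perm r)"
    if "q \<in> set (permL 4)" "r \<in> set (permL 4)" for q r
    unfolding perm_pcomp[OF that] by (rule evenperm_comp[OF pp[OF that(1)] pp[OF that(2)]])
  have ev: "evenperm (perm q)" if "q \<in> set evenL" for q
  proof -
    have "list_all (\<lambda>p. list_ex (\<lambda>x. list_ex (\<lambda>y. pcomp (pcomp x x) (pcomp y y) = p) [[1, 2, 3, 4], [2, 3, 1, 4]]) (permL 4)) evenL"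
      by code_simp
    then have "\<exists>x\<in>set (permL 4). \<exists>y\<in>set [[1, 2, 3, 4], [2, 3, 1, 4]]. pcomp (pcomp x x) (pcomp y y) = q"
      using that unfolding list_all_iff list_ex_iff by blast
    then obtain x y where x: "x \<in> set (permL 4)" and y: "y \<in> set [[1, 2, 3, 4], [2, 3, 1, 4]]"
        and q: "q = pcomp (pcomp x x) (pcomp y y)"
      by blast
    have "y \<in> set (permL 4)" using y by (auto simp: permL_iff)
    then show ?thesis unfolding q using x by (simp add: comp pcomp_closed)
  qed
  show ?thesis
  proof (cases "p \<in> set evenL")
    case False
    let ?t = "[2, 1, 3, 4] :: nat list"
    have t: "?t \<in> set (permL 4)" by (auto simp: permL_iff)
    have "perm ?t = Transposition.transpose 1 2"
    proof
      fix i :: nat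
      consider "i = 0" | "i = 1" | "i = 2" | "i = 3" | "i = 4" | "i > 4" by linarith
      then show "perm ?t i = Transposition.transpose 1 2 i" by cases (simp_all add: perm_def transpose_def)
    qed
    then have nt: "\<not> evenperm (perm ?t)" by (simp add: evenperm_swap)
    have "list_all (\<lambda>p. List.member evenL p \<or> List.member evenL (pcomp ?t p)) (permL 4)" by code_simp
    then have "pcomp ?t p \<in> set evenL" using p False unfolding list_all_iff List.member_iff by blast
    then show ?thesis using ev comp[OF t p] nt False by blast
  qed (simp add: ev)
qed

lemma bij_evenL: "bij_betw perm (set evenL) (carrier (alt_group 4))"
proof -
  have s: "set evenL \<subseteq> set (permL 4)" using evenL_iff by blast
  have "perm ` set evenL = carrier (alt_group 4)"
  proof (intro equalityI subsetI)
    fix f assume "f \<in> perm ` set evenL"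
    then show "f \<in> carrier (alt_group 4)"
      using s evenperm_iff perm_permutes[where n = 4] unfolding alt_group_def by auto
  next
    fix f assume f: "f \<in> carrier (alt_group 4)"
    then have "f \<in> perm ` set (permL 4)" using bij_perm[of 4] unfolding bij_betw_def alt_group_def by simp
    then obtain p where "p \<in> set (permL 4)" "f = perm p" by blast
    then show "f \<in> perm ` set evenL" using f evenperm_iff unfolding alt_group_def by auto
  qed
  then show ?thesis using inj_on_subset[OF bij_betw_imp_inj_on[OF bij_perm[of 4]] s] by (simp add: bij_betw_def)
qed

lemma alt4_base: "base (12, 4) (alt_group 4)"
proof (rule base_realize[where \<rho> = rotq and A = "set evenL" and \<sigma> = perm and m = pcomp])
  have s: "set evenL \<subseteq> set (permL 4)" using evenL_iff by blast
  have "rot ` set evenL = set tet"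
  proof (intro equalityI subsetI)
    fix g assume g: "g \<in> set (tet :: int m3 list)"
    then obtain p where "p \<in> set (permL 4)" "g = rot p" using bij_rot unfolding bij_betw_def by (metis UnCI imageE set_append)
    then show "g \<in> rot ` set evenL" using g evenL_iff by blast
  qed (use evenL_iff in blast)
  moreover have "rotq ` set evenL = map_m3 of_int ` rot ` set evenL" by (simp only: image_image)
  ultimately have i: "rotq ` set evenL = set tet" by (simp add: tet_oct_of_int)
  show "good (rotq ` set evenL) (rotq ` set evenL) ((12, 4), (12, 4))" unfolding i by (rule tet_good)
  show "det3 g = 1" if "g \<in> rotq ` set evenL" for g using det_oct that unfolding i by simp
  show "inj_on rotq (set evenL)" using inj_rotq s by (rule inj_on_subset)
  show "bij_betw perm (set evenL) (carrier (alt_group 4))" by (rule bij_evenL)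
  fix p q assume pq: "p \<in> set evenL" "q \<in> set evenL"
  then have pq': "p \<in> set (permL 4)" "q \<in> set (permL 4)" using s by blast+
  have "list_all (\<lambda>p. list_all (\<lambda>q. List.member tet (p * q)) tet) (tet :: int m3 list)" by code_simp
  then show "pcomp p q \<in> set evenL"
    using pq pcomp_closed[OF pq'] unfolding evenL_iff rot_pcomp[OF pq'] list_all_iff List.member_iff by blast
  show "rotq p * rotq q = rotq (pcomp p q)" using rot_pcomp[OF pq'] by (simp add: m3_of_int(1))
  show "perm (pcomp p q) = perm p \<otimes>\<^bsub>alt_group 4\<^esub> perm q" using perm_pcomp[OF pq'] by (simp add: alt_group_mult)
qed

subsection \<open>The quaternion group and \<open>SL(2, 3)\<close>\<close>

definition vm2 :: "'a::comm_ring_1 m2 \<Rightarrow> 'a ^ 2 ^ 2" where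
  "vm2 x = vector [vector [a11 x, a12 x], vector [a21 x, a22 x]]"

lemma vm2_nth [simp]: "vm2 x $ 1 $ 1 = a11 x" "vm2 x $ 1 $ 2 = a12 x" "vm2 x $ 2 $ 1 = a21 x" "vm2 x $ 2 $ 2 = a22 x"
  by (simp_all add: vm2_def)

lemma vm2_mult: "vm2 (x * y) = vm2 x ** vm2 y"
  by (simp add: vec_eq_iff forall_2 matrix_matrix_mult_def sum_2)

lemma vm2_1: "vm2 1 = mat 1" and vm2_minus: "vm2 (- x) = - vm2 x"
  by (simp_all add: vec_eq_iff forall_2 mat_def)

lemma vm2_inj: "vm2 x = vm2 y \<longleftrightarrow> x = y"
  by (auto simp: vec_eq_iff forall_2 m2_eq_iff)

definition qi :: "complex m2" where "qi = M2 \<i> 0 0 (- \<i>)"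
definition qj :: "complex m2" where "qj = M2 0 1 (-1) 0"

lemma quat_vm2: "quat_I = vm2 qi" "quat_J = vm2 qj"
  by (simp_all add: quat_I_def quat_J_def vm2_def qi_def qj_def)

text \<open>\<open>I\<close> and \<open>J\<close> satisfy the same relations as \<open>gs 0\<close>
  and \<open>js0\<close>, so both groups have the same table, and the eight normal forms exhaust the
  eight listed matrices by counting.\<close>

lemma Q8_base: "base (8, 2) Q8"
proof (rule dih_base[OF _ gs_powers(2) distinct_powers(4) gs_conj(4,9) not_in_cyc(5) dih_goods(11),
    where \<sigma> = "\<lambda>p. vm2 (qi ^ fst p * qj ^ snd p)"])
  have p: "qi ^ 4 = 1" "distinct (map (\<lambda>a. qi ^ a) [0..<4])" "qj * qi = qi ^ (4 - 1) * qj" "qj * qj = qi ^ 2"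
    by (simp_all add: upt_rec numeral_eq_Suc qi_def qj_def m2_eq_iff complex_eq_iff)
  have q: "qj \<notin> set (cyc qi 4 0)"
  proof -
    have "a12 (qi ^ a) = 0 \<and> a21 (qi ^ a) = 0" for a by (induction a) (simp_all add: qi_def)
    moreover have "a12 qj = 1" by (simp add: qj_def)
    ultimately have "qj \<noteq> qi ^ a" for a by (metis zero_neq_one)
    then show ?thesis unfolding set_cyc by blast
  qed
  note pr = dih_presentation[OF _ p(1-3) p(4) q]
  let ?\<sigma> = "\<lambda>p. vm2 (qi ^ fst p * qj ^ snd p)"
  let ?C = "[mat 1, - mat 1, quat_I, - quat_I, quat_J, - quat_J, quat_I ** quat_J, - (quat_I ** quat_J)]"
  have C: "carrier Q8 = set ?C" by (simp add: Q8_def matrix_group_def)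
  have inj: "inj_on ?\<sigma> (set (mcI 4))" using pr(1) unfolding inj_on_def vm2_inj by simp
  have sub: "?\<sigma> ` set (mcI 4) \<subseteq> set ?C"
  proof
    fix y assume "y \<in> ?\<sigma> ` set (mcI 4)"
    then obtain a b where ab: "a < 4" "b < 2" "y = vm2 (qi ^ a * qj ^ b)" by (auto simp: mcI_def)
    have i: "qi ^ 2 = -1" "qi ^ 3 = - qi" by (simp_all add: numeral_eq_Suc qi_def m2_eq_iff)
    have "a \<in> {0, 1, 2, 3}" "b \<in> {0, 1}" using ab(1,2) by auto
    then show "y \<in> set ?C" unfolding ab(3)
      by (elim insertE emptyE) (simp_all add: i vm2_1 vm2_minus vm2_mult quat_vm2)
  qed
  have "card (set ?C) \<le> 8" using card_length[of ?C] by simp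
  moreover have "card (?\<sigma> ` set (mcI 4)) = 8" unfolding card_image[OF inj]
    using distinct_card[of "mcI 4"] by (simp add: mcI_def distinct_product)
  ultimately have "?\<sigma> ` set (mcI 4) = set ?C" using card_seteq[OF _ sub] by simp
  then show "bij_betw ?\<sigma> (set (mcI 4)) (carrier Q8)" unfolding C bij_betw_def using inj by blast
  show "?\<sigma> (mcm 4 2 p q) = ?\<sigma> p \<otimes>\<^bsub>Q8\<^esub> ?\<sigma> q" if "p \<in> set (mcI 4)" "q \<in> set (mcI 4)" for p q
    using pr(2)[OF _ that] unfolding vm2_mult[symmetric] by (simp add: Q8_def matrix_group_def vm2_mult[symmetric])
qed simp

section \<open>\<open>SL(2, 3)\<close> by integer quadruples\<close>

definition sl3L :: "iquad list" where
  "sl3L = filter (\<lambda>(a, b, c, d). (a * d - b * c) mod 3 = 1) (List.product [0, 1, 2] (List.product [0, 1, 2] (List.product [0, 1, 2] [0, 1, 2])))"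
definition mul3 :: "iquad \<Rightarrow> iquad \<Rightarrow> iquad" where
  "mul3 = (\<lambda>(a, b, c, d) (a', b', c', d'). ((a * a' + b * c') mod 3, (a * b' + b * d') mod 3, (c * a' + d * c') mod 3, (c * b' + d * d') mod 3))"
definition vec3 :: "iquad \<Rightarrow> 3 ^ 2 ^ 2" where
  "vec3 = (\<lambda>(a, b, c, d). vm2 (M2 (of_int a) (of_int b) (of_int c) (of_int d)))"

lemma numeral_type_3: "(0 :: 3) \<noteq> 1" "(0 :: 3) \<noteq> 2" "(1 :: 3) \<noteq> 2" "(x :: 3) \<in> {0, 1, 2}"
proof -
  show n: "(0 :: 3) \<noteq> 1" "(0 :: 3) \<noteq> 2" "(1 :: 3) \<noteq> 2" by simp_all
  have "card {0, 1, 2 :: 3} = 3" using n by simp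
  then have "{0, 1, 2 :: 3} = UNIV" using card_seteq[of "UNIV :: 3 set" "{0, 1, 2}"] by simp
  then show "x \<in> {0, 1, 2}" by simp
qed

lemma of_int_mod3: "(of_int (x mod 3) :: 3) = of_int x"
proof -
  have z: "(3 :: 3) = 0" by simp
  have "(of_int x :: 3) = of_int (3 * (x div 3) + x mod 3)" by simp
  also have "\<dots> = of_int (x mod 3)"
    unfolding of_int_add of_int_mult of_int_numeral z by (simp only: mult_zero_left add_0)
  finally show ?thesis ..
qed

lemma of_int_3_eq: "(of_int a :: 3) = of_int b \<longleftrightarrow> a mod 3 = b mod 3"
proof -
  have "a mod 3 \<in> {0, 1, 2}" "b mod 3 \<in> {0, 1, 2}" by auto
  then have "(of_int (a mod 3) :: 3) = of_int (b mod 3) \<longleftrightarrow> a mod 3 = b mod 3"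
    using numeral_type_3(1-3) numeral_type_3(1-3)[symmetric] by auto
  then show ?thesis unfolding of_int_mod3 .
qed

lemma sl3L_iff: "(a, b, c, d) \<in> set sl3L \<longleftrightarrow> a \<in> {0, 1, 2} \<and> b \<in> {0, 1, 2} \<and> c \<in> {0, 1, 2} \<and> d \<in> {0, 1, 2} \<and> (a * d - b * c) mod 3 = 1"
  unfolding sl3L_def set_filter set_product mem_Collect_eq mem_Sigma_iff prod.case list.set by blast

lemma bij_vec3: "bij_betw vec3 (set sl3L) (carrier SL23)"
proof (rule bij_betwI')
  have r: "x mod 3 = x" if "x \<in> {0, 1, 2}" for x :: int using that by auto
  have dt: "det (vec3 (a, b, c, d)) = 1 \<longleftrightarrow> (a * d - b * c) mod 3 = 1" for a b c d
  proof -
    have "det (vec3 (a, b, c, d)) = of_int (a * d - b * c)" unfolding vec3_def det_2 by simp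
    then show ?thesis using of_int_3_eq[of "a * d - b * c" 1] by simp
  qed
  have ca: "carrier SL23 = {A. det A = 1}" by (simp add: SL23_def matrix_group_def)
  fix p q assume pq: "p \<in> set sl3L" "q \<in> set sl3L"
  obtain a b c d where p: "p = (a, b, c, d)" by (metis prod_cases4)
  obtain a' b' c' d' where q: "q = (a', b', c', d')" by (metis prod_cases4)
  show "(vec3 p = vec3 q) = (p = q)"
    using pq r unfolding p q sl3L_iff vec3_def by (auto simp: vm2_inj of_int_3_eq)
next
  fix p assume "p \<in> set sl3L"
  obtain a b c d where p: "p = (a, b, c, d)" by (metis prod_cases4)
  have "det (vec3 (a, b, c, d)) = of_int (a * d - b * c)" unfolding vec3_def det_2 by simp
  then show "vec3 p \<in> carrier SL23" using \<open>p \<in> set sl3L\<close> of_int_3_eq[of "a * d - b * c" 1]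
    unfolding p sl3L_iff by (simp add: SL23_def matrix_group_def)
next
  fix A assume "A \<in> carrier SL23"
  then have A: "det A = 1" by (simp add: SL23_def matrix_group_def)
  have "\<exists>z\<in>{0, 1, 2}. x = of_int z" for x :: 3 using numeral_type_3(4)[of x] by auto
  then obtain f where f: "\<And>x :: 3. f x \<in> {0, 1, 2 :: int}" "\<And>x :: 3. x = of_int (f x)" by metis
  let ?p = "(f (A $ 1 $ 1), f (A $ 1 $ 2), f (A $ 2 $ 1), f (A $ 2 $ 2))"
  have e: "A = vec3 ?p" by (simp add: vec3_def vec_eq_iff forall_2 f(2)[symmetric])
  have "(of_int (f (A $ 1 $ 1) * f (A $ 2 $ 2) - f (A $ 1 $ 2) * f (A $ 2 $ 1)) :: 3) = of_int 1"
    using A unfolding det_2 by (simp add: f(2)[symmetric])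
  then have "?p \<in> set sl3L" unfolding of_int_3_eq sl3L_iff using f(1) by simp
  then show "\<exists>p\<in>set sl3L. A = vec3 p" using e by blast
qed

lemma vec3_mult: "vec3 (mul3 p q) = vec3 p ** vec3 q"
proof -
  obtain a b c d a' b' c' d' where p: "p = (a, b, c, d)" "q = (a', b', c', d')" by (metis prod_cases4)
  show ?thesis unfolding p by (simp add: vec3_def mul3_def vm2_mult[symmetric] of_int_mod3 vm2_inj m2_eq_iff)
qed

text \<open>Reduction of the Hurwitz quaternions modulo 3, with \<open>i = (0, -1; 1, 0)\<close> and
  \<open>j = (1, 1; 1, -1)\<close>; halving is multiplication by 2.\<close>

definition qmod3 :: "iquad \<Rightarrow> iquad" where
  "qmod3 = (\<lambda>(a, b, c, d). (2 * (a + c - d) mod 3, 2 * (c + d - b) mod 3, 2 * (b + c + d) mod 3, 2 * (a - c + d) mod 3))"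

text \<open>Reduction of the Hurwitz units modulo three is multiplicative and injective, and there
  are as many units as matrices of determinant one.\<close>

lemma SL23_base: "base (24, 2) SL23"
proof (rule base_realize[where \<rho> = "\<lambda>p. iota (qst p)" and A = "set hurwitz" and \<sigma> = "vec3 \<circ> qmod3" and m = "\<lambda>p q. qhalf (qmul p q)"])
  have i: "(\<lambda>p. iota (qst p)) ` set hurwitz = iota ` set sls" unfolding sls_def by (simp add: image_image)
  show "good ((\<lambda>p. iota (qst p)) ` set hurwitz) ((\<lambda>p. iota (qst p)) ` set hurwitz) ((24, 2), (24, 2))"
    unfolding i by (rule good_iota(1)[OF sls_good])
  show "det3 h = 1" if "h \<in> (\<lambda>p. iota (qst p)) ` set hurwitz" for h using good_iota(2)[OF sls_good] that unfolding i .
  show "inj_on (\<lambda>p. iota (qst p)) (set hurwitz)" unfolding iota_cong using inj_qst inj_on_subset by blast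
  have "bij_betw qmod3 (set hurwitz) (set sl3L)"
  proof (rule bij_betw_lists)
    show "distinct (map qmod3 hurwitz)" by code_simp
    show "list_all (\<lambda>p. List.member sl3L (qmod3 p)) hurwitz" by code_simp
    show "length sl3L = length hurwitz" by code_simp
  qed
  then show "bij_betw (vec3 \<circ> qmod3) (set hurwitz) (carrier SL23)" using bij_vec3 by (rule bij_betw_trans)
  fix p q assume pq: "p \<in> set hurwitz" "q \<in> set hurwitz"
  obtain r where r: "r \<in> set hurwitz" "qdbl r = qmul p q" using hurwitz_closed[OF pq] by metis
  have rh: "qhalf (qmul p q) = r" unfolding r(2)[symmetric] by (rule qhalf_qdbl)
  show "qhalf (qmul p q) \<in> set hurwitz" unfolding rh by (rule r(1))
  show "iota (qst p) * iota (qst q) = iota (qst (qhalf (qmul p q)))"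
    unfolding rh iota_mult[symmetric] using qst_mult[OF r(2)] by simp
  have "list_all (\<lambda>p. list_all (\<lambda>q. qmod3 (qhalf (qmul p q)) = mul3 (qmod3 p) (qmod3 q)) hurwitz) hurwitz" by code_simp
  then have "qmod3 (qhalf (qmul p q)) = mul3 (qmod3 p) (qmod3 q)" using pq unfolding list_all_iff by blast
  then show "(vec3 \<circ> qmod3) (qhalf (qmul p q)) = (vec3 \<circ> qmod3) p \<otimes>\<^bsub>SL23\<^esub> (vec3 \<circ> qmod3) q"
    by (simp add: vec3_mult SL23_def matrix_group_def)
qed

subsection \<open>The types of the groups with a given label\<close>

lemma cyc_bases: "base (1, 1) (Cyc 1)" "base (2, 2) (Cyc 2)" "base (3, 1) (Cyc 3)" "base (4, 2) (Cyc 4)" "base (6, 2) (Cyc 6)"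
  subgoal by (rule cyc_base[OF _ _ distinct_powers(1) cyc_goods(1)]) simp_all
  subgoal by (rule cyc_base[OF _ refl0_conj(3) distinct_powers(2) cyc_goods(2)]) simp
  subgoal by (rule cyc_base[OF _ gs_powers(1) distinct_powers(3) cyc_goods(4)]) simp
  subgoal by (rule cyc_base[OF _ gs_powers(2) distinct_powers(4) cyc_goods(5)]) simp
  subgoal by (rule cyc_base[OF _ gs_powers(3) distinct_powers(5) cyc_goods(7)]) simp
  done

lemma model_Dih: "m > 0 \<Longrightarrow> model (Dih m) (sdL m 2) (sdmul m 2)"
  unfolding Dih_def by (rule model_sd) simp_all

lemma klein_base: "base (4, 4) (Cyc 2 \<times>\<times> Cyc 2)"
proof -
  have T: "model (Cyc 2 \<times>\<times> Cyc 2) (List.product (cycL 2) (cycL 2)) (dpmul (cmul 2) (cmul 2))"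
    by (intro model_DirProd model_Cyc) simp_all
  show ?thesis
    by (rule dih_base_model[where \<sigma> = "\<lambda>p. (int (fst p), int (snd p))",
        OF _ refl0_conj(3) distinct_powers(2) refl0_conj(1,2) not_in_cyc(1) dih_goods(1) T]; code_simp)
qed

lemma dih_bases: "base (6, 4) (Dih 3)" "base (8, 6) (Dih 4)" "base (12, 8) (Dih 6)"
  subgoal by (rule dih_base_model[where \<sigma> = "\<lambda>p. (int (fst p), int (snd p))",
        OF _ gs_powers(1) distinct_powers(3) gs_conj(1,6) not_in_cyc(2) dih_goods(3) model_Dih]; code_simp)
  subgoal by (rule dih_base_model[where \<sigma> = "\<lambda>p. (int (fst p), int (snd p))",
        OF _ gs_powers(2) distinct_powers(4) gs_conj(2,7) not_in_cyc(3) dih_goods(5) model_Dih]; code_simp)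
  subgoal by (rule dih_base_model[where \<sigma> = "\<lambda>p. (int (fst p), int (snd p))",
        OF _ gs_powers(3) distinct_powers(5) gs_conj(3,8) not_in_cyc(4) dih_goods(8) model_Dih]; code_simp)
  done

text \<open>With \<open>g\<close> of order six and \<open>x\<^sup>2 = g\<^sup>3\<close>, the normal subgroup of order three is generated by
  \<open>r = g\<^sup>2\<close>, and \<open>g = r\<^sup>2 x\<^sup>2\<close>.\<close>

lemma dic3_base: "base (12, 2) (Cyc_inversion_Cyc 3 4)"
proof -
  have T: "model (Cyc_inversion_Cyc 3 4) (sdL 3 4) (sdmul 3 4)" by (rule model_sd) simp_all
  show ?thesis
    by (rule dih_base_model[where \<sigma> = "\<lambda>p. (2 * int (fst p) mod 3, (2 * int (fst p) + int (snd p)) mod 4)",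
        OF _ gs_powers(3) distinct_powers(5) gs_conj(5,10) not_in_cyc(6) dih_goods(13) T]; code_simp)
qed

section \<open>Adjoining the central element -1\<close>

lemma card_pm:
  fixes N :: "qf m3 set"
  assumes "finite N" "\<And>g. g \<in> N \<Longrightarrow> det3 g = 1"
  shows "card (N \<union> uminus ` N) = 2 * card N"
proof -
  have "N \<inter> uminus ` N = {}"
  proof (rule ccontr)
    assume "N \<inter> uminus ` N \<noteq> {}"
    then obtain x where x: "x \<in> N" "- x \<in> N" by force
    then show False using assms(2)[OF x(1)] assms(2)[OF x(2)] by (simp add: det3_minus)
  qed
  moreover have "card (uminus ` N) = card N" by (rule card_image) simp
  ultimately show ?thesis using assms(1) by (simp add: card_Un_disjoint)
qed

lemma nrm_square: "nrm x * nrm x = x * x" by (simp add: nrm_def)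

lemma inj_nrm:
  assumes "fgrp H" "-1 \<notin> H"
  shows "inj_on nrm H"
proof (rule inj_onI)
  fix h k assume hk: "h \<in> H" "k \<in> H" "nrm h = nrm k"
  then have "h = k \<or> h = - k" unfolding nrm_def by (auto split: if_splits)
  then show "h = k" using neg_mem[OF assms(1) hk(2)] assms(2) hk(1) by blast
qed

lemma nrm_pm:
  assumes "fgrp H" "-1 \<in> H"
  shows "H = nrm ` H \<union> uminus ` nrm ` H"
  using build_nrm[OF assms(1)] assms(2) by (simp add: build_def)

text \<open>The value of \<open>tau\<close> for the subgroup itself. With \<open>-1\<close> present
  the subgroup is the product of \<open>N\<close> with the two signs and both numbers double;
  otherwise \<open>nrm\<close> is an isomorphism onto \<open>N\<close>.\<close>

definition ltau :: "((nat \<times> nat) \<times> (nat \<times> nat)) \<times> bool \<Rightarrow> nat \<times> nat" where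
  "ltau l = (if snd l then (2 * fst (fst (fst l)), 2 * snd (fst (fst l))) else fst (fst l))"

lemma tau_label:
  assumes "fgrp H"
  shows "tau H = ltau (label H)"
proof (cases "-1 \<in> H")
  case True
  let ?N = "nrm ` H"
  let ?I = "\<lambda>A. {x \<in> A. x * x = (1 :: qf m3)}"
  have fin: "finite ?N" using fgrpD(1)[OF assms] by simp
  have d: "\<And>g. g \<in> ?N \<Longrightarrow> det3 g = 1" using det3_nrm[OF assms] by blast
  have "?I (?N \<union> uminus ` ?N) = ?I ?N \<union> uminus ` ?I ?N" by auto
  then have "card (?I H) = 2 * card (?I ?N)" using card_pm[of "?I ?N"] fin d nrm_pm[OF assms True] by simp
  moreover have "card H = 2 * card ?N" using card_pm[OF fin d] nrm_pm[OF assms True] by simp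
  ultimately show ?thesis using True by (simp add: tau_def ltau_def label_def)
next
  case False
  note i = inj_nrm[OF assms False]
  have "{y \<in> nrm ` H. y * y = 1} = nrm ` {x \<in> H. x * x = 1}" by (auto simp: nrm_square)
  then show ?thesis using False card_image[OF i] card_image[OF inj_on_subset[OF i], of "{x \<in> H. x * x = 1}"]
    by (simp add: tau_def ltau_def label_def)
qed

definition is_type :: "nat \<times> nat \<Rightarrow> bool \<Rightarrow> ('c, 'd) monoid_scheme \<Rightarrow> bool" where
  "is_type s b T \<longleftrightarrow> (\<forall>H. fgrp H \<longrightarrow> fst (fst (label H)) = s \<longrightarrow> snd (label H) = b \<longrightarrow> mgroup H \<cong> T)"

lemma is_type_F:
  assumes "base s T"
  shows "is_type s False T"
  unfolding is_type_def
proof (intro allI impI)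
  fix H assume H: "fgrp H" "fst (fst (label H)) = s" "snd (label H) = False"
  have m: "-1 \<notin> H" using H(3) by (simp add: label_def)
  have "nrm \<in> iso (mgroup H) (mgroup (nrm ` H))"
    unfolding iso_def hom_def bij_betw_def using inj_nrm[OF H(1) m] nrm_mult[OF H(1)] by simp
  then have "mgroup H \<cong> mgroup (nrm ` H)" by (rule is_isoI)
  moreover have "mgroup (nrm ` H) \<cong> T"
    using assms H(2) gpD(1)[OF gp_nrm(1)[OF H(1)]] gp_nrm(2)[OF H(1)] unfolding base_def label_def by auto
  ultimately show "mgroup H \<cong> T" by (rule iso_trans)
qed

lemma is_type_T:
  assumes "base s T" "Cyc 2 \<times>\<times> T \<cong> T'"
  shows "is_type s True T'"
  unfolding is_type_def
proof (intro allI impI)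
  fix H assume H: "fgrp H" "fst (fst (label H)) = s" "snd (label H) = True"
  let ?N = "nrm ` H"
  have m: "-1 \<in> H" using H(3) by (simp add: label_def)
  note gN = gp_nrm[OF H(1)]
  have fN: "fgrp ?N" by (rule gpD(1)[OF gN(1)])
  \<comment> \<open>The factor of order two is read as the sign.\<close>
  define f where "f p = (if fst p = 0 then snd p else - snd p)" for p :: "int \<times> qf m3"
  have c2: "carrier (Cyc 2) = {0, 1}" by (auto simp: carrier_integer_mod_group)
  have im: "f ` ({0, 1} \<times> ?N) = ?N \<union> uminus ` ?N"
  proof -
    have p: "{0, 1} \<times> ?N = Pair 0 ` ?N \<union> Pair 1 ` ?N" by auto
    show ?thesis unfolding p image_Un image_image f_def by simp
  qed
  have inj: "inj_on f ({0, 1} \<times> ?N)"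
  proof (rule inj_onI)
    fix p q assume pq: "p \<in> {0, 1} \<times> ?N" "q \<in> {0, 1} \<times> ?N" "f p = f q"
    obtain a x b y where p: "p = (a, x)" "q = (b, y)" by (metis surj_pair)
    have ab: "a \<in> {0, 1}" "b \<in> {0, 1}" and d: "det3 x = 1" "det3 y = 1" using pq(1,2) gN(2) unfolding p by auto
    have "det3 (f p) = det3 (f q)" using pq(3) by simp
    then have "a = b" using ab d unfolding p f_def by (auto simp: det3_minus)
    then show "p = q" using pq(3) ab unfolding p f_def by auto
  qed
  have "f \<in> iso (Cyc 2 \<times>\<times> mgroup ?N) (mgroup H)"
    unfolding iso_def hom_def bij_betw_def using im inj nrm_pm[OF H(1) m]
    by (auto simp: DirProd_def c2 f_def)
  then have "Cyc 2 \<times>\<times> mgroup ?N \<cong> mgroup H" by (rule is_isoI)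
  then have "mgroup H \<cong> Cyc 2 \<times>\<times> mgroup ?N"
    by (rule group.iso_sym[OF DirProd_group[OF group_integer_mod_group group_mgroup[OF fN]]])
  also have "Cyc 2 \<times>\<times> mgroup ?N \<cong> Cyc 2 \<times>\<times> T"
  proof (rule group.DirProd_iso_trans[OF group_integer_mod_group iso_refl])
    show "mgroup ?N \<cong> T" using assms(1) fN gN(2) H(2) unfolding base_def label_def by auto
  qed
  also note assms(2)
  finally show "mgroup H \<cong> T'" .
qed

lemma is_type_T': "base s T \<Longrightarrow> is_type s True (Cyc 2 \<times>\<times> T)"
  by (rule is_type_T[OF _ iso_refl])

section \<open>Recognising isomorphism types from numerical invariants\<close>

lemma tau_iso:
  assumes "fgrp H" "fgrp K" "mgroup H \<cong> mgroup K"
  shows "tau H = tau K"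
proof -
  obtain f where f: "f \<in> hom (mgroup H) (mgroup K)" "bij_betw f H K"
    using assms(3) unfolding is_iso_def iso_def by auto
  have one: "f 1 = 1" using hom_one[OF f(1) group_mgroup[OF assms(1)] group_mgroup[OF assms(2)]] by simp
  have m: "f (x * y) = f x * f y" if "x \<in> H" "y \<in> H" for x y using hom_mult[OF f(1)] that by simp
  note fH = fgrpD[OF assms(1)]
  have i: "inj_on f H" "f ` H = K" using f(2) unfolding bij_betw_def by auto
  have "f x * f x = 1 \<longleftrightarrow> x * x = 1" if x: "x \<in> H" for x
    using inj_onD[OF i(1), of "x * x" 1] fH(2) fH(3)[OF x x] m[OF x x] one by auto
  then have "{y \<in> K. y * y = 1} = f ` {x \<in> H. x * x = 1}" unfolding i(2)[symmetric] by auto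
  then show ?thesis unfolding tau_def using i card_image[OF i(1)] card_image[OF inj_on_subset[OF i(1)], of "{x \<in> H. x * x = 1}"]
    by simp
qed

lemma type_tau:
  fixes H K :: "qf m3 set"
  assumes H: "fgrp H" "mgroup H \<cong> T" and K: "fgrp K" "mgroup K \<cong> T"
  shows "tau H = tau K"
proof -
  have "mgroup K \<cong> mgroup H"
  proof -
    obtain f where f: "f \<in> iso (mgroup H) T" using H(2) unfolding is_iso_def by blast
    obtain g where g: "g \<in> iso (mgroup K) T" using K(2) unfolding is_iso_def by blast
    have fb: "bij_betw f H (carrier T)" and gb: "bij_betw g K (carrier T)" using f g unfolding iso_def by auto
    let ?h = "inv_into H f \<circ> g"
    have b: "bij_betw ?h K H" using bij_betw_trans[OF gb bij_betw_inv_into[OF fb]] .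
    have "?h (x * y) = ?h x * ?h y" if xy: "x \<in> K" "y \<in> K" for x y
    proof -
      have h: "?h x \<in> H" "?h y \<in> H" using bij_betwE[OF b] xy by blast+
      have "f (?h x) = g x" "f (?h y) = g y"
        using bij_betw_inv_into_right[OF fb] bij_betwE[OF gb] xy by auto
      moreover have "f (?h x * ?h y) = f (?h x) \<otimes>\<^bsub>T\<^esub> f (?h y)" using f h unfolding iso_def hom_def by auto
      moreover have "g (x * y) = g x \<otimes>\<^bsub>T\<^esub> g y" using g xy unfolding iso_def hom_def by auto
      ultimately have "f (?h x * ?h y) = g (x * y)" by simp
      moreover have "?h x * ?h y \<in> H" using fgrpD(3)[OF H(1)] h by blast
      ultimately show ?thesis using bij_betw_inv_into_left[OF fb] by (metis comp_apply)
    qed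
    then have "?h \<in> iso (mgroup K) (mgroup H)" using b unfolding iso_def hom_def by (auto dest: bij_betwE)
    then show ?thesis by (rule is_isoI)
  qed
  then show ?thesis using tau_iso[OF K(1) H(1)] by simp
qed

text \<open>\<open>ps\<close> collects the values of \<open>tau N\<close> and the bit for
  \<open>-1\<close> from all labels with invariant \<open>v\<close>. The condition \<open>c\<close>
  on the bit serves the value \<open>(12, 4)\<close>, which two types share.\<close>

lemma type_if:
  fixes H :: "qf m3 set"
  assumes ps: "list_all (\<lambda>l. ltau l = v \<and> c (snd l) \<longrightarrow> List.member ps (fst (fst l), snd l)) all_labels"
    and t: "\<And>s b. (s, b) \<in> set ps \<Longrightarrow> is_type s b T"
    and H: "fgrp H" "tau H = v" "c (-1 \<in> H)"
  shows "mgroup H \<cong> T"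
proof -
  have "snd (label H) = (-1 \<in> H)" by (simp add: label_def)
  then have "ltau (label H) = v \<and> c (snd (label H))" using tau_label[OF H(1)] H(2,3) by simp
  then have "(fst (fst (label H)), snd (label H)) \<in> set ps"
    using ps label_mem[OF H(1)] unfolding list_all_iff List.member_iff by blast
  then show ?thesis using t H(1) unfolding is_type_def by blast
qed

text \<open>Some label in the list has invariant \<open>v\<close>, and a group with that label has
  type \<open>T\<close>; since \<open>tau\<close> is an isomorphism invariant, every group of type
  \<open>T\<close> has this value.\<close>

lemma type_only_if:
  fixes H :: "qf m3 set"
  assumes ps: "list_all (\<lambda>l. ltau l = v \<and> c (snd l) \<longrightarrow> List.member ps (fst (fst l), snd l)) all_labels"
    and t: "\<And>s b. (s, b) \<in> set ps \<Longrightarrow> is_type s b T"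
    and ex: "list_ex (\<lambda>l. ltau l = v \<and> c (snd l)) all_labels"
    and H: "fgrp H" "mgroup H \<cong> T"
  shows "tau H = v"
proof -
  obtain l where l: "l \<in> set all_labels" "ltau l = v" "c (snd l)" using ex unfolding list_ex_iff by blast
  obtain K where K: "fgrp K" "label K = l" using label_exists[OF l(1)] .
  have "tau K = v" using tau_label[OF K(1)] K(2) l(2) by simp
  moreover have "mgroup K \<cong> T"
    by (rule type_if[OF ps t K(1) calculation]) (use l(3) K(2) in \<open>auto simp: label_def\<close>)
  ultimately show ?thesis using type_tau[OF H K(1)] by simp
qed

lemma type_iff:
  fixes H :: "qf m3 set"
  assumes ps: "list_all (\<lambda>l. ltau l = v \<and> True \<longrightarrow> List.member ps (fst (fst l), snd l)) all_labels"
    and ex: "list_ex (\<lambda>l. ltau l = v \<and> True) all_labels"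
    and t: "list_all (\<lambda>(s, b). is_type s b T) ps"
    and H: "fgrp H"
  shows "mgroup H \<cong> T \<longleftrightarrow> tau H = v"
proof -
  have t: "is_type s b T" if "(s, b) \<in> set ps" for s b using t that unfolding list_all_iff by auto
  show ?thesis
    using type_if[where c = "\<lambda>_. True", OF ps t H] type_only_if[where c = "\<lambda>_. True", OF ps t ex H] by blast
qed

text \<open>The Chinese remainder map \<open>(a, b) \<mapsto> 3 a + 2 b\<close> modulo six, applied
  to the rotation part in the dihedral case.\<close>

lemma DirProd_isos: "Cyc 2 \<times>\<times> Cyc 1 \<cong> Cyc 2" "Cyc 2 \<times>\<times> Cyc 3 \<cong> Cyc 6" "Cyc 2 \<times>\<times> Dih 3 \<cong> Dih 6"
  subgoal by (rule model_iso[where \<sigma> = fst, OF model_DirProd[OF model_Cyc model_Cyc] model_Cyc]; code_simp)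
  subgoal by (rule model_iso[where \<sigma> = "\<lambda>p. (3 * fst p + 2 * snd p) mod 6", OF model_DirProd[OF model_Cyc model_Cyc] model_Cyc]; code_simp)
  subgoal by (rule model_iso[where \<sigma> = "\<lambda>p. ((3 * fst p + 2 * fst (snd p)) mod 6, snd (snd p))",
        OF model_DirProd[OF model_Cyc model_Dih] model_Dih]; code_simp)
  done

text \<open>A matrix group known to be of both types mediates between \<open>Dih 3\<close> and
  \<open>sym_group 3\<close>, in place of an explicit map.\<close>

lemma dih6_sym3: "Cyc 2 \<times>\<times> Dih 6 \<cong> Cyc 2 \<times>\<times> Cyc 2 \<times>\<times> sym_group 3"
proof -
  have "(((6, 4), (6, 4)), False) \<in> set all_labels" by (simp add: all_labels_def pair_labels_def)
  from label_exists[OF this] obtain K where K: "fgrp K" "label K = (((6, 4), (6, 4)), False)" .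
  have "mgroup K \<cong> Dih 3" "mgroup K \<cong> sym_group 3"
    using is_type_F[OF dih_bases(1)] is_type_F[OF sym3_base] K unfolding is_type_def by auto
  moreover have g: "group (mgroup K)" by (rule group_mgroup[OF K(1)])
  ultimately have KD: "mgroup K \<cong> Dih 3" "mgroup K \<cong> sym_group 3" by blast+
  have C: "group (Cyc 2)" by simp
  have "Cyc 2 \<times>\<times> mgroup K \<cong> Cyc 2 \<times>\<times> Dih 3" by (rule group.DirProd_iso_trans[OF C iso_refl KD(1)])
  also note DirProd_isos(3)
  finally have "Dih 6 \<cong> Cyc 2 \<times>\<times> mgroup K" by (rule group.iso_sym[OF DirProd_group[OF C g]])
  also have "Cyc 2 \<times>\<times> mgroup K \<cong> Cyc 2 \<times>\<times> sym_group 3" by (rule group.DirProd_iso_trans[OF C iso_refl KD(2)])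
  finally show ?thesis by (rule group.DirProd_iso_trans[OF C iso_refl])
qed

text \<open>Each \<open>ps\<close> lists the values of \<open>tau N\<close> and the bit for
  \<open>-1\<close> that lead to the given \<open>tau H\<close>. Two entries mean that the type
  occurs both with and without \<open>-1\<close>, as the cyclic group of order six does.\<close>

lemma types:
  fixes H :: "qf m3 set"
  assumes "fgrp H"
  shows "mgroup H \<cong> Cyc 1 \<longleftrightarrow> tau H = (1, 1)"
    "mgroup H \<cong> Cyc 2 \<longleftrightarrow> tau H = (2, 2)"
    "mgroup H \<cong> Cyc 3 \<longleftrightarrow> tau H = (3, 1)"
    "mgroup H \<cong> Cyc 4 \<longleftrightarrow> tau H = (4, 2)"
    "mgroup H \<cong> Cyc 2 \<times>\<times> Cyc 2 \<longleftrightarrow> tau H = (4, 4)"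
    "mgroup H \<cong> sym_group 3 \<longleftrightarrow> tau H = (6, 4)"
    "mgroup H \<cong> Cyc 6 \<longleftrightarrow> tau H = (6, 2)"
    "mgroup H \<cong> Cyc 2 \<times>\<times> Cyc 4 \<longleftrightarrow> tau H = (8, 4)"
    "mgroup H \<cong> Q8 \<longleftrightarrow> tau H = (8, 2)"
    "mgroup H \<cong> Cyc 2 \<times>\<times> Cyc 2 \<times>\<times> Cyc 2 \<longleftrightarrow> tau H = (8, 8)"
    "mgroup H \<cong> Dih 4 \<longleftrightarrow> tau H = (8, 6)"
    "mgroup H \<cong> Dih 6 \<longleftrightarrow> tau H = (12, 8)"
    "mgroup H \<cong> Cyc_inversion_Cyc 3 4 \<longleftrightarrow> tau H = (12, 2)"
    "mgroup H \<cong> Cyc 2 \<times>\<times> Q8 \<longleftrightarrow> tau H = (16, 4)"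
    "mgroup H \<cong> Cyc 2 \<times>\<times> Dih 4 \<longleftrightarrow> tau H = (16, 12)"
    "mgroup H \<cong> Cyc 2 \<times>\<times> Cyc_inversion_Cyc 3 4 \<longleftrightarrow> tau H = (24, 4)"
    "mgroup H \<cong> SL23 \<longleftrightarrow> tau H = (24, 2)"
    "mgroup H \<cong> Cyc 2 \<times>\<times> Cyc 2 \<times>\<times> sym_group 3 \<longleftrightarrow> tau H = (24, 16)"
    "mgroup H \<cong> sym_group 4 \<longleftrightarrow> tau H = (24, 10)"
    "mgroup H \<cong> Cyc 2 \<times>\<times> alt_group 4 \<longleftrightarrow> tau H = (24, 8)"
    "mgroup H \<cong> Cyc 2 \<times>\<times> SL23 \<longleftrightarrow> tau H = (48, 4)"
    "mgroup H \<cong> Cyc 2 \<times>\<times> sym_group 4 \<longleftrightarrow> tau H = (48, 20)"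
  subgoal by (rule type_iff[where ps = "[((1, 1), False)]", OF _ _ _ assms], code_simp, code_simp) (simp add: is_type_F cyc_bases[simplified])
  subgoal by (rule type_iff[where ps = "[((2, 2), False), ((1, 1), True)]", OF _ _ _ assms], code_simp, code_simp)
    (use is_type_F[OF cyc_bases(2)] is_type_T[OF cyc_bases(1) DirProd_isos(1)] in simp)
  subgoal by (rule type_iff[where ps = "[((3, 1), False)]", OF _ _ _ assms], code_simp, code_simp) (use is_type_F[OF cyc_bases(3)] in simp)
  subgoal by (rule type_iff[where ps = "[((4, 2), False)]", OF _ _ _ assms], code_simp, code_simp) (use is_type_F[OF cyc_bases(4)] in simp)
  subgoal by (rule type_iff[where ps = "[((4, 4), False), ((2, 2), True)]", OF _ _ _ assms], code_simp, code_simp)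
    (use is_type_F[OF klein_base] is_type_T'[OF cyc_bases(2)] in simp)
  subgoal by (rule type_iff[where ps = "[((6, 4), False)]", OF _ _ _ assms], code_simp, code_simp) (use is_type_F[OF sym3_base] in simp)
  subgoal by (rule type_iff[where ps = "[((6, 2), False), ((3, 1), True)]", OF _ _ _ assms], code_simp, code_simp)
    (use is_type_F[OF cyc_bases(5)] is_type_T[OF cyc_bases(3) DirProd_isos(2)] in simp)
  subgoal by (rule type_iff[where ps = "[((4, 2), True)]", OF _ _ _ assms], code_simp, code_simp) (use is_type_T'[OF cyc_bases(4)] in simp)
  subgoal by (rule type_iff[where ps = "[((8, 2), False)]", OF _ _ _ assms], code_simp, code_simp) (use is_type_F[OF Q8_base] in simp)
  subgoal by (rule type_iff[where ps = "[((4, 4), True)]", OF _ _ _ assms], code_simp, code_simp) (use is_type_T'[OF klein_base] in simp)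
  subgoal by (rule type_iff[where ps = "[((8, 6), False)]", OF _ _ _ assms], code_simp, code_simp) (use is_type_F[OF dih_bases(2)] in simp)
  subgoal by (rule type_iff[where ps = "[((12, 8), False), ((6, 4), True)]", OF _ _ _ assms], code_simp, code_simp)
    (use is_type_F[OF dih_bases(3)] is_type_T[OF dih_bases(1) DirProd_isos(3)] in simp)
  subgoal by (rule type_iff[where ps = "[((12, 2), False)]", OF _ _ _ assms], code_simp, code_simp) (use is_type_F[OF dic3_base] in simp)
  subgoal by (rule type_iff[where ps = "[((8, 2), True)]", OF _ _ _ assms], code_simp, code_simp) (use is_type_T'[OF Q8_base] in simp)
  subgoal by (rule type_iff[where ps = "[((8, 6), True)]", OF _ _ _ assms], code_simp, code_simp) (use is_type_T'[OF dih_bases(2)] in simp)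
  subgoal by (rule type_iff[where ps = "[((12, 2), True)]", OF _ _ _ assms], code_simp, code_simp) (use is_type_T'[OF dic3_base] in simp)
  subgoal by (rule type_iff[where ps = "[((24, 2), False)]", OF _ _ _ assms], code_simp, code_simp) (use is_type_F[OF SL23_base] in simp)
  subgoal by (rule type_iff[where ps = "[((12, 8), True)]", OF _ _ _ assms], code_simp, code_simp) (use is_type_T[OF dih_bases(3) dih6_sym3] in simp)
  subgoal by (rule type_iff[where ps = "[((24, 10), False)]", OF _ _ _ assms], code_simp, code_simp) (use is_type_F[OF sym4_base] in simp)
  subgoal by (rule type_iff[where ps = "[((12, 4), True)]", OF _ _ _ assms], code_simp, code_simp) (use is_type_T'[OF alt4_base] in simp)
  subgoal by (rule type_iff[where ps = "[((24, 2), True)]", OF _ _ _ assms], code_simp, code_simp) (use is_type_T'[OF SL23_base] in simp)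
  subgoal by (rule type_iff[where ps = "[((24, 10), True)]", OF _ _ _ assms], code_simp, code_simp) (use is_type_T'[OF sym4_base] in simp)
  done

lemma not_both:
  fixes H :: "qf m3 set"
  assumes "mgroup H \<cong> alt_group 4" "mgroup H \<cong> Cyc 2 \<times>\<times> Cyc 6"
    and "fgrp H"
  shows False
proof -
  obtain f where f: "f \<in> iso (mgroup H) (alt_group 4)" using assms(1) unfolding is_iso_def by blast
  obtain g where g: "g \<in> iso (mgroup H) (Cyc 2 \<times>\<times> Cyc 6)" using assms(2) unfolding is_iso_def by blast
  have fb: "f ` H = carrier (alt_group 4)" and fm: "\<And>x y. x \<in> H \<Longrightarrow> y \<in> H \<Longrightarrow> f (x * y) = f x \<circ> f y"
    using f unfolding iso_def hom_def bij_betw_def by (auto simp: alt_group_mult)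
  have gb: "inj_on g H" and gm: "\<And>x y. x \<in> H \<Longrightarrow> y \<in> H \<Longrightarrow> g (x * y) = g x \<otimes>\<^bsub>Cyc 2 \<times>\<times> Cyc 6\<^esub> g y"
    using g unfolding iso_def hom_def bij_betw_def by auto
  \<comment> \<open>A three-cycle and a double transposition, which do not commute, while the
    product of cyclic groups is abelian.\<close>
  let ?p = "[2, 3, 1, 4] :: nat list" and ?q = "[2, 1, 4, 3] :: nat list"
  have "list_all (List.member evenL) [?p, ?q]" by code_simp
  then have "perm ?p \<in> carrier (alt_group 4)" "perm ?q \<in> carrier (alt_group 4)"
    using bij_evenL unfolding bij_betw_def by (auto simp: List.member_iff)
  then have "perm ?p \<in> f ` H" "perm ?q \<in> f ` H" unfolding fb .
  then obtain x y where xy: "x \<in> H" "y \<in> H" "perm ?p = f x" "perm ?q = f y" by blast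
  have "g (x * y) = g (y * x)" unfolding gm[OF xy(1,2)] gm[OF xy(2,1)] by (simp add: DirProd_def case_prod_beta add.commute)
  then have "x * y = y * x" using inj_onD[OF gb] fgrpD(3)[OF assms(3)] xy by blast
  then have "perm ?p \<circ> perm ?q = perm ?q \<circ> perm ?p" unfolding xy(3,4) using fm xy(1,2) by metis
  from fun_cong[OF this, of 1] show False by (simp add: perm_def)
qed

text \<open>Two labels share this value: the rotations of the tetrahedron without \<open>-1\<close>,
  and the cyclic group of order six with \<open>-1\<close> adjoined. The bit for \<open>-1\<close>
  decides between them.\<close>

lemma types_12_4:
  fixes H :: "qf m3 set"
  assumes "fgrp H"
  shows "mgroup H \<cong> alt_group 4 \<longleftrightarrow> tau H = (12, 4) \<and> -1 \<notin> H"
    "mgroup H \<cong> Cyc 2 \<times>\<times> Cyc 6 \<longleftrightarrow> tau H = (12, 4) \<and> -1 \<in> H"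
proof -
  have A: "list_all (\<lambda>l. ltau l = (12, 4) \<and> \<not> snd l \<longrightarrow> List.member [((12, 4), False)] (fst (fst l), snd l)) all_labels" by code_simp
  have A': "list_ex (\<lambda>l. ltau l = (12, 4) \<and> \<not> snd l) all_labels" by code_simp
  have B: "list_all (\<lambda>l. ltau l = (12, 4) \<and> snd l \<longrightarrow> List.member [((6, 2), True)] (fst (fst l), snd l)) all_labels" by code_simp
  have B': "list_ex (\<lambda>l. ltau l = (12, 4) \<and> snd l) all_labels" by code_simp
  have tA: "is_type s b (alt_group 4)" if "(s, b) \<in> set [((12, 4), False)]" for s b using that is_type_F[OF alt4_base] by simp
  have tB: "is_type s b (Cyc 2 \<times>\<times> Cyc 6)" if "(s, b) \<in> set [((6, 2), True)]" for s b using that is_type_T'[OF cyc_bases(5)] by simp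
  have a: "mgroup H \<cong> alt_group 4" if "tau H = (12, 4)" "-1 \<notin> H" by (rule type_if[where c = Not, OF A tA assms that])
  have b: "mgroup H \<cong> Cyc 2 \<times>\<times> Cyc 6" if "tau H = (12, 4)" "-1 \<in> H" by (rule type_if[where c = "\<lambda>x. x", OF B tB assms that])
  have a': "tau H = (12, 4)" if "mgroup H \<cong> alt_group 4" by (rule type_only_if[where c = Not, OF A tA A' assms that])
  have b': "tau H = (12, 4)" if "mgroup H \<cong> Cyc 2 \<times>\<times> Cyc 6" by (rule type_only_if[where c = "\<lambda>x. x", OF B tB B' assms that])
  show "mgroup H \<cong> alt_group 4 \<longleftrightarrow> tau H = (12, 4) \<and> -1 \<notin> H"
    "mgroup H \<cong> Cyc 2 \<times>\<times> Cyc 6 \<longleftrightarrow> tau H = (12, 4) \<and> -1 \<in> H"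
    using a b a' b' not_both[OF _ _ assms] by blast+
qed

section \<open>Transfer to complex matrices\<close>

definition vm3 :: "qf m3 \<Rightarrow> complex ^ 3 ^ 3" where
  "vm3 x = vector [vector [cpx (b11 x), cpx (b12 x), cpx (b13 x)],
     vector [cpx (b21 x), cpx (b22 x), cpx (b23 x)], vector [cpx (b31 x), cpx (b32 x), cpx (b33 x)]]"

lemma vm3_nth [simp]:
  "vm3 x $ 1 $ 1 = cpx (b11 x)" "vm3 x $ 1 $ 2 = cpx (b12 x)" "vm3 x $ 1 $ 3 = cpx (b13 x)"
  "vm3 x $ 2 $ 1 = cpx (b21 x)" "vm3 x $ 2 $ 2 = cpx (b22 x)" "vm3 x $ 2 $ 3 = cpx (b23 x)"
  "vm3 x $ 3 $ 1 = cpx (b31 x)" "vm3 x $ 3 $ 2 = cpx (b32 x)" "vm3 x $ 3 $ 3 = cpx (b33 x)"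
  by (simp_all add: vm3_def)

lemma vm3_mult: "vm3 (x * y) = vm3 x ** vm3 y"
  by (simp add: vec_eq_iff forall_3 matrix_matrix_mult_def sum_3 cpx_add cpx_mult)

lemma vm3_1: "vm3 1 = mat 1"
  by (simp add: vec_eq_iff forall_3 mat_def cpx_0 cpx_1)

lemma vm3_eq [simp]: "vm3 x = vm3 y \<longleftrightarrow> x = y"
  by (auto simp: vec_eq_iff forall_3 m3_eq_iff inj_cpx)

lemma inj_vm3: "inj_on vm3 A" by (rule inj_onI) simp

lemma range_vm3: "range vm3 = matrices_over (quadratic_field (- 19))"
proof (intro equalityI subsetI)
  fix A :: "complex ^ 3 ^ 3" assume "A \<in> matrices_over (quadratic_field (- 19))"
  then have "\<forall>i j. \<exists>z. A $ i $ j = cpx z" unfolding matrices_over_def range_cpx[symmetric] by auto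
  then obtain f where f: "\<And>i j. A $ i $ j = cpx (f i j)" by metis
  have "A = vm3 (M3 (f 1 1) (f 1 2) (f 1 3) (f 2 1) (f 2 2) (f 2 3) (f 3 1) (f 3 2) (f 3 3))"
    by (simp add: vec_eq_iff forall_3 f)
  then show "A \<in> range vm3" by blast
next
  fix A assume "A \<in> range vm3"
  then obtain x where "A = vm3 x" by blast
  then show "A \<in> matrices_over (quadratic_field (- 19))"
    unfolding matrices_over_def range_cpx[symmetric] by (simp add: forall_3)
qed

abbreviation GL3 :: "(complex ^ 3 ^ 3) monoid" where "GL3 \<equiv> GL (quadratic_field (- 19))"

lemma GL3_simps [simp]: "x \<otimes>\<^bsub>GL3\<^esub> y = x ** y" "\<one>\<^bsub>GL3\<^esub> = mat 1"
  by (simp_all add: GL_def matrix_group_def)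

lemma vm3_in_GL3: "vm3 x \<in> carrier GL3 \<longleftrightarrow> (\<exists>y. x * y = 1 \<and> y * x = 1)"
proof -
  have "vm3 x \<in> carrier GL3 \<longleftrightarrow> (\<exists>y. vm3 x ** vm3 y = mat 1 \<and> vm3 y ** vm3 x = mat 1)"
    unfolding GL_def matrix_group_def range_vm3[symmetric] by auto
  then show ?thesis unfolding vm3_mult[symmetric] vm3_1[symmetric] vm3_eq .
qed

lemma carrier_GL3:
  assumes "A \<in> carrier GL3"
  obtains x y where "A = vm3 x" "x * y = 1" "y * x = 1" "vm3 y \<in> carrier GL3"
proof -
  have "A \<in> range vm3" using assms unfolding range_vm3 by (simp add: GL_def matrix_group_def)
  then obtain x where x: "A = vm3 x" by blast
  then obtain y where "x * y = 1" "y * x = 1" using assms vm3_in_GL3 by auto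
  then show thesis using that x vm3_in_GL3[of y] by blast
qed

lemma group_GL3: "group GL3"
proof (rule groupI)
  show "\<one>\<^bsub>GL3\<^esub> \<in> carrier GL3" using vm3_in_GL3[of 1] by (simp add: vm3_1)
  fix A assume A: "A \<in> carrier GL3"
  then obtain x y where x: "A = vm3 x" "x * y = 1" "y * x = 1" "vm3 y \<in> carrier GL3" by (rule carrier_GL3)
  show "\<exists>B\<in>carrier GL3. B \<otimes>\<^bsub>GL3\<^esub> A = \<one>\<^bsub>GL3\<^esub>" 
    by (rule bexI[of _ "vm3 y"]) (simp_all add: x(1,3,4) vm3_mult[symmetric] vm3_1)
  fix B assume B: "B \<in> carrier GL3"
  then obtain u v where u: "B = vm3 u" "u * v = 1" "v * u = 1" "vm3 v \<in> carrier GL3" by (rule carrier_GL3)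
  have "x * u * (v * y) = x * (u * v) * y" "v * y * (x * u) = v * (y * x) * u" by (simp_all only: mult.assoc)
  then have "x * u * (v * y) = 1" "v * y * (x * u) = 1" using x u by simp_all
  then have "vm3 (x * u) \<in> carrier GL3" unfolding vm3_in_GL3 by blast
  then show "A \<otimes>\<^bsub>GL3\<^esub> B \<in> carrier GL3" by (simp add: x(1) u(1) vm3_mult)
qed (simp_all add: matrix_mul_assoc)

lemma inv_GL3:
  assumes "x * y = 1" "y * x = 1"
  shows "inv\<^bsub>GL3\<^esub> (vm3 x) = vm3 y"
proof (rule group.inv_equality[OF group_GL3])
  show "vm3 y \<otimes>\<^bsub>GL3\<^esub> vm3 x = \<one>\<^bsub>GL3\<^esub>" using assms by (simp add: vm3_mult[symmetric] vm3_1)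
  show "vm3 x \<in> carrier GL3" "vm3 y \<in> carrier GL3" using assms vm3_in_GL3 by blast+
qed

lemma subgroup_GL3:
  assumes "fgrp H"
  shows "subgroup (vm3 ` H) GL3"
proof (rule group.subgroupI[OF group_GL3])
  note f = fgrpD[OF assms]
  show "vm3 ` H \<subseteq> carrier GL3" using f(4) vm3_in_GL3 by blast
  show "vm3 ` H \<noteq> {}" using f(2) by blast
  show "inv\<^bsub>GL3\<^esub> A \<in> vm3 ` H" if A: "A \<in> vm3 ` H" for A
  proof -
    obtain x where x: "x \<in> H" "A = vm3 x" using A by blast
    obtain y where "y \<in> H" "x * y = 1" "y * x = 1" using f(4)[OF x(1)] by blast
    then show ?thesis using inv_GL3[of x y] x(2) by simp
  qed
  show "A \<otimes>\<^bsub>GL3\<^esub> B \<in> vm3 ` H" if "A \<in> vm3 ` H" "B \<in> vm3 ` H" for A B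
    using that f(3) by (auto simp: vm3_mult[symmetric])
qed

lemma finite_subgroups_GL3: "finite_subgroups GL3 = (\<lambda>H. vm3 ` H) ` {H. fgrp H}"
proof (intro equalityI subsetI)
  fix S assume "S \<in> (\<lambda>H. vm3 ` H) ` {H. fgrp H}"
  then obtain H where "fgrp H" "S = vm3 ` H" by blast
  then show "S \<in> finite_subgroups GL3" using subgroup_GL3 fgrpD(1) unfolding finite_subgroups_def by blast
next
  fix S assume "S \<in> finite_subgroups GL3"
  then have S: "subgroup S GL3" "finite S" unfolding finite_subgroups_def by blast+
  define H where "H = {x. vm3 x \<in> S}"
  have c: "S \<subseteq> carrier GL3" by (rule subgroup.subset[OF S(1)])
  have SH: "S = vm3 ` H"
  proof (intro equalityI subsetI)
    fix A assume A: "A \<in> S"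
    then have "A \<in> carrier GL3" using c by blast
    then obtain x y where "A = vm3 x" "x * y = 1" "y * x = 1" "vm3 y \<in> carrier GL3" by (rule carrier_GL3)
    then show "A \<in> vm3 ` H" using A unfolding H_def by blast
  qed (auto simp: H_def)
  have "fgrp H"
  proof (rule fgrp_I)
    show "finite H" using S(2) unfolding SH using inj_vm3 finite_imageD by blast
    show "1 \<in> H" using subgroup.one_closed[OF S(1)] by (simp add: H_def vm3_1)
    show "x * y \<in> H" if "x \<in> H" "y \<in> H" for x y
      using subgroup.m_closed[OF S(1), of "vm3 x" "vm3 y"] that by (simp add: H_def vm3_mult)
    show "\<exists>z. z * x = 1" if "x \<in> H" for x using that c vm3_in_GL3 unfolding H_def by blast
  qed
  then show "S \<in> (\<lambda>H. vm3 ` H) ` {H. fgrp H}" using SH by blast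
qed

lemma GL3_type:
  assumes "fgrp H"
  shows "vm3 ` H \<in> finite_subgroups_of_type GL3 T \<longleftrightarrow> mgroup H \<cong> T"
proof -
  have "vm3 \<in> iso (mgroup H) (GL3\<lparr>carrier := vm3 ` H\<rparr>)"
    unfolding iso_def hom_def bij_betw_def using inj_vm3 by (auto simp: vm3_mult)
  then have i: "mgroup H \<cong> GL3\<lparr>carrier := vm3 ` H\<rparr>" by (rule is_isoI)
  have "GL3\<lparr>carrier := vm3 ` H\<rparr> \<cong> T \<longleftrightarrow> mgroup H \<cong> T"
    using iso_trans[OF i] iso_trans[OF group.iso_sym[OF group_mgroup[OF assms] i]] by blast
  then show ?thesis unfolding finite_subgroups_of_type_def finite_subgroups_GL3 using assms by blast
qed

lemma conjugacy_GL3: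
  assumes "fgrp H"
  shows "(vm3 ` H, S) \<in> conjugacy GL3 \<longleftrightarrow> (\<exists>H'. fgrp H' \<and> S = vm3 ` H' \<and> label H' = label H)"
proof -
  have coset: "(vm3 b <#\<^bsub>GL3\<^esub> (vm3 ` H)) #>\<^bsub>GL3\<^esub> vm3 b' = vm3 ` (\<lambda>x. b * x * b') ` H" for b b'
    unfolding l_coset_def r_coset_def by (auto simp: vm3_mult[symmetric] image_image)
  show ?thesis
  proof
    assume "(vm3 ` H, S) \<in> conjugacy GL3"
    then obtain g where g: "g \<in> carrier GL3" "S = (g <#\<^bsub>GL3\<^esub> (vm3 ` H)) #>\<^bsub>GL3\<^esub> (inv\<^bsub>GL3\<^esub> g)"
      unfolding conjugacy_def by blast
    obtain b b' where b: "g = vm3 b" "b * b' = 1" "b' * b = 1" using g(1) by (rule carrier_GL3)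
    let ?H' = "(\<lambda>x. b * x * b') ` H"
    have S: "S = vm3 ` ?H'" unfolding g(2) b(1) inv_GL3[OF b(2,3)] by (rule coset)
    have "fgrp ?H'" by (rule fgrp_conj[OF b(2,3) assms])
    moreover from this have "label H = label ?H'" using label_complete[OF assms] b(2,3) by blast
    ultimately show "\<exists>H'. fgrp H' \<and> S = vm3 ` H' \<and> label H' = label H" using S by metis
  next
    assume "\<exists>H'. fgrp H' \<and> S = vm3 ` H' \<and> label H' = label H"
    then obtain H' where H': "fgrp H'" "S = vm3 ` H'" "label H = label H'" by metis
    then obtain b b' where b: "b * b' = 1" "b' * b = 1" "H' = (\<lambda>x. b * x * b') ` H"
      using label_complete[OF assms] by blast
    have "vm3 b \<in> carrier GL3" using b vm3_in_GL3 by blast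
    moreover have "subgroup S GL3" unfolding H'(2) by (rule subgroup_GL3[OF H'(1)])
    moreover have "S = (vm3 b <#\<^bsub>GL3\<^esub> (vm3 ` H)) #>\<^bsub>GL3\<^esub> (inv\<^bsub>GL3\<^esub> (vm3 b))"
      unfolding inv_GL3[OF b(1,2)] coset H'(2) b(3) ..
    ultimately show "(vm3 ` H, S) \<in> conjugacy GL3"
      unfolding conjugacy_def mem_Collect_eq prod.case using subgroup_GL3[OF assms] by blast
  qed
qed

text \<open>Conjugacy classes are the fibres of \<open>label\<close>, so counting classes is
  counting labels.\<close>

lemma card_quotient_label:
  assumes "Y \<subseteq> {H. fgrp H}"
  shows "card ((\<lambda>H. vm3 ` H) ` Y // conjugacy GL3) = card (label ` Y)"
proof -
  define C where "C l = {vm3 ` H | H. fgrp H \<and> label H = l}" for l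
  have "conjugacy GL3 `` {vm3 ` H} = C (label H)" if "H \<in> Y" for H
  proof -
    have f: "fgrp H" using that assms by blast
    show ?thesis unfolding C_def Image_singleton conjugacy_GL3[OF f] by auto
  qed
  then have "(\<lambda>H. vm3 ` H) ` Y // conjugacy GL3 = C ` label ` Y" unfolding quotient_def by auto
  moreover have "inj_on C (label ` Y)"
  proof (rule inj_onI)
    fix l l' assume l: "l \<in> label ` Y" "l' \<in> label ` Y" "C l = C l'"
    then obtain H where H: "H \<in> Y" "l = label H" by blast
    then have "vm3 ` H \<in> C l" using assms unfolding C_def by auto
    then have "vm3 ` H \<in> C l'" using l(3) by simp
    then obtain K where K: "vm3 ` H = vm3 ` K" "label K = l'" unfolding C_def by auto
    have "H = K" using K(1) by (simp only: inj_image_eq_iff[OF inj_vm3])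
    then show "l = l'" using H(2) K(2) by simp
  qed
  ultimately show ?thesis using card_image by metis
qed

lemma distinct_all_labels: "distinct all_labels" by code_simp

section \<open>Counting conjugacy classes\<close>

lemma label_image: "label ` {H. fgrp H \<and> P (label H)} = set (filter P all_labels)"
proof (intro equalityI subsetI)
  fix l assume "l \<in> set (filter P all_labels)"
  then have l: "l \<in> set all_labels" "P l" by simp_all
  obtain H where "fgrp H" "label H = l" using label_exists[OF l(1)] .
  then show "l \<in> label ` {H. fgrp H \<and> P (label H)}" using l(2) by blast
qed (auto simp: label_mem)

lemma count_type:
  assumes "\<And>H. fgrp H \<Longrightarrow> mgroup H \<cong> T \<longleftrightarrow> P (label H)" and n: "length (filter P all_labels) = n"
  shows "card (finite_subgroups_of_type GL3 T // conjugacy GL3) = n"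
proof -
  let ?Y = "{H. fgrp H \<and> P (label H)}"
  have "finite_subgroups_of_type GL3 T = (\<lambda>H. vm3 ` H) ` ?Y"
  proof (intro equalityI subsetI)
    fix S assume S: "S \<in> finite_subgroups_of_type GL3 T"
    then have "S \<in> finite_subgroups GL3" unfolding finite_subgroups_of_type_def by blast
    then obtain H where H: "fgrp H" "S = vm3 ` H" unfolding finite_subgroups_GL3 by blast
    then have "P (label H)" using S GL3_type[OF H(1)] assms(1)[OF H(1)] by blast
    then show "S \<in> (\<lambda>H. vm3 ` H) ` ?Y" using H by blast
  next
    fix S assume "S \<in> (\<lambda>H. vm3 ` H) ` ?Y"
    then obtain H where H: "fgrp H" "P (label H)" "S = vm3 ` H" by blast
    then show "S \<in> finite_subgroups_of_type GL3 T" using GL3_type[OF H(1)] assms(1)[OF H(1)] by blast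
  qed
  then show ?thesis using card_quotient_label[of ?Y] distinct_card[of "filter P all_labels"] distinct_all_labels n
    by (auto simp: label_image)
qed

lemma count_tau:
  assumes "\<And>H :: qf m3 set. fgrp H \<Longrightarrow> mgroup H \<cong> T \<longleftrightarrow> tau H = v" and "length (filter (\<lambda>l. ltau l = v) all_labels) = n"
  shows "card (finite_subgroups_of_type GL3 T // conjugacy GL3) = n"
  by (rule count_type[where P = "\<lambda>l. ltau l = v", OF _ assms(2)]) (simp add: assms(1) tau_label)

lemma counts:
  "card (finite_subgroups_of_type GL3 (Cyc 1) // conjugacy GL3) = 1"
  "card (finite_subgroups_of_type GL3 (Cyc 2) // conjugacy GL3) = 3"
  "card (finite_subgroups_of_type GL3 (Cyc 3) // conjugacy GL3) = 1"
  "card (finite_subgroups_of_type GL3 (Cyc 4) // conjugacy GL3) = 2"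
  "card (finite_subgroups_of_type GL3 (Cyc 2 \<times>\<times> Cyc 2) // conjugacy GL3) = 3"
  "card (finite_subgroups_of_type GL3 (sym_group 3) // conjugacy GL3) = 2"
  "card (finite_subgroups_of_type GL3 (Cyc 6) // conjugacy GL3) = 3"
  "card (finite_subgroups_of_type GL3 (Cyc 2 \<times>\<times> Cyc 4) // conjugacy GL3) = 1"
  "card (finite_subgroups_of_type GL3 Q8 // conjugacy GL3) = 2"
  "card (finite_subgroups_of_type GL3 (Cyc 2 \<times>\<times> Cyc 2 \<times>\<times> Cyc 2) // conjugacy GL3) = 1"
  "card (finite_subgroups_of_type GL3 (Dih 4) // conjugacy GL3) = 3"
  "card (finite_subgroups_of_type GL3 (Dih 6) // conjugacy GL3) = 4"
  "card (finite_subgroups_of_type GL3 (Cyc_inversion_Cyc 3 4) // conjugacy GL3) = 2"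
  "card (finite_subgroups_of_type GL3 (Cyc 2 \<times>\<times> Q8) // conjugacy GL3) = 1"
  "card (finite_subgroups_of_type GL3 (Cyc 2 \<times>\<times> Dih 4) // conjugacy GL3) = 1"
  "card (finite_subgroups_of_type GL3 (Cyc 2 \<times>\<times> Cyc_inversion_Cyc 3 4) // conjugacy GL3) = 1"
  "card (finite_subgroups_of_type GL3 SL23 // conjugacy GL3) = 1"
  "card (finite_subgroups_of_type GL3 (Cyc 2 \<times>\<times> Cyc 2 \<times>\<times> sym_group 3) // conjugacy GL3) = 1"
  "card (finite_subgroups_of_type GL3 (sym_group 4) // conjugacy GL3) = 2"
  "card (finite_subgroups_of_type GL3 (Cyc 2 \<times>\<times> alt_group 4) // conjugacy GL3) = 1"
  "card (finite_subgroups_of_type GL3 (Cyc 2 \<times>\<times> SL23) // conjugacy GL3) = 1"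
  "card (finite_subgroups_of_type GL3 (Cyc 2 \<times>\<times> sym_group 4) // conjugacy GL3) = 1"
  by (rule count_tau[OF types(1)], assumption, code_simp, rule count_tau[OF types(2)], assumption, code_simp,
      rule count_tau[OF types(3)], assumption, code_simp, rule count_tau[OF types(4)], assumption, code_simp,
      rule count_tau[OF types(5)], assumption, code_simp, rule count_tau[OF types(6)], assumption, code_simp,
      rule count_tau[OF types(7)], assumption, code_simp, rule count_tau[OF types(8)], assumption, code_simp,
      rule count_tau[OF types(9)], assumption, code_simp, rule count_tau[OF types(10)], assumption, code_simp,
      rule count_tau[OF types(11)], assumption, code_simp, rule count_tau[OF types(12)], assumption, code_simp,
      rule count_tau[OF types(13)], assumption, code_simp, rule count_tau[OF types(14)], assumption, code_simp,
      rule count_tau[OF types(15)], assumption, code_simp, rule count_tau[OF types(16)], assumption, code_simp,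
      rule count_tau[OF types(17)], assumption, code_simp, rule count_tau[OF types(18)], assumption, code_simp,
      rule count_tau[OF types(19)], assumption, code_simp, rule count_tau[OF types(20)], assumption, code_simp,
      rule count_tau[OF types(21)], assumption, code_simp, rule count_tau[OF types(22)], assumption, code_simp)

lemma counts_12_4:
  "card (finite_subgroups_of_type GL3 (alt_group 4) // conjugacy GL3) = 1"
  "card (finite_subgroups_of_type GL3 (Cyc 2 \<times>\<times> Cyc 6) // conjugacy GL3) = 1"
proof -
  have s: "snd (label H) \<longleftrightarrow> -1 \<in> H" for H by (simp add: label_def)
  have n: "length (filter (\<lambda>l. ltau l = (12, 4) \<and> \<not> snd l) all_labels) = 1"
    "length (filter (\<lambda>l. ltau l = (12, 4) \<and> snd l) all_labels) = 1"
    by code_simp+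
  show "card (finite_subgroups_of_type GL3 (alt_group 4) // conjugacy GL3) = 1"
    by (rule count_type[OF _ n(1)]) (simp add: types_12_4 tau_label s)
  show "card (finite_subgroups_of_type GL3 (Cyc 2 \<times>\<times> Cyc 6) // conjugacy GL3) = 1"
    by (rule count_type[OF _ n(2)]) (simp add: types_12_4 tau_label s)
qed

lemma tau_cases:
  fixes H :: "qf m3 set"
  assumes "fgrp H"
  shows "tau H \<in> {(1, 1), (2, 2), (3, 1), (4, 2), (4, 4), (6, 4), (6, 2), (8, 4), (8, 2), (8, 8), (8, 6), (12, 8), (12, 2),
    (16, 4), (16, 12), (24, 4), (24, 2), (24, 16), (24, 10), (24, 8), (48, 4), (48, 20)} \<or> tau H = (12, 4)"
proof -
  have "list_all (\<lambda>l. List.member [(1, 1), (2, 2), (3, 1), (4, 2), (4, 4), (6, 4), (6, 2), (8, 4), (8, 2), (8, 8), (8, 6), (12, 8), (12, 2),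
    (16, 4), (16, 12), (24, 4), (24, 2), (24, 16), (24, 10), (24, 8), (48, 4), (48, 20), (12, 4)] (ltau l)) all_labels" by code_simp
  then have "tau H \<in> set [(1, 1), (2, 2), (3, 1), (4, 2), (4, 4), (6, 4), (6, 2), (8, 4), (8, 2), (8, 8), (8, 6), (12, 8), (12, 2),
    (16, 4), (16, 12), (24, 4), (24, 2), (24, 16), (24, 10), (24, 8), (48, 4), (48, 20), (12, 4)]"
    using label_mem[OF assms] unfolding tau_label[OF assms] list_all_iff List.member_iff by blast
  then show ?thesis by auto
qed

theorem mainTheorem2:
  fixes G :: "(complex ^ 3 ^ 3) monoid"
  defines "G \<equiv> GL (quadratic_field (- 19))"
  shows
    "let types =
       [(finite_subgroups_of_type G (Cyc 1), 1),
        (finite_subgroups_of_type G (Cyc 2), 3),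
        (finite_subgroups_of_type G (Cyc 3), 1),
        (finite_subgroups_of_type G (Cyc 4), 2),
        (finite_subgroups_of_type G (Cyc 2 \<times>\<times> Cyc 2), 3),
        (finite_subgroups_of_type G (sym_group 3), 2),
        (finite_subgroups_of_type G (Cyc 6), 3),
        (finite_subgroups_of_type G (Cyc 2 \<times>\<times> Cyc 4), 1),
        (finite_subgroups_of_type G Q8, 2),
        (finite_subgroups_of_type G (Cyc 2 \<times>\<times> Cyc 2 \<times>\<times> Cyc 2), 1),
        (finite_subgroups_of_type G (Dih 4), 3),
        (finite_subgroups_of_type G (Dih 6), 4),
        (finite_subgroups_of_type G (Cyc_inversion_Cyc 3 4), 2),
        (finite_subgroups_of_type G (alt_group 4), 1),
        (finite_subgroups_of_type G (Cyc 2 \<times>\<times> Cyc 6), 1),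
        (finite_subgroups_of_type G (Cyc 2 \<times>\<times> Q8), 1),
        (finite_subgroups_of_type G (Cyc 2 \<times>\<times> Dih 4), 1),
        (finite_subgroups_of_type G (Cyc 2 \<times>\<times> Cyc_inversion_Cyc 3 4), 1),
        (finite_subgroups_of_type G SL23, 1),
        (finite_subgroups_of_type G (Cyc 2 \<times>\<times> Cyc 2 \<times>\<times> sym_group 3), 1),
        (finite_subgroups_of_type G (sym_group 4), 2),
        (finite_subgroups_of_type G (Cyc 2 \<times>\<times> alt_group 4), 1),
        (finite_subgroups_of_type G (Cyc 2 \<times>\<times> SL23), 1),
        (finite_subgroups_of_type G (Cyc 2 \<times>\<times> sym_group 4), 1)]
     in card (finite_subgroups G // conjugacy G) = 40 \<and>
        finite_subgroups G = (\<Union>(S, n) \<in> set types. S) \<and>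
        (\<forall>(S, n) \<in> set types. card (S // conjugacy G) = n)"
proof -
  have "card (finite_subgroups GL3 // conjugacy GL3) = card (label ` {H. fgrp H})"
    unfolding finite_subgroups_GL3 by (rule card_quotient_label) simp
  also have "\<dots> = length (filter (\<lambda>_. True) all_labels)"
    using label_image[of "\<lambda>_. True"] distinct_card[OF distinct_all_labels] by simp
  also have "\<dots> = 40" by code_simp
  finally have total: "card (finite_subgroups G // conjugacy G) = 40" unfolding G_def .
  show ?thesis unfolding Let_def
  proof (intro conjI total)
    show "finite_subgroups G = (\<Union>(S, n) \<in> set [
        (finite_subgroups_of_type G (Cyc 1), 1 :: nat),
        (finite_subgroups_of_type G (Cyc 2), 3),
        (finite_subgroups_of_type G (Cyc 3), 1),
        (finite_subgroups_of_type G (Cyc 4), 2),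
        (finite_subgroups_of_type G (Cyc 2 \<times>\<times> Cyc 2), 3),
        (finite_subgroups_of_type G (sym_group 3), 2),
        (finite_subgroups_of_type G (Cyc 6), 3),
        (finite_subgroups_of_type G (Cyc 2 \<times>\<times> Cyc 4), 1),
        (finite_subgroups_of_type G Q8, 2),
        (finite_subgroups_of_type G (Cyc 2 \<times>\<times> Cyc 2 \<times>\<times> Cyc 2), 1),
        (finite_subgroups_of_type G (Dih 4), 3),
        (finite_subgroups_of_type G (Dih 6), 4),
        (finite_subgroups_of_type G (Cyc_inversion_Cyc 3 4), 2),
        (finite_subgroups_of_type G (alt_group 4), 1),
        (finite_subgroups_of_type G (Cyc 2 \<times>\<times> Cyc 6), 1),
        (finite_subgroups_of_type G (Cyc 2 \<times>\<times> Q8), 1),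
        (finite_subgroups_of_type G (Cyc 2 \<times>\<times> Dih 4), 1),
        (finite_subgroups_of_type G (Cyc 2 \<times>\<times> Cyc_inversion_Cyc 3 4), 1),
        (finite_subgroups_of_type G SL23, 1),
        (finite_subgroups_of_type G (Cyc 2 \<times>\<times> Cyc 2 \<times>\<times> sym_group 3), 1),
        (finite_subgroups_of_type G (sym_group 4), 2),
        (finite_subgroups_of_type G (Cyc 2 \<times>\<times> alt_group 4), 1),
        (finite_subgroups_of_type G (Cyc 2 \<times>\<times> SL23), 1),
        (finite_subgroups_of_type G (Cyc 2 \<times>\<times> sym_group 4), 1)]. S)" (is "_ = ?U")
    proof (intro equalityI subsetI)
      fix S assume "S \<in> finite_subgroups G"
      then obtain H where H: "fgrp H" "S = vm3 ` H" unfolding G_def finite_subgroups_GL3 by blast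
      \<comment> \<open>Each of the 23 possible values of \<open>tau\<close> leads to a type in the
        list, and for \<open>(12, 4)\<close> membership of \<open>-1\<close> chooses between
        two.\<close>
      show "S \<in> ?U"
        unfolding list.set UN_insert prod.case Un_iff H(2) G_def GL3_type[OF H(1)] types[OF H(1)] types_12_4[OF H(1)]
        using tau_cases[OF H(1)] by blast
    next
      fix S assume "S \<in> ?U"
      then show "S \<in> finite_subgroups G"
        unfolding list.set UN_insert prod.case Un_iff finite_subgroups_of_type_def mem_Collect_eq by blast
    qed
  qed (simp only: G_def list.set ball_simps prod.case counts counts_12_4 simp_thms)
qed

end
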